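(* Let $A=\bigoplus_{i\geq 0}A_i$ be a standard graded ring over a field $A_0=k$ with irrelevant ideal $\mathfrak n=\bigoplus_{i>0}A_i$, such that $e:=\dim_k A_1>1$ and $\operatorname{Ord}(A)>1$. Let $n$ be an integer with $1<n\leq \operatorname{Ord}(A)$ and set $R:=A/\mathfrak n^n$. If $M$ is a finitely generated nonfree $R$-module and $i\geq 2$, then $$\beta_{i+1}(M)-\beta_i(M)\ \geq\ \binom{e+n-1}{e-1}-1\ >\ \dim A-1 .$$ In particular, $\beta_{i+1}(\omega_R)-\beta_i(\omega_R)\geq e-1\geq \dim A-1$ for all $i\neq 1$ (with $i\ge 0$).
   Context: $R$ is an artinian local ring with residue field $k$, $\omega_R$ is its canonical module, and $\beta_i(M)=\dim_k\operatorname{Tor}_i^R(k,M)$ is the $i$-th Betti number over $R$. Write $A=k[X_1,\ldots,X_e]/(f_1,\ldots,f_t)$ with $f_1,\dots,f_t$ homogeneous and $e=\dim_k A_1$. Then $\operatorname{Ord}(A)$ is the order of the ideal of relations: $\operatorname{Ord}(A)=\sup\{i : (f_1,\ldots,f_t)\subseteq (X_1,\ldots,X_e)^{i}\}$ (which is $\infty$ if $(f_1,\dots,f_t)=0$). *)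

theory Defs
  imports
    "HOL-Algebra.Indexed_Polynomials"
    "HOL-Algebra.Ideal_Product"
    "HOL-Algebra.QuotRing"
    "HOL-Algebra.Generated_Rings"
    "HOL-Algebra.Free_Abelian_Groups"
    "HOL-Library.Extended_Real"
    "Jordan_Normal_Form.Missing_VectorSpace"
begin

definition homogeneous_components :: "('a, 'b) ring_scheme \<Rightarrow> (nat \<Rightarrow> 'a set) \<Rightarrow> (nat \<Rightarrow> 'a) \<Rightarrow> 'a \<Rightarrow> bool"
  where "homogeneous_components A G f a \<longleftrightarrow>
    (\<forall>i. f i \<in> G i) \<and> finite {i. f i \<noteq> \<zero>\<^bsub>A\<^esub>} \<and> a = (\<Oplus>\<^bsub>A\<^esub>i\<in>{i. f i \<noteq> \<zero>\<^bsub>A\<^esub>}. f i)"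

locale standard_graded = cring A for A :: "('a, 'b) ring_scheme" (structure) and G :: "nat \<Rightarrow> 'a set" +
  assumes component_subgroup: "additive_subgroup (G i) A"
    and component_mult: "\<lbrakk> x \<in> G i; y \<in> G j \<rbrakk> \<Longrightarrow> x \<otimes> y \<in> G (i + j)"
    and decomposition: "a \<in> carrier A \<Longrightarrow> \<exists>!f. homogeneous_components A G f a"
    and base_field: "subfield (G 0) A"
    and degree_one_finite: "finite_dimension (G 0) (G 1)"
    and generated_in_degree_one: "generate_ring A (G 0 \<union> G 1) = carrier A"

definition irrelevant_ideal :: "('a, 'b) ring_scheme \<Rightarrow> (nat \<Rightarrow> 'a set) \<Rightarrow> 'a set"
  where "irrelevant_ideal A G = {a. \<exists>f. homogeneous_components A G f a \<and> f 0 = \<zero>\<^bsub>A\<^esub>}"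

definition ideal_power :: "('a, 'b) ring_scheme \<Rightarrow> 'a set \<Rightarrow> nat \<Rightarrow> 'a set"
  where "ideal_power A I n = I [^]\<^bsub>ideals_set A\<^esub> n"

definition krull_dim :: "('a, 'b) ring_scheme \<Rightarrow> enat"
  where "krull_dim A = Sup {enat n | n. \<exists>p :: nat \<Rightarrow> 'a set.
    (\<forall>i\<le>n. primeideal (p i) A) \<and> (\<forall>i<n. p i \<subset> p (Suc i))}"

text \<open>The polynomial ring \<open>K[X\<^sub>0,\<dots>,X\<^sub>e\<^sub>-\<^sub>1]\<close> on the library's indexed polynomials: functions
  from monomials (multisets of variable indices) to coefficients.\<close>

definition poly_ring :: "('a, 'b) ring_scheme \<Rightarrow> nat \<Rightarrow> (nat multiset \<Rightarrow> 'a) ring"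
  where "poly_ring K e =
    \<lparr> carrier = ring.indexed_pset K {..<e} (carrier K),
      monoid.mult = (\<lambda>P Q m. \<Oplus>\<^bsub>K\<^esub>l\<in>{l. l \<subseteq># m}. P l \<otimes>\<^bsub>K\<^esub> Q (m - l)),
      one = ring.indexed_const K \<one>\<^bsub>K\<^esub>,
      ring.zero = ring.indexed_const K \<zero>\<^bsub>K\<^esub>,
      add = ring.indexed_padd K \<rparr>"

definition vars_ideal :: "('a, 'b) ring_scheme \<Rightarrow> nat \<Rightarrow> (nat multiset \<Rightarrow> 'a) set"
  where "vars_ideal K e = genideal (poly_ring K e) (ring.indexed_var K ` {..<e})"

definition degree_zero_ring :: "('a, 'b) ring_scheme \<Rightarrow> (nat \<Rightarrow> 'a set) \<Rightarrow> ('a, 'b) ring_scheme"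
  where "degree_zero_ring A G = A\<lparr>carrier := G 0\<rparr>"

definition embdim :: "('a, 'b) ring_scheme \<Rightarrow> (nat \<Rightarrow> 'a set) \<Rightarrow> nat"
  where "embdim A G = ring.dim A (G 0) (G 1)"

text \<open>A presentation \<open>A = k[X\<^sub>0,\<dots>,X\<^sub>e\<^sub>-\<^sub>1]/(f\<^sub>1,\<dots>,f\<^sub>t)\<close> as a graded \<open>k\<close>-algebra with
  \<open>e = dim\<^sub>k A\<^sub>1\<close>, given by the surjection \<open>\<phi>\<close>. Its kernel is the ideal \<open>(f\<^sub>1,\<dots>,f\<^sub>t)\<close>; it is
  homogeneous because \<open>\<phi>\<close> preserves degrees.\<close>

definition graded_presentation ::
    "('a, 'b) ring_scheme \<Rightarrow> (nat \<Rightarrow> 'a set) \<Rightarrow> ((nat multiset \<Rightarrow> 'a) \<Rightarrow> 'a) \<Rightarrow> bool"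
  where "graded_presentation A G \<phi> \<longleftrightarrow>
    (let K = degree_zero_ring A G; S = poly_ring K (embdim A G) in
      \<phi> \<in> ring_hom S A \<and>
      (\<forall>c\<in>G 0. \<phi> (ring.indexed_const K c) = c) \<and>
      (\<forall>i<embdim A G. \<phi> (ring.indexed_var K i) \<in> G 1) \<and>
      \<phi> ` carrier S = carrier A)"

definition relations_ideal :: "('a, 'b) ring_scheme \<Rightarrow> (nat \<Rightarrow> 'a set) \<Rightarrow> (nat multiset \<Rightarrow> 'a) set"
  where "relations_ideal A G =
    a_kernel (poly_ring (degree_zero_ring A G) (embdim A G)) A (SOME \<phi>. graded_presentation A G \<phi>)"

text \<open>Two presentations differ by a linear change of variables, which preserves the powers of
  \<open>(X\<^sub>0,\<dots>,X\<^sub>e\<^sub>-\<^sub>1)\<close>; so the choice made in \<open>relations_ideal\<close> is immaterial here.\<close>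

definition Ord :: "('a, 'b) ring_scheme \<Rightarrow> (nat \<Rightarrow> 'a set) \<Rightarrow> enat"
  where "Ord A G = (let K = degree_zero_ring A G; e = embdim A G in
    Sup {enat i | i. relations_ideal A G \<subseteq> ideal_power (poly_ring K e) (vars_ideal K e) i})"

text \<open>A module record extends a ring record; the fields \<open>mult\<close> and \<open>one\<close> of the modules built
  below carry no information.\<close>

definition self_module :: "('r, 'b) ring_scheme \<Rightarrow> ('r, 'r) module"
  where "self_module R = \<lparr> carrier = carrier R, monoid.mult = monoid.mult R, one = one R, ring.zero = ring.zero R,
    add = add R, smult = monoid.mult R \<rparr>"

definition quot_module :: "('r, 'm, 'c) module_scheme \<Rightarrow> 'm set \<Rightarrow> ('r, 'm set) module"
  where "quot_module M N = \<lparr> carrier = a_rcosets\<^bsub>M\<^esub> N, monoid.mult = (\<lambda>_ _. N), one = N, ring.zero = N,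
    add = set_add M, smult = (\<lambda>r C. \<Union>c\<in>C. N +>\<^bsub>M\<^esub> (r \<odot>\<^bsub>M\<^esub> c)) \<rparr>"

definition finitely_generated_module :: "('r, 'b) ring_scheme \<Rightarrow> ('r, 'm, 'c) module_scheme \<Rightarrow> bool"
  where "finitely_generated_module R M \<longleftrightarrow>
    (\<exists>S. finite S \<and> S \<subseteq> carrier M \<and> module.span R M S = carrier M)"

definition free_module :: "('r, 'b) ring_scheme \<Rightarrow> ('r, 'm, 'c) module_scheme \<Rightarrow> bool"
  where "free_module R M \<longleftrightarrow>
    (\<exists>B. B \<subseteq> carrier M \<and> \<not> module.lin_dep R M B \<and> module.span R M B = carrier M)"

definition tensor_free :: "('r, 'm, 'c) module_scheme \<Rightarrow> ('r, 'n, 'd) module_scheme \<Rightarrow> ('m \<times> 'n \<Rightarrow>\<^sub>0 int) monoid"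
  where "tensor_free M N = free_Abelian_group (carrier M \<times> carrier N)"

definition tensor_relations ::
    "('r, 'b) ring_scheme \<Rightarrow> ('r, 'm, 'c) module_scheme \<Rightarrow> ('r, 'n, 'd) module_scheme \<Rightarrow> ('m \<times> 'n \<Rightarrow>\<^sub>0 int) set"
  where "tensor_relations R M N = generate (tensor_free M N)
    ({frag_of (x \<oplus>\<^bsub>M\<^esub> x', y) - frag_of (x, y) - frag_of (x', y) | x x' y.
        x \<in> carrier M \<and> x' \<in> carrier M \<and> y \<in> carrier N} \<union>
     {frag_of (x, y \<oplus>\<^bsub>N\<^esub> y') - frag_of (x, y) - frag_of (x, y') | x y y'.
        x \<in> carrier M \<and> y \<in> carrier N \<and> y' \<in> carrier N} \<union>
     {frag_of (r \<odot>\<^bsub>M\<^esub> x, y) - frag_of (x, r \<odot>\<^bsub>N\<^esub> y) | r x y.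
        r \<in> carrier R \<and> x \<in> carrier M \<and> y \<in> carrier N})"

definition tensor_product ::
    "('r, 'b) ring_scheme \<Rightarrow> ('r, 'm, 'c) module_scheme \<Rightarrow> ('r, 'n, 'd) module_scheme
      \<Rightarrow> ('r, ('m \<times> 'n \<Rightarrow>\<^sub>0 int) set) module"
  where "tensor_product R M N = (let F = tensor_free M N; Z = tensor_relations R M N in
    \<lparr> carrier = rcosets\<^bsub>F\<^esub> Z, monoid.mult = (\<lambda>_ _. Z), one = Z, ring.zero = Z, add = set_mult F,
      smult = (\<lambda>r C. \<Union>c\<in>C. Z #>\<^bsub>F\<^esub> frag_extend (\<lambda>(x, y). frag_of (r \<odot>\<^bsub>M\<^esub> x, y)) c) \<rparr>)"

text \<open>The map \<open>id \<otimes> f\<close> from \<open>M \<otimes> N\<close> to \<open>M \<otimes> N'\<close>.\<close>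

definition tensor_map ::
    "('r, 'b) ring_scheme \<Rightarrow> ('r, 'm, 'c) module_scheme \<Rightarrow> ('r, 'n, 'd) module_scheme \<Rightarrow> ('p \<Rightarrow> 'n)
      \<Rightarrow> ('m \<times> 'p \<Rightarrow>\<^sub>0 int) set \<Rightarrow> ('m \<times> 'n \<Rightarrow>\<^sub>0 int) set"
  where "tensor_map R M N' f C =
    (\<Union>c\<in>C. tensor_relations R M N' #>\<^bsub>tensor_free M N'\<^esub> frag_extend (\<lambda>(x, y). frag_of (x, f y)) c)"

text \<open>A resolution \<open>\<dots> \<rightarrow> R\<^bsup>b 1\<^esup> \<rightarrow> R\<^bsup>b 0\<^esup> \<rightarrow> M \<rightarrow> 0\<close> by finite free modules, with differentials
  \<open>d i : R\<^bsup>b (i + 1)\<^esup> \<rightarrow> R\<^bsup>b i\<^esup>\<close> and augmentation \<open>\<epsilon>\<close>. One exists whenever \<open>R\<close> is noetherian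
  and \<open>M\<close> is finitely generated.\<close>

abbreviation free_mod :: "('r, 'b) ring_scheme \<Rightarrow> nat \<Rightarrow> ('r, nat \<Rightarrow> 'r) module"
  where "free_mod R b \<equiv> ring.func_space R {..<b}"

definition free_resolution ::
    "('r, 'b) ring_scheme \<Rightarrow> ('r, 'm, 'c) module_scheme \<Rightarrow> (nat \<Rightarrow> nat)
      \<Rightarrow> (nat \<Rightarrow> (nat \<Rightarrow> 'r) \<Rightarrow> (nat \<Rightarrow> 'r)) \<Rightarrow> ((nat \<Rightarrow> 'r) \<Rightarrow> 'm) \<Rightarrow> bool"
  where "free_resolution R M b d \<epsilon> \<longleftrightarrow>
    \<epsilon> \<in> module_hom R (free_mod R (b 0)) M \<and>
    (\<forall>i. d i \<in> module_hom R (free_mod R (b (Suc i))) (free_mod R (b i))) \<and>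
    \<epsilon> ` carrier (free_mod R (b 0)) = carrier M \<and>
    d 0 ` carrier (free_mod R (b 1)) = a_kernel (free_mod R (b 0)) M \<epsilon> \<and>
    (\<forall>i. d (Suc i) ` carrier (free_mod R (b (Suc (Suc i)))) =
          a_kernel (free_mod R (b (Suc i))) (free_mod R (b i)) (d i))"

text \<open>\<open>Tor\<^sub>i\<^sup>R(N, M)\<close>, the homology in degree \<open>i\<close> of \<open>N \<otimes> F\<close> for a chosen resolution \<open>F\<close> of a
  finitely generated module \<open>M\<close>; up to isomorphism it does not depend on the choice.\<close>

definition Tor ::
    "('r, 'b) ring_scheme \<Rightarrow> ('r, 'n, 'd) module_scheme \<Rightarrow> ('r, 'm, 'c) module_scheme \<Rightarrow> nat
      \<Rightarrow> ('r, ('n \<times> (nat \<Rightarrow> 'r) \<Rightarrow>\<^sub>0 int) set set) module"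
  where "Tor R N M i =
    (let (b, d) = (SOME (b, d). \<exists>\<epsilon>. free_resolution R M b d \<epsilon>);
         T = (\<lambda>j. tensor_product R N (free_mod R (b j)));
         D = (\<lambda>j. tensor_map R N (free_mod R (b j)) (d j));
         cycles = (case i of 0 \<Rightarrow> carrier (T 0) | Suc j \<Rightarrow> a_kernel (T (Suc j)) (T j) (D j));
         boundaries = D i ` carrier (T (Suc i))
     in quot_module ((T i)\<lparr>carrier := cycles\<rparr>) boundaries)"

definition local_max_ideal :: "('r, 'b) ring_scheme \<Rightarrow> 'r set"
  where "local_max_ideal R = (THE m. maximalideal m R)"

definition residue_field :: "('r, 'b) ring_scheme \<Rightarrow> 'r set ring"
  where "residue_field R = R Quot local_max_ideal R"

definition residue_module :: "('r, 'b) ring_scheme \<Rightarrow> ('r, 'r set) module"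
  where "residue_module R = quot_module (self_module R) (local_max_ideal R)"

text \<open>The residue field acts on a module annihilated by the maximal ideal through representatives.\<close>

definition over_residue_field :: "('r, 'm, 'c) module_scheme \<Rightarrow> ('r set, 'm) module"
  where "over_residue_field V = \<lparr> carrier = carrier V, monoid.mult = monoid.mult V, one = one V,
    ring.zero = ring.zero V, add = add V, smult = (\<lambda>C v. THE w. \<exists>r\<in>C. w = r \<odot>\<^bsub>V\<^esub> v) \<rparr>"

definition betti :: "('r, 'b) ring_scheme \<Rightarrow> ('r, 'm, 'c) module_scheme \<Rightarrow> nat \<Rightarrow> nat"
  where "betti R M i =
    vectorspace.dim (residue_field R) (over_residue_field (Tor R (residue_module R) M i))"

text \<open>HOL does not quantify over types inside a definition, so the extension property is required
  for modules \<open>Y\<close> whose elements lie in the type of the ring elements. These include \<open>R\<close> itself,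
  with its ideals as submodules; by Baer's criterion nothing is lost.\<close>

definition injective_module :: "('r, 'b) ring_scheme \<Rightarrow> ('r, 'm, 'c) module_scheme \<Rightarrow> bool"
  where "injective_module R W \<longleftrightarrow> module R W \<and>
    (\<forall>(Y :: ('r, 'r) module) Z g. module R Y \<and> submodule R Z Y \<and>
      g \<in> module_hom R (Y\<lparr>carrier := Z\<rparr>) W \<longrightarrow> (\<exists>h \<in> module_hom R Y W. \<forall>z\<in>Z. h z = g z))"

text \<open>Over an artinian local ring the canonical module is the injective hull of the residue
  field: a finitely generated injective module that is an essential extension of \<open>k\<close>.\<close>

definition canonical_module :: "('r, 'b) ring_scheme \<Rightarrow> ('r, 'm, 'c) module_scheme \<Rightarrow> bool"
  where "canonical_module R W \<longleftrightarrow>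
    finitely_generated_module R W \<and> injective_module R W \<and>
    (\<exists>\<iota> \<in> module_hom R (residue_module R) W.
      inj_on \<iota> (carrier (residue_module R)) \<and>
      (\<forall>N. submodule R N W \<and> N \<noteq> {\<zero>\<^bsub>W\<^esub>} \<longrightarrow> N \<inter> \<iota> ` carrier (residue_module R) \<noteq> {\<zero>\<^bsub>W\<^esub>}))"

end

theory Submission
  imports Defs
begin

text \<open>Let \<open>Q = k[X\<^sub>1,\<dots>,X\<^sub>e]\<close> with irrelevant ideal \<open>m\<close>. Since \<open>n \<le> Ord A\<close>, the ring \<open>R\<close> is \<open>Q/m\<^sup>n\<close>.
  Comparing an arbitrary resolution of a nonfree \<open>M\<close> with minimal covers, \<open>\<beta>\<^sub>i(M)\<close> for \<open>i \<ge> 2\<close> is the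
  number \<open>p\<close> of columns of a minimal matrix \<open>\<phi> : R\<^sup>p \<rightarrow> R\<^sup>q\<close> with \<open>q \<ge> 1\<close> whose image is a minimal syzygy and
  hence contains the socle \<open>m\<^bsup>n-1\<^esup>R\<^sup>q\<close>, and \<open>\<beta>\<^sub>i\<^sub>+\<^sub>1(M)\<close> is the number of generators of its kernel. Lifting
  \<open>\<phi>\<close> to \<open>Q\<close> and comparing Hilbert functions gives \<open>q h(n) + p \<le> \<beta>\<^sub>i\<^sub>+\<^sub>1(M) + q\<close>, where
  \<open>h(n) = dim Q\<^sub>n\<close>. For the canonical module \<open>W\<close>, the assignment \<open>I \<mapsto> (0 :\<^sub>W I)\<close> preserves lengths of
  subquotients; so \<open>W\<close> has the length \<open>l\<close> of \<open>R\<close>, \<open>\<beta>\<^sub>0(W)\<close> is at least the length \<open>r\<close> of the socle, and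
  counting lengths in a presentation gives \<open>(\<beta>\<^sub>0(W) - 1) l \<le> \<beta>\<^sub>1(W) (l - r)\<close>. Finally \<open>dim A \<le> e\<close>, because a
  longer chain of primes would yield \<open>e + 1\<close> elements without polynomial relation over \<open>k\<close>.\<close>

section \<open>Lengths of modules\<close>

text \<open>Two obstacles shape the proof. \<open>Tor\<close> uses an arbitrary chosen resolution,
  so minimality is not given: syzygies are compared up to stable equivalence, and the Betti number
  in degree j + 1 is recognised as the length of (B \<inter> mF)/mB, where B is the kernel of the
  cover by the free module F in degree j; this length does not depend on the cover. Secondly, the
  lift \<Phi> of the minimal matrix to Q is not homogeneous, so its kernel is not graded. It is
  replaced by approximations Zn N = {z. \<Phi> z \<in> m^N Q^q}, and all statements hold up to high
  powers of m. With Z = Zn n the number of generators of the kernel over R is the length of Z/mZ.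
  Here Z/Zn (n+1) is m^n Q^q/m^(n+1) Q^q and gives q h(n). The rest receives the generators of K =
  Zn N for large N independently, because K \<inter> mZ lies in mK up to high order; this is a
  Koszul argument. K has at least p - q generators, as Q^p/K embeds into Q^q/m^N Q^q; N is taken so
  large that the polynomial growth of lengths forces this integer inequality.\<close>

definition cyc :: "('a, 'b) ring_scheme \<Rightarrow> ('a, 'm, 'c) module_scheme \<Rightarrow> 'm \<Rightarrow> 'm set"
  where "cyc R M u = {r \<odot>\<^bsub>M\<^esub> u | r. r \<in> carrier R}"

text \<open>This is mU for the ideal m generated by \<open>x 0\<close>, ...,
  \<open>x (e - 1)\<close>. As U will be closed under scalars, one summand per generator suffices
  and no ring coefficients occur. Giving m by its generators lets the same formula serve the
  polynomial ring, its truncation and the residue field.\<close>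

definition mmul :: "('a, 'm, 'c) module_scheme \<Rightarrow> (nat \<Rightarrow> 'a) \<Rightarrow> nat \<Rightarrow> 'm set \<Rightarrow> 'm set"
  where "mmul M x e U = {v. \<exists>f \<in> {..<e} \<rightarrow> U. v = (\<Oplus>\<^bsub>M\<^esub>i\<in>{..<e}. x i \<odot>\<^bsub>M\<^esub> f i)}"

definition var_ideal :: "('a, 'b) ring_scheme \<Rightarrow> (nat \<Rightarrow> 'a) \<Rightarrow> nat \<Rightarrow> 'a set"
  where "var_ideal R x e = mmul (self_module R) x e (carrier R)"

text \<open>\<open>mlen R x e M V U n\<close>: the module \<open>U/V\<close> has a composition series of length \<open>n\<close> with all factors
  killed by \<open>x\<^sub>0,\<dots>,x\<^sub>e\<^sub>-\<^sub>1\<close>.\<close>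
inductive mlen :: "('a, 'b) ring_scheme \<Rightarrow> (nat \<Rightarrow> 'a) \<Rightarrow> nat \<Rightarrow> ('a, 'm, 'c) module_scheme
    \<Rightarrow> 'm set \<Rightarrow> 'm set \<Rightarrow> nat \<Rightarrow> bool"
  for R x e M V where
  mlen_refl: "submodule R V M \<Longrightarrow> mlen R x e M V V 0"
| mlen_step: "\<lbrakk> mlen R x e M V U k; u \<in> carrier M; u \<notin> U; \<And>i. i < e \<Longrightarrow> x i \<odot>\<^bsub>M\<^esub> u \<in> U \<rbrakk>
    \<Longrightarrow> mlen R x e M V (U <+>\<^bsub>M\<^esub> cyc R M u) (Suc k)"

text \<open>The ideal generated by the \<open>x i\<close> is maximal, but \<open>R\<close> need not be local: the locale covers both the
  polynomial ring with its variables and its truncations.\<close>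
locale mring = cring R for R :: "('a, 'b) ring_scheme" (structure) +
  fixes x :: "nat \<Rightarrow> 'a" and e :: nat
  assumes x_closed: "i < e \<Longrightarrow> x i \<in> carrier R"
    and one_notin: "\<one> \<notin> var_ideal R x e"
    and inv_mod: "\<lbrakk> a \<in> carrier R; a \<notin> var_ideal R x e \<rbrakk>
      \<Longrightarrow> \<exists>b\<in>carrier R. \<exists>c\<in>var_ideal R x e. a \<otimes> b = \<one> \<oplus> c"

locale lmod = R?: mring R x e + module R M for R :: "('a, 'b) ring_scheme" (structure) and x e
  and M :: "('a, 'm, 'c) module_scheme" (structure)
begin

abbreviation "sub U \<equiv> submodule R U M"
abbreviation "mm U \<equiv> mmul M x e U"
abbreviation "len \<equiv> mlen R x e M"

lemma subD: assumes "sub U" shows "U \<subseteq> carrier M" "u \<in> U \<Longrightarrow> u \<in> carrier M"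
  "\<zero>\<^bsub>M\<^esub> \<in> U" "\<lbrakk> u \<in> U; v \<in> U \<rbrakk> \<Longrightarrow> u \<oplus>\<^bsub>M\<^esub> v \<in> U" "\<lbrakk> r \<in> carrier R; u \<in> U \<rbrakk> \<Longrightarrow> r \<odot>\<^bsub>M\<^esub> u \<in> U"
  using assms unfolding submodule_def by auto

lemma subI: assumes "U \<subseteq> carrier M" "\<zero>\<^bsub>M\<^esub> \<in> U" "\<And>u v. \<lbrakk> u \<in> U; v \<in> U \<rbrakk> \<Longrightarrow> u \<oplus>\<^bsub>M\<^esub> v \<in> U"
  "\<And>r u. \<lbrakk> r \<in> carrier R; u \<in> U \<rbrakk> \<Longrightarrow> r \<odot>\<^bsub>M\<^esub> u \<in> U" shows "sub U"
  using assms module_axioms unfolding submodule_def by auto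

lemma sub_neg: "\<lbrakk> sub U; u \<in> U \<rbrakk> \<Longrightarrow> \<ominus>\<^bsub>M\<^esub> u \<in> U"
  by (metis R.add.inv_closed one_closed smult_minus_1 subD(2) subD(5))

lemma sub_minus: "\<lbrakk> sub U; u \<in> U; v \<in> U \<rbrakk> \<Longrightarrow> u \<ominus>\<^bsub>M\<^esub> v \<in> U"
  by (simp add: a_minus_def sub_neg subD(4))

lemma add_minus: "\<lbrakk> t \<in> carrier M; w \<in> carrier M \<rbrakk> \<Longrightarrow> t \<oplus>\<^bsub>M\<^esub> (w \<ominus>\<^bsub>M\<^esub> t) = w"
  by (simp add: a_minus_def M.a_comm[of w] M.r_neg2)

lemma sub_add_cancel: assumes "sub U" "u \<in> U" "u \<oplus>\<^bsub>M\<^esub> v \<in> U" "v \<in> carrier M" shows "v \<in> U"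
proof -
  have "v = \<ominus>\<^bsub>M\<^esub> u \<oplus>\<^bsub>M\<^esub> (u \<oplus>\<^bsub>M\<^esub> v)"
    using assms subD(2)[OF assms(1)] by (simp add: M.r_neg1)
  then show ?thesis using assms sub_neg subD(4) by metis
qed

lemma sub_finsum: "\<lbrakk> sub U; finite I; \<And>i. i \<in> I \<Longrightarrow> f i \<in> U \<rbrakk> \<Longrightarrow> (\<Oplus>\<^bsub>M\<^esub>i\<in>I. f i) \<in> U"
proof -
  assume U: "sub U" and fin: "finite I" and f: "\<And>i. i \<in> I \<Longrightarrow> f i \<in> U"
  show ?thesis using fin f
  proof (induction I)
    case empty then show ?case using subD(3)[OF U] by simp
  next
    case (insert i I)
    have "f \<in> I \<rightarrow> carrier M" "f i \<in> carrier M" using insert subD(2)[OF U] by auto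
    then show ?case using insert subD(4)[OF U] by simp
  qed
qed

lemma sub_carrier: "sub (carrier M)" by (rule subI) auto
lemma sub_zero: "sub {\<zero>\<^bsub>M\<^esub>}" by (rule subI) auto
lemma sub_Int: "\<lbrakk> sub U; sub V \<rbrakk> \<Longrightarrow> sub (U \<inter> V)"
  by (rule subI) (auto dest: subD)
lemma sub_cyc: "u \<in> carrier M \<Longrightarrow> sub (cyc R M u)"
proof (rule subI)
  assume u: "u \<in> carrier M"
  show "cyc R M u \<subseteq> carrier M" using u by (auto simp: cyc_def)
  show "\<zero>\<^bsub>M\<^esub> \<in> cyc R M u" using u lmult_0[OF u] by (force simp: cyc_def)
  show "\<And>a b. a \<in> cyc R M u \<Longrightarrow> b \<in> cyc R M u \<Longrightarrow> a \<oplus>\<^bsub>M\<^esub> b \<in> cyc R M u"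
    using u by (auto simp: cyc_def) (metis R.add.m_closed smult_l_distr)
  show "\<And>r a. r \<in> carrier R \<Longrightarrow> a \<in> cyc R M u \<Longrightarrow> r \<odot>\<^bsub>M\<^esub> a \<in> cyc R M u"
    using u by (auto simp: cyc_def) (metis R.m_closed smult_assoc1)
qed

lemma cyc_self: "u \<in> carrier M \<Longrightarrow> u \<in> cyc R M u"
  unfolding cyc_def by (metis (mono_tags, lifting) mem_Collect_eq one_closed smult_one)

lemma cyc_least: "\<lbrakk> sub U; u \<in> U \<rbrakk> \<Longrightarrow> cyc R M u \<subseteq> U"
  by (auto simp: cyc_def dest: subD)

lemma mem_add: "z \<in> V <+>\<^bsub>M\<^esub> W \<longleftrightarrow> (\<exists>v\<in>V. \<exists>w\<in>W. z = v \<oplus>\<^bsub>M\<^esub> w)"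
  by (auto simp: set_add_def')

lemma sub_add: assumes "sub V" "sub W" shows "sub (V <+>\<^bsub>M\<^esub> W)"
proof (rule subI)
  note V = subD[OF assms(1)] and W = subD[OF assms(2)]
  show "V <+>\<^bsub>M\<^esub> W \<subseteq> carrier M" using V W by (auto simp: mem_add)
  show "\<zero>\<^bsub>M\<^esub> \<in> V <+>\<^bsub>M\<^esub> W" unfolding mem_add using V W M.l_zero by (metis M.zero_closed)
  fix a b assume "a \<in> V <+>\<^bsub>M\<^esub> W" "b \<in> V <+>\<^bsub>M\<^esub> W"
  then obtain v w v' w' where *: "v \<in> V" "w \<in> W" "a = v \<oplus>\<^bsub>M\<^esub> w" "v' \<in> V" "w' \<in> W" "b = v' \<oplus>\<^bsub>M\<^esub> w'"
    by (auto simp: mem_add)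
  have "a \<oplus>\<^bsub>M\<^esub> b = (v \<oplus>\<^bsub>M\<^esub> v') \<oplus>\<^bsub>M\<^esub> (w \<oplus>\<^bsub>M\<^esub> w')"
    using * V(2) W(2) by (simp add: M.a_ac)
  then show "a \<oplus>\<^bsub>M\<^esub> b \<in> V <+>\<^bsub>M\<^esub> W" unfolding mem_add using * V(4) W(4) by blast
next
  note V = subD[OF assms(1)] and W = subD[OF assms(2)]
  fix r a assume r: "r \<in> carrier R" and "a \<in> V <+>\<^bsub>M\<^esub> W"
  then obtain v w where *: "v \<in> V" "w \<in> W" "a = v \<oplus>\<^bsub>M\<^esub> w" by (auto simp: mem_add)
  have "r \<odot>\<^bsub>M\<^esub> a = r \<odot>\<^bsub>M\<^esub> v \<oplus>\<^bsub>M\<^esub> r \<odot>\<^bsub>M\<^esub> w" using * r V(2) W(2) by (simp add: smult_r_distr)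
  then show "r \<odot>\<^bsub>M\<^esub> a \<in> V <+>\<^bsub>M\<^esub> W" unfolding mem_add using * r V(5) W(5) by blast
qed

lemma add_least: "\<lbrakk> sub T; V \<subseteq> T; W \<subseteq> T \<rbrakk> \<Longrightarrow> V <+>\<^bsub>M\<^esub> W \<subseteq> T"
  unfolding mem_add subset_iff using subD(4) by (metis mem_add)
lemma add_upper1: "\<lbrakk> sub V; sub W \<rbrakk> \<Longrightarrow> V \<subseteq> V <+>\<^bsub>M\<^esub> W"
  by (auto simp: mem_add) (metis M.r_zero subD(2) subD(3))
lemma add_upper2: "\<lbrakk> sub V; sub W \<rbrakk> \<Longrightarrow> W \<subseteq> V <+>\<^bsub>M\<^esub> W"
  by (auto simp: mem_add) (metis M.l_zero subD(2) subD(3))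
lemma add_mono: "\<lbrakk> V \<subseteq> V'; W \<subseteq> W' \<rbrakk> \<Longrightarrow> V <+>\<^bsub>M\<^esub> W \<subseteq> V' <+>\<^bsub>M\<^esub> W'"
  unfolding set_add_def' by blast
lemma add_absorb: assumes "sub V" "sub U" "V \<subseteq> U" shows "V <+>\<^bsub>M\<^esub> U = U" "U <+>\<^bsub>M\<^esub> V = U"
  using add_least[OF assms(2), of V U] add_least[OF assms(2), of U V] add_upper1 add_upper2 assms
  by (simp_all add: subset_antisym)
lemma sub_add_ac:
  assumes "sub U" "sub V" "sub W"
  shows "U <+>\<^bsub>M\<^esub> V = V <+>\<^bsub>M\<^esub> U" "(U <+>\<^bsub>M\<^esub> V) <+>\<^bsub>M\<^esub> W = U <+>\<^bsub>M\<^esub> (V <+>\<^bsub>M\<^esub> W)"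
proof -
  note s = sub_add assms add_upper1 add_upper2
  show "U <+>\<^bsub>M\<^esub> V = V <+>\<^bsub>M\<^esub> U"
    by (intro subset_antisym add_least) (auto simp: s)
  show "(U <+>\<^bsub>M\<^esub> V) <+>\<^bsub>M\<^esub> W = U <+>\<^bsub>M\<^esub> (V <+>\<^bsub>M\<^esub> W)"
    by (intro subset_antisym add_least) (use s in \<open>meson subset_trans sub_add add_upper1 add_upper2\<close>)+
qed

lemma mm_gen: assumes "sub U" "i < e" "u \<in> U" shows "x i \<odot>\<^bsub>M\<^esub> u \<in> mm U"
proof -
  define f where "f = (\<lambda>j. if j = i then u else \<zero>\<^bsub>M\<^esub>)"
  have f: "f \<in> {..<e} \<rightarrow> U" using assms subD(3)[OF assms(1)] by (auto simp: f_def)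
  have u: "u \<in> carrier M" using assms subD(2) by blast
  have "(\<Oplus>\<^bsub>M\<^esub>j\<in>{..<e}. x j \<odot>\<^bsub>M\<^esub> f j) = (\<Oplus>\<^bsub>M\<^esub>j\<in>{..<e}. if i = j then x j \<odot>\<^bsub>M\<^esub> u else \<zero>\<^bsub>M\<^esub>)"
    by (rule M.finsum_cong') (use u x_closed in \<open>auto simp: f_def\<close>)
  also have "\<dots> = x i \<odot>\<^bsub>M\<^esub> u"
    using M.finsum_singleton[of i "{..<e}" "\<lambda>j. x j \<odot>\<^bsub>M\<^esub> u"] assms u x_closed by auto
  finally show ?thesis using f unfolding mmul_def by force
qed

lemma mm_least: assumes "sub T" "\<And>i u. \<lbrakk> i < e; u \<in> U \<rbrakk> \<Longrightarrow> x i \<odot>\<^bsub>M\<^esub> u \<in> T" shows "mm U \<subseteq> T"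
  unfolding mmul_def using assms by (auto intro!: sub_finsum)

lemma mm_sub: assumes "sub U" shows "sub (mm U)"
proof (rule subI)
  note U = subD[OF assms]
  show "mm U \<subseteq> carrier M" by (rule mm_least[OF sub_carrier]) (use U x_closed in auto)
  show "\<zero>\<^bsub>M\<^esub> \<in> mm U" unfolding mmul_def
    apply (rule CollectI, rule bexI[of _ "\<lambda>_. \<zero>\<^bsub>M\<^esub>"]) using U x_closed by (auto intro!: M.add.finprod_one_eqI[symmetric])
  fix a b assume "a \<in> mm U" "b \<in> mm U"
  then obtain f g where *: "f \<in> {..<e} \<rightarrow> U" "g \<in> {..<e} \<rightarrow> U" "a = (\<Oplus>\<^bsub>M\<^esub>i\<in>{..<e}. x i \<odot>\<^bsub>M\<^esub> f i)"
     "b = (\<Oplus>\<^bsub>M\<^esub>i\<in>{..<e}. x i \<odot>\<^bsub>M\<^esub> g i)" by (auto simp: mmul_def)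
  have c: "\<And>i. i < e \<Longrightarrow> f i \<in> carrier M" "\<And>i. i < e \<Longrightarrow> g i \<in> carrier M" using * U by auto
  have "a \<oplus>\<^bsub>M\<^esub> b = (\<Oplus>\<^bsub>M\<^esub>i\<in>{..<e}. x i \<odot>\<^bsub>M\<^esub> f i \<oplus>\<^bsub>M\<^esub> x i \<odot>\<^bsub>M\<^esub> g i)"
    unfolding * by (subst M.finsum_addf) (use c x_closed in auto)
  also have "\<dots> = (\<Oplus>\<^bsub>M\<^esub>i\<in>{..<e}. x i \<odot>\<^bsub>M\<^esub> (f i \<oplus>\<^bsub>M\<^esub> g i))"
    by (rule M.finsum_cong') (use c x_closed in \<open>auto simp: smult_r_distr\<close>)
  finally show "a \<oplus>\<^bsub>M\<^esub> b \<in> mm U" unfolding mmul_def using * U(4)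
    by (intro CollectI bexI[of _ "\<lambda>i. f i \<oplus>\<^bsub>M\<^esub> g i"]) auto
next
  note U = subD[OF assms]
  fix r a assume r: "r \<in> carrier R" and "a \<in> mm U"
  then obtain f where *: "f \<in> {..<e} \<rightarrow> U" "a = (\<Oplus>\<^bsub>M\<^esub>i\<in>{..<e}. x i \<odot>\<^bsub>M\<^esub> f i)" by (auto simp: mmul_def)
  have c: "\<And>i. i < e \<Longrightarrow> f i \<in> carrier M" using * U by auto
  have "r \<odot>\<^bsub>M\<^esub> a = (\<Oplus>\<^bsub>M\<^esub>i\<in>{..<e}. r \<odot>\<^bsub>M\<^esub> (x i \<odot>\<^bsub>M\<^esub> f i))"
    unfolding * by (subst finsum_smult) (use c r x_closed in auto)
  also have "\<dots> = (\<Oplus>\<^bsub>M\<^esub>i\<in>{..<e}. x i \<odot>\<^bsub>M\<^esub> (r \<odot>\<^bsub>M\<^esub> f i))"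
    by (rule M.finsum_cong') (use c r x_closed in \<open>auto simp: smult_assoc1[symmetric] R.m_comm\<close>)
  finally show "r \<odot>\<^bsub>M\<^esub> a \<in> mm U" unfolding mmul_def using * U(5) r
    by (intro CollectI bexI[of _ "\<lambda>i. r \<odot>\<^bsub>M\<^esub> f i"]) auto
qed

lemma mm_subset: "sub U \<Longrightarrow> mm U \<subseteq> U"
  by (rule mm_least) (auto simp: subD x_closed)

lemma mm_mono: "U \<subseteq> V \<Longrightarrow> mm U \<subseteq> mm V"
  unfolding mmul_def by fast

lemma mm_add: assumes "sub U" "sub V" shows "mm (U <+>\<^bsub>M\<^esub> V) = mm U <+>\<^bsub>M\<^esub> mm V"
proof (rule subset_antisym)
  show "mm (U <+>\<^bsub>M\<^esub> V) \<subseteq> mm U <+>\<^bsub>M\<^esub> mm V"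
  proof (rule mm_least[OF sub_add[OF mm_sub[OF assms(1)] mm_sub[OF assms(2)]]])
    fix i u assume i: "i < e" and "u \<in> U <+>\<^bsub>M\<^esub> V"
    then obtain a b where *: "a \<in> U" "b \<in> V" "u = a \<oplus>\<^bsub>M\<^esub> b" by (auto simp: mem_add)
    have "x i \<odot>\<^bsub>M\<^esub> u = x i \<odot>\<^bsub>M\<^esub> a \<oplus>\<^bsub>M\<^esub> x i \<odot>\<^bsub>M\<^esub> b"
      using * subD(2)[OF assms(1)] subD(2)[OF assms(2)] i x_closed by (simp add: smult_r_distr)
    then show "x i \<odot>\<^bsub>M\<^esub> u \<in> mm U <+>\<^bsub>M\<^esub> mm V" unfolding mem_add using mm_gen assms i * by blast
  qed
  show "mm U <+>\<^bsub>M\<^esub> mm V \<subseteq> mm (U <+>\<^bsub>M\<^esub> V)"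
    using assms by (intro add_least mm_sub sub_add mm_mono add_upper1 add_upper2) auto
qed

lemma finsum_smult_l:
  assumes "finite I" "u \<in> carrier M" "f \<in> I \<rightarrow> carrier R"
  shows "finsum R f I \<odot>\<^bsub>M\<^esub> u = (\<Oplus>\<^bsub>M\<^esub>i\<in>I. f i \<odot>\<^bsub>M\<^esub> u)"
  using assms(1,3)
proof (induction I)
  case empty then show ?case using assms(2) by simp
next
  case (insert i I)
  have "f \<in> I \<rightarrow> carrier R" "f i \<in> carrier R" "(\<lambda>i. f i \<odot>\<^bsub>M\<^esub> u) \<in> I \<rightarrow> carrier M"
    using insert.prems assms(2) by auto
  then show ?case using insert assms(2) by (simp add: smult_l_distr)
qed

lemma self_finsum: "finsum (self_module R) f I = finsum R f I"
  unfolding finsum_def finprod_def self_module_def by simp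

lemma var_ideal_alt: "var_ideal R x e = {r. \<exists>f\<in>{..<e} \<rightarrow> carrier R. r = (\<Oplus>i\<in>{..<e}. x i \<otimes> f i)}"
  unfolding var_ideal_def mmul_def self_finsum by (simp add: self_module_def)

lemma smult_var_ideal: assumes "sub U" "u \<in> U" "r \<in> var_ideal R x e" shows "r \<odot>\<^bsub>M\<^esub> u \<in> mm U"
proof -
  obtain f where f: "f \<in> {..<e} \<rightarrow> carrier R" "r = (\<Oplus>i\<in>{..<e}. x i \<otimes> f i)"
    using assms(3) unfolding var_ideal_alt by blast
  have u: "u \<in> carrier M" using assms subD by blast
  have c: "\<And>i. i < e \<Longrightarrow> f i \<in> carrier R" using f by auto
  have "r \<odot>\<^bsub>M\<^esub> u = (\<Oplus>\<^bsub>M\<^esub>i\<in>{..<e}. (x i \<otimes> f i) \<odot>\<^bsub>M\<^esub> u)"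
    unfolding f by (subst finsum_smult_l) (use c u x_closed in auto)
  also have "\<dots> = (\<Oplus>\<^bsub>M\<^esub>i\<in>{..<e}. x i \<odot>\<^bsub>M\<^esub> (f i \<odot>\<^bsub>M\<^esub> u))"
    by (rule M.finsum_cong') (use c u x_closed in \<open>auto simp: smult_assoc1\<close>)
  finally show ?thesis unfolding mmul_def
    using c assms(2) subD(5)[OF assms(1)] by (intro CollectI bexI[of _ "\<lambda>i. f i \<odot>\<^bsub>M\<^esub> u"]) auto
qed

lemma var_ideal_carrier: "var_ideal R x e \<subseteq> carrier R"
  unfolding var_ideal_alt using x_closed by (auto intro!: R.finsum_closed)

lemma len_sub: assumes "len V U n" shows "sub V" "sub U" "V \<subseteq> U"
proof -
  have "sub V \<and> sub U \<and> V \<subseteq> U"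
    using assms
  proof (induction rule: mlen.induct)
    case (mlen_step U k u)
    then show ?case using sub_add[OF _ sub_cyc] add_upper1[OF _ sub_cyc] by blast
  qed auto
  then show "sub V" "sub U" "V \<subseteq> U" by auto
qed

text \<open>Annihilation modulo U is assumed for the generators \<open>x i\<close> only. It passes
  to all of m because an element of m times u lies in m(Ru), whose generators are scalar multiples
  of the \<open>x i\<close> times u.\<close>

lemma cyc_mod:
  assumes "sub U" "u \<in> carrier M" "\<And>i. i < e \<Longrightarrow> x i \<odot>\<^bsub>M\<^esub> u \<in> U" "r \<in> var_ideal R x e"
  shows "r \<odot>\<^bsub>M\<^esub> u \<in> U"
proof -
  have "r \<odot>\<^bsub>M\<^esub> u \<in> mm (cyc R M u)"
    using assms smult_var_ideal[OF sub_cyc] cyc_self by blast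
  moreover have "mm (cyc R M u) \<subseteq> U"
  proof (rule mm_least[OF assms(1)])
    fix i v assume i: "i < e" and "v \<in> cyc R M u"
    then obtain s where s: "s \<in> carrier R" "v = s \<odot>\<^bsub>M\<^esub> u" by (auto simp: cyc_def)
    have "x i \<odot>\<^bsub>M\<^esub> v = s \<odot>\<^bsub>M\<^esub> (x i \<odot>\<^bsub>M\<^esub> u)"
      using s i assms x_closed by (simp add: smult_assoc1[symmetric] R.m_comm)
    then show "x i \<odot>\<^bsub>M\<^esub> v \<in> U" using assms i s subD(5)[OF assms(1)] by simp
  qed
  ultimately show ?thesis by blast
qed

text \<open>A step U < U + Ru of a composition series is simple: a new element w = a + ru has r
  outside m, because mu lies in U. Then r is invertible modulo m, which recovers u from w modulo
  U.\<close>

lemma cyc_exchange: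
  assumes U: "sub U" and u: "u \<in> carrier M" and xu: "\<And>i. i < e \<Longrightarrow> x i \<odot>\<^bsub>M\<^esub> u \<in> U"
    and w: "w \<in> U <+>\<^bsub>M\<^esub> cyc R M u" "w \<notin> U"
  shows "U <+>\<^bsub>M\<^esub> cyc R M u = U <+>\<^bsub>M\<^esub> cyc R M w" "\<And>i. i < e \<Longrightarrow> x i \<odot>\<^bsub>M\<^esub> w \<in> U"
proof -
  obtain a r where *: "a \<in> U" "r \<in> carrier R" "w = a \<oplus>\<^bsub>M\<^esub> r \<odot>\<^bsub>M\<^esub> u"
    using w by (auto simp: mem_add cyc_def)
  have a: "a \<in> carrier M" using * U subD by blast
  have wc: "w \<in> carrier M" using * a u by simp
  have "r \<notin> var_ideal R x e"
    using cyc_mod[OF U u xu] * w(2) subD(4)[OF U] by blast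
  then obtain b c where bc: "b \<in> carrier R" "c \<in> var_ideal R x e" "r \<otimes> b = \<one> \<oplus> c"
    using inv_mod * by blast
  have cc: "c \<in> carrier R" using bc var_ideal_carrier by auto
  have "b \<odot>\<^bsub>M\<^esub> w = b \<odot>\<^bsub>M\<^esub> a \<oplus>\<^bsub>M\<^esub> (b \<otimes> r) \<odot>\<^bsub>M\<^esub> u"
    using * a u bc by (simp add: smult_r_distr smult_assoc1)
  also have "(b \<otimes> r) \<odot>\<^bsub>M\<^esub> u = u \<oplus>\<^bsub>M\<^esub> c \<odot>\<^bsub>M\<^esub> u"
    using bc * u cc by (simp add: R.m_comm[of b r] smult_l_distr)
  finally have 1: "b \<odot>\<^bsub>M\<^esub> w = (b \<odot>\<^bsub>M\<^esub> a \<oplus>\<^bsub>M\<^esub> c \<odot>\<^bsub>M\<^esub> u) \<oplus>\<^bsub>M\<^esub> u"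
    using bc a u cc by (simp add: M.a_ac)
  have 2: "b \<odot>\<^bsub>M\<^esub> a \<oplus>\<^bsub>M\<^esub> c \<odot>\<^bsub>M\<^esub> u \<in> U"
    using bc(1) * cyc_mod[OF U u xu bc(2)] subD(4,5)[OF U] by simp
  have s: "sub (U <+>\<^bsub>M\<^esub> cyc R M w)" using sub_add[OF U sub_cyc[OF wc]] .
  have "b \<odot>\<^bsub>M\<^esub> w \<in> U <+>\<^bsub>M\<^esub> cyc R M w"
    using add_upper2[OF U sub_cyc[OF wc]] bc(1) by (auto simp: cyc_def)
  then have "u \<in> U <+>\<^bsub>M\<^esub> cyc R M w"
    using 1 2 sub_add_cancel[OF s, of "b \<odot>\<^bsub>M\<^esub> a \<oplus>\<^bsub>M\<^esub> c \<odot>\<^bsub>M\<^esub> u" u]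
     add_upper1[OF U sub_cyc[OF wc]] u by auto
  then have "cyc R M u \<subseteq> U <+>\<^bsub>M\<^esub> cyc R M w" using cyc_least[OF s] by blast
  moreover have "cyc R M w \<subseteq> U <+>\<^bsub>M\<^esub> cyc R M u" using cyc_least[OF sub_add[OF U sub_cyc[OF u]] w(1)] .
  ultimately show "U <+>\<^bsub>M\<^esub> cyc R M u = U <+>\<^bsub>M\<^esub> cyc R M w"
    using add_least s sub_add[OF U sub_cyc[OF u]] add_upper1[OF U] sub_cyc u wc
    by (intro subset_antisym) auto
  fix i assume i: "i < e"
  have "x i \<odot>\<^bsub>M\<^esub> w = x i \<odot>\<^bsub>M\<^esub> a \<oplus>\<^bsub>M\<^esub> r \<odot>\<^bsub>M\<^esub> (x i \<odot>\<^bsub>M\<^esub> u)"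
    using * a u i x_closed by (simp add: smult_r_distr smult_assoc1[symmetric] R.m_comm)
  then show "x i \<odot>\<^bsub>M\<^esub> w \<in> U" using * i xu x_closed subD[OF U] by simp
qed

text \<open>Each step of the series enlarges exactly one of U \<inter> W and U + W, and it does so
  by one simple factor. Additivity, uniqueness and monotonicity of lengths are all drawn from this
  splitting, in which W is arbitrary.\<close>

lemma len_Int_add:
  assumes "len V U n" "sub W"
  shows "\<exists>a b. a + b = n \<and> len (V \<inter> W) (U \<inter> W) a \<and> len (V <+>\<^bsub>M\<^esub> W) (U <+>\<^bsub>M\<^esub> W) b"
  using assms
proof (induction rule: mlen.induct)
  case mlen_refl
  then show ?case
    using mlen.mlen_refl[OF sub_Int] mlen.mlen_refl[OF sub_add] by (metis add_0)
next
  case (mlen_step U k u)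
  then obtain a b where ab: "a + b = k" "len (V \<inter> W) (U \<inter> W) a" "len (V <+>\<^bsub>M\<^esub> W) (U <+>\<^bsub>M\<^esub> W) b"
    by blast
  have U: "sub U" using len_sub mlen_step by blast
  have W: "sub W" by fact
  have cu: "sub (cyc R M u)" using sub_cyc mlen_step by blast
  let ?U = "U <+>\<^bsub>M\<^esub> cyc R M u"
  have U': "sub ?U" using sub_add[OF U cu] .
  have sUW: "sub (U <+>\<^bsub>M\<^esub> W)" using sub_add U W by blast
  show ?case
  \<comment> \<open>Either the new simple factor has no representative in W, and then it survives in
    the sum with W, or its generator can be exchanged for one inside W, and then it counts in the
    intersection.\<close>
  proof (cases "?U \<inter> W \<subseteq> U")
    case True
    then have eq: "?U \<inter> W = U \<inter> W" using add_upper1[OF U cu] by auto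
    have sum: "?U <+>\<^bsub>M\<^esub> W = (U <+>\<^bsub>M\<^esub> W) <+>\<^bsub>M\<^esub> cyc R M u"
      using sub_add_ac U W cu by metis
    have "u \<notin> U <+>\<^bsub>M\<^esub> W"
    proof
      assume "u \<in> U <+>\<^bsub>M\<^esub> W"
      then obtain a w where aw: "a \<in> U" "w \<in> W" "u = a \<oplus>\<^bsub>M\<^esub> w" by (auto simp: mem_add)
      have "u \<in> ?U" using add_upper2[OF U cu] cyc_self mlen_step by blast
      then have "w \<in> ?U" using sub_add_cancel[OF U', of a w] aw add_upper1[OF U cu] subD[OF W] by blast
      then have "w \<in> U" using True aw by blast
      then show False using aw subD(4)[OF U] mlen_step by blast
    qed
    then have "len (V <+>\<^bsub>M\<^esub> W) ((U <+>\<^bsub>M\<^esub> W) <+>\<^bsub>M\<^esub> cyc R M u) (Suc b)"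
      using mlen_step add_upper1[OF U W] by (intro mlen.mlen_step[OF ab(3)]) auto
    then show ?thesis using ab eq sum by (metis add_Suc_right)
  next
    case False
    then obtain w where w: "w \<in> ?U" "w \<in> W" "w \<notin> U" by blast
    have ex: "?U = U <+>\<^bsub>M\<^esub> cyc R M w"
      by (rule cyc_exchange(1)[OF U mlen_step(2) _ w(1) w(3)]) (rule mlen_step)
    have ex2: "x i \<odot>\<^bsub>M\<^esub> w \<in> U" if "i < e" for i
      by (rule cyc_exchange(2)[OF U mlen_step(2) _ w(1) w(3) that]) (rule mlen_step)
    have wc: "w \<in> carrier M" using w W subD by blast
    have cw: "sub (cyc R M w)" using sub_cyc wc by blast
    have cwW: "cyc R M w \<subseteq> W" using cyc_least W w by blast
    have 1: "?U \<inter> W = (U \<inter> W) <+>\<^bsub>M\<^esub> cyc R M w"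
    proof (rule subset_antisym)
      show "?U \<inter> W \<subseteq> (U \<inter> W) <+>\<^bsub>M\<^esub> cyc R M w"
      proof
        fix z assume z: "z \<in> ?U \<inter> W"
        then obtain a b where *: "a \<in> U" "b \<in> cyc R M w" "z = a \<oplus>\<^bsub>M\<^esub> b" using ex by (auto simp: mem_add)
        have "a \<in> W" using sub_add_cancel[OF W, of b a] * z cwW subD[OF W] subD[OF U] M.a_comm by (metis IntE in_mono)
        then show "z \<in> (U \<inter> W) <+>\<^bsub>M\<^esub> cyc R M w" using * by (auto simp: mem_add)
      qed
      show "(U \<inter> W) <+>\<^bsub>M\<^esub> cyc R M w \<subseteq> ?U \<inter> W"
        by (rule add_least[OF sub_Int[OF U' W]]) (use cwW add_upper1[OF U cu] add_upper2[OF U cw] ex in auto)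
    qed
    have 2: "?U <+>\<^bsub>M\<^esub> W = U <+>\<^bsub>M\<^esub> W"
      unfolding ex sub_add_ac(2)[OF U cw W] add_absorb(1)[OF cw W cwW] ..
    have "len (V \<inter> W) ((U \<inter> W) <+>\<^bsub>M\<^esub> cyc R M w) (Suc a)"
      using ex2 w wc W x_closed subD(5)[OF W] by (intro mlen.mlen_step[OF ab(2)]) auto
    then show ?thesis using 1 2 ab by (metis add_Suc)
  qed
qed

lemma len_trans: assumes "len U T b" "len V U a" shows "len V T (a + b)"
  using assms by (induction rule: mlen.induct) (auto intro: mlen.mlen_step)

text \<open>The splitting by W = U, where V \<inter> U = V and T + U = T. It is also the source of
  existence for lengths of subquotients.\<close>

lemma len_mid: assumes "len V T n" "sub U" "V \<subseteq> U" "U \<subseteq> T"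
  shows "\<exists>a b. a + b = n \<and> len V U a \<and> len U T b"
proof -
  have T: "sub T" "sub V" using len_sub assms by auto
  have "V \<inter> U = V" "T \<inter> U = U" using assms by auto
  moreover have "V <+>\<^bsub>M\<^esub> U = U" "T <+>\<^bsub>M\<^esub> U = T" using add_absorb T assms by auto
  ultimately show ?thesis using len_Int_add[OF assms(1,2)] by simp
qed

lemma len_0: assumes "len V V n" shows "n = 0"
  using assms
proof (cases rule: mlen.cases)
  case (mlen_step U k u)
  have "sub U" "V \<subseteq> U" using len_sub[OF mlen_step(3)] by auto
  moreover have "u \<in> U <+>\<^bsub>M\<^esub> cyc R M u"
    using add_upper2[OF \<open>sub U\<close> sub_cyc] cyc_self mlen_step(4) by blast
  ultimately show ?thesis using mlen_step(1,5) by blast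
qed auto

lemma len_0_eq: "len V U 0 \<Longrightarrow> V = U"
  by (auto elim: mlen.cases)

lemma len_Suc_cases:
  assumes "len V U (Suc n)"
  obtains T u where "U = T <+>\<^bsub>M\<^esub> cyc R M u" "len V T n" "u \<in> carrier M" "u \<notin> T"
    "\<forall>i<e. x i \<odot>\<^bsub>M\<^esub> u \<in> T" "sub T" "u \<in> U" "T \<subseteq> U"
  using assms
proof (cases rule: mlen.cases)
  case (mlen_step T u)
  have T: "sub T" using len_sub mlen_step by blast
  have cu: "sub (cyc R M u)" using sub_cyc mlen_step by blast
  have "u \<in> U" unfolding mlen_step(1) using add_upper2[OF T cu] cyc_self[OF mlen_step(3)] by (rule subsetD)
  moreover have "T \<subseteq> U" unfolding mlen_step(1) by (rule add_upper1[OF T cu])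
  ultimately show ?thesis using mlen_step T by (intro that[of T u]) simp_all
qed

text \<open>The last proper member S of such a series equals T: otherwise S contains some w outside
  T, and exchanging u for w makes S everything.\<close>

lemma len_cyc_1:
  assumes T: "sub T" "u \<in> carrier M" "u \<notin> T" "\<And>i. i < e \<Longrightarrow> x i \<odot>\<^bsub>M\<^esub> u \<in> T"
    and b: "len T (T <+>\<^bsub>M\<^esub> cyc R M u) b"
  shows "b = 1"
proof (cases b)
  case 0
  have "u \<in> T <+>\<^bsub>M\<^esub> cyc R M u"
    using add_upper2[OF T(1) sub_cyc[OF T(2)]] cyc_self[OF T(2)] by (rule subsetD)
  then show ?thesis using len_0_eq b 0 T(3) by blast
next
  case (Suc k)
  let ?U = "T <+>\<^bsub>M\<^esub> cyc R M u"
  obtain S v where S: "?U = S <+>\<^bsub>M\<^esub> cyc R M v" "len T S k" "v \<in> carrier M" "v \<notin> S"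
      "sub S" "v \<in> ?U" "S \<subseteq> ?U" using b unfolding Suc by (rule len_Suc_cases)
  have TS: "T \<subseteq> S" using len_sub(3)[OF S(2)] .
  have "S = T"
  proof (rule ccontr)
    assume "S \<noteq> T"
    then obtain w where w: "w \<in> S" "w \<notin> T" using TS by blast
    have "w \<in> ?U" using w S(7) by blast
    have "?U = T <+>\<^bsub>M\<^esub> cyc R M w"
      by (rule cyc_exchange(1)[OF T(1,2) _ \<open>w \<in> ?U\<close> w(2)]) (rule T(4))
    also have "\<dots> \<subseteq> S" by (rule add_least[OF S(5) TS cyc_least[OF S(5) w(1)]])
    finally show False using S(4,6) by blast
  qed
  then show ?thesis using S(2) len_0 Suc by simp
qed

text \<open>The Jordan-Hoelder theorem. Induction on one of the two series: cutting the other at the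
  last proper member T of the first leaves a series of U/T, which has one step.\<close>

lemma len_unique: "\<lbrakk> len V U n; len V U m \<rbrakk> \<Longrightarrow> n = m"
proof (induction m arbitrary: n U)
  case 0
  then show ?case using len_0 len_0_eq by blast
next
  case (Suc m)
  obtain T u where T: "U = T <+>\<^bsub>M\<^esub> cyc R M u" "len V T m" "u \<in> carrier M" "u \<notin> T"
    "\<forall>i<e. x i \<odot>\<^bsub>M\<^esub> u \<in> T" "sub T" "u \<in> U" "T \<subseteq> U"
    by (rule len_Suc_cases[OF Suc.prems(2)])
  obtain a b where ab: "a + b = n" "len V T a" "len T U b"
    using len_mid[OF Suc.prems(1) T(6) len_sub(3)[OF T(2)] T(8)] by (elim exE conjE)
  have "a = m" using Suc.IH[OF ab(2) T(2)] .
  moreover have "b = 1" by (rule len_cyc_1[OF T(6,3,4)]) (use T(5) ab(3) T(1) in simp_all)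
  ultimately show ?case using ab by simp
qed

lemma len_mono:
  assumes "len V T n" "len V' U k" "V \<subseteq> V'" "U \<subseteq> T"
  shows "k \<le> n"
proof -
  note s = len_sub[OF assms(2)]
  obtain p q where 1: "p + q = n" "len V V' p" "len V' T q"
    using len_mid[OF assms(1) s(1) assms(3) subset_trans[OF s(3) assms(4)]] by (elim exE conjE)
  obtain p' q' where 2: "p' + q' = q" "len V' U p'" "len U T q'"
    using len_mid[OF 1(3) s(2,3) assms(4)] by (elim exE conjE)
  have "p' = k" by (rule len_unique[OF 2(2) assms(2)])
  then show ?thesis using 1 2 by simp
qed

lemma len_sub_ex:
  assumes "len V T n" "sub V'" "sub U" "V \<subseteq> V'" "V' \<subseteq> U" "U \<subseteq> T"
  shows "\<exists>k. len V' U k"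
proof -
  obtain p q where 1: "p + q = n" "len V V' p" "len V' T q"
    using len_mid[OF assms(1,2,4) subset_trans[OF assms(5,6)]] by (elim exE conjE)
  show ?thesis using len_mid[OF 1(3) assms(3,5,6)] by (elim exE conjE) (rule exI)
qed

end

section \<open>Semilinear maps and the transfer of lengths\<close>

text \<open>Maps over a change of rings \<psi>, defined on a submodule U only. The locale covers
  linear maps (\<psi> the identity), the reduction of vectors from Q to R, and the passage from R to
  its residue field. Partial domains are used because kernels and syzygies occur as subsets of free
  modules; surjectivity of \<psi> makes images of submodules into submodules.\<close>

locale slin = M: lmod R x e M + N: lmod S y e N
  for R :: "('a, 'b) ring_scheme" and x e and M :: "('a, 'm, 'c) module_scheme"
    and S :: "('d, 'g) ring_scheme" and y and N :: "('d, 'n, 'h) module_scheme" +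
  fixes \<psi> :: "'a \<Rightarrow> 'd" and a :: "'m \<Rightarrow> 'n" and U :: "'m set"
  assumes psi_surj: "\<psi> ` carrier R = carrier S" and psi_x: "i < e \<Longrightarrow> \<psi> (x i) = y i"
    and U: "submodule R U M" and a_closed: "u \<in> U \<Longrightarrow> a u \<in> carrier N"
    and a_add: "\<lbrakk> u \<in> U; v \<in> U \<rbrakk> \<Longrightarrow> a (u \<oplus>\<^bsub>M\<^esub> v) = a u \<oplus>\<^bsub>N\<^esub> a v"
    and a_smult: "\<lbrakk> r \<in> carrier R; u \<in> U \<rbrakk> \<Longrightarrow> a (r \<odot>\<^bsub>M\<^esub> u) = \<psi> r \<odot>\<^bsub>N\<^esub> a u"
begin

lemma psi_closed: "r \<in> carrier R \<Longrightarrow> \<psi> r \<in> carrier S" using psi_surj by blast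
lemma U_c: "u \<in> U \<Longrightarrow> u \<in> carrier M" using M.subD(2)[OF U] .
lemma a_zero: "a \<zero>\<^bsub>M\<^esub> = \<zero>\<^bsub>N\<^esub>"
proof -
  have z: "\<zero>\<^bsub>M\<^esub> \<in> U" using M.subD(3)[OF U] .
  have "a \<zero>\<^bsub>M\<^esub> \<oplus>\<^bsub>N\<^esub> a \<zero>\<^bsub>M\<^esub> = a \<zero>\<^bsub>M\<^esub>" using a_add[OF z z] by simp
  then show ?thesis using a_closed[OF z] by (metis N.M.add.r_cancel_one)
qed
lemma a_neg: "u \<in> U \<Longrightarrow> a (\<ominus>\<^bsub>M\<^esub> u) = \<ominus>\<^bsub>N\<^esub> a u"
proof -
  assume u: "u \<in> U"
  have "a (\<ominus>\<^bsub>M\<^esub> u) \<oplus>\<^bsub>N\<^esub> a u = \<zero>\<^bsub>N\<^esub>"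
    using a_add[OF M.sub_neg[OF U u] u] U_c[OF u] a_zero by (simp add: M.M.l_neg)
  then show ?thesis using a_closed u M.sub_neg[OF U u] by (metis N.M.minus_equality)
qed
lemma a_minus: "\<lbrakk> u \<in> U; v \<in> U \<rbrakk> \<Longrightarrow> a (u \<ominus>\<^bsub>M\<^esub> v) = a u \<ominus>\<^bsub>N\<^esub> a v"
  by (simp add: a_minus_def a_add a_neg M.sub_neg[OF U])

lemma a_finsum: "\<lbrakk> finite I; f \<in> I \<rightarrow> U \<rbrakk> \<Longrightarrow> a (\<Oplus>\<^bsub>M\<^esub>i\<in>I. f i) = (\<Oplus>\<^bsub>N\<^esub>i\<in>I. a (f i))"
proof (induction I rule: finite_induct)
  case empty then show ?case by (simp add: a_zero)
next
  case (insert i I)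
  have f: "f \<in> I \<rightarrow> U" "f i \<in> U" using insert.prems by auto
  have "(\<Oplus>\<^bsub>M\<^esub>i\<in>I. f i) \<in> U" by (rule M.sub_finsum[OF U insert(1)]) (use f in blast)
  moreover have "f \<in> I \<rightarrow> carrier M" "(\<lambda>i. a (f i)) \<in> I \<rightarrow> carrier N"
    using f U_c a_closed by auto
  ultimately show ?case using insert f U_c a_closed a_add by simp
qed

lemma sub_vimage: assumes "submodule S T N" shows "submodule R {u \<in> U. a u \<in> T} M"
  by (rule M.subI) (use M.subD[OF U] N.subD[OF assms] a_add a_smult a_zero psi_closed in auto)

lemma sub_image: assumes T: "submodule R T M" "T \<subseteq> U" shows "submodule S (a ` T) N"
proof (rule N.subI)
  note D = M.subD[OF T(1)]
  show "a ` T \<subseteq> carrier N" using a_closed T by blast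
  show "\<zero>\<^bsub>N\<^esub> \<in> a ` T" using D(3) a_zero by force
  show "\<And>u v. u \<in> a ` T \<Longrightarrow> v \<in> a ` T \<Longrightarrow> u \<oplus>\<^bsub>N\<^esub> v \<in> a ` T"
    using D(4) a_add T(2) by (smt (verit) image_iff subsetD)
  show "\<And>r u. r \<in> carrier S \<Longrightarrow> u \<in> a ` T \<Longrightarrow> r \<odot>\<^bsub>N\<^esub> u \<in> a ` T"
    using D(5) a_smult T(2) psi_surj by (smt (verit) image_iff subsetD)
qed

lemma image_mm: assumes T: "submodule R T M" "T \<subseteq> U" shows "a ` mmul M x e T = mmul N y e (a ` T)"
proof (rule subset_antisym)
  show "a ` mmul M x e T \<subseteq> mmul N y e (a ` T)"
  proof
    fix w assume "w \<in> a ` mmul M x e T"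
    then obtain f where f: "f \<in> {..<e} \<rightarrow> T" "w = a (\<Oplus>\<^bsub>M\<^esub>i\<in>{..<e}. x i \<odot>\<^bsub>M\<^esub> f i)" by (auto simp: mmul_def)
    have "w = (\<Oplus>\<^bsub>N\<^esub>i\<in>{..<e}. a (x i \<odot>\<^bsub>M\<^esub> f i))"
      unfolding f(2) by (rule a_finsum) (use f T M.subD(5)[OF U] M.x_closed in auto)
    also have "\<dots> = (\<Oplus>\<^bsub>N\<^esub>i\<in>{..<e}. y i \<odot>\<^bsub>N\<^esub> a (f i))"
      by (rule N.M.finsum_cong') (use f T a_smult psi_x M.x_closed N.x_closed a_closed in \<open>auto simp: Pi_iff subset_iff\<close>)
    finally show "w \<in> mmul N y e (a ` T)" unfolding mmul_def
      by (intro CollectI bexI[of _ "\<lambda>i. a (f i)"]) (use f in auto)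
  qed
  show "mmul N y e (a ` T) \<subseteq> a ` mmul M x e T"
  proof (rule N.mm_least[OF sub_image[OF M.mm_sub[OF T(1)]]])
    show "mmul M x e T \<subseteq> U" using M.mm_subset T by blast
    fix i w assume i: "i < e" and "w \<in> a ` T"
    then obtain t where t: "t \<in> T" "w = a t" by blast
    have "y i \<odot>\<^bsub>N\<^esub> w = a (x i \<odot>\<^bsub>M\<^esub> t)" using t T i M.x_closed psi_x a_smult by auto
    then show "y i \<odot>\<^bsub>N\<^esub> w \<in> a ` mmul M x e T" using M.mm_gen[OF T(1) i t(1)] by blast
  qed
qed

text \<open>Modulo the preimage of V' the map becomes injective, so a composition series above that
  preimage is carried over step by step. A new generator stays new: if its image were old, a
  difference would lie in the preimage, hence already in T.\<close>

lemma len_image: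
  assumes V: "submodule S V' N" and n: "mlen R x e M {u \<in> U. a u \<in> V'} T n" "T \<subseteq> U"
  shows "mlen S y e N V' (a ` T <+>\<^bsub>N\<^esub> V') n"
  using n
proof (induction rule: mlen.induct)
  case mlen_refl
  let ?V = "{u \<in> U. a u \<in> V'}"
  have "a ` ?V <+>\<^bsub>N\<^esub> V' = V'"
    by (rule N.add_absorb(1)[OF sub_image[OF mlen_refl(1)] V]) auto
  then show ?case using mlen.mlen_refl[OF V] by metis
next
  case (mlen_step T k w)
  have T: "submodule R T M" "{u \<in> U. a u \<in> V'} \<subseteq> T" using M.len_sub[OF mlen_step(1)] by auto
  have cw: "submodule R (cyc R M w) M" using M.sub_cyc[OF mlen_step(2)] .
  have sub: "T \<subseteq> U" "w \<in> U"
    using mlen_step.prems M.add_upper1[OF T(1) cw] M.add_upper2[OF T(1) cw] M.cyc_self[OF mlen_step(2)] by auto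
  let ?T = "a ` T <+>\<^bsub>N\<^esub> V'"
  have IH: "mlen S y e N V' ?T k" using mlen_step.IH sub by blast
  have aT: "submodule S (a ` T) N" using sub_image T sub by blast
  have aw: "a w \<in> carrier N" using a_closed sub by blast
  have ni: "a w \<notin> ?T"
  proof
    assume "a w \<in> ?T"
    then obtain t v where tv: "t \<in> T" "v \<in> V'" "a w = a t \<oplus>\<^bsub>N\<^esub> v" by (auto simp: N.mem_add)
    have c: "a t \<in> carrier N" "v \<in> carrier N" using tv a_closed sub N.subD(2)[OF V] by auto
    have tU: "t \<in> U" using tv sub by blast
    have "a (w \<ominus>\<^bsub>M\<^esub> t) = v"
      using c tv(3) a_minus[OF sub(2) tU] N.M.r_neg1[of "a t" v]
      by (simp add: a_minus_def N.M.a_comm)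
    then have "w \<ominus>\<^bsub>M\<^esub> t \<in> T" using tv T(2) M.sub_minus[OF U sub(2) tU] by auto
    then have "t \<oplus>\<^bsub>M\<^esub> (w \<ominus>\<^bsub>M\<^esub> t) \<in> T" using M.subD(4)[OF T(1)] tv by blast
    moreover have "t \<oplus>\<^bsub>M\<^esub> (w \<ominus>\<^bsub>M\<^esub> t) = w"
      using M.add_minus U_c[OF tU] U_c[OF sub(2)] by blast
    ultimately show False using mlen_step(3) by simp
  qed
  have xw: "y i \<odot>\<^bsub>N\<^esub> a w \<in> ?T" if "i < e" for i
  proof -
    have "y i \<odot>\<^bsub>N\<^esub> a w = a (x i \<odot>\<^bsub>M\<^esub> w)" using that psi_x a_smult[OF M.x_closed[OF that] sub(2)] by simp
    then show ?thesis using mlen_step(4)[OF that] N.add_upper1[OF aT V] by auto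
  qed
  have "a ` (T <+>\<^bsub>M\<^esub> cyc R M w) <+>\<^bsub>N\<^esub> V' = ?T <+>\<^bsub>N\<^esub> cyc S N (a w)"
  proof (rule subset_antisym)
    have s: "submodule S (?T <+>\<^bsub>N\<^esub> cyc S N (a w)) N" using N.sub_add N.sub_cyc aT V aw by metis
    show "a ` (T <+>\<^bsub>M\<^esub> cyc R M w) <+>\<^bsub>N\<^esub> V' \<subseteq> ?T <+>\<^bsub>N\<^esub> cyc S N (a w)"
    proof (rule N.add_least[OF s])
      have V1: "V' \<subseteq> ?T" "a ` T \<subseteq> ?T" "?T \<subseteq> ?T <+>\<^bsub>N\<^esub> cyc S N (a w)"
        using N.add_upper2[OF aT V] N.add_upper1[OF aT V] N.add_upper1[OF N.sub_add[OF aT V] N.sub_cyc[OF aw]] by auto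
      then show "V' \<subseteq> ?T <+>\<^bsub>N\<^esub> cyc S N (a w)" by blast
      show "a ` (T <+>\<^bsub>M\<^esub> cyc R M w) \<subseteq> ?T <+>\<^bsub>N\<^esub> cyc S N (a w)"
      proof
        fix z assume "z \<in> a ` (T <+>\<^bsub>M\<^esub> cyc R M w)"
        then obtain t r where tr: "t \<in> T" "r \<in> carrier R" "z = a (t \<oplus>\<^bsub>M\<^esub> r \<odot>\<^bsub>M\<^esub> w)"
          by (auto simp: M.mem_add cyc_def)
        have tU: "t \<in> U" using tr sub by blast
        have "z = a t \<oplus>\<^bsub>N\<^esub> \<psi> r \<odot>\<^bsub>N\<^esub> a w"
          unfolding tr(3) using a_add[OF tU M.subD(5)[OF U tr(2) sub(2)]] a_smult[OF tr(2) sub(2)] by simp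
        moreover have "\<psi> r \<odot>\<^bsub>N\<^esub> a w \<in> cyc S N (a w)" using psi_closed tr(2) by (auto simp: cyc_def)
        ultimately show "z \<in> ?T <+>\<^bsub>N\<^esub> cyc S N (a w)" using V1(2) tr(1) by (subst N.mem_add) blast
      qed
    qed
    have s': "submodule R (T <+>\<^bsub>M\<^esub> cyc R M w) M" using M.sub_add[OF T(1) cw] .
    have s2: "submodule S (a ` (T <+>\<^bsub>M\<^esub> cyc R M w)) N" using sub_image[OF s' mlen_step.prems] .
    have T2: "T \<subseteq> T <+>\<^bsub>M\<^esub> cyc R M w" "w \<in> T <+>\<^bsub>M\<^esub> cyc R M w"
      using M.add_upper1[OF T(1) cw] M.add_upper2[OF T(1) cw] M.cyc_self[OF mlen_step(2)] by auto
    note s3 = N.sub_add[OF s2 V]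
    note up = N.add_upper1[OF s2 V] N.add_upper2[OF s2 V]
    show "?T <+>\<^bsub>N\<^esub> cyc S N (a w) \<subseteq> a ` (T <+>\<^bsub>M\<^esub> cyc R M w) <+>\<^bsub>N\<^esub> V'"
    proof (rule N.add_least[OF s3 N.add_least[OF s3 _ up(2)]])
      show "a ` T \<subseteq> a ` (T <+>\<^bsub>M\<^esub> cyc R M w) <+>\<^bsub>N\<^esub> V'" using T2(1) up(1) by blast
      show "cyc S N (a w) \<subseteq> a ` (T <+>\<^bsub>M\<^esub> cyc R M w) <+>\<^bsub>N\<^esub> V'"
        by (rule N.cyc_least[OF s3]) (use T2(2) up(1) in blast)
    qed
  qed
  then show ?case using mlen.mlen_step[OF IH aw ni xw] by simp
qed

text \<open>The first isomorphism theorem for lengths: \<open>a\<close> induces a bijection from T/V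
  to T'/V'. Surjectivity is demanded only modulo V', which suits maps that are inverse to each other
  up to an error in V'.\<close>

lemma len_hom:
  assumes n: "mlen R x e M V T n" "T \<subseteq> U"
    and V: "V = {u \<in> U. a u \<in> V'}" and V': "submodule S V' N" "V' \<subseteq> T'"
    and T': "submodule S T' N" "a ` T \<subseteq> T'" and surj: "\<And>t. t \<in> T' \<Longrightarrow> \<exists>u\<in>T. \<exists>v\<in>V'. t = a u \<oplus>\<^bsub>N\<^esub> v"
  shows "mlen S y e N V' T' n"
proof -
  have "a ` T <+>\<^bsub>N\<^esub> V' = T'"
    using N.add_least[OF T' V'(2)] surj by (fastforce simp: N.mem_add)
  then show ?thesis using len_image[OF V'(1) n[unfolded V]] by simp
qed

end

section \<open>Linear maps between subsets, free modules, generators\<close>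

text \<open>In contrast to \<open>module_hom\<close>, domain and target are free parameters, so a
  function can be restricted to a kernel without forming a new module record.\<close>

definition lin :: "('a, 'b) ring_scheme \<Rightarrow> ('a, 'm, 'c) module_scheme \<Rightarrow> 'm set \<Rightarrow> ('a, 'n, 'd) module_scheme
    \<Rightarrow> 'n set \<Rightarrow> ('m \<Rightarrow> 'n) \<Rightarrow> bool"
  where "lin R M U N V a \<longleftrightarrow> (\<forall>u\<in>U. a u \<in> V) \<and> (\<forall>u\<in>U. \<forall>v\<in>U. a (u \<oplus>\<^bsub>M\<^esub> v) = a u \<oplus>\<^bsub>N\<^esub> a v) \<and>
    (\<forall>r\<in>carrier R. \<forall>u\<in>U. a (r \<odot>\<^bsub>M\<^esub> u) = r \<odot>\<^bsub>N\<^esub> a u)"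

lemma linD: assumes "lin R M U N V a" shows "u \<in> U \<Longrightarrow> a u \<in> V"
  "\<lbrakk> u \<in> U; v \<in> U \<rbrakk> \<Longrightarrow> a (u \<oplus>\<^bsub>M\<^esub> v) = a u \<oplus>\<^bsub>N\<^esub> a v"
  "\<lbrakk> r \<in> carrier R; u \<in> U \<rbrakk> \<Longrightarrow> a (r \<odot>\<^bsub>M\<^esub> u) = r \<odot>\<^bsub>N\<^esub> a u"
  using assms unfolding lin_def by auto

lemma lin_mono: "\<lbrakk> lin R M U N V a; U' \<subseteq> U; a ` U' \<subseteq> V' \<rbrakk> \<Longrightarrow> lin R M U' N V' a"
  unfolding lin_def by (auto simp: subset_iff)

lemma lin_comp: "\<lbrakk> lin R M U N V a; lin R N V L W b \<rbrakk> \<Longrightarrow> lin R M U L W (\<lambda>u. b (a u))"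
  unfolding lin_def by auto

lemma module_hom_lin: "module_hom R M N = {f. lin R M (carrier M) N (carrier N) f}"
  unfolding module_hom_def lin_def by blast

definition unit_vec :: "('a, 'b) ring_scheme \<Rightarrow> nat \<Rightarrow> nat \<Rightarrow> nat \<Rightarrow> 'a"
  where "unit_vec R p i = (\<lambda>j\<in>{..<p}. if j = i then \<one>\<^bsub>R\<^esub> else \<zero>\<^bsub>R\<^esub>)"

context mring begin

abbreviation Fr :: "nat \<Rightarrow> ('a, nat \<Rightarrow> 'a) module" where "Fr p \<equiv> func_space {..<p}"
abbreviation Fc :: "nat \<Rightarrow> (nat \<Rightarrow> 'a) set" where "Fc p \<equiv> carrier (func_space {..<p})"

lemma lmod_Fr: "lmod R x e (Fr p)"
  by (intro lmod.intro mring_axioms func_space_is_module)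

lemma lmod_self: "lmod R x e (self_module R)"
proof (intro lmod.intro mring_axioms)
  show "module R (self_module R)"
    by (rule module_criteria)
      (use a_assoc a_comm m_assoc l_distr r_distr l_neg a_inv_closed r_neg in \<open>auto simp: self_module_def cring_axioms\<close>)
qed

lemma Fr_simps:
  "c \<in> Fc p \<longleftrightarrow> c \<in> {..<p} \<rightarrow>\<^sub>E carrier R"
  "c \<oplus>\<^bsub>Fr p\<^esub> d = (\<lambda>i\<in>{..<p}. c i \<oplus> d i)"
  "r \<odot>\<^bsub>Fr p\<^esub> c = (\<lambda>i\<in>{..<p}. r \<otimes> c i)"
  "\<zero>\<^bsub>Fr p\<^esub> = (\<lambda>i\<in>{..<p}. \<zero>)"
  by (auto simp: func_space_def)

lemma Fr_closed: "c \<in> Fc p \<Longrightarrow> i < p \<Longrightarrow> c i \<in> carrier R"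
  by (auto simp: Fr_simps)

lemma Fr_eqI: "\<lbrakk> c \<in> Fc p; d \<in> Fc p; \<And>i. i < p \<Longrightarrow> c i = d i \<rbrakk> \<Longrightarrow> c = d"
  by (auto simp: Fr_simps intro: PiE_ext)

lemma unit_vec_closed: "unit_vec R p i \<in> Fc p"
  by (auto simp: unit_vec_def Fr_simps)

lemma self_simps: "carrier (self_module R) = carrier R" "r \<odot>\<^bsub>self_module R\<^esub> s = r \<otimes> s"
  "r \<oplus>\<^bsub>self_module R\<^esub> s = r \<oplus> s" "\<zero>\<^bsub>self_module R\<^esub> = \<zero>"
  by (auto simp: self_module_def)

end

context lmod begin

lemma slin_lin:
  assumes "lmod R x e N" "sub U" "lin R M U N V a" "V \<subseteq> carrier N"
  shows "slin R x e M R x N (\<lambda>r. r) a U"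
proof -
  interpret N: lmod R x e N by fact
  show ?thesis
  proof (intro slin.intro slin_axioms.intro lmod_axioms assms(1,2))
    show "a u \<in> carrier N" if "u \<in> U" for u using linD(1)[OF assms(3) that] assms(4) by blast
  qed (simp_all add: linD[OF assms(3)])
qed

definition comb :: "nat \<Rightarrow> (nat \<Rightarrow> 'm) \<Rightarrow> (nat \<Rightarrow> 'a) \<Rightarrow> 'm"
  where "comb p u c = (\<Oplus>\<^bsub>M\<^esub>i\<in>{..<p}. c i \<odot>\<^bsub>M\<^esub> u i)"

lemma comb_lin: assumes "sub V" "\<And>i. i < p \<Longrightarrow> u i \<in> V" shows "lin R (Fr p) (Fc p) M V (comb p u)"
  unfolding lin_def
proof (intro conjI ballI)
  note V = subD[OF assms(1)]
  have u: "\<And>i. i < p \<Longrightarrow> u i \<in> carrier M" using assms V by auto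
  fix c assume c: "c \<in> Fc p"
  note cc = Fr_closed[OF c]
  show "comb p u c \<in> V" unfolding comb_def by (rule sub_finsum[OF assms(1)]) (use cc V assms in auto)
  { fix d assume d: "d \<in> Fc p"
    note dd = Fr_closed[OF d]
    have "comb p u (c \<oplus>\<^bsub>Fr p\<^esub> d) = (\<Oplus>\<^bsub>M\<^esub>i\<in>{..<p}. c i \<odot>\<^bsub>M\<^esub> u i \<oplus>\<^bsub>M\<^esub> d i \<odot>\<^bsub>M\<^esub> u i)"
      unfolding comb_def by (rule M.finsum_cong') (use u cc dd in \<open>auto simp: Fr_simps smult_l_distr\<close>)
    also have "\<dots> = comb p u c \<oplus>\<^bsub>M\<^esub> comb p u d"
      unfolding comb_def by (rule M.finsum_addf) (use u cc dd in auto)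
    finally show "comb p u (c \<oplus>\<^bsub>Fr p\<^esub> d) = comb p u c \<oplus>\<^bsub>M\<^esub> comb p u d" . }
  { fix r assume r: "r \<in> carrier R"
    have "comb p u (r \<odot>\<^bsub>Fr p\<^esub> c) = (\<Oplus>\<^bsub>M\<^esub>i\<in>{..<p}. r \<odot>\<^bsub>M\<^esub> (c i \<odot>\<^bsub>M\<^esub> u i))"
      unfolding comb_def by (rule M.finsum_cong') (use u cc r in \<open>auto simp: Fr_simps smult_assoc1\<close>)
    also have "\<dots> = r \<odot>\<^bsub>M\<^esub> comb p u c"
      unfolding comb_def by (rule finsum_smult[symmetric]) (use u cc r in auto)
    finally show "comb p u (r \<odot>\<^bsub>Fr p\<^esub> c) = r \<odot>\<^bsub>M\<^esub> comb p u c" . }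
qed

lemma comb_unit_vec: assumes "\<And>i. i < p \<Longrightarrow> u i \<in> carrier M" "j < p" shows "comb p u (unit_vec R p j) = u j"
proof -
  have "comb p u (unit_vec R p j) = (\<Oplus>\<^bsub>M\<^esub>i\<in>{..<p}. if j = i then u i else \<zero>\<^bsub>M\<^esub>)"
    unfolding comb_def by (rule M.finsum_cong') (use assms in \<open>auto simp: unit_vec_def\<close>)
  also have "\<dots> = u j"
    using M.finsum_singleton[of j "{..<p}" u] assms by auto
  finally show ?thesis .
qed

lemma lin_expand:
  assumes h: "lin R (Fr p) (Fc p) M V h" "V \<subseteq> carrier M" and c: "c \<in> Fc p"
  shows "h c = comb p (\<lambda>i. h (unit_vec R p i)) c"
proof -
  interpret F: lmod R x e "Fr p" by (rule lmod_Fr)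
  interpret H: slin R x e "Fr p" R x M "\<lambda>r. r" h "Fc p"
    by (rule F.slin_lin[OF lmod_axioms F.sub_carrier h])
  note cc = Fr_closed[OF c]
  \<comment> \<open>Truncations of c: passing from \<open>t k\<close> to \<open>t (Suc k)\<close>
    adds one multiple of a unit vector.\<close>
  define t where "t = (\<lambda>k. \<lambda>i\<in>{..<p}. if i < k then c i else \<zero>)"
  have tc: "t k \<in> Fc p" for k using cc by (auto simp: t_def Fr_simps)
  have hc: "h (unit_vec R p i) \<in> carrier M" for i using linD(1)[OF h(1) unit_vec_closed] h(2) by auto
  have "h (t k) = (\<Oplus>\<^bsub>M\<^esub>i\<in>{..<k}. c i \<odot>\<^bsub>M\<^esub> h (unit_vec R p i))" if "k \<le> p" for k
    using that
  proof (induction k)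
    case 0
    have "t 0 = \<zero>\<^bsub>Fr p\<^esub>" by (auto simp: t_def Fr_simps)
    then show ?case using H.a_zero by simp
  next
    case (Suc k)
    have "t (Suc k) = t k \<oplus>\<^bsub>Fr p\<^esub> c k \<odot>\<^bsub>Fr p\<^esub> unit_vec R p k"
      by (rule Fr_eqI[of _ p]) (use cc tc Suc unit_vec_closed in \<open>auto simp: t_def Fr_simps unit_vec_def less_Suc_eq\<close>)
    then have "h (t (Suc k)) = h (t k) \<oplus>\<^bsub>M\<^esub> c k \<odot>\<^bsub>M\<^esub> h (unit_vec R p k)"
      using tc[of k] cc[of k] Suc.prems unit_vec_closed[of p k] linD(2,3)[OF h(1)] by simp
    also have "\<dots> = (\<Oplus>\<^bsub>M\<^esub>i\<in>{..<Suc k}. c i \<odot>\<^bsub>M\<^esub> h (unit_vec R p i))"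
    proof -
      have "(\<lambda>i. c i \<odot>\<^bsub>M\<^esub> h (unit_vec R p i)) \<in> {..<k} \<rightarrow> carrier M" using cc hc Suc.prems by auto
      then show ?thesis using Suc hc cc[of k] by (simp add: lessThan_Suc M.a_comm M.finsum_closed)
    qed
    finally show ?case .
  qed
  from this[of p] have "h (t p) = comb p (\<lambda>i. h (unit_vec R p i)) c" by (simp add: comb_def)
  moreover have "t p = c" by (rule Fr_eqI[of _ p]) (use tc c in \<open>auto simp: t_def\<close>)
  ultimately show ?thesis by simp
qed

lemma lin_eqI:
  assumes h: "lin R (Fr p) (Fc p) M V h" "lin R (Fr p) (Fc p) M V g" "V \<subseteq> carrier M"
    and "\<And>i. i < p \<Longrightarrow> h (unit_vec R p i) = g (unit_vec R p i)" and c: "c \<in> Fc p"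
  shows "h c = g c"
  unfolding lin_expand[OF h(1,3) c] lin_expand[OF h(2,3) c] comb_def
  using subsetD[OF h(3) linD(1)[OF h(2) unit_vec_closed]] assms(4) Fr_closed[OF c]
  by (intro M.finsum_cong') auto

text \<open>Projectivity of free modules: preimages are chosen for the images of the unit vectors,
  and linear maps that agree on unit vectors are equal.\<close>

lemma lift_free:
  assumes h: "lin R (Fr p) (Fc p) M U h" "sub U" and N: "lmod R x e N" "submodule R V N"
    and \<pi>: "lin R N V M U \<pi>" "\<pi> ` V = U"
  obtains g where "lin R (Fr p) (Fc p) N V g" "\<And>c. c \<in> Fc p \<Longrightarrow> \<pi> (g c) = h c"
proof -
  interpret N: lmod R x e N by fact
  have "\<exists>v\<in>V. \<pi> v = h (unit_vec R p i)" for i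
    using linD(1)[OF h(1) unit_vec_closed[of p i]] \<pi>(2) by (metis image_iff)
  then obtain v where v: "\<And>i. v i \<in> V" "\<And>i. \<pi> (v i) = h (unit_vec R p i)" by metis
  have g: "lin R (Fr p) (Fc p) N V (N.comb p v)" by (rule N.comb_lin[OF N(2)]) (rule v)
  have vc: "\<And>i. v i \<in> carrier N" using v N.subD(2)[OF N(2)] by blast
  have "\<pi> (N.comb p v c) = h c" if "c \<in> Fc p" for c
    by (rule lin_eqI[OF lin_comp[OF g \<pi>(1)] h(1) subD(1)[OF h(2)] _ that])
       (use N.comb_unit_vec vc v in auto)
  with g that show ?thesis by blast
qed

text \<open>Iterating the first inclusion gives U \<subseteq> S + m^k U for every k. Nilpotency
  modulo S takes the place of locality, so the lemma can also be used over the polynomial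
  ring.\<close>

lemma nakayama:
  assumes "sub S" "sub U" "U \<subseteq> S <+>\<^bsub>M\<^esub> mm U" "(mm ^^ k) U \<subseteq> S" shows "U \<subseteq> S"
proof -
  have sk: "sub ((mm ^^ k) U)" for k by (induction k) (simp_all add: mm_sub assms)
  have "U \<subseteq> S <+>\<^bsub>M\<^esub> (mm ^^ k) U" for k
  proof (induction k)
    case 0 then show ?case using add_upper2[OF assms(1,2)] by simp
  next
    case (Suc k)
    have "mm U \<subseteq> mm (S <+>\<^bsub>M\<^esub> (mm ^^ k) U)" by (rule mm_mono[OF Suc])
    also have "\<dots> = mm S <+>\<^bsub>M\<^esub> mm ((mm ^^ k) U)" by (rule mm_add[OF assms(1) sk])
    also have "\<dots> \<subseteq> S <+>\<^bsub>M\<^esub> (mm ^^ Suc k) U" using mm_subset[OF assms(1)] by (intro add_mono) auto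
    finally have "S <+>\<^bsub>M\<^esub> mm U \<subseteq> S <+>\<^bsub>M\<^esub> (mm ^^ Suc k) U"
      using add_least[OF sub_add[OF assms(1) sk]] add_upper1[OF assms(1) sk] by blast
    then show ?case using assms(3) by blast
  qed
  from this[of k] show ?thesis using assms(1,4) add_least[of S S "(mm ^^ k) U"] by blast
qed

lemma mmk_sub: "sub U \<Longrightarrow> sub ((mm ^^ k) U)"
  by (induction k) (simp_all add: mm_sub)
lemma mmk_mono: "U \<subseteq> V \<Longrightarrow> (mm ^^ k) U \<subseteq> (mm ^^ k) V"
  by (induction k) (simp_all add: mm_mono)
lemma mmk_subset: assumes "sub U" shows "(mm ^^ k) U \<subseteq> U"
proof (induction k)
  case (Suc k)
  then show ?case using mm_subset[OF mmk_sub[OF assms, of k]] by simp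
qed simp
lemma mmk_antimono: assumes "sub U" "j \<le> k" shows "(mm ^^ k) U \<subseteq> (mm ^^ j) U"
proof -
  have "(mm ^^ k) U = (mm ^^ (k - j)) ((mm ^^ j) U)" using funpow_add[of "k - j" j "mmul M x e"] assms(2) by simp
  then show ?thesis using mmk_subset[OF mmk_sub[OF assms(1)]] by simp
qed

text \<open>The vectors are generators of the successive simple factors. In general they only
  generate U modulo V. If all of them are killed by m modulo V, then U/V is a vector space over the
  residue field and they are a basis of it; this is the content of the last clause.\<close>

lemma len_generators:
  assumes "len V U k"
  obtains u where "\<And>i. i < k \<Longrightarrow> u i \<in> U" "U \<subseteq> V <+>\<^bsub>M\<^esub> comb k u ` Fc k"
    "(\<forall>i<k. \<forall>j<e. x j \<odot>\<^bsub>M\<^esub> u i \<in> V) \<longrightarrow>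
      (\<forall>c\<in>Fc k. comb k u c \<in> V \<longrightarrow> (\<forall>i<k. c i \<in> var_ideal R x e))"
proof -
  define P where "P k u U \<longleftrightarrow> (\<forall>i<k. u i \<in> U) \<and> U \<subseteq> V <+>\<^bsub>M\<^esub> comb k u ` Fc k \<and>
    ((\<forall>i<k. \<forall>j<e. x j \<odot>\<^bsub>M\<^esub> u i \<in> V) \<longrightarrow> (\<forall>c\<in>Fc k. comb k u c \<in> V \<longrightarrow> (\<forall>i<k. c i \<in> var_ideal R x e)))"
    for k and u :: "nat \<Rightarrow> 'm" and U
  have "\<exists>u. P k u U"
    using assms
  proof (induction k arbitrary: U rule: nat_induct)
    case 0
    then have "U = V" "sub V" using len_0_eq len_sub by auto
    moreover have "z \<in> V <+>\<^bsub>M\<^esub> comb 0 u ` Fc 0" if "z \<in> V" for z and u :: "nat \<Rightarrow> 'm"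
    proof -
      have "z = z \<oplus>\<^bsub>M\<^esub> comb 0 u (unit_vec R 0 0)" using subD(2)[OF \<open>sub V\<close> that] by (simp add: comb_def)
      then show ?thesis unfolding mem_add using that unit_vec_closed by blast
    qed
    ultimately show ?case unfolding P_def by blast
  next
    case (Suc k)
    obtain T w where T: "U = T <+>\<^bsub>M\<^esub> cyc R M w" "len V T k" "w \<in> carrier M" "w \<notin> T"
      "\<forall>i<e. x i \<odot>\<^bsub>M\<^esub> w \<in> T" "sub T" "w \<in> U" "T \<subseteq> U" by (rule len_Suc_cases[OF Suc.prems])
    obtain u where u: "P k u T" using Suc.IH[OF T(2)] by blast
    define v where "v = u(k := w)"
    have V: "sub V" "V \<subseteq> T" using len_sub[OF T(2)] by auto
    have uc: "\<And>i. i < k \<Longrightarrow> u i \<in> carrier M" using u subD(2)[OF T(6)] by (auto simp: P_def)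
    have split: "comb (Suc k) v c = comb k u (restrict c {..<k}) \<oplus>\<^bsub>M\<^esub> c k \<odot>\<^bsub>M\<^esub> w" if c: "c \<in> Fc (Suc k)" for c
    proof -
      have cc: "\<And>i. i < Suc k \<Longrightarrow> c i \<in> carrier R" using Fr_closed[OF c] .
      have 1: "(\<lambda>i. c i \<odot>\<^bsub>M\<^esub> v i) \<in> {..<k} \<rightarrow> carrier M" using cc uc by (auto simp: v_def)
      have "comb (Suc k) v c = c k \<odot>\<^bsub>M\<^esub> w \<oplus>\<^bsub>M\<^esub> (\<Oplus>\<^bsub>M\<^esub>i\<in>{..<k}. c i \<odot>\<^bsub>M\<^esub> v i)"
        unfolding comb_def lessThan_Suc using 1 cc[of k] T(3) by (subst M.finsum_insert) (auto simp: v_def)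
      also have "(\<Oplus>\<^bsub>M\<^esub>i\<in>{..<k}. c i \<odot>\<^bsub>M\<^esub> v i) = comb k u (restrict c {..<k})"
        unfolding comb_def by (rule M.finsum_cong') (use cc uc in \<open>auto simp: v_def\<close>)
      finally have "comb (Suc k) v c = c k \<odot>\<^bsub>M\<^esub> w \<oplus>\<^bsub>M\<^esub> comb k u (restrict c {..<k})" .
      moreover have "comb k u (restrict c {..<k}) \<in> carrier M"
        by (rule linD(1)[OF comb_lin[OF sub_carrier]]) (use uc cc in \<open>auto simp: Fr_simps\<close>)
      ultimately show ?thesis using M.a_comm[OF smult_closed[OF cc[OF lessI] T(3)]] by metis
    qed
    have "P (Suc k) v U"
      unfolding P_def
    proof (intro conjI impI allI ballI)
      show "v i \<in> U" if "i < Suc k" for i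
      proof (cases "i = k")
        case False
        then have "u i \<in> T" using that u unfolding P_def by simp
        then show ?thesis using False T(8) by (auto simp: v_def)
      qed (simp add: v_def T(7))
      show "U \<subseteq> V <+>\<^bsub>M\<^esub> comb (Suc k) v ` Fc (Suc k)"
      proof
        fix z assume z: "z \<in> U"
        obtain t r where tr: "t \<in> T" "r \<in> carrier R" "z = t \<oplus>\<^bsub>M\<^esub> r \<odot>\<^bsub>M\<^esub> w"
          using z unfolding T(1) mem_add cyc_def by blast
        have "t \<in> V <+>\<^bsub>M\<^esub> comb k u ` Fc k" using u tr(1) unfolding P_def by blast
        then obtain y c where y: "y \<in> V" "c \<in> Fc k" "t = y \<oplus>\<^bsub>M\<^esub> comb k u c" unfolding mem_add by blast
        define d where "d = (\<lambda>i\<in>{..<Suc k}. if i < k then c i else r)"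
        have d: "d \<in> Fc (Suc k)" using Fr_closed[OF y(2)] tr by (auto simp: d_def Fr_simps)
        have "restrict d {..<k} = c" by (rule Fr_eqI[of _ k]) (use d y in \<open>auto simp: d_def Fr_simps\<close>)
        then have "comb (Suc k) v d = comb k u c \<oplus>\<^bsub>M\<^esub> r \<odot>\<^bsub>M\<^esub> w" using split[OF d] by (simp add: d_def)
        moreover have "comb k u c \<in> carrier M" by (rule linD(1)[OF comb_lin[OF sub_carrier] y(2)]) (rule uc)
        moreover have "y \<in> carrier M" by (rule subD(2)[OF V(1) y(1)])
        ultimately have "z = y \<oplus>\<^bsub>M\<^esub> comb (Suc k) v d"
          unfolding tr(3) y(3) using M.a_assoc smult_closed[OF tr(2) T(3)] by metis
        then show "z \<in> V <+>\<^bsub>M\<^esub> comb (Suc k) v ` Fc (Suc k)" unfolding mem_add using y(1) d by blast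
      qed
      fix c i assume a: "\<forall>i<Suc k. \<forall>j<e. x j \<odot>\<^bsub>M\<^esub> v i \<in> V" and c: "c \<in> Fc (Suc k)" "comb (Suc k) v c \<in> V" and i: "i < Suc k"
      have r: "restrict c {..<k} \<in> Fc k" using Fr_closed[OF c(1)] by (auto simp: Fr_simps)
      have xw: "\<And>j. j < e \<Longrightarrow> x j \<odot>\<^bsub>M\<^esub> w \<in> V" using a by (auto simp: v_def)
      have combT: "comb k u (restrict c {..<k}) \<in> T" by (rule linD(1)[OF comb_lin[OF T(6)] r]) (use u in \<open>simp add: P_def\<close>)
      have ck: "c k \<in> carrier R" using Fr_closed[OF c(1)] by auto
      \<comment> \<open>The top coefficient comes first: were it outside m, it could be inverted
        modulo m, and the relation would put w into T.\<close>
      have ck1: "c k \<in> var_ideal R x e"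
      proof (rule ccontr)
        assume n: "c k \<notin> var_ideal R x e"
        obtain b d where bd: "b \<in> carrier R" "d \<in> var_ideal R x e" "c k \<otimes> b = \<one> \<oplus> d" using inv_mod[OF ck n] by blast
        have dc: "d \<in> carrier R" using bd var_ideal_carrier by auto
        have "comb k u (restrict c {..<k}) \<oplus>\<^bsub>M\<^esub> c k \<odot>\<^bsub>M\<^esub> w \<in> T"
          by (rule subsetD[OF V(2) c(2)[unfolded split[OF c(1)]]])
        then have ckw: "c k \<odot>\<^bsub>M\<^esub> w \<in> T"
          by (rule sub_add_cancel[OF T(6) combT]) (rule smult_closed[OF ck T(3)])
        have "b \<odot>\<^bsub>M\<^esub> (c k \<odot>\<^bsub>M\<^esub> w) = (c k \<otimes> b) \<odot>\<^bsub>M\<^esub> w"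
          by (simp only: smult_assoc1[OF bd(1) ck T(3), symmetric] R.m_comm[OF bd(1) ck])
        also have "\<dots> = w \<oplus>\<^bsub>M\<^esub> d \<odot>\<^bsub>M\<^esub> w"
          unfolding bd(3) by (simp only: smult_l_distr[OF R.one_closed dc T(3)] smult_one[OF T(3)])
        also have "\<dots> = d \<odot>\<^bsub>M\<^esub> w \<oplus>\<^bsub>M\<^esub> w" by (rule M.a_comm[OF T(3) smult_closed[OF dc T(3)]])
        finally have dw: "d \<odot>\<^bsub>M\<^esub> w \<oplus>\<^bsub>M\<^esub> w \<in> T"
          by (rule subst[of _ _ "\<lambda>z. z \<in> T"]) (rule subD(5)[OF T(6) bd(1) ckw])
        have "d \<odot>\<^bsub>M\<^esub> w \<in> T" by (rule cyc_mod[OF T(6,3) _ bd(2)]) (use T(5) in blast)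
        from sub_add_cancel[OF T(6) this dw T(3)] show False using T(4) by blast
      qed
      show "c i \<in> var_ideal R x e"
      proof (cases "i = k")
        case True then show ?thesis using ck1 by simp
      next
        case False
        have ckV: "c k \<odot>\<^bsub>M\<^esub> w \<in> V" by (rule cyc_mod[OF V(1) T(3) _ ck1]) (rule xw)
        have cc: "comb k u (restrict c {..<k}) \<in> carrier M" by (rule subD(2)[OF T(6) combT])
        have "c k \<odot>\<^bsub>M\<^esub> w \<oplus>\<^bsub>M\<^esub> comb k u (restrict c {..<k}) \<in> V"
          using c(2) M.a_comm[OF cc smult_closed[OF ck T(3)]] unfolding split[OF c(1)] by metis
        from sub_add_cancel[OF V(1) ckV this cc] have cV: "comb k u (restrict c {..<k}) \<in> V" .
        have xu: "\<forall>i<k. \<forall>j<e. x j \<odot>\<^bsub>M\<^esub> u i \<in> V"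
        proof (intro allI impI)
          fix i' j assume "i' < k" "j < e"
          then show "x j \<odot>\<^bsub>M\<^esub> u i' \<in> V" using a[rule_format, of i' j] by (simp add: v_def)
        qed
        have "i < k" using i False by simp
        moreover have "\<forall>c\<in>Fc k. comb k u c \<in> V \<longrightarrow> (\<forall>i<k. c i \<in> var_ideal R x e)"
          using u xu unfolding P_def by (elim conjE) (erule mp)
        ultimately have "restrict c {..<k} i \<in> var_ideal R x e" using r cV by metis
        then show ?thesis using i False by simp
      qed
    qed
    then show ?case by blast
  qed
  then show ?thesis using that unfolding P_def by blast
qed

end

context lmod begin

lemma add_cancel2:
  assumes "u \<in> carrier M" "v \<in> carrier M"
  shows "((u \<oplus>\<^bsub>M\<^esub> v) \<ominus>\<^bsub>M\<^esub> u) \<ominus>\<^bsub>M\<^esub> v = \<zero>\<^bsub>M\<^esub>"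
proof -
  have "(u \<oplus>\<^bsub>M\<^esub> v) \<ominus>\<^bsub>M\<^esub> u = v"
    using assms by (simp add: a_minus_def M.a_comm[of u v] M.a_assoc M.r_neg)
  then show ?thesis using assms by simp
qed

lemma lin_zero:
  assumes "lmod R x e N" "sub U" "lin R M U N V a" "V \<subseteq> carrier N"
  shows "a \<zero>\<^bsub>M\<^esub> = \<zero>\<^bsub>N\<^esub>"
  using slin.a_zero[OF slin_lin[OF assms]] .

lemma lin_const_zero: "lmod R x e N \<Longrightarrow> lin R N U M {\<zero>\<^bsub>M\<^esub>} (\<lambda>_. \<zero>\<^bsub>M\<^esub>)"
  unfolding lin_def by simp

lemma lin_diff:
  assumes "lin R N U M V a" "lin R N U M V b" "sub V"
  shows "lin R N U M V (\<lambda>u. a u \<ominus>\<^bsub>M\<^esub> b u)"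
  unfolding lin_def
proof (intro conjI ballI)
  note V = subD(2)[OF assms(3)]
  show "a u \<ominus>\<^bsub>M\<^esub> b u \<in> V" if "u \<in> U" for u
    using sub_minus[OF assms(3) linD(1)[OF assms(1) that] linD(1)[OF assms(2) that]] .
  show "a (u \<oplus>\<^bsub>N\<^esub> v) \<ominus>\<^bsub>M\<^esub> b (u \<oplus>\<^bsub>N\<^esub> v) = a u \<ominus>\<^bsub>M\<^esub> b u \<oplus>\<^bsub>M\<^esub> (a v \<ominus>\<^bsub>M\<^esub> b v)" if "u \<in> U" "v \<in> U" for u v
  proof -
    have "a u \<in> carrier M" "a v \<in> carrier M" "b u \<in> carrier M" "b v \<in> carrier M"
      using linD(1)[OF assms(1)] linD(1)[OF assms(2)] V that by blast+
    then show ?thesis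
      unfolding linD(2)[OF assms(1) that] linD(2)[OF assms(2) that]
      by (simp add: a_minus_def M.minus_add M.a_ac)
  qed
  show "a (r \<odot>\<^bsub>N\<^esub> u) \<ominus>\<^bsub>M\<^esub> b (r \<odot>\<^bsub>N\<^esub> u) = r \<odot>\<^bsub>M\<^esub> (a u \<ominus>\<^bsub>M\<^esub> b u)" if "r \<in> carrier R" "u \<in> U" for r u
  proof -
    have "a u \<in> carrier M" "b u \<in> carrier M"
      using linD(1)[OF assms(1)] linD(1)[OF assms(2)] V that by blast+
    then show ?thesis
      unfolding linD(3)[OF assms(1) that] linD(3)[OF assms(2) that] using that(1)
      by (simp add: a_minus_def smult_r_distr smult_r_minus)
  qed
qed

end

section \<open>Powers of ideals in free modules, and syzygies up to stable equivalence\<close>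

context mring begin

definition pw :: "'a set \<Rightarrow> nat \<Rightarrow> (nat \<Rightarrow> 'a) set"
  where "pw J p = {c \<in> Fc p. \<forall>i<p. c i \<in> J}"

definition ins :: "nat \<Rightarrow> nat \<Rightarrow> 'a \<Rightarrow> nat \<Rightarrow> 'a"
  where "ins p i r = (\<lambda>j\<in>{..<p}. if j = i then r else \<zero>)"

abbreviation "S1 \<equiv> self_module R"
abbreviation "idl J \<equiv> submodule R J S1"

lemma idlD: assumes "idl J" shows "J \<subseteq> carrier R" "\<zero> \<in> J" "\<lbrakk> u \<in> J; v \<in> J \<rbrakk> \<Longrightarrow> u \<oplus> v \<in> J"
  "\<lbrakk> r \<in> carrier R; u \<in> J \<rbrakk> \<Longrightarrow> r \<otimes> u \<in> J"
  using lmod.subD[OF lmod_self assms] unfolding self_simps by auto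

lemma idl_carrier: "idl (carrier R)"
  using lmod.sub_carrier[OF lmod_self] by (simp add: self_simps)

lemma idl_var: "idl (var_ideal R x e)"
  unfolding var_ideal_def by (rule lmod.mm_sub[OF lmod_self idl_carrier])

lemma pw_sub: assumes "idl J" shows "submodule R (pw J p) (Fr p)"
proof (rule lmod.subI[OF lmod_Fr])
  note J = idlD[OF assms]
  show "pw J p \<subseteq> Fc p" by (auto simp: pw_def)
  show "\<zero>\<^bsub>Fr p\<^esub> \<in> pw J p" using J by (auto simp: pw_def Fr_simps)
  show "u \<oplus>\<^bsub>Fr p\<^esub> v \<in> pw J p" if "u \<in> pw J p" "v \<in> pw J p" for u v
    using that J by (auto simp: pw_def Fr_simps)
  show "r \<odot>\<^bsub>Fr p\<^esub> u \<in> pw J p" if "r \<in> carrier R" "u \<in> pw J p" for r u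
    using that J by (auto simp: pw_def Fr_simps)
qed

lemma pw_carrier: "pw (carrier R) p = Fc p"
  by (auto simp: pw_def Fr_simps)

lemma pw_zero: "pw {\<zero>} p = {\<zero>\<^bsub>Fr p\<^esub>}"
proof -
  have "\<zero>\<^bsub>Fr p\<^esub> \<in> Fc p" by (auto simp: Fr_simps)
  then show ?thesis
    by (auto simp: pw_def Fr_simps(4) intro!: Fr_eqI[of _ p])
qed

lemma ins_lin: "lin R S1 (carrier R) (Fr p) (Fc p) (ins p i)"
  unfolding lin_def by (auto simp: ins_def self_simps Fr_simps fun_eq_iff)

lemma ins_slin: "slin R x e S1 R x (Fr p) (\<lambda>r. r) (ins p i) (carrier R)"
  by (rule lmod.slin_lin[OF lmod_self lmod_Fr idl_carrier ins_lin]) simp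

lemma ins_pw: "\<lbrakk> idl J; r \<in> J \<rbrakk> \<Longrightarrow> ins p i r \<in> pw J p"
  using idlD[of J] by (auto simp: ins_def pw_def Fr_simps)

lemma mm_pw: assumes "idl J" shows "mmul (Fr p) x e (pw J p) = pw (mmul S1 x e J) p"
proof (rule subset_antisym)
  interpret F: lmod R x e "Fr p" by (rule lmod_Fr)
  interpret S: lmod R x e S1 by (rule lmod_self)
  have J: "idl (mmul S1 x e J)" by (rule S.mm_sub[OF assms])
  show "mmul (Fr p) x e (pw J p) \<subseteq> pw (mmul S1 x e J) p"
  proof (rule F.mm_least[OF pw_sub[OF J]])
    fix i u assume i: "i < e" and u: "u \<in> pw J p"
    have "x i \<otimes> u j \<in> mmul S1 x e J" if "j < p" for j
      using S.mm_gen[OF assms i, of "u j"] u that by (simp add: self_simps pw_def)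
    then show "x i \<odot>\<^bsub>Fr p\<^esub> u \<in> pw (mmul S1 x e J) p"
      using idlD(1)[OF J] by (auto simp: pw_def Fr_simps)
  qed
  show "pw (mmul S1 x e J) p \<subseteq> mmul (Fr p) x e (pw J p)"
  proof
    fix c assume c: "c \<in> pw (mmul S1 x e J) p"
    then have cF: "c \<in> Fc p" by (simp add: pw_def)
    \<comment> \<open>The vector c is assembled coordinate by coordinate; each coordinate enters
      through the inclusion \<open>ins p k\<close>, which carries mJ into m times the vectors over
      J.\<close>
    define t where "t = (\<lambda>k. \<lambda>i\<in>{..<p}. if i < k then c i else \<zero>)"
    have "t k \<in> mmul (Fr p) x e (pw J p)" if "k \<le> p" for k
      using that
    proof (induction k)
      case 0
      have "t 0 = \<zero>\<^bsub>Fr p\<^esub>" by (auto simp: t_def Fr_simps)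
      then show ?case using F.subD(3)[OF F.mm_sub[OF pw_sub[OF assms]]] by simp
    next
      case (Suc k)
      interpret I: slin R x e S1 R x "Fr p" "\<lambda>r. r" "ins p k" "carrier R" by (rule ins_slin)
      have ck: "c k \<in> mmul S1 x e J" using c Suc.prems by (auto simp: pw_def)
      have "ins p k (c k) \<in> mmul (Fr p) x e (ins p k ` J)"
        using I.image_mm[OF assms idlD(1)[OF assms]] ck by blast
      moreover have "mmul (Fr p) x e (ins p k ` J) \<subseteq> mmul (Fr p) x e (pw J p)"
        by (rule F.mm_mono) (use ins_pw[OF assms] in blast)
      ultimately have 1: "ins p k (c k) \<in> mmul (Fr p) x e (pw J p)" by blast
      have "t (Suc k) = t k \<oplus>\<^bsub>Fr p\<^esub> ins p k (c k)"
        using Fr_closed[OF cF] Suc.prems by (auto simp: t_def Fr_simps ins_def fun_eq_iff less_Suc_eq)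
      then show ?case using Suc 1 F.subD(4)[OF F.mm_sub[OF pw_sub[OF assms]]] by simp
    qed
    moreover have "t p = c" using cF by (auto simp: t_def Fr_simps fun_eq_iff PiE_def extensional_def)
    ultimately show "c \<in> mmul (Fr p) x e (pw J p)" by (metis le_refl)
  qed
qed

lemma mm_Fc: "mmul (Fr p) x e (Fc p) = pw (var_ideal R x e) p"
  unfolding pw_carrier[symmetric] var_ideal_def by (rule mm_pw[OF idl_carrier])

lemma mmk_pw: "idl J \<Longrightarrow> (mmul (Fr p) x e ^^ k) (pw J p) = pw ((mmul S1 x e ^^ k) J) p"
  by (induction k) (simp_all add: mm_pw lmod.mmk_sub[OF lmod_self])

text \<open>The filtration \<open>T k\<close>, in which the coordinates from k on are confined to I,
  has p factors, each isomorphic to J/I through a coordinate inclusion.\<close>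

lemma len_pw:
  assumes "mlen R x e S1 I J l" shows "mlen R x e (Fr p) (pw I p) (pw J p) (p * l)"
proof -
  interpret F: lmod R x e "Fr p" by (rule lmod_Fr)
  interpret S: lmod R x e S1 by (rule lmod_self)
  have I: "idl I" "I \<subseteq> J" and J: "idl J" using S.len_sub[OF assms] by auto
  note Ic = idlD[OF I(1)] and Jc = idlD[OF J]
  define T where "T = (\<lambda>k. {c \<in> pw J p. \<forall>i<p. k \<le> i \<longrightarrow> c i \<in> I})"
  have T: "F.sub (T k)" for k
    by (rule F.subI) (use Ic Jc in \<open>auto simp: T_def pw_def Fr_simps\<close>)
  have "F.len (pw I p) (T k) (k * l)" if "k \<le> p" for k
    using that
  proof (induction k)
    case 0
    have "T 0 = pw I p" using I(2) by (auto simp: T_def pw_def)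
    then show ?case using mlen.mlen_refl[OF pw_sub[OF I(1)]] by simp
  next
    case (Suc k)
    have "F.len (T k) (T (Suc k)) l"
    proof (rule slin.len_hom[OF ins_slin[of p k] assms idlD(1)[OF J]])
      show "I = {u \<in> carrier R. ins p k u \<in> T k}"
      proof (intro subset_antisym subsetI)
        fix u assume "u \<in> I"
        then show "u \<in> {u \<in> carrier R. ins p k u \<in> T k}"
          using Ic Jc I(2) by (auto simp: T_def ins_def pw_def Fr_simps)
      next
        fix u assume "u \<in> {u \<in> carrier R. ins p k u \<in> T k}"
        then have "\<forall>i<p. k \<le> i \<longrightarrow> ins p k u i \<in> I" by (simp add: T_def)
        from this[rule_format, of k] show "u \<in> I" using Suc.prems by (simp add: ins_def)
      qed
      show "T k \<subseteq> T (Suc k)" by (auto simp: T_def)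
      show "ins p k ` J \<subseteq> T (Suc k)" using Jc Ic by (auto simp: T_def ins_def pw_def Fr_simps split: if_splits)
      fix t assume t: "t \<in> T (Suc k)"
      define v where "v = (\<lambda>i\<in>{..<p}. if i = k then \<zero> else t i)"
      have tc: "\<And>i. i < p \<Longrightarrow> t i \<in> carrier R" "t \<in> Fc p" using t Jc by (auto simp: T_def pw_def)
      have "v \<in> T k" using t Jc Ic tc by (auto simp: T_def pw_def v_def Fr_simps)
      moreover have "t = ins p k (t k) \<oplus>\<^bsub>Fr p\<^esub> v"
        by (rule Fr_eqI[OF tc(2)]) (use tc in \<open>auto simp: v_def ins_def Fr_simps\<close>)
      moreover have "t k \<in> J" using t Suc.prems by (auto simp: T_def pw_def)
      ultimately show "\<exists>u\<in>J. \<exists>v\<in>T k. t = ins p k u \<oplus>\<^bsub>Fr p\<^esub> v" by blast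
    qed (rule T)+
    from F.len_trans[OF this Suc.IH] Suc.prems show ?case by (simp add: add.commute)
  qed
  from this[of p] have "F.len (pw I p) (T p) (p * l)" by simp
  moreover have "T p = pw J p" by (auto simp: T_def)
  ultimately show ?thesis by simp
qed

lemma len_residue: "mlen R x e S1 (var_ideal R x e) (carrier R) 1"
proof -
  interpret S: lmod R x e S1 by (rule lmod_self)
  have 1: "S.len (var_ideal R x e) (var_ideal R x e <+>\<^bsub>S1\<^esub> cyc R S1 \<one>) (Suc 0)"
  proof (rule mlen.mlen_step[OF mlen.mlen_refl[OF idl_var]])
    show "x i \<odot>\<^bsub>S1\<^esub> \<one> \<in> var_ideal R x e" if "i < e" for i
      unfolding var_ideal_def using S.mm_gen[OF idl_carrier that] by simp
  qed (simp_all add: self_simps one_notin)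
  have "cyc R S1 \<one> = carrier R" by (force simp: cyc_def self_simps)
  moreover have "var_ideal R x e <+>\<^bsub>S1\<^esub> carrier R = carrier R"
    by (rule S.add_absorb(1)[OF idl_var idl_carrier S.var_ideal_carrier])
  ultimately show ?thesis using 1 by simp
qed

definition krn :: "nat \<Rightarrow> ('a, 'm, 'c) module_scheme \<Rightarrow> ((nat \<Rightarrow> 'a) \<Rightarrow> 'm) \<Rightarrow> (nat \<Rightarrow> 'a) set"
  where "krn p M \<pi> = {z \<in> Fc p. \<pi> z = \<zero>\<^bsub>M\<^esub>}"

definition cover :: "nat \<Rightarrow> ('a, 'm, 'c) module_scheme \<Rightarrow> 'm set \<Rightarrow> ((nat \<Rightarrow> 'a) \<Rightarrow> 'm) \<Rightarrow> bool"
  where "cover p M U \<pi> \<longleftrightarrow> lin R (Fr p) (Fc p) M U \<pi> \<and> \<pi> ` Fc p = U"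

text \<open>The identity of U differs from c after a by a map that factors through a finite free
  module. The two factors g and l are kept apart so that l can be lifted along a cover.\<close>

definition retr :: "('a, 'm, 'c) module_scheme \<Rightarrow> 'm set \<Rightarrow> ('m \<Rightarrow> 'n) \<Rightarrow> ('n \<Rightarrow> 'm) \<Rightarrow> bool"
  where "retr M U a c \<longleftrightarrow> (\<exists>p g l. lin R M U (Fr p) (Fc p) g \<and> lin R (Fr p) (Fc p) M U l \<and>
    (\<forall>u\<in>U. u = c (a u) \<oplus>\<^bsub>M\<^esub> l (g u)))"

text \<open>Stable equivalence: mutually inverse maps up to maps that factor through free modules.\<close>
definition steq :: "('a, 'm, 'c) module_scheme \<Rightarrow> 'm set \<Rightarrow> ('a, 'n, 'd) module_scheme \<Rightarrow> 'n set \<Rightarrow> bool"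
  where "steq M U N V \<longleftrightarrow> (\<exists>a c. lin R M U N V a \<and> lin R N V M U c \<and> retr M U a c \<and> retr N V c a)"

lemma steq_refl: assumes "lmod R x e M" "submodule R U M" shows "steq M U M U"
proof -
  interpret lmod R x e M by fact
  interpret F: lmod R x e "Fr 0" by (rule lmod_Fr)
  have "retr M U (\<lambda>u. u) (\<lambda>u. u)"
    unfolding retr_def
  proof (intro exI conjI ballI)
    show "lin R M U (Fr 0) (Fc 0) (\<lambda>_. \<zero>\<^bsub>Fr 0\<^esub>)"
      by (rule lin_mono[OF F.lin_const_zero[OF assms(1)] subset_refl]) (use F.M.zero_closed in auto)
    show "lin R (Fr 0) (Fc 0) M U (\<lambda>_. \<zero>\<^bsub>M\<^esub>)"
      by (rule lin_mono[OF lin_const_zero[OF lmod_Fr] subset_refl]) (use subD(3)[OF assms(2)] in auto)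
    show "u = u \<oplus>\<^bsub>M\<^esub> \<zero>\<^bsub>M\<^esub>" if "u \<in> U" for u using subD(2)[OF assms(2) that] by simp
  qed
  moreover have "lin R M U M U (\<lambda>u. u)" by (simp add: lin_def)
  ultimately show ?thesis unfolding steq_def by blast
qed

lemma krn_sub: assumes "lmod R x e M" "submodule R U M" "cover p M U \<pi>" shows "submodule R (krn p M \<pi>) (Fr p)"
proof -
  interpret lmod R x e M by fact
  interpret F: lmod R x e "Fr p" by (rule lmod_Fr)
  interpret slin R x e "Fr p" R x M "\<lambda>r. r" \<pi> "Fc p"
    using F.slin_lin[OF assms(1) F.sub_carrier] assms(3) subD(1)[OF assms(2)] unfolding cover_def by blast
  have "{u \<in> Fc p. \<pi> u \<in> {\<zero>\<^bsub>M\<^esub>}} = krn p M \<pi>" by (auto simp: krn_def)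
  then show ?thesis using sub_vimage[OF sub_zero] by simp
qed

text \<open>The comparison step: a stable equivalence of modules lifts to the covers, and the induced maps
  of the kernels are inverse to each other up to a map \<open>Z\<close> that is defined on the whole free module.\<close>
lemma syz_retr:
  assumes M: "lmod R x e M" "submodule R U M" and N: "lmod R x e N" "submodule R V N"
    and \<pi>: "cover p M U \<pi>" and \<rho>: "cover q N V \<rho>"
    and ac: "lin R M U N V a" "lin R N V M U c" "retr M U a c"
    and A: "lin R (Fr p) (Fc p) (Fr q) (Fc q) A" "\<And>z. z \<in> Fc p \<Longrightarrow> \<rho> (A z) = a (\<pi> z)"
    and C: "lin R (Fr q) (Fc q) (Fr p) (Fc p) C" "\<And>z. z \<in> Fc q \<Longrightarrow> \<pi> (C z) = c (\<rho> z)"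
  obtains Z where "lin R (Fr p) (Fc p) (Fr p) (krn p M \<pi>) Z"
    "\<And>z. z \<in> krn p M \<pi> \<Longrightarrow> z = C (A z) \<oplus>\<^bsub>Fr p\<^esub> Z z"
proof -
  interpret M: lmod R x e M by fact
  interpret F: lmod R x e "Fr p" by (rule lmod_Fr)
  have pl: "lin R (Fr p) (Fc p) M U \<pi>" "\<pi> ` Fc p = U" using \<pi> by (auto simp: cover_def)
  note Uc = M.subD(1)[OF M(2)]
  interpret P: slin R x e "Fr p" R x M "\<lambda>r. r" \<pi> "Fc p"
    by (rule F.slin_lin[OF M(1) F.sub_carrier pl(1) Uc])
  obtain s g l where gl: "lin R M U (Fr s) (Fc s) g" "lin R (Fr s) (Fc s) M U l"
      "\<And>u. u \<in> U \<Longrightarrow> u = c (a u) \<oplus>\<^bsub>M\<^esub> l (g u)"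
    using ac(3) unfolding retr_def by blast
  obtain L where L: "lin R (Fr s) (Fc s) (Fr p) (Fc p) L" "\<And>y. y \<in> Fc s \<Longrightarrow> \<pi> (L y) = l y"
    using M.lift_free[OF gl(2) M(2) lmod_Fr F.sub_carrier pl] by blast
  \<comment> \<open>From z are subtracted \<open>C (A z)\<close> and a lift of the part that goes
    through the free module. By the retraction identity the image in M vanishes for every z of the
    free module, not only for those in the kernel.\<close>
  define Z where "Z = (\<lambda>z. (z \<ominus>\<^bsub>Fr p\<^esub> C (A z)) \<ominus>\<^bsub>Fr p\<^esub> L (g (\<pi> z)))"
  have 1: "lin R (Fr p) (Fc p) (Fr p) (Fc p) (\<lambda>z. z)" by (simp add: lin_def)
  have 2: "lin R (Fr p) (Fc p) (Fr p) (Fc p) (\<lambda>z. C (A z))" by (rule lin_comp[OF A(1) C(1)])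
  have 3: "lin R (Fr p) (Fc p) (Fr p) (Fc p) (\<lambda>z. L (g (\<pi> z)))"
    by (rule lin_comp[OF lin_comp[OF pl(1) gl(1)] L(1)])
  have Z: "lin R (Fr p) (Fc p) (Fr p) (Fc p) Z"
    unfolding Z_def by (intro F.lin_diff 1 2 3 F.sub_carrier)
  have Zk: "Z z \<in> krn p M \<pi>" if z: "z \<in> Fc p" for z
  proof -
    have zU: "\<pi> z \<in> U" using linD(1)[OF pl(1) z] .
    have c1: "C (A z) \<in> Fc p" "L (g (\<pi> z)) \<in> Fc p" using linD(1)[OF 2 z] linD(1)[OF 3 z] by auto
    have c2: "c (a (\<pi> z)) \<in> carrier M" "l (g (\<pi> z)) \<in> carrier M"
      using linD(1)[OF lin_comp[OF ac(1,2)] zU] linD(1)[OF lin_comp[OF gl(1,2)] zU] Uc by auto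
    have "\<pi> (Z z) = (\<pi> z \<ominus>\<^bsub>M\<^esub> \<pi> (C (A z))) \<ominus>\<^bsub>M\<^esub> \<pi> (L (g (\<pi> z)))"
      unfolding Z_def using z c1 by (simp add: P.a_minus)
    also have "\<dots> = (\<pi> z \<ominus>\<^bsub>M\<^esub> c (a (\<pi> z))) \<ominus>\<^bsub>M\<^esub> l (g (\<pi> z))"
      using C(2)[OF linD(1)[OF A(1) z]] A(2)[OF z] L(2)[OF linD(1)[OF lin_comp[OF pl(1) gl(1)] z]] by simp
    also have "\<dots> = \<zero>\<^bsub>M\<^esub>"
    proof -
      have "((c (a (\<pi> z)) \<oplus>\<^bsub>M\<^esub> l (g (\<pi> z))) \<ominus>\<^bsub>M\<^esub> c (a (\<pi> z))) \<ominus>\<^bsub>M\<^esub> l (g (\<pi> z)) = \<zero>\<^bsub>M\<^esub>"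
        using M.add_cancel2 c2 by blast
      then show ?thesis using gl(3)[OF zU] by simp
    qed
    finally show ?thesis using linD(1)[OF Z z] by (simp add: krn_def)
  qed
  have "lin R (Fr p) (Fc p) (Fr p) (krn p M \<pi>) Z" by (rule lin_mono[OF Z subset_refl]) (use Zk in blast)
  \<comment> \<open>On the kernel the part through the free module is zero, so there
    \<open>Z z\<close> is just z minus \<open>C (A z)\<close>.\<close>
  moreover have "z = C (A z) \<oplus>\<^bsub>Fr p\<^esub> Z z" if z: "z \<in> krn p M \<pi>" for z
  proof -
    have zc: "z \<in> Fc p" "\<pi> z = \<zero>\<^bsub>M\<^esub>" using z by (auto simp: krn_def)
    have "g \<zero>\<^bsub>M\<^esub> = \<zero>\<^bsub>Fr s\<^esub>" by (rule M.lin_zero[OF lmod_Fr M(2) gl(1)]) simp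
    moreover have "L \<zero>\<^bsub>Fr s\<^esub> = \<zero>\<^bsub>Fr p\<^esub>"
      by (rule lmod.lin_zero[OF lmod_Fr lmod_Fr lmod.sub_carrier[OF lmod_Fr] L(1)]) simp
    ultimately have "Z z = z \<ominus>\<^bsub>Fr p\<^esub> C (A z)"
      unfolding Z_def zc using zc linD(1)[OF 2 zc(1)] by (simp add: a_minus_def)
    then show ?thesis using F.add_minus[OF linD(1)[OF 2 zc(1)] zc(1)] by simp
  qed
  ultimately show ?thesis using that by blast
qed

text \<open>The first part is Schanuel's lemma up to free summands. For the second, with K the
  kernel of a cover by F, the quotient (K \<inter> mF)/mK is Tor in degree 1 with the residue field,
  so it depends only on the stable class of the covered module.\<close>

lemma syz_compare:
  assumes M: "lmod R x e M" "submodule R U M" and N: "lmod R x e N" "submodule R V N"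
    and \<pi>: "cover p M U \<pi>" and \<rho>: "cover q N V \<rho>" and st: "steq M U N V"
  shows "steq (Fr p) (krn p M \<pi>) (Fr q) (krn q N \<rho>)"
    and "mlen R x e (Fr p) (mmul (Fr p) x e (krn p M \<pi>)) (krn p M \<pi> \<inter> mmul (Fr p) x e (Fc p)) k
     \<Longrightarrow> mlen R x e (Fr q) (mmul (Fr q) x e (krn q N \<rho>)) (krn q N \<rho> \<inter> mmul (Fr q) x e (Fc q)) k"
proof -
  interpret M: lmod R x e M by fact
  interpret N: lmod R x e N by fact
  interpret F: lmod R x e "Fr p" by (rule lmod_Fr)
  interpret G: lmod R x e "Fr q" by (rule lmod_Fr)
  have pl: "lin R (Fr p) (Fc p) M U \<pi>" "\<pi> ` Fc p = U" using \<pi> by (auto simp: cover_def)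
  have rl: "lin R (Fr q) (Fc q) N V \<rho>" "\<rho> ` Fc q = V" using \<rho> by (auto simp: cover_def)
  obtain a c where ac: "lin R M U N V a" "lin R N V M U c" "retr M U a c" "retr N V c a"
    using st unfolding steq_def by blast
  obtain A where A: "lin R (Fr p) (Fc p) (Fr q) (Fc q) A" "\<And>z. z \<in> Fc p \<Longrightarrow> \<rho> (A z) = a (\<pi> z)"
    using N.lift_free[OF lin_comp[OF pl(1) ac(1)] N(2) lmod_Fr G.sub_carrier rl] by blast
  obtain C where C: "lin R (Fr q) (Fc q) (Fr p) (Fc p) C" "\<And>z. z \<in> Fc q \<Longrightarrow> \<pi> (C z) = c (\<rho> z)"
    using M.lift_free[OF lin_comp[OF rl(1) ac(2)] M(2) lmod_Fr F.sub_carrier pl] by blast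
  obtain Z where Z: "lin R (Fr p) (Fc p) (Fr p) (krn p M \<pi>) Z"
    "\<And>z. z \<in> krn p M \<pi> \<Longrightarrow> z = C (A z) \<oplus>\<^bsub>Fr p\<^esub> Z z"
    using syz_retr[OF M N \<pi> \<rho> ac(1-3) A C] by blast
  obtain Y where Y: "lin R (Fr q) (Fc q) (Fr q) (krn q N \<rho>) Y"
    "\<And>z. z \<in> krn q N \<rho> \<Longrightarrow> z = A (C z) \<oplus>\<^bsub>Fr q\<^esub> Y z"
    using syz_retr[OF N M \<rho> \<pi> ac(2,1,4) C A] by blast
  have K: "F.sub (krn p M \<pi>)" by (rule krn_sub[OF M \<pi>])
  have K': "G.sub (krn q N \<rho>)" by (rule krn_sub[OF N \<rho>])
  have Kc: "krn p M \<pi> \<subseteq> Fc p" "krn q N \<rho> \<subseteq> Fc q" by (auto simp: krn_def)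
  have az: "a \<zero>\<^bsub>M\<^esub> = \<zero>\<^bsub>N\<^esub>" by (rule M.lin_zero[OF N(1) M(2) ac(1) N.subD(1)[OF N(2)]])
  have cz: "c \<zero>\<^bsub>N\<^esub> = \<zero>\<^bsub>M\<^esub>" by (rule N.lin_zero[OF M(1) N(2) ac(2) M.subD(1)[OF M(2)]])
  have AK: "A z \<in> krn q N \<rho>" if "z \<in> krn p M \<pi>" for z
    using that A(2)[of z] az linD(1)[OF A(1), of z] by (auto simp: krn_def)
  have CK: "C z \<in> krn p M \<pi>" if "z \<in> krn q N \<rho>" for z
    using that C(2)[of z] cz linD(1)[OF C(1), of z] by (auto simp: krn_def)
  have A': "lin R (Fr p) (krn p M \<pi>) (Fr q) (krn q N \<rho>) A"
    by (rule lin_mono[OF A(1) Kc(1)]) (use AK in blast)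
  have C': "lin R (Fr q) (krn q N \<rho>) (Fr p) (krn p M \<pi>) C"
    by (rule lin_mono[OF C(1) Kc(2)]) (use CK in blast)
  have "retr (Fr p) (krn p M \<pi>) A C"
    unfolding retr_def
  proof (intro exI conjI ballI)
    show "lin R (Fr p) (krn p M \<pi>) (Fr p) (Fc p) (\<lambda>z. z)" using Kc by (auto simp: lin_def)
  qed (rule Z Z(2))+
  moreover have "retr (Fr q) (krn q N \<rho>) C A"
    unfolding retr_def
  proof (intro exI conjI ballI)
    show "lin R (Fr q) (krn q N \<rho>) (Fr q) (Fc q) (\<lambda>z. z)" using Kc by (auto simp: lin_def)
  qed (rule Y Y(2))+
  ultimately show "steq (Fr p) (krn p M \<pi>) (Fr q) (krn q N \<rho>)" unfolding steq_def using A' C' by blast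
  assume len: "F.len (F.mm (krn p M \<pi>)) (krn p M \<pi> \<inter> F.mm (Fc p)) k"
  let ?U = "krn p M \<pi> \<inter> F.mm (Fc p)"
  have mF: "F.sub (F.mm (Fc p))" "G.sub (G.mm (Fc q))" by (rule F.mm_sub[OF F.sub_carrier], rule G.mm_sub[OF G.sub_carrier])
  have U: "F.sub ?U" by (rule F.sub_Int[OF K mF(1)])
  have Am: "A u \<in> G.mm T" if "F.sub U'" "G.sub T" "\<And>u. u \<in> U' \<Longrightarrow> A u \<in> T" "u \<in> F.mm U'" for u U' T
  proof -
    interpret AA: slin R x e "Fr p" R x "Fr q" "\<lambda>r. r" A "Fc p"
      by (rule F.slin_lin[OF lmod_Fr F.sub_carrier A(1)]) simp
    show ?thesis using AA.image_mm[OF that(1) F.subD(1)[OF that(1)]] that(4) G.mm_mono[of "A ` U'" T] that(3) by blast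
  qed
  have Cm: "C u \<in> F.mm T" if "G.sub U'" "F.sub T" "\<And>u. u \<in> U' \<Longrightarrow> C u \<in> T" "u \<in> G.mm U'" for u U' T
  proof -
    interpret CC: slin R x e "Fr q" R x "Fr p" "\<lambda>r. r" C "Fc q"
      by (rule G.slin_lin[OF lmod_Fr G.sub_carrier C(1)]) simp
    show ?thesis using CC.image_mm[OF that(1) G.subD(1)[OF that(1)]] that(4) F.mm_mono[of "C ` U'" T] that(3) by blast
  qed
  \<comment> \<open>The correction Z is defined on the whole free module and has values in the
    kernel, so it sends m times the free module into m times the kernel. Modulo the latter, A and C
    are therefore inverse to each other on the part inside mF.\<close>
  have Zm: "Z u \<in> F.mm (krn p M \<pi>)" if "u \<in> F.mm (Fc p)" for u
  proof -
    interpret ZZ: slin R x e "Fr p" R x "Fr p" "\<lambda>r. r" Z "Fc p"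
      by (rule F.slin_lin[OF lmod_Fr F.sub_carrier Z(1) Kc(1)])
    show ?thesis using ZZ.image_mm[OF F.sub_carrier subset_refl] that F.mm_mono[of "Z ` Fc p" "krn p M \<pi>"] linD(1)[OF Z(1)] by blast
  qed
  have Ym: "Y u \<in> G.mm (krn q N \<rho>)" if "u \<in> G.mm (Fc q)" for u
  proof -
    interpret YY: slin R x e "Fr q" R x "Fr q" "\<lambda>r. r" Y "Fc q"
      by (rule G.slin_lin[OF lmod_Fr G.sub_carrier Y(1) Kc(2)])
    show ?thesis using YY.image_mm[OF G.sub_carrier subset_refl] that G.mm_mono[of "Y ` Fc q" "krn q N \<rho>"] linD(1)[OF Y(1)] by blast
  qed
  interpret AU: slin R x e "Fr p" R x "Fr q" "\<lambda>r. r" A ?U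
    by (rule F.slin_lin[OF lmod_Fr U lin_mono[OF A(1), of _ "Fc q"]]) (use Kc linD(1)[OF A(1)] in auto)
  show "G.len (G.mm (krn q N \<rho>)) (krn q N \<rho> \<inter> G.mm (Fc q)) k"
  proof (rule AU.len_hom[OF len subset_refl])
    show "F.mm (krn p M \<pi>) = {u \<in> ?U. A u \<in> G.mm (krn q N \<rho>)}"
    proof (intro subset_antisym subsetI)
      fix u assume u: "u \<in> F.mm (krn p M \<pi>)"
      have "A u \<in> G.mm (krn q N \<rho>)" by (rule Am[OF K K' AK u])
      then show "u \<in> {u \<in> ?U. A u \<in> G.mm (krn q N \<rho>)}"
        using u F.mm_subset[OF K] F.mm_mono[OF Kc(1)] by blast
    next
      fix u assume "u \<in> {u \<in> ?U. A u \<in> G.mm (krn q N \<rho>)}"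
      then have u: "u \<in> krn p M \<pi>" "u \<in> F.mm (Fc p)" "A u \<in> G.mm (krn q N \<rho>)" by auto
      have "C (A u) \<in> F.mm (krn p M \<pi>)" by (rule Cm[OF K' K CK u(3)])
      then show "u \<in> F.mm (krn p M \<pi>)"
        using F.subD(4)[OF F.mm_sub[OF K]] Zm[OF u(2)] Z(2)[OF u(1)] by metis
    qed
    show "G.sub (G.mm (krn q N \<rho>))" by (rule G.mm_sub[OF K'])
    show "G.mm (krn q N \<rho>) \<subseteq> krn q N \<rho> \<inter> G.mm (Fc q)" using G.mm_subset[OF K'] G.mm_mono[OF Kc(2)] by blast
    show "G.sub (krn q N \<rho> \<inter> G.mm (Fc q))" by (rule G.sub_Int[OF K' mF(2)])
    show "A ` ?U \<subseteq> krn q N \<rho> \<inter> G.mm (Fc q)"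
      using AK Am[OF F.sub_carrier G.sub_carrier linD(1)[OF A(1)]] by blast
    fix t assume t: "t \<in> krn q N \<rho> \<inter> G.mm (Fc q)"
    have "C t \<in> ?U" using t CK Cm[OF G.sub_carrier F.sub_carrier linD(1)[OF C(1)]] by blast
    moreover have "Y t \<in> G.mm (krn q N \<rho>)" using Ym t by blast
    moreover have "t = A (C t) \<oplus>\<^bsub>Fr q\<^esub> Y t" using Y(2) t by blast
    ultimately show "\<exists>u\<in>?U. \<exists>v\<in>G.mm (krn q N \<rho>). t = A u \<oplus>\<^bsub>Fr q\<^esub> v" by blast
  qed
qed

end

context lmod begin

lemma image_mmk:
  assumes "lmod R x e N" "sub U" "lin R M U N V a" "V \<subseteq> carrier N"
  shows "a ` ((mm ^^ k) U) = (mmul N x e ^^ k) (a ` U)"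
proof (induction k)
  case (Suc k)
  interpret slin R x e M R x N "\<lambda>r. r" a U by (rule slin_lin[OF assms])
  show ?case using image_mm[OF mmk_sub[OF assms(2)] mmk_subset[OF assms(2)], of k] Suc by simp
qed simp

lemma sub_nontrivial: "\<lbrakk> sub U; U \<noteq> {\<zero>\<^bsub>M\<^esub>} \<rbrakk> \<Longrightarrow> \<exists>u\<in>U. u \<noteq> \<zero>\<^bsub>M\<^esub>"
  using subD(3) by auto

end

lemma (in mring) coverD:
  assumes "cover p M U \<pi>" shows "lin R (Fr p) (Fc p) M U \<pi>" "\<pi> ` Fc p = U"
  using assms unfolding cover_def by blast+

section \<open>Artinian rings: minimal covers and minimal syzygies\<close>

text \<open>The number n kills m as an exponent, and l is the length of the ring. Locality is not
  assumed but follows, see \<open>idl_not_var\<close>.\<close>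

locale artin = mring +
  fixes n l :: nat
  assumes nilp: "(mmul (self_module R) x e ^^ n) (carrier R) = {\<zero>}"
    and fin_len: "mlen R x e (self_module R) {\<zero>} (carrier R) l"
begin

lemma len_Fr: "mlen R x e (Fr p) {\<zero>\<^bsub>Fr p\<^esub>} (Fc p) (p * l)"
  using len_pw[OF fin_len, of p] by (simp add: pw_zero pw_carrier)

lemma nil_Fr: "(mmul (Fr p) x e ^^ n) (Fc p) = {\<zero>\<^bsub>Fr p\<^esub>}"
  using mmk_pw[OF idl_carrier, where p = p and k = n] by (simp add: nilp pw_zero pw_carrier)

lemma len_Fr_sub: "submodule R K (Fr p) \<Longrightarrow> \<exists>k. mlen R x e (Fr p) {\<zero>\<^bsub>Fr p\<^esub>} K k"
  using lmod.len_sub_ex[OF lmod_Fr len_Fr lmod.sub_zero[OF lmod_Fr]] lmod.subD[OF lmod_Fr] by blast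

lemma cover_slin:
  assumes "lmod R x e M" "submodule R U M" "cover p M U \<pi>"
  shows "slin R x e (Fr p) R x M (\<lambda>r. r) \<pi> (Fc p)"
proof -
  interpret lmod R x e M by fact
  interpret F: lmod R x e "Fr p" by (rule lmod_Fr)
  show ?thesis
    by (rule F.slin_lin[OF assms(1) F.sub_carrier]) (use assms(3) subD(1)[OF assms(2)] in \<open>auto simp: cover_def\<close>)
qed

lemma cover_nil:
  assumes "lmod R x e M" "submodule R U M" "cover p M U \<pi>" shows "(mmul M x e ^^ n) U = {\<zero>\<^bsub>M\<^esub>}"
proof -
  interpret F: lmod R x e "Fr p" by (rule lmod_Fr)
  interpret lmod R x e M by fact
  have pl: "lin R (Fr p) (Fc p) M U \<pi>" "\<pi> ` Fc p = U" using assms(3) by (auto simp: cover_def)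
  have "\<pi> ` ((mmul (Fr p) x e ^^ n) (Fc p)) = (mm ^^ n) U"
    using F.image_mmk[OF assms(1) F.sub_carrier pl(1) subD(1)[OF assms(2)]] pl(2) by simp
  moreover have "\<pi> \<zero>\<^bsub>Fr p\<^esub> = \<zero>\<^bsub>M\<^esub>"
    by (rule F.lin_zero[OF assms(1) F.sub_carrier pl(1) subD(1)[OF assms(2)]])
  ultimately show ?thesis by (simp add: nil_Fr)
qed

lemma cover_len:
  assumes M: "lmod R x e M" "submodule R U M" "cover p M U \<pi>" and T: "submodule R T M" "T \<subseteq> U"
  shows "\<exists>k. mlen R x e (Fr p) {z \<in> Fc p. \<pi> z \<in> T} (Fc p) k \<and> mlen R x e M T U k"
proof -
  interpret F: lmod R x e "Fr p" by (rule lmod_Fr)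
  interpret slin R x e "Fr p" R x M "\<lambda>r. r" \<pi> "Fc p" by (rule cover_slin[OF M])
  have s: "F.sub {z \<in> Fc p. \<pi> z \<in> T}" by (rule sub_vimage[OF T(1)])
  obtain k where k: "F.len {z \<in> Fc p. \<pi> z \<in> T} (Fc p) k"
    using F.len_sub_ex[OF len_Fr s F.sub_carrier] F.subD[OF s] by blast
  have U: "\<pi> ` Fc p = U" using M(3) by (simp add: cover_def)
  have "N.len T U k"
  proof (rule len_hom[OF k subset_refl refl T M(2)])
    show "\<pi> ` Fc p \<subseteq> U" using U by simp
    fix t assume "t \<in> U"
    then obtain u where "u \<in> Fc p" "t = \<pi> u" using U by blast
    then show "\<exists>u\<in>Fc p. \<exists>v\<in>T. t = \<pi> u \<oplus>\<^bsub>M\<^esub> v"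
      using N.subD(3)[OF T(1)] a_closed by (metis N.M.r_zero)
  qed
  then show ?thesis using k by blast
qed

text \<open>Additivity of length for the exact sequence of kernel, free module and image.\<close>

lemma cover_krn_len:
  assumes M: "lmod R x e M" "submodule R U M" "cover p M U \<pi>"
  obtains a c where "mlen R x e (Fr p) {\<zero>\<^bsub>Fr p\<^esub>} (krn p M \<pi>) a" "mlen R x e M {\<zero>\<^bsub>M\<^esub>} U c" "a + c = p * l"
proof -
  interpret F: lmod R x e "Fr p" by (rule lmod_Fr)
  interpret M: lmod R x e M by fact
  have K: "F.sub (krn p M \<pi>)" by (rule krn_sub[OF M])
  have eq: "{z \<in> Fc p. \<pi> z \<in> {\<zero>\<^bsub>M\<^esub>}} = krn p M \<pi>" by (auto simp: krn_def)
  obtain c where c: "F.len (krn p M \<pi>) (Fc p) c" "M.len {\<zero>\<^bsub>M\<^esub>} U c"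
    using cover_len[OF M M.sub_zero] M.subD(3)[OF M(2)] unfolding eq by blast
  obtain a where a: "F.len {\<zero>\<^bsub>Fr p\<^esub>} (krn p M \<pi>) a" using len_Fr_sub[OF K] by blast
  have "a + c = p * l" by (rule F.len_unique[OF F.len_trans[OF c(1) a] len_Fr])
  then show ?thesis using that a c by blast
qed

text \<open>Generators of U/mU lift to generators of U by Nakayama. They form a basis of U/mU, so a
  relation between them has all its coefficients in m.\<close>

lemma min_cover:
  assumes M: "lmod R x e M" "submodule R U M" "mlen R x e M (mmul M x e U) U k" "(mmul M x e ^^ j) U \<subseteq> {\<zero>\<^bsub>M\<^esub>}"
  obtains \<pi> where "cover k M U \<pi>" "krn k M \<pi> \<subseteq> mmul (Fr k) x e (Fc k)"
proof -
  interpret F: lmod R x e "Fr k" by (rule lmod_Fr)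
  interpret M: lmod R x e M by fact
  obtain u where u: "\<And>i. i < k \<Longrightarrow> u i \<in> U" "U \<subseteq> M.mm U <+>\<^bsub>M\<^esub> M.comb k u ` Fc k"
    "(\<forall>i<k. \<forall>j<e. x j \<odot>\<^bsub>M\<^esub> u i \<in> M.mm U) \<longrightarrow>
      (\<forall>c\<in>Fc k. M.comb k u c \<in> M.mm U \<longrightarrow> (\<forall>i<k. c i \<in> var_ideal R x e))"
    by (rule M.len_generators[OF M(3)]) blast
  have l: "lin R (Fr k) (Fc k) M U (M.comb k u)" by (rule M.comb_lin[OF M(2) u(1)])
  interpret slin R x e "Fr k" R x M "\<lambda>r. r" "M.comb k u" "Fc k"
    by (rule F.slin_lin[OF M(1) F.sub_carrier l M.subD(1)[OF M(2)]])
  have S: "M.sub (M.comb k u ` Fc k)" by (rule sub_image[OF F.sub_carrier subset_refl])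
  have "U \<subseteq> M.comb k u ` Fc k"
  proof (rule M.nakayama[OF S M(2)])
    show "U \<subseteq> M.comb k u ` Fc k <+>\<^bsub>M\<^esub> M.mm U"
      using u(2) M.sub_add_ac(1)[OF M.mm_sub[OF M(2)] S S] by simp
    show "(M.mm ^^ j) U \<subseteq> M.comb k u ` Fc k" using M(4) M.subD(3)[OF S] by blast
  qed
  then have c: "cover k M U (M.comb k u)" unfolding cover_def using l linD(1)[OF l] by blast
  have "krn k M (M.comb k u) \<subseteq> F.mm (Fc k)"
  proof
    fix z assume z: "z \<in> krn k M (M.comb k u)"
    then have "M.comb k u z \<in> M.mm U" "z \<in> Fc k" using M.subD(3)[OF M.mm_sub[OF M(2)]] by (auto simp: krn_def)
    moreover have "\<forall>i<k. \<forall>j<e. x j \<odot>\<^bsub>M\<^esub> u i \<in> M.mm U" using M.mm_gen[OF M(2) _ u(1)] by blast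
    ultimately have "\<forall>i<k. z i \<in> var_ideal R x e" using u(3) by blast
    then show "z \<in> F.mm (Fc k)" unfolding mm_Fc using \<open>z \<in> Fc k\<close> by (simp add: pw_def)
  qed
  with c that show ?thesis by blast
qed

lemma ex_min_cover:
  assumes M: "lmod R x e M" "submodule R U M" "cover p M U \<pi>"
  obtains q \<rho> where "cover q M U \<rho>" "krn q M \<rho> \<subseteq> mmul (Fr q) x e (Fc q)"
proof -
  interpret M: lmod R x e M by fact
  obtain k where k: "M.len (M.mm U) U k"
    using cover_len[OF M M.mm_sub[OF M(2)] M.mm_subset[OF M(2)]] by blast
  have nl: "(M.mm ^^ n) U \<subseteq> {\<zero>\<^bsub>M\<^esub>}" using cover_nil[OF M] by simp
  show ?thesis by (rule min_cover[OF M(1,2) k nl]) (rule that)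
qed

text \<open>A submodule of a finite free module has finite length, and a composition series yields
  that many generators. The cover is not minimal; it provides the finiteness from which
  \<open>ex_min_cover\<close> starts.\<close>

lemma ex_cover_Fr: assumes "submodule R K (Fr p)" obtains q \<pi> where "cover q (Fr p) K \<pi>"
proof -
  interpret F: lmod R x e "Fr p" by (rule lmod_Fr)
  obtain k where k: "F.len {\<zero>\<^bsub>Fr p\<^esub>} K k" using len_Fr_sub[OF assms] by blast
  obtain u where u: "\<And>i. i < k \<Longrightarrow> u i \<in> K" "K \<subseteq> {\<zero>\<^bsub>Fr p\<^esub>} <+>\<^bsub>Fr p\<^esub> F.comb k u ` Fc k"
    by (rule F.len_generators[OF k]) blast
  have l: "lin R (Fr k) (Fc k) (Fr p) K (F.comb k u)" by (rule F.comb_lin[OF assms u(1)])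
  have "z \<in> F.comb k u ` Fc k" if "z \<in> K" for z
  proof -
    have "z \<in> {\<zero>\<^bsub>Fr p\<^esub>} <+>\<^bsub>Fr p\<^esub> F.comb k u ` Fc k" using u(2) that by blast
    then obtain c where c: "c \<in> Fc k" "z = \<zero>\<^bsub>Fr p\<^esub> \<oplus>\<^bsub>Fr p\<^esub> F.comb k u c" by (auto simp: F.mem_add)
    then show ?thesis using F.subD(2)[OF assms linD(1)[OF l c(1)]] by auto
  qed
  then have "cover k (Fr p) K (F.comb k u)" unfolding cover_def using l linD(1)[OF l] by blast
  then show ?thesis using that by blast
qed

text \<open>As C lies in m R^q, it is killed by m^(n-1), so the kernel of its cover contains m^(n-1)
  R^p. With p \<ge> 1 this part is nonzero. Thus being a nonzero minimal syzygy passes on to the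
  next syzygy.\<close>

lemma min_cover_nonzero:
  assumes "(mmul S1 x e ^^ (n - 1)) (carrier R) \<noteq> {\<zero>}" "n \<ge> 1"
    and C: "submodule R C (Fr q)" "C \<subseteq> mmul (Fr q) x e (Fc q)" "C \<noteq> {\<zero>\<^bsub>Fr q\<^esub>}" and \<rho>: "cover p (Fr q) C \<rho>"
  shows "(mmul (Fr p) x e ^^ (n - 1)) (Fc p) \<subseteq> krn p (Fr q) \<rho>" "p \<ge> 1" "krn p (Fr q) \<rho> \<noteq> {\<zero>\<^bsub>Fr p\<^esub>}"
proof -
  interpret F: lmod R x e "Fr p" by (rule lmod_Fr)
  interpret G: lmod R x e "Fr q" by (rule lmod_Fr)
  have rl: "lin R (Fr p) (Fc p) (Fr q) C \<rho>" "\<rho> ` Fc p = C" by (rule coverD[OF \<rho>])+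
  have "(G.mm ^^ (n - 1)) C \<subseteq> (G.mm ^^ (n - 1)) (G.mm (Fc q))" by (rule G.mmk_mono[OF C(2)])
  also have "\<dots> = (G.mm ^^ n) (Fc q)" using assms(2) funpow_Suc_right[of "n - 1" "G.mm"] by simp
  finally have "\<rho> ` (F.mm ^^ (n - 1)) (Fc p) \<subseteq> {\<zero>\<^bsub>Fr q\<^esub>}"
    using F.image_mmk[OF lmod_Fr F.sub_carrier rl(1) G.subD(1)[OF C(1)], of "n - 1"] rl(2) nil_Fr by simp
  then show 1: "(F.mm ^^ (n - 1)) (Fc p) \<subseteq> krn p (Fr q) \<rho>"
    using F.mmk_subset[OF F.sub_carrier] by (auto simp: krn_def)
  show p1: "p \<ge> 1"
  proof (rule ccontr)
    assume "\<not> p \<ge> 1"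
    then have p0: "p = 0" by simp
    have F0: "Fc p = {\<zero>\<^bsub>Fr p\<^esub>}" unfolding p0 func_space_def by (simp add: restrict_def)
    have z: "\<rho> \<zero>\<^bsub>Fr p\<^esub> = \<zero>\<^bsub>Fr q\<^esub>" by (rule F.lin_zero[OF lmod_Fr F.sub_carrier rl(1) G.subD(1)[OF C(1)]])
    have "C = \<rho> ` {\<zero>\<^bsub>Fr p\<^esub>}" by (rule trans[OF rl(2)[symmetric] arg_cong[OF F0, of "\<lambda>S. \<rho> ` S"]])
    also have "\<dots> = {\<zero>\<^bsub>Fr q\<^esub>}" by (simp only: image_insert image_empty z)
    finally show False using C(3) by contradiction
  qed
  have P: "idl ((mmul S1 x e ^^ (n - 1)) (carrier R))" by (rule lmod.mmk_sub[OF lmod_self idl_carrier])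
  obtain s where s: "s \<in> (mmul S1 x e ^^ (n - 1)) (carrier R)" "s \<noteq> \<zero>"
    using lmod.sub_nontrivial[OF lmod_self P] assms(1) unfolding self_simps by blast
  have "ins p 0 s \<in> pw ((mmul S1 x e ^^ (n - 1)) (carrier R)) p" by (rule ins_pw[OF P s(1)])
  then have "ins p 0 s \<in> (F.mm ^^ (n - 1)) (Fc p)"
    using mmk_pw[OF idl_carrier, where p = p and k = "n - 1"] by (simp add: pw_carrier)
  moreover have "ins p 0 s \<noteq> \<zero>\<^bsub>Fr p\<^esub>"
  proof
    assume "ins p 0 s = \<zero>\<^bsub>Fr p\<^esub>"
    from fun_cong[OF this, of 0] show False using p1 s(2) by (simp add: ins_def Fr_simps)
  qed
  ultimately show "krn p (Fr q) \<rho> \<noteq> {\<zero>\<^bsub>Fr p\<^esub>}" using 1 by blast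
qed

text \<open>The resolution \<open>\<dots> \<rightarrow> R\<^bsup>b 1\<^esup> \<rightarrow> R\<^bsup>b 0\<^esup> \<rightarrow> M\<close> as a sequence of covers of the syzygies \<open>B i\<close>.\<close>
definition resol :: "('a, 'm, 'c) module_scheme \<Rightarrow> (nat \<Rightarrow> nat) \<Rightarrow> (nat \<Rightarrow> (nat \<Rightarrow> 'a) \<Rightarrow> (nat \<Rightarrow> 'a)) \<Rightarrow>
    ((nat \<Rightarrow> 'a) \<Rightarrow> 'm) \<Rightarrow> (nat \<Rightarrow> (nat \<Rightarrow> 'a) set) \<Rightarrow> bool"
  where "resol M b d \<epsilon> B \<longleftrightarrow> cover (b 0) M (carrier M) \<epsilon> \<and> B 0 = krn (b 0) M \<epsilon> \<and>
    (\<forall>i. cover (b (Suc i)) (Fr (b i)) (B i) (d i) \<and> B (Suc i) = krn (b (Suc i)) (Fr (b i)) (d i))"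

lemma resolD:
  assumes "resol M b d \<epsilon> B"
  shows "cover (b 0) M (carrier M) \<epsilon>" "B 0 = krn (b 0) M \<epsilon>" "cover (b (Suc i)) (Fr (b i)) (B i) (d i)"
    "B (Suc i) = krn (b (Suc i)) (Fr (b i)) (d i)"
  using assms unfolding resol_def by blast+

lemma resol_sub: assumes "lmod R x e M" "resol M b d \<epsilon> B" shows "submodule R (B i) (Fr (b i))"
proof (induction i)
  case 0
  show ?case using krn_sub[OF assms(1) lmod.sub_carrier[OF assms(1)]] assms(2) by (simp add: resol_def)
next
  case (Suc i)
  show ?case using krn_sub[OF lmod_Fr Suc] assms(2) by (simp add: resol_def)
qed

text \<open>The syzygies of the given resolution need not be minimal. Minimal ones are constructed
  in parallel, beginning with a minimal cover of M, whose kernel is nonzero by the last hypothesis;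
  \<open>syz_compare\<close> keeps the two sequences stably equivalent.\<close>

lemma resol_minimal:
  assumes soc: "(mmul S1 x e ^^ (n - 1)) (carrier R) \<noteq> {\<zero>}" "n \<ge> 1"
    and M: "lmod R x e M" "resol M b d \<epsilon> B"
    and nonfree: "\<And>q \<rho>. cover q M (carrier M) \<rho> \<Longrightarrow> krn q M \<rho> \<noteq> {\<zero>\<^bsub>Fr q\<^esub>}"
  shows "\<exists>q C. submodule R C (Fr q) \<and> C \<subseteq> mmul (Fr q) x e (Fc q) \<and> C \<noteq> {\<zero>\<^bsub>Fr q\<^esub>} \<and> steq (Fr (b i)) (B i) (Fr q) C"
proof (induction i)
  case 0
  note c = resolD(1,2)[OF M(2)]
  note Mc = lmod.sub_carrier[OF M(1)]
  obtain q \<rho> where q: "cover q M (carrier M) \<rho>" "krn q M \<rho> \<subseteq> mmul (Fr q) x e (Fc q)"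
    using ex_min_cover[OF M(1) Mc c(1)] by blast
  show ?case
    using krn_sub[OF M(1) Mc q(1)] q(2) nonfree[OF q(1)]
      syz_compare(1)[OF M(1) Mc M(1) Mc c(1) q(1) steq_refl[OF M(1) Mc]] unfolding c(2) by (intro exI conjI)
next
  case (Suc i)
  then obtain q C where C: "submodule R C (Fr q)" "C \<subseteq> mmul (Fr q) x e (Fc q)" "C \<noteq> {\<zero>\<^bsub>Fr q\<^esub>}" "steq (Fr (b i)) (B i) (Fr q) C"
    by blast
  note c = resolD(3,4)[OF M(2), of i]
  obtain p' \<rho>' where "cover p' (Fr q) C \<rho>'" using ex_cover_Fr[OF C(1)] by blast
  then obtain p \<rho> where p: "cover p (Fr q) C \<rho>" "krn p (Fr q) \<rho> \<subseteq> mmul (Fr p) x e (Fc p)"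
    using ex_min_cover[OF lmod_Fr C(1)] by blast
  show ?case
    using krn_sub[OF lmod_Fr C(1) p(1)] p(2) min_cover_nonzero(3)[OF soc C(1-3) p(1)]
      syz_compare(1)[OF lmod_Fr resol_sub[OF M] lmod_Fr C(1) c(1) p(1) C(4)] unfolding c(2) by (intro exI conjI)
qed

text \<open>Reduction of Betti numbers in degrees \<open>i + 2\<close> and \<open>i + 3\<close> to one minimal matrix \<open>\<phi>\<close>.\<close>
lemma resol_betti_minimal:
  assumes soc: "(mmul S1 x e ^^ (n - 1)) (carrier R) \<noteq> {\<zero>}" "n \<ge> 1"
    and M: "lmod R x e M" "resol M b d \<epsilon> B"
    and nonfree: "\<And>q \<rho>. cover q M (carrier M) \<rho> \<Longrightarrow> krn q M \<rho> \<noteq> {\<zero>\<^bsub>Fr q\<^esub>}"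
    and \<beta>: "\<And>i. mlen R x e (Fr (b i)) (mmul (Fr (b i)) x e (B i)) (B i \<inter> mmul (Fr (b i)) x e (Fc (b i))) (\<beta> i)"
  obtains q \<phi> where "q \<ge> 1" "lin R (Fr (\<beta> (Suc i))) (Fc (\<beta> (Suc i))) (Fr q) (Fc q) \<phi>"
    "\<phi> ` Fc (\<beta> (Suc i)) \<subseteq> mmul (Fr q) x e (Fc q)" "(mmul (Fr q) x e ^^ (n - 1)) (Fc q) \<subseteq> \<phi> ` Fc (\<beta> (Suc i))"
    "krn (\<beta> (Suc i)) (Fr q) \<phi> \<subseteq> mmul (Fr (\<beta> (Suc i))) x e (Fc (\<beta> (Suc i)))"
    "mlen R x e (Fr (\<beta> (Suc i))) (mmul (Fr (\<beta> (Suc i))) x e (krn (\<beta> (Suc i)) (Fr q) \<phi>)) (krn (\<beta> (Suc i)) (Fr q) \<phi>) (\<beta> (Suc (Suc i)))"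
proof -
  obtain s C where C: "submodule R C (Fr s)" "C \<subseteq> mmul (Fr s) x e (Fc s)" "C \<noteq> {\<zero>\<^bsub>Fr s\<^esub>}" "steq (Fr (b i)) (B i) (Fr s) C"
    using resol_minimal[OF soc M] nonfree by metis
  have c: "cover (b (Suc i)) (Fr (b i)) (B i) (d i)" "B (Suc i) = krn (b (Suc i)) (Fr (b i)) (d i)"
    "cover (b (Suc (Suc i))) (Fr (b (Suc i))) (B (Suc i)) (d (Suc i))" "B (Suc (Suc i)) = krn (b (Suc (Suc i))) (Fr (b (Suc i))) (d (Suc i))"
    by (rule resolD[OF M(2)])+
  note Bs = resol_sub[OF M]
  obtain p' \<rho>' where "cover p' (Fr s) C \<rho>'" using ex_cover_Fr[OF C(1)] by blast
  then obtain q \<rho> where q: "cover q (Fr s) C \<rho>" "krn q (Fr s) \<rho> \<subseteq> mmul (Fr q) x e (Fc q)"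
    using ex_min_cover[OF lmod_Fr C(1)] by blast
  let ?N = "krn q (Fr s) \<rho>"
  have N: "submodule R ?N (Fr q)" by (rule krn_sub[OF lmod_Fr C(1) q(1)])
  note nz = min_cover_nonzero[OF soc C(1-3) q(1)]
  \<comment> \<open>By minimality the intersection with m times the free module is all of
    \<open>?N\<close>, so \<open>\<beta> (Suc i)\<close> counts generators of \<open>?N\<close>. The
    index is shifted: \<open>\<beta> j\<close> will be the Betti number in degree j + 1.\<close>
  have "mlen R x e (Fr q) (mmul (Fr q) x e ?N) (?N \<inter> mmul (Fr q) x e (Fc q)) (\<beta> (Suc i))"
    by (rule syz_compare(2)[OF lmod_Fr Bs lmod_Fr C(1) c(1) q(1) C(4)]) (use \<beta>[of "Suc i"] c(2) in simp)
  moreover have "?N \<inter> mmul (Fr q) x e (Fc q) = ?N" using q(2) by blast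
  ultimately have lN: "mlen R x e (Fr q) (mmul (Fr q) x e ?N) ?N (\<beta> (Suc i))" by simp
  have st: "steq (Fr (b (Suc i))) (B (Suc i)) (Fr q) ?N"
    using syz_compare(1)[OF lmod_Fr Bs lmod_Fr C(1) c(1) q(1) C(4)] c(2) by simp
  obtain p'' \<rho>'' where c'': "cover p'' (Fr q) ?N \<rho>''" using ex_cover_Fr[OF N] by blast
  have nl: "(mmul (Fr q) x e ^^ n) ?N \<subseteq> {\<zero>\<^bsub>Fr q\<^esub>}" using cover_nil[OF lmod_Fr N c''] by simp
  obtain \<phi> where \<phi>: "cover (\<beta> (Suc i)) (Fr q) ?N \<phi>"
      "krn (\<beta> (Suc i)) (Fr q) \<phi> \<subseteq> mmul (Fr (\<beta> (Suc i))) x e (Fc (\<beta> (Suc i)))"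
    by (rule min_cover[OF lmod_Fr N lN nl])
  let ?p = "\<beta> (Suc i)"
  let ?K = "krn ?p (Fr q) \<phi>"
  have "mlen R x e (Fr ?p) (mmul (Fr ?p) x e ?K) (?K \<inter> mmul (Fr ?p) x e (Fc ?p)) (\<beta> (Suc (Suc i)))"
    by (rule syz_compare(2)[OF lmod_Fr Bs lmod_Fr N c(3) \<phi>(1) st]) (use \<beta>[of "Suc (Suc i)"] c(4) in simp)
  moreover have "?K \<inter> mmul (Fr ?p) x e (Fc ?p) = ?K" using \<phi>(2) by blast
  ultimately have lK: "mlen R x e (Fr ?p) (mmul (Fr ?p) x e ?K) ?K (\<beta> (Suc (Suc i)))" by simp
  have im: "\<phi> ` Fc ?p = ?N" "lin R (Fr ?p) (Fc ?p) (Fr q) ?N \<phi>"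
    by (rule coverD[OF \<phi>(1)])+
  have Nc: "?N \<subseteq> Fc q" unfolding krn_def by (rule Collect_subset)
  have 1: "lin R (Fr ?p) (Fc ?p) (Fr q) (Fc q) \<phi>"
    by (rule lin_mono[OF im(2) subset_refl]) (rule ord_eq_le_trans[OF im(1) Nc])
  have 2: "\<phi> ` Fc ?p \<subseteq> mmul (Fr q) x e (Fc q)" by (rule ord_eq_le_trans[OF im(1) q(2)])
  have 3: "(mmul (Fr q) x e ^^ (n - 1)) (Fc q) \<subseteq> \<phi> ` Fc ?p" by (rule ord_le_eq_trans[OF nz(1) im(1)[symmetric]])
  show ?thesis by (rule that[OF nz(2) 1 2 3 \<phi>(2) lK])
qed

end

section \<open>Counting the generators of the kernel of a minimal matrix\<close>

context lmod begin

lemma add_add_swap: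
  assumes a: "a \<in> carrier M" and t: "t \<in> carrier M" and b: "b \<in> carrier M" and w: "w \<in> carrier M"
  shows "((a \<oplus>\<^bsub>M\<^esub> t) \<oplus>\<^bsub>M\<^esub> b) \<oplus>\<^bsub>M\<^esub> w = (b \<oplus>\<^bsub>M\<^esub> t) \<oplus>\<^bsub>M\<^esub> (w \<oplus>\<^bsub>M\<^esub> a)"
    "(a \<oplus>\<^bsub>M\<^esub> t) \<oplus>\<^bsub>M\<^esub> (b \<oplus>\<^bsub>M\<^esub> w) = (a \<oplus>\<^bsub>M\<^esub> b) \<oplus>\<^bsub>M\<^esub> (t \<oplus>\<^bsub>M\<^esub> w)"
proof -
  have "(a \<oplus>\<^bsub>M\<^esub> t) \<oplus>\<^bsub>M\<^esub> b = b \<oplus>\<^bsub>M\<^esub> (t \<oplus>\<^bsub>M\<^esub> a)"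
    unfolding M.a_comm[OF a t] by (rule M.a_comm[OF M.a_closed[OF t a] b])
  then show "((a \<oplus>\<^bsub>M\<^esub> t) \<oplus>\<^bsub>M\<^esub> b) \<oplus>\<^bsub>M\<^esub> w = (b \<oplus>\<^bsub>M\<^esub> t) \<oplus>\<^bsub>M\<^esub> (w \<oplus>\<^bsub>M\<^esub> a)"
    by (simp only: M.a_assoc[OF b t a, symmetric] M.a_assoc[OF M.a_closed[OF b t] a w] M.a_comm[OF a w])
  have "t \<oplus>\<^bsub>M\<^esub> (b \<oplus>\<^bsub>M\<^esub> w) = b \<oplus>\<^bsub>M\<^esub> (t \<oplus>\<^bsub>M\<^esub> w)" by (rule M.a_lcomm[OF t b w])
  then show "(a \<oplus>\<^bsub>M\<^esub> t) \<oplus>\<^bsub>M\<^esub> (b \<oplus>\<^bsub>M\<^esub> w) = (a \<oplus>\<^bsub>M\<^esub> b) \<oplus>\<^bsub>M\<^esub> (t \<oplus>\<^bsub>M\<^esub> w)"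
    by (simp only: M.a_assoc[OF a t M.a_closed[OF b w]] M.a_assoc[OF a b M.a_closed[OF t w]])
qed

lemma add_left_imp_eq:
  assumes "s \<oplus>\<^bsub>M\<^esub> u = s \<oplus>\<^bsub>M\<^esub> v" "s \<in> carrier M" "u \<in> carrier M" "v \<in> carrier M" shows "u = v"
proof -
  have "u = \<ominus>\<^bsub>M\<^esub> s \<oplus>\<^bsub>M\<^esub> (s \<oplus>\<^bsub>M\<^esub> u)" by (rule M.r_neg1[OF assms(2,3), symmetric])
  also have "\<dots> = v" unfolding assms(1) by (rule M.r_neg1[OF assms(2,4)])
  finally show ?thesis .
qed

end

text \<open>The properties of a polynomial ring on which the count rests. \<open>hilb\<close> makes
  h the Hilbert function. \<open>colon\<close> is the regularity of the sequence of variables in a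
  filtered form: a relation of order N + 1 among the variables up to k forces its last coefficient
  into the ideal of the earlier variables, up to order N. \<open>growth\<close> expresses that
  lengths grow polynomially, so that a shift by d changes them by a factor tending to 1.\<close>

locale kosz = mring +
  fixes h :: "nat \<Rightarrow> nat"
  assumes hilb: "mlen R x e (self_module R) ((mmul (self_module R) x e ^^ Suc j) (carrier R))
      ((mmul (self_module R) x e ^^ j) (carrier R)) (h j)"
    and colon: "\<lbrakk> k < e; \<And>i. i \<le> k \<Longrightarrow> c i \<in> (mmul (self_module R) x e ^^ Suc m) (carrier R);
        (\<Oplus>i\<in>{..k}. x i \<otimes> c i) \<in> (mmul (self_module R) x e ^^ Suc N) (carrier R) \<rbrakk>
      \<Longrightarrow> \<exists>a r. (\<forall>j<k. a j \<in> (mmul (self_module R) x e ^^ m) (carrier R)) \<and>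
        r \<in> (mmul (self_module R) x e ^^ N) (carrier R) \<and> c k = (\<Oplus>j\<in>{..<k}. x j \<otimes> a j) \<oplus> r"
    and growth: "\<exists>N>1. q * (\<Sum>j<N + d. h j) < (q + 1) * (\<Sum>j<N. h j)"
begin

definition Ipow :: "nat \<Rightarrow> 'a set" where "Ipow j = (mmul S1 x e ^^ j) (carrier R)"
definition Fm :: "nat \<Rightarrow> nat \<Rightarrow> (nat \<Rightarrow> 'a) set" where "Fm j p = pw (Ipow j) p"
text \<open>The length of the ring modulo \<open>Ipow N\<close>, see
  \<open>len_Fm_top\<close>.\<close>

abbreviation ell :: "nat \<Rightarrow> nat" where "ell N \<equiv> (\<Sum>j<N. h j)"

lemma Ipow_idl: "idl (Ipow j)"
  unfolding Ipow_def by (rule lmod.mmk_sub[OF lmod_self idl_carrier])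
lemma Fm_sub: "submodule R (Fm j p) (Fr p)"
  unfolding Fm_def by (rule pw_sub[OF Ipow_idl])
lemma Fm_0: "Fm 0 p = Fc p" by (simp add: Fm_def Ipow_def pw_carrier)
lemma Fm_eq: "Fm j p = (mmul (Fr p) x e ^^ j) (Fc p)"
  using mmk_pw[OF idl_carrier, where p = p and k = j] by (simp add: Fm_def Ipow_def pw_carrier)
lemma mm_Fm: "mmul (Fr p) x e (Fm j p) = Fm (Suc j) p" by (simp add: Fm_eq)
lemma Fm_antimono: "i \<le> j \<Longrightarrow> Fm j p \<subseteq> Fm i p"
  unfolding Fm_eq by (rule lmod.mmk_antimono[OF lmod_Fr lmod.sub_carrier[OF lmod_Fr]])
lemma Fm_Fc: "Fm j p \<subseteq> Fc p" using Fm_antimono[of 0 j p] by (simp add: Fm_0)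
lemma Fm_smult: "\<lbrakk> i < e; u \<in> Fm j p \<rbrakk> \<Longrightarrow> x i \<odot>\<^bsub>Fr p\<^esub> u \<in> Fm (Suc j) p"
  unfolding mm_Fm[symmetric] by (rule lmod.mm_gen[OF lmod_Fr Fm_sub])

lemma len_Fm: "mlen R x e (Fr p) (Fm (Suc j) p) (Fm j p) (p * h j)"
  unfolding Fm_def Ipow_def by (rule len_pw[OF hilb])

lemma len_Fm_top: "mlen R x e (Fr p) (Fm N p) (Fc p) (p * ell N)"
proof (induction N)
  case 0
  show ?case using mlen.mlen_refl[OF Fm_sub[of 0 p]] by (simp add: Fm_0)
next
  case (Suc N)
  show ?case using lmod.len_trans[OF lmod_Fr Suc len_Fm] by (simp add: add.commute distrib_left)
qed

text \<open>The property \<open>colon\<close> in each coordinate; the coefficients found there are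
  collected into vectors.\<close>

lemma colon_Fr:
  assumes k: "k < e" and c: "\<And>i. i \<le> k \<Longrightarrow> c i \<in> Fm (Suc m) q"
    and s: "(\<Oplus>\<^bsub>Fr q\<^esub>i\<in>{..k}. x i \<odot>\<^bsub>Fr q\<^esub> c i) \<in> Fm (Suc N) q"
  obtains a r where "\<And>j. j < k \<Longrightarrow> a j \<in> Fm m q" "r \<in> Fm N q"
    "c k = (\<Oplus>\<^bsub>Fr q\<^esub>j\<in>{..<k}. x j \<odot>\<^bsub>Fr q\<^esub> a j) \<oplus>\<^bsub>Fr q\<^esub> r"
proof -
  interpret F: lmod R x e "Fr q" by (rule lmod_Fr)
  have fs: "(\<Oplus>\<^bsub>Fr q\<^esub>i\<in>A. f i) t = (\<Oplus>i\<in>A. f i t)" if "finite A" "\<And>i. i \<in> A \<Longrightarrow> f i \<in> Fc q" "t < q" for A :: "nat set" and f t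
    using that(1,2)
  proof (induction A)
    case empty then show ?case using that(3) by (simp add: Fr_simps)
  next
    case (insert i A)
    have 1: "f \<in> A \<rightarrow> Fc q" "f i \<in> Fc q" using insert.prems by auto
    have 2: "(\<lambda>i. f i t) \<in> A \<rightarrow> carrier R" "f i t \<in> carrier R" using 1 Fr_closed[OF _ that(3)] by auto
    show ?case using insert 1 2 that(3) F.M.finsum_insert[OF insert(1,2) 1] by (simp add: Fr_simps(2))
  qed
  have cc: "\<And>i. i \<le> k \<Longrightarrow> c i \<in> Fc q" using c Fm_Fc by blast
  have xc: "\<And>i. i \<le> k \<Longrightarrow> x i \<in> carrier R" using x_closed k by auto
  have "\<exists>a r. (\<forall>j<k. a j \<in> Ipow m) \<and> r \<in> Ipow N \<and> c k t = (\<Oplus>j\<in>{..<k}. x j \<otimes> a j) \<oplus> r" if t: "t < q" for t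
    unfolding Ipow_def
  proof (rule colon[OF k])
    show "c i t \<in> (mmul S1 x e ^^ Suc m) (carrier R)" if "i \<le> k" for i
      using c[OF that] t by (simp add: Fm_def pw_def Ipow_def)
    have "(\<Oplus>\<^bsub>Fr q\<^esub>i\<in>{..k}. x i \<odot>\<^bsub>Fr q\<^esub> c i) t = (\<Oplus>i\<in>{..k}. (x i \<odot>\<^bsub>Fr q\<^esub> c i) t)"
      by (rule fs) (use cc xc t in auto)
    also have "\<dots> = (\<Oplus>i\<in>{..k}. x i \<otimes> c i t)"
      by (rule finsum_cong') (use xc t m_closed[OF xc Fr_closed[OF cc t]] in \<open>auto simp: Fr_simps(3)\<close>)
    finally have "(\<Oplus>\<^bsub>Fr q\<^esub>i\<in>{..k}. x i \<odot>\<^bsub>Fr q\<^esub> c i) t = (\<Oplus>i\<in>{..k}. x i \<otimes> c i t)" .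
    moreover have "(\<Oplus>\<^bsub>Fr q\<^esub>i\<in>{..k}. x i \<odot>\<^bsub>Fr q\<^esub> c i) t \<in> Ipow (Suc N)"
      using s t unfolding Fm_def pw_def by blast
    ultimately show "(\<Oplus>i\<in>{..k}. x i \<otimes> c i t) \<in> (mmul S1 x e ^^ Suc N) (carrier R)"
      unfolding Ipow_def by (rule subst)
  qed
  then obtain a r where ar: "\<And>t j. t < q \<Longrightarrow> j < k \<Longrightarrow> a t j \<in> Ipow m" "\<And>t. t < q \<Longrightarrow> r t \<in> Ipow N"
      "\<And>t. t < q \<Longrightarrow> c k t = (\<Oplus>j\<in>{..<k}. x j \<otimes> a t j) \<oplus> r t" by metis
  define a' where "a' = (\<lambda>j. \<lambda>t\<in>{..<q}. a t j)"
  define r' where "r' = restrict r {..<q}"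
  have a': "a' j \<in> Fm m q" if "j < k" for j
    using ar(1) that idlD(1)[OF Ipow_idl[of m]] by (auto simp: a'_def Fm_def pw_def Fr_simps)
  have r': "r' \<in> Fm N q"
    using ar(2) idlD(1)[OF Ipow_idl[of N]] by (auto simp: r'_def Fm_def pw_def Fr_simps)
  have ac: "a' j \<in> Fc q" if "j < k" for j using a'[OF that] Fm_Fc by blast
  have rc: "r' \<in> Fc q" using r' Fm_Fc by blast
  have sc: "(\<Oplus>\<^bsub>Fr q\<^esub>j\<in>{..<k}. x j \<odot>\<^bsub>Fr q\<^esub> a' j) \<in> Fc q"
    by (rule F.M.finsum_closed) (use ac xc in auto)
  have "c k = (\<Oplus>\<^bsub>Fr q\<^esub>j\<in>{..<k}. x j \<odot>\<^bsub>Fr q\<^esub> a' j) \<oplus>\<^bsub>Fr q\<^esub> r'"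
  proof (rule Fr_eqI[OF cc[OF order_refl] F.M.add.m_closed[OF sc rc]])
    fix t assume t: "t < q"
    have "(\<Oplus>\<^bsub>Fr q\<^esub>j\<in>{..<k}. x j \<odot>\<^bsub>Fr q\<^esub> a' j) t = (\<Oplus>j\<in>{..<k}. (x j \<odot>\<^bsub>Fr q\<^esub> a' j) t)"
      by (rule fs) (use ac xc t in auto)
    also have "\<dots> = (\<Oplus>j\<in>{..<k}. x j \<otimes> a t j)"
      by (rule finsum_cong') (use xc t m_closed[OF xc subsetD[OF idlD(1)[OF Ipow_idl[of m]] ar(1)[OF t]]] in \<open>auto simp: Fr_simps(3) a'_def\<close>)
    finally show "c k t = ((\<Oplus>\<^bsub>Fr q\<^esub>j\<in>{..<k}. x j \<odot>\<^bsub>Fr q\<^esub> a' j) \<oplus>\<^bsub>Fr q\<^esub> r') t"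
      using ar(3)[OF t] t by (simp add: Fr_simps(2) r'_def)
  qed
  with that a' r' show ?thesis by blast
qed

end

text \<open>A minimal presentation matrix \<open>\<phi>\<close> whose image contains \<open>m\<^bsup>n - 1\<^esup> F\<close> modulo \<open>m\<^bsup>n\<^esup> F\<close>, with \<open>n = Suc m\<close>.\<close>
locale kmat = kosz +
  fixes p q m :: nat and \<phi> :: "(nat \<Rightarrow> 'a) \<Rightarrow> (nat \<Rightarrow> 'a)"
  assumes phi: "lin R (Fr p) (Fc p) (Fr q) (Fc q) \<phi>"
    and phi_min: "\<phi> ` Fc p \<subseteq> mmul (Fr q) x e (Fc q)"
    and phi_big: "Fm m q \<subseteq> (\<phi> ` Fc p) <+>\<^bsub>Fr q\<^esub> Fm (Suc m) q"
begin

sublocale F: lmod R x e "Fr p" by (rule lmod_Fr)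
sublocale G: lmod R x e "Fr q" by (rule lmod_Fr)
sublocale P: slin R x e "Fr p" R x "Fr q" "\<lambda>r. r" \<phi> "Fc p"
  by (rule F.slin_lin[OF lmod_Fr F.sub_carrier phi subset_refl])

text \<open>The kernel of \<phi> modulo order N. \<open>Zn (Suc m)\<close> corresponds to the
  syzygies over the truncated ring, while \<open>Zn N\<close> for large N stands in for the kernel
  of \<phi> itself.\<close>

definition Zn :: "nat \<Rightarrow> (nat \<Rightarrow> 'a) set" where "Zn N = {z \<in> Fc p. \<phi> z \<in> Fm N q}"

lemma Zn_sub: "F.sub (Zn N)"
  unfolding Zn_def by (rule P.sub_vimage[OF Fm_sub])

lemma Zn_antimono: "i \<le> j \<Longrightarrow> Zn j \<subseteq> Zn i"
  unfolding Zn_def using Fm_antimono[of i j q] by blast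

lemma phi_Fm: "\<phi> ` Fm i p = (G.mm ^^ i) (\<phi> ` Fc p)"
  unfolding Fm_eq by (rule F.image_mmk[OF lmod_Fr F.sub_carrier phi subset_refl])

lemma phi_Fm_sub: "G.sub (\<phi> ` Fm i p)"
  by (rule P.sub_image[OF Fm_sub Fm_Fc])

lemma phi_Fm_Suc: "\<phi> ` Fm i p \<subseteq> Fm (Suc i) q"
proof -
  have "\<phi> ` Fm i p \<subseteq> (G.mm ^^ i) (G.mm (Fc q))" unfolding phi_Fm by (rule G.mmk_mono[OF phi_min])
  also have "\<dots> = Fm (Suc i) q" unfolding Fm_eq using funpow_Suc_right[of i "G.mm"] by simp
  finally show ?thesis .
qed

lemma phi_Fm_antimono: "i \<le> j \<Longrightarrow> \<phi> ` Fm j p \<subseteq> \<phi> ` Fm i p"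
  by (rule image_mono[OF Fm_antimono])

text \<open>The hypothesis \<open>phi_big\<close>, multiplied i times by the ideal of the
  variables.\<close>

lemma approx1: "Fm (m + i) q \<subseteq> \<phi> ` Fm i p <+>\<^bsub>Fr q\<^esub> Fm (Suc (m + i)) q"
proof (induction i)
  case 0 then show ?case using phi_big by (simp add: Fm_0)
next
  case (Suc i)
  have "Fm (m + Suc i) q = G.mm (Fm (m + i) q)" by (simp add: mm_Fm)
  also have "\<dots> \<subseteq> G.mm (\<phi> ` Fm i p <+>\<^bsub>Fr q\<^esub> Fm (Suc (m + i)) q)" by (rule G.mm_mono[OF Suc])
  also have "\<dots> = G.mm (\<phi> ` Fm i p) <+>\<^bsub>Fr q\<^esub> G.mm (Fm (Suc (m + i)) q)" by (rule G.mm_add[OF phi_Fm_sub Fm_sub])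
  also have "\<dots> = \<phi> ` Fm (Suc i) p <+>\<^bsub>Fr q\<^esub> Fm (Suc (m + Suc i)) q"
    using P.image_mm[OF Fm_sub Fm_Fc, of i] by (simp add: mm_Fm)
  finally show ?case .
qed

text \<open>The error term in \<open>approx1\<close> is itself covered by the image of \<phi> up to
  the next order, so it can be pushed to any prescribed order.\<close>

lemma approx: "Fm (m + i) q \<subseteq> \<phi> ` Fm i p <+>\<^bsub>Fr q\<^esub> Fm (m + i + k) q"
proof (induction k)
  case 0 then show ?case using G.add_upper2[OF phi_Fm_sub Fm_sub] by simp
next
  case (Suc k)
  let ?T = "\<phi> ` Fm i p <+>\<^bsub>Fr q\<^esub> Fm (m + i + Suc k) q"
  have T: "G.sub ?T" by (rule G.sub_add[OF phi_Fm_sub Fm_sub])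
  have 1: "\<phi> ` Fm i p \<subseteq> ?T" by (rule G.add_upper1[OF phi_Fm_sub Fm_sub])
  have "Fm (m + (i + k)) q \<subseteq> \<phi> ` Fm (i + k) p <+>\<^bsub>Fr q\<^esub> Fm (Suc (m + (i + k))) q" by (rule approx1)
  also have "\<dots> \<subseteq> ?T"
  proof (rule G.add_least[OF T])
    show "\<phi> ` Fm (i + k) p \<subseteq> ?T" using phi_Fm_antimono[of i "i + k"] 1 by auto
    show "Fm (Suc (m + (i + k))) q \<subseteq> ?T" using G.add_upper2[OF phi_Fm_sub[of i] Fm_sub[of "m + i + Suc k" q]]
      by (simp add: add.assoc)
  qed
  finally have "Fm (m + i + k) q \<subseteq> ?T" by (simp add: add.assoc)
  then have "\<phi> ` Fm i p <+>\<^bsub>Fr q\<^esub> Fm (m + i + k) q \<subseteq> ?T" by (rule G.add_least[OF T 1])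
  then show ?case using Suc by blast
qed

lemma approx_obtain:
  assumes "t \<in> Fm (m + i) q" obtains u v where "u \<in> Fm i p" "v \<in> Fm (m + i + k) q" "t = \<phi> u \<oplus>\<^bsub>Fr q\<^esub> v"
  using subsetD[OF approx assms, of k] unfolding G.mem_add by blast

text \<open>An element of \<open>K \<inter> mZ\<close>, where \<open>Z = Zn (m + 1)\<close> and \<open>K = Zn (m + 1 + d)\<close>, lies in \<open>mK\<close> up to
  high order: the relation among the variables is removed one variable at a time.\<close>
lemma koszul_step:
  assumes "k \<le> e" "\<And>i. i < k \<Longrightarrow> z i \<in> Zn (Suc m)"
    "\<phi> (\<Oplus>\<^bsub>Fr p\<^esub>i\<in>{..<k}. x i \<odot>\<^bsub>Fr p\<^esub> z i) \<in> Fm (Suc (m + d)) q"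
  shows "(\<Oplus>\<^bsub>Fr p\<^esub>i\<in>{..<k}. x i \<odot>\<^bsub>Fr p\<^esub> z i) \<in> F.mm (Zn (Suc (m + d))) <+>\<^bsub>Fr p\<^esub> Fm (Suc d) p"
  using assms
proof (induction k arbitrary: z)
  case 0
  have "F.sub (F.mm (Zn (Suc (m + d))) <+>\<^bsub>Fr p\<^esub> Fm (Suc d) p)"
    by (rule F.sub_add[OF F.mm_sub[OF Zn_sub] Fm_sub])
  then show ?case using F.subD(3) by simp
next
  case (Suc k)
  let ?K = "Zn (Suc (m + d))"
  let ?W = "F.mm ?K <+>\<^bsub>Fr p\<^esub> Fm (Suc d) p"
  have W: "F.sub ?W" by (rule F.sub_add[OF F.mm_sub[OF Zn_sub] Fm_sub])
  have ke: "k < e" using Suc.prems(1) by simp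
  have zc: "z i \<in> Fc p" "\<phi> (z i) \<in> Fm (Suc m) q" if "i < Suc k" for i using Suc.prems(2)[OF that] by (auto simp: Zn_def)
  have xc: "x i \<in> carrier R" if "i < Suc k" for i using x_closed that ke by simp
  have xzc: "x i \<odot>\<^bsub>Fr p\<^esub> z i \<in> Fc p" if "i < Suc k" for i using zc xc that by simp
  have "\<phi> (\<Oplus>\<^bsub>Fr p\<^esub>i\<in>{..<Suc k}. x i \<odot>\<^bsub>Fr p\<^esub> z i) = (\<Oplus>\<^bsub>Fr q\<^esub>i\<in>{..<Suc k}. \<phi> (x i \<odot>\<^bsub>Fr p\<^esub> z i))"
    by (rule P.a_finsum) (use xzc in auto)
  also have "\<dots> = (\<Oplus>\<^bsub>Fr q\<^esub>i\<in>{..k}. x i \<odot>\<^bsub>Fr q\<^esub> \<phi> (z i))"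
    unfolding lessThan_Suc_atMost by (rule G.M.finsum_cong') (use zc xc P.a_smult P.a_closed in auto)
  finally have s: "(\<Oplus>\<^bsub>Fr q\<^esub>i\<in>{..k}. x i \<odot>\<^bsub>Fr q\<^esub> \<phi> (z i)) \<in> Fm (Suc (m + d)) q" using Suc.prems(3) by simp
  \<comment> \<open>The image of the last coefficient is a combination of the earlier variables with
    coefficients of order m, plus a term of order m + d.\<close>
  obtain a r where ar: "\<And>j. j < k \<Longrightarrow> a j \<in> Fm m q" "r \<in> Fm (m + d) q"
    "\<phi> (z k) = (\<Oplus>\<^bsub>Fr q\<^esub>j\<in>{..<k}. x j \<odot>\<^bsub>Fr q\<^esub> a j) \<oplus>\<^bsub>Fr q\<^esub> r"
    by (rule colon_Fr[OF ke _ s]) (use zc in auto)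
  \<comment> \<open>Order m is exactly what lets the \<open>a j\<close> be written as images
    \<open>\<phi> (y j)\<close> up to order m + d + 1. In the same way r is, up to that order, the
    image of some u of order d.\<close>
  have "\<exists>u v. u \<in> Fm 0 p \<and> v \<in> Fm (m + 0 + Suc d) q \<and> a j = \<phi> u \<oplus>\<^bsub>Fr q\<^esub> v" if "j < k" for j
  proof -
    have "a j \<in> Fm (m + 0) q" using ar(1)[OF that] by simp
    then show ?thesis by (rule approx_obtain[of _ 0 "Suc d"]) blast
  qed
  then obtain y t where yt: "\<And>j. j < k \<Longrightarrow> y j \<in> Fc p" "\<And>j. j < k \<Longrightarrow> t j \<in> Fm (Suc (m + d)) q"
      "\<And>j. j < k \<Longrightarrow> a j = \<phi> (y j) \<oplus>\<^bsub>Fr q\<^esub> t j" unfolding Fm_0 by (simp, metis)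
  obtain u w where uw: "u \<in> Fm d p" "w \<in> Fm (m + d + 1) q" "r = \<phi> u \<oplus>\<^bsub>Fr q\<^esub> w" by (rule approx_obtain[OF ar(2)])
  have uc: "u \<in> Fc p" "w \<in> Fc q" using uw Fm_Fc by blast+
  have tc: "t j \<in> Fc q" "a j \<in> Fc q" if "j < k" for j using yt(2)[OF that] ar(1)[OF that] Fm_Fc by blast+
  have phc: "\<phi> v \<in> Fc q" if "v \<in> Fc p" for v using P.a_closed[OF that] .
  define Y where "Y = (\<Oplus>\<^bsub>Fr p\<^esub>j\<in>{..<k}. x j \<odot>\<^bsub>Fr p\<^esub> y j)"
  have Yc: "Y \<in> Fc p" unfolding Y_def by (rule F.M.finsum_closed) (use yt xc in auto)
  \<comment> \<open>What is left of \<open>z k\<close> after removal of the combination Y and of u.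
    Its image has order m + d + 1, so it lies in K.\<close>
  define z' where "z' = z k \<ominus>\<^bsub>Fr p\<^esub> (Y \<oplus>\<^bsub>Fr p\<^esub> u)"
  have z'c: "z' \<in> Fc p" unfolding z'_def using zc(1)[of k] Yc uc by simp
  define T where "T = (\<Oplus>\<^bsub>Fr q\<^esub>j\<in>{..<k}. x j \<odot>\<^bsub>Fr q\<^esub> t j)"
  have T: "T \<in> Fm (Suc (m + d)) q"
    unfolding T_def by (rule G.sub_finsum[OF Fm_sub]) (use yt(2) xc G.subD(5)[OF Fm_sub] in auto)
  have Tc: "T \<in> Fc q" using T Fm_Fc by blast
  have phY: "\<phi> Y = (\<Oplus>\<^bsub>Fr q\<^esub>j\<in>{..<k}. x j \<odot>\<^bsub>Fr q\<^esub> \<phi> (y j))"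
  proof -
    have "\<phi> Y = (\<Oplus>\<^bsub>Fr q\<^esub>j\<in>{..<k}. \<phi> (x j \<odot>\<^bsub>Fr p\<^esub> y j))"
      unfolding Y_def by (rule P.a_finsum) (use yt xc in auto)
    also have "\<dots> = (\<Oplus>\<^bsub>Fr q\<^esub>j\<in>{..<k}. x j \<odot>\<^bsub>Fr q\<^esub> \<phi> (y j))"
      by (rule G.M.finsum_cong') (use yt xc P.a_smult phc in auto)
    finally show ?thesis .
  qed
  have "(\<Oplus>\<^bsub>Fr q\<^esub>j\<in>{..<k}. x j \<odot>\<^bsub>Fr q\<^esub> a j) = (\<Oplus>\<^bsub>Fr q\<^esub>j\<in>{..<k}. x j \<odot>\<^bsub>Fr q\<^esub> \<phi> (y j) \<oplus>\<^bsub>Fr q\<^esub> x j \<odot>\<^bsub>Fr q\<^esub> t j)"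
    by (rule G.M.finsum_cong') (use yt tc xc phc in \<open>auto simp: G.smult_r_distr\<close>)
  also have "\<dots> = \<phi> Y \<oplus>\<^bsub>Fr q\<^esub> T"
    unfolding phY T_def by (rule G.M.finsum_addf) (use yt tc xc phc in auto)
  finally have phzk: "\<phi> (z k) = (\<phi> Y \<oplus>\<^bsub>Fr q\<^esub> T) \<oplus>\<^bsub>Fr q\<^esub> (\<phi> u \<oplus>\<^bsub>Fr q\<^esub> w)" using ar(3) uw(3) by simp
  have zk: "z k = (Y \<oplus>\<^bsub>Fr p\<^esub> u) \<oplus>\<^bsub>Fr p\<^esub> z'"
    unfolding z'_def using F.add_minus[of "Y \<oplus>\<^bsub>Fr p\<^esub> u" "z k"] zc(1)[of k] Yc uc by simp
  have "\<phi> (z k) = (\<phi> Y \<oplus>\<^bsub>Fr q\<^esub> \<phi> u) \<oplus>\<^bsub>Fr q\<^esub> \<phi> z'"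
    unfolding zk using P.a_add Yc uc z'c by simp
  with phzk have "(\<phi> Y \<oplus>\<^bsub>Fr q\<^esub> \<phi> u) \<oplus>\<^bsub>Fr q\<^esub> \<phi> z' = (\<phi> Y \<oplus>\<^bsub>Fr q\<^esub> \<phi> u) \<oplus>\<^bsub>Fr q\<^esub> (T \<oplus>\<^bsub>Fr q\<^esub> w)"
    using G.add_add_swap(2)[OF phc[OF Yc] Tc phc[OF uc(1)] uc(2)] by metis
  then have "\<phi> z' = T \<oplus>\<^bsub>Fr q\<^esub> w"
    by (rule G.add_left_imp_eq) (use phc Yc uc z'c Tc in \<open>simp_all\<close>)
  then have "\<phi> z' \<in> Fm (Suc (m + d)) q" using G.subD(4)[OF Fm_sub T] uw(2) by simp
  then have z'K: "z' \<in> ?K" using z'c by (simp add: Zn_def)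
  \<comment> \<open>The product of \<open>x k\<close> and Y is redistributed: its summand with
    factor \<open>x i\<close> is charged to the coefficient of \<open>x i\<close>. The new
    coefficients still have images of order m + 1, since \<open>\<phi> (y i)\<close> has order
    m.\<close>
  define b where "b = (\<lambda>i. z i \<oplus>\<^bsub>Fr p\<^esub> x k \<odot>\<^bsub>Fr p\<^esub> y i)"
  have xk: "x k \<in> carrier R" using xc by simp
  have bZ: "b i \<in> Zn (Suc m)" if i: "i < k" for i
  proof -
    have "\<phi> (y i) \<oplus>\<^bsub>Fr q\<^esub> t i \<in> Fm m q" using ar(1)[OF i] yt(3)[OF i] by simp
    then have "t i \<oplus>\<^bsub>Fr q\<^esub> \<phi> (y i) \<in> Fm m q" using G.M.a_comm tc[OF i] phc[OF yt(1)[OF i]] by metis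
    moreover have "t i \<in> Fm m q" using yt(2)[OF i] Fm_antimono[of m "Suc (m + d)" q] by auto
    ultimately have "\<phi> (y i) \<in> Fm m q" using G.sub_add_cancel[OF Fm_sub] phc[OF yt(1)[OF i]] by metis
    then have "x k \<odot>\<^bsub>Fr q\<^esub> \<phi> (y i) \<in> Fm (Suc m) q" using Fm_smult ke by blast
    then have "\<phi> (z i) \<oplus>\<^bsub>Fr q\<^esub> x k \<odot>\<^bsub>Fr q\<^esub> \<phi> (y i) \<in> Fm (Suc m) q"
      using G.subD(4)[OF Fm_sub] zc(2)[of i] i by simp
    moreover have "\<phi> (b i) = \<phi> (z i) \<oplus>\<^bsub>Fr q\<^esub> x k \<odot>\<^bsub>Fr q\<^esub> \<phi> (y i)"
      unfolding b_def using P.a_add P.a_smult zc(1)[of i] yt(1)[OF i] xk i by simp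
    ultimately show ?thesis using zc(1)[of i] yt(1)[OF i] xk i by (simp add: Zn_def b_def)
  qed
  have bc: "b i \<in> Fc p" if "i < k" for i using bZ[OF that] by (simp add: Zn_def)
  define B where "B = (\<Oplus>\<^bsub>Fr p\<^esub>i\<in>{..<k}. x i \<odot>\<^bsub>Fr p\<^esub> b i)"
  have Bc: "B \<in> Fc p" unfolding B_def by (rule F.M.finsum_closed) (use bc xc in auto)
  define S where "S = (\<Oplus>\<^bsub>Fr p\<^esub>i\<in>{..<k}. x i \<odot>\<^bsub>Fr p\<^esub> z i)"
  have Sc: "S \<in> Fc p" unfolding S_def by (rule F.M.finsum_closed) (use xzc in auto)
  have "B = (\<Oplus>\<^bsub>Fr p\<^esub>i\<in>{..<k}. x i \<odot>\<^bsub>Fr p\<^esub> z i \<oplus>\<^bsub>Fr p\<^esub> x k \<odot>\<^bsub>Fr p\<^esub> (x i \<odot>\<^bsub>Fr p\<^esub> y i))"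
    unfolding B_def
  proof (rule F.M.finsum_cong')
    fix i assume "i \<in> {..<k}"
    then have i: "i < k" by simp
    have "x i \<odot>\<^bsub>Fr p\<^esub> (x k \<odot>\<^bsub>Fr p\<^esub> y i) = x k \<odot>\<^bsub>Fr p\<^esub> (x i \<odot>\<^bsub>Fr p\<^esub> y i)"
      using F.smult_assoc1[OF xc[of i] xk yt(1)[OF i]] F.smult_assoc1[OF xk xc[of i] yt(1)[OF i]] m_comm[OF xk xc[of i]] i by simp
    then show "x i \<odot>\<^bsub>Fr p\<^esub> b i = x i \<odot>\<^bsub>Fr p\<^esub> z i \<oplus>\<^bsub>Fr p\<^esub> x k \<odot>\<^bsub>Fr p\<^esub> (x i \<odot>\<^bsub>Fr p\<^esub> y i)"
      unfolding b_def using F.smult_r_distr[OF xc[of i] zc(1)[of i] F.smult_closed[OF xk yt(1)[OF i]]] i by simp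
  qed (use xzc yt(1) xc xk in auto)
  also have "\<dots> = S \<oplus>\<^bsub>Fr p\<^esub> x k \<odot>\<^bsub>Fr p\<^esub> Y"
    unfolding S_def Y_def using F.finsum_smult_ldistr[of "{..<k}" "x k" "\<lambda>i. x i \<odot>\<^bsub>Fr p\<^esub> y i"] xk yt(1) xc xzc
    by (subst F.M.finsum_addf) auto
  finally have B: "B = S \<oplus>\<^bsub>Fr p\<^esub> x k \<odot>\<^bsub>Fr p\<^esub> Y" .
  \<comment> \<open>The final contribution of the variable \<open>x k\<close>: its multiple of z' is
    a variable times an element of K, and its multiple of u has order d + 1.\<close>
  define E where "E = x k \<odot>\<^bsub>Fr p\<^esub> z' \<oplus>\<^bsub>Fr p\<^esub> x k \<odot>\<^bsub>Fr p\<^esub> u"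
  have Ec: "E \<in> Fc p" unfolding E_def using xk z'c uc by simp
  have tot: "(\<Oplus>\<^bsub>Fr p\<^esub>i\<in>{..<Suc k}. x i \<odot>\<^bsub>Fr p\<^esub> z i) = E \<oplus>\<^bsub>Fr p\<^esub> B"
  proof -
    have "(\<Oplus>\<^bsub>Fr p\<^esub>i\<in>{..<Suc k}. x i \<odot>\<^bsub>Fr p\<^esub> z i) = x k \<odot>\<^bsub>Fr p\<^esub> z k \<oplus>\<^bsub>Fr p\<^esub> S"
      unfolding S_def lessThan_Suc by (rule F.M.finsum_insert) (use xzc in auto)
    also have "x k \<odot>\<^bsub>Fr p\<^esub> z k = (x k \<odot>\<^bsub>Fr p\<^esub> Y \<oplus>\<^bsub>Fr p\<^esub> x k \<odot>\<^bsub>Fr p\<^esub> u) \<oplus>\<^bsub>Fr p\<^esub> x k \<odot>\<^bsub>Fr p\<^esub> z'"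
      unfolding zk using xk Yc uc z'c by (simp add: F.smult_r_distr)
    also have "\<dots> \<oplus>\<^bsub>Fr p\<^esub> S = E \<oplus>\<^bsub>Fr p\<^esub> B" unfolding B E_def
      by (rule F.add_add_swap(1)[OF F.smult_closed[OF xk Yc] F.smult_closed[OF xk uc(1)] F.smult_closed[OF xk z'c] Sc])
    finally show ?thesis .
  qed
  \<comment> \<open>This is needed so that the remaining sum B meets the hypothesis of the
    induction. That \<open>\<phi> u\<close> has order m + d comes from r, not from the order of
    u.\<close>
  have phE: "\<phi> E \<in> Fm (Suc (m + d)) q"
  proof -
    have "\<phi> u \<in> Fm (Suc d) q" using phi_Fm_Suc uw(1) by blast
    have "\<phi> u \<oplus>\<^bsub>Fr q\<^esub> w \<in> Fm (m + d) q" using ar(2) uw(3) by simp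
    then have "w \<oplus>\<^bsub>Fr q\<^esub> \<phi> u \<in> Fm (m + d) q" using G.M.a_comm uc phc by metis
    moreover have "w \<in> Fm (m + d) q" using uw(2) Fm_antimono[of "m + d" "m + d + 1" q] by auto
    ultimately have "\<phi> u \<in> Fm (m + d) q" using G.sub_add_cancel[OF Fm_sub] phc[OF uc(1)] by metis
    then have 1: "x k \<odot>\<^bsub>Fr q\<^esub> \<phi> u \<in> Fm (Suc (m + d)) q" using Fm_smult ke by blast
    have 2: "x k \<odot>\<^bsub>Fr q\<^esub> \<phi> z' \<in> Fm (Suc (m + d)) q" using G.subD(5)[OF Fm_sub xk] z'K by (simp add: Zn_def)
    have "\<phi> E = x k \<odot>\<^bsub>Fr q\<^esub> \<phi> z' \<oplus>\<^bsub>Fr q\<^esub> x k \<odot>\<^bsub>Fr q\<^esub> \<phi> u"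
      unfolding E_def using P.a_add P.a_smult xk z'c uc by simp
    then show ?thesis using G.subD(4)[OF Fm_sub 2 1] by simp
  qed
  have "\<phi> E \<oplus>\<^bsub>Fr q\<^esub> \<phi> B \<in> Fm (Suc (m + d)) q"
    using Suc.prems(3) P.a_add[OF Ec Bc] unfolding tot by simp
  then have "\<phi> B \<in> Fm (Suc (m + d)) q" by (rule G.sub_add_cancel[OF Fm_sub phE _ phc[OF Bc]])
  then have BW: "B \<in> ?W" unfolding B_def by (intro Suc.IH bZ) (use ke in simp_all)
  have "x k \<odot>\<^bsub>Fr p\<^esub> z' \<in> F.mm ?K" by (rule F.mm_gen[OF Zn_sub ke z'K])
  moreover have "x k \<odot>\<^bsub>Fr p\<^esub> u \<in> Fm (Suc d) p" by (rule Fm_smult[OF ke uw(1)])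
  ultimately have "E \<in> ?W" unfolding E_def F.mem_add by blast
  then show ?case unfolding tot by (rule F.subD(4)[OF W _ BW])
qed

lemma Zn_mm: "F.mm (Zn (Suc m)) \<subseteq> Zn (Suc (Suc m))"
proof (rule F.mm_least[OF Zn_sub])
  fix i u assume i: "i < e" and u: "u \<in> Zn (Suc m)"
  then have "\<phi> (x i \<odot>\<^bsub>Fr p\<^esub> u) = x i \<odot>\<^bsub>Fr q\<^esub> \<phi> u" using P.a_smult x_closed by (simp add: Zn_def)
  then show "x i \<odot>\<^bsub>Fr p\<^esub> u \<in> Zn (Suc (Suc m))"
    using u i x_closed Fm_smult[OF i] by (simp add: Zn_def)
qed

lemma Fm_Zn: "Fm i p \<subseteq> Zn (Suc i)"
  using phi_Fm_Suc[of i] Fm_Fc[of i p] by (auto simp: Zn_def)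

text \<open>The purpose: generators of K stay independent in Z modulo multiples of Z by variables,
  up to order d + 1. It is \<open>koszul_step\<close> for all e variables.\<close>

lemma K_mZ: "Zn (Suc (m + d)) \<inter> F.mm (Zn (Suc m)) \<subseteq> F.mm (Zn (Suc (m + d))) <+>\<^bsub>Fr p\<^esub> Fm (Suc d) p"
proof
  fix w assume w: "w \<in> Zn (Suc (m + d)) \<inter> F.mm (Zn (Suc m))"
  then obtain z where z: "z \<in> {..<e} \<rightarrow> Zn (Suc m)" "w = (\<Oplus>\<^bsub>Fr p\<^esub>i\<in>{..<e}. x i \<odot>\<^bsub>Fr p\<^esub> z i)"
    unfolding mmul_def by blast
  show "w \<in> F.mm (Zn (Suc (m + d))) <+>\<^bsub>Fr p\<^esub> Fm (Suc d) p"
    unfolding z(2) by (rule koszul_step) (use z w in \<open>auto simp: Zn_def\<close>)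
qed

text \<open>A truncated form of the fact that a map from rank p to rank q has a kernel with at least
  p - q generators. Modulo order d + 1, K is generated by c elements, which bounds its length by
  \<open>c * ell (Suc d)\<close>. What K leaves of the free module of rank p embeds through \<phi>
  into the free module of rank q modulo order m + d + 1.\<close>

lemma generators_bound:
  assumes c: "F.len (F.mm (Zn (Suc (m + d))) <+>\<^bsub>Fr p\<^esub> Fm (Suc d) p) (Zn (Suc (m + d)) <+>\<^bsub>Fr p\<^esub> Fm (Suc d) p) c"
  shows "p * ell (Suc d) \<le> c * ell (Suc d) + q * ell (Suc (m + d))"
proof -
  let ?K = "Zn (Suc (m + d))" and ?E = "Fm (Suc d) p"
  let ?T = "?K <+>\<^bsub>Fr p\<^esub> ?E"
  have T: "F.sub ?T" by (rule F.sub_add[OF Zn_sub Fm_sub])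
  interpret H: lmod R x e "Fr c" by (rule lmod_Fr)
  obtain v where v: "\<And>i. i < c \<Longrightarrow> v i \<in> ?T" "?T \<subseteq> (F.mm ?K <+>\<^bsub>Fr p\<^esub> ?E) <+>\<^bsub>Fr p\<^esub> F.comb c v ` Fc c"
    by (rule F.len_generators[OF c]) blast
  have vl: "lin R (Fr c) (Fc c) (Fr p) ?T (F.comb c v)" by (rule F.comb_lin[OF T v(1)])
  interpret V: slin R x e "Fr c" R x "Fr p" "\<lambda>r. r" "F.comb c v" "Fc c"
    by (rule H.slin_lin[OF lmod_Fr H.sub_carrier vl F.subD(1)[OF T]])
  have C: "F.sub (F.comb c v ` Fc c)" by (rule V.sub_image[OF H.sub_carrier subset_refl])
  let ?S = "?E <+>\<^bsub>Fr p\<^esub> F.comb c v ` Fc c"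
  have S: "F.sub ?S" by (rule F.sub_add[OF Fm_sub C])
  have TS: "?T \<subseteq> ?S"
  \<comment> \<open>Nakayama applies although the ring is not local, since S contains all vectors of
    order d + 1.\<close>
  proof (rule F.nakayama[OF S T])
    have mT: "F.sub (F.mm ?T)" by (rule F.mm_sub[OF T])
    have SM: "F.sub (?S <+>\<^bsub>Fr p\<^esub> F.mm ?T)" by (rule F.sub_add[OF S mT])
    have 1: "?S \<subseteq> ?S <+>\<^bsub>Fr p\<^esub> F.mm ?T" "F.mm ?T \<subseteq> ?S <+>\<^bsub>Fr p\<^esub> F.mm ?T"
      by (rule F.add_upper1[OF S mT], rule F.add_upper2[OF S mT])
    have 2: "?E \<subseteq> ?S" "F.comb c v ` Fc c \<subseteq> ?S"
      by (rule F.add_upper1[OF Fm_sub C], rule F.add_upper2[OF Fm_sub C])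
    have 3: "F.mm ?K \<subseteq> F.mm ?T" by (rule F.mm_mono[OF F.add_upper1[OF Zn_sub Fm_sub]])
    have "(F.mm ?K <+>\<^bsub>Fr p\<^esub> ?E) <+>\<^bsub>Fr p\<^esub> F.comb c v ` Fc c \<subseteq> ?S <+>\<^bsub>Fr p\<^esub> F.mm ?T"
      by (intro F.add_least[OF SM] subset_trans[OF 3 1(2)] subset_trans[OF 2(1) 1(1)] subset_trans[OF 2(2) 1(1)])
    then show "?T \<subseteq> ?S <+>\<^bsub>Fr p\<^esub> F.mm ?T" using v(2) by (rule subset_trans[rotated])
    have "(F.mm ^^ Suc d) ?T \<subseteq> (F.mm ^^ Suc d) (Fc p)" by (rule F.mmk_mono[OF F.subD(1)[OF T]])
    also have "\<dots> = ?E" by (rule Fm_eq[symmetric])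
    finally show "(F.mm ^^ Suc d) ?T \<subseteq> ?S" using 2(1) by (rule subset_trans)
  qed
  have vi: "F.sub ?E" by (rule Fm_sub)
  let ?V = "{u \<in> Fc c. F.comb c v u \<in> ?E}"
  have Vs: "H.sub ?V" by (rule V.sub_vimage[OF vi])
  have FV: "Fm (Suc d) c \<subseteq> ?V"
  proof -
    have "F.comb c v ` Fm (Suc d) c = (F.mm ^^ Suc d) (F.comb c v ` Fc c)"
      unfolding Fm_eq by (rule H.image_mmk[OF lmod_Fr H.sub_carrier vl F.subD(1)[OF T]])
    also have "\<dots> \<subseteq> ?E" unfolding Fm_eq by (rule F.mmk_mono[OF F.subD(1)[OF C]])
    finally show ?thesis using Fm_Fc[of "Suc d" c] by blast
  qed
  obtain k' where k': "H.len ?V (Fc c) k'"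
    using H.len_sub_ex[OF len_Fm_top Vs H.sub_carrier FV H.subD(1)[OF Vs] subset_refl] by blast
  have k'le: "k' \<le> c * ell (Suc d)" by (rule H.len_mono[OF len_Fm_top k' FV subset_refl])
  have lT: "F.len ?E ?T k'"
  proof (rule V.len_hom[OF k' subset_refl refl vi F.add_upper2[OF Zn_sub Fm_sub] T])
    show "F.comb c v ` Fc c \<subseteq> ?T" using linD(1)[OF vl] by blast
    fix t assume "t \<in> ?T"
    then have "t \<in> ?S" using TS by blast
    then obtain e1 u where "e1 \<in> ?E" "u \<in> Fc c" "t = e1 \<oplus>\<^bsub>Fr p\<^esub> F.comb c v u" unfolding F.mem_add by blast
    moreover then have "t = F.comb c v u \<oplus>\<^bsub>Fr p\<^esub> e1"
      using F.M.a_comm[OF F.subD(2)[OF vi] V.a_closed] by simp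
    ultimately show "\<exists>u\<in>Fc c. \<exists>v'\<in>?E. t = F.comb c v u \<oplus>\<^bsub>Fr p\<^esub> v'" by blast
  qed
  have ET: "?E \<subseteq> ?T" by (rule F.add_upper2[OF Zn_sub Fm_sub])
  obtain s1 s2 where s: "s1 + s2 = p * ell (Suc d)" "F.len ?E ?T s1" "F.len ?T (Fc p) s2"
    using F.len_mid[OF len_Fm_top T ET F.subD(1)[OF T]] by (elim exE conjE)
  have "s1 = k'" by (rule F.len_unique[OF s(2) lT])
  have KK: "Fm (Suc (m + d)) p \<subseteq> ?K" using Fm_Zn[of "Suc (m + d)"] Zn_antimono[of "Suc (m + d)" "Suc (Suc (m + d))"] by auto
  obtain k where k: "F.len ?K (Fc p) k"
    using F.len_sub_ex[OF len_Fm_top Zn_sub F.sub_carrier KK F.subD(1)[OF Zn_sub] subset_refl] by blast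
  have "s2 \<le> k" by (rule F.len_mono[OF k s(3) F.add_upper1[OF Zn_sub Fm_sub] subset_refl])
  moreover have "k \<le> q * ell (Suc (m + d))"
  proof -
    have "G.len (Fm (Suc (m + d)) q) (\<phi> ` Fc p <+>\<^bsub>Fr q\<^esub> Fm (Suc (m + d)) q) k"
      by (rule P.len_image[OF Fm_sub k[unfolded Zn_def] subset_refl])
    moreover have "\<phi> ` Fc p <+>\<^bsub>Fr q\<^esub> Fm (Suc (m + d)) q \<subseteq> Fc q"
      by (rule G.add_least[OF G.sub_carrier _ Fm_Fc]) (use P.a_closed in blast)
    ultimately show ?thesis by (rule G.len_mono[OF len_Fm_top _ subset_refl])
  qed
  ultimately show ?thesis using s(1) \<open>s1 = k'\<close> k'le by linarith
qed

text \<open>Let Z be \<open>Zn (Suc m)\<close>. The quotient of Z by its multiples by variables is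
  cut at \<open>Zn (Suc (Suc m))\<close>. The upper factor is mapped isomorphically onto order m + 1
  modulo order m + 2 and gives \<open>q * h (Suc m)\<close>; the lower one has room for the
  generators of K, of which there are at least p - q.\<close>

theorem betti_growth:
  assumes k: "F.len (F.mm (Zn (Suc m))) (Zn (Suc m)) k"
  shows "q * h (Suc m) + p \<le> k + q"
proof -
  \<comment> \<open>N is so large that passing from \<open>ell N\<close> to the longer
    \<open>ell (N + m)\<close> in q copies costs less than one further \<open>ell N\<close>. This
    strictness turns the comparison of lengths into the integer bound p \<le> c + q.\<close>
  obtain N where N: "N > 1" "q * ell (N + m) < (q + 1) * ell N" using growth[of q m] by (elim exE conjE)
  define d where "d = N - 1"
  have d: "N = Suc d" using N(1) by (simp add: d_def)
  let ?K = "Zn (Suc (m + d))" and ?E = "Fm (Suc d) p" and ?Z = "Zn (Suc m)" and ?Z1 = "Zn (Suc (Suc m))"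
  let ?W = "F.mm ?K <+>\<^bsub>Fr p\<^esub> ?E"
  have mZ: "F.sub (F.mm ?Z)" by (rule F.mm_sub[OF Zn_sub])
  have W: "F.sub ?W" by (rule F.sub_add[OF F.mm_sub[OF Zn_sub] Fm_sub])
  obtain k1 k2 where kk: "k1 + k2 = k" "F.len (F.mm ?Z) ?Z1 k1" "F.len ?Z1 ?Z k2"
    using F.len_mid[OF k Zn_sub[of "Suc (Suc m)"] Zn_mm Zn_antimono[OF le_SucI[OF order_refl]]] by (elim exE conjE)
  \<comment> \<open>The map is onto modulo order m + 2: by \<open>approx\<close>, an element of
    order m + 1 is an image up to that order.\<close>
  have "G.len (Fm (Suc (Suc m)) q) (Fm (Suc m) q) k2"
  proof (rule P.len_hom[OF kk(3) F.subD(1)[OF Zn_sub] Zn_def Fm_sub _ Fm_sub])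
    show "Fm (Suc (Suc m)) q \<subseteq> Fm (Suc m) q" by (rule Fm_antimono) simp
    show "\<phi> ` ?Z \<subseteq> Fm (Suc m) q" by (auto simp: Zn_def)
    fix t assume t: "t \<in> Fm (Suc m) q"
    then have "t \<in> Fm (m + 1) q" by simp
    then obtain u v where uv: "u \<in> Fm 1 p" "v \<in> Fm (m + 1 + 1) q" "t = \<phi> u \<oplus>\<^bsub>Fr q\<^esub> v" by (rule approx_obtain)
    have uc: "u \<in> Fc p" "v \<in> Fc q" using uv Fm_Fc by blast+
    have "v \<in> Fm (Suc m) q" using uv(2) Fm_antimono[of "Suc m" "Suc (Suc m)" q] by auto
    moreover have "v \<oplus>\<^bsub>Fr q\<^esub> \<phi> u \<in> Fm (Suc m) q" using t uv(3) G.M.a_comm[OF uc(2) P.a_closed[OF uc(1)]] by simp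
    ultimately have "\<phi> u \<in> Fm (Suc m) q" by (rule G.sub_add_cancel[OF Fm_sub _ _ P.a_closed[OF uc(1)]])
    then have "u \<in> ?Z" using uc by (simp add: Zn_def)
    then show "\<exists>u\<in>?Z. \<exists>v\<in>Fm (Suc (Suc m)) q. t = \<phi> u \<oplus>\<^bsub>Fr q\<^esub> v" using uv by auto
  qed
  then have k2: "k2 = q * h (Suc m)" by (rule G.len_unique[OF _ len_Fm])
  have KZ: "?K \<subseteq> ?Z1" by (rule Zn_antimono) (use d N(1) in simp)
  have mZK: "F.sub (F.mm ?Z \<inter> ?K)" by (rule F.sub_Int[OF mZ Zn_sub])
  \<comment> \<open>Of the lower factor only the part inside K is kept, and of this only the image
    modulo \<open>?W\<close>. Both cuts can only lose length.\<close>
  obtain a b where ab: "a + b = k1" "F.len (F.mm ?Z \<inter> ?K) (?Z1 \<inter> ?K) a"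
      "F.len (F.mm ?Z <+>\<^bsub>Fr p\<^esub> ?K) (?Z1 <+>\<^bsub>Fr p\<^esub> ?K) b"
    using F.len_Int_add[OF kk(2) Zn_sub[of "Suc (m + d)"]] by blast
  obtain a' c where ac: "a' + c = a" "F.len ((F.mm ?Z \<inter> ?K) \<inter> ?W) ((?Z1 \<inter> ?K) \<inter> ?W) a'"
      "F.len ((F.mm ?Z \<inter> ?K) <+>\<^bsub>Fr p\<^esub> ?W) ((?Z1 \<inter> ?K) <+>\<^bsub>Fr p\<^esub> ?W) c"
    using F.len_Int_add[OF ab(2) W] by blast
  have 1: "(F.mm ?Z \<inter> ?K) <+>\<^bsub>Fr p\<^esub> ?W = ?W"
    by (rule F.add_absorb(1)[OF mZK W]) (use K_mZ in blast)
  have mK: "F.sub (F.mm ?K)" by (rule F.mm_sub[OF Zn_sub])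
  have "(?Z1 \<inter> ?K) <+>\<^bsub>Fr p\<^esub> ?W = (?K <+>\<^bsub>Fr p\<^esub> F.mm ?K) <+>\<^bsub>Fr p\<^esub> ?E"
    unfolding Int_absorb1[OF KZ] by (rule F.sub_add_ac(2)[OF Zn_sub mK Fm_sub, symmetric])
  also have "?K <+>\<^bsub>Fr p\<^esub> F.mm ?K = ?K"
    by (rule F.add_absorb(2)[OF mK Zn_sub F.mm_subset[OF Zn_sub]])
  finally have "F.len ?W (?K <+>\<^bsub>Fr p\<^esub> ?E) c" using ac(3) 1 by simp
  then have "p * ell (Suc d) \<le> c * ell (Suc d) + q * ell (Suc (m + d))" by (rule generators_bound)
  also have "q * ell (Suc (m + d)) < (q + 1) * ell (Suc d)" using N(2) d by (simp add: add.commute)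
  finally have "p * ell (Suc d) < (c + q + 1) * ell (Suc d)" by (simp add: algebra_simps)
  then have "p < c + q + 1" by (simp only: mult_less_cancel2)
  then show ?thesis using k2 kk(1) ab(1) ac(1) by linarith
qed

end

section \<open>Monomials and polynomial rings\<close>

definition monoms :: "nat \<Rightarrow> nat \<Rightarrow> nat multiset set"
  where "monoms e j = {\<mu>. set_mset \<mu> \<subseteq> {..<e} \<and> size \<mu> = j}"

lemma monoms_0: "monoms e 0 = {{#}}" by (auto simp: monoms_def)
lemma monoms_no_vars: "monoms 0 (Suc j) = {}" by (auto simp: monoms_def)
lemma monoms_Suc: "monoms (Suc e) (Suc j) = monoms e (Suc j) \<union> add_mset e ` monoms (Suc e) j"
proof (intro subset_antisym subsetI)
  fix \<mu> assume m: "\<mu> \<in> monoms (Suc e) (Suc j)"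
  show "\<mu> \<in> monoms e (Suc j) \<union> add_mset e ` monoms (Suc e) j"
  proof (cases "e \<in># \<mu>")
    case True
    then obtain \<nu> where "\<mu> = add_mset e \<nu>" by (metis multi_member_split)
    then show ?thesis using m by (auto simp: monoms_def)
  next
    case False
    then have "t < e" if "t \<in># \<mu>" for t using m that by (auto simp: monoms_def subset_iff) (metis less_SucE that)
    then show ?thesis using m by (auto simp: monoms_def)
  qed
qed (auto simp: monoms_def)

lemma finite_monoms: "finite (monoms e j)"
proof (induction "e + j" arbitrary: e j rule: less_induct)
  case less
  show ?case
  proof (cases e; cases j)
    fix e' j' assume "e = Suc e'" "j = Suc j'"
    then show ?thesis using less[of e' "Suc j'"] less[of "Suc e'" j'] by (simp add: monoms_Suc)
  qed (auto simp: monoms_0 monoms_no_vars)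
qed

text \<open>Pascal's rule, by the distinction whether the last variable divides the monomial. The
  shift to \<open>Suc e\<close> variables makes e the lower index.\<close>

lemma card_monoms: "card (monoms (Suc e) j) = (e + j) choose e"
proof (induction "e + j" arbitrary: e j rule: less_induct)
  case less
  show ?case
  proof (cases j)
    case 0 then show ?thesis by (simp add: monoms_0)
  next
    case (Suc j')
    have disj: "monoms e (Suc j') \<inter> add_mset e ` monoms (Suc e) j' = {}" by (auto simp: monoms_def)
    have "card (monoms (Suc e) j) = card (monoms e (Suc j')) + card (monoms (Suc e) j')"
      unfolding Suc monoms_Suc by (subst card_Un_disjoint) (use disj finite_monoms in \<open>auto simp: card_image inj_on_def\<close>)
    also have "card (monoms (Suc e) j') = (e + j') choose e" using less[of e j'] Suc by simp
    finally show ?thesis using less[of "e - 1" "Suc j'"] Suc by (cases e) (auto simp: monoms_no_vars)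
  qed
qed

definition numm :: "nat \<Rightarrow> nat \<Rightarrow> nat" where "numm e j = card (monoms e j)"

lemma sum_numm: "(\<Sum>j<Suc N. numm (Suc e) j) = (Suc e + N) choose Suc e"
  by (induction N) (auto simp: numm_def card_monoms)

text \<open>The partial sums are binomial coefficients with fixed lower index e, hence polynomial in
  N, so the quotient of their values at N + d and at N tends to 1.\<close>

lemma numm_growth: assumes "e \<ge> 1"
  shows "\<exists>N>1. q * (\<Sum>j<N + d. numm e j) < (q + 1) * (\<Sum>j<N. numm e j)"
proof -
  obtain e' where e: "e = Suc e'" using assms by (cases e) auto
  \<comment> \<open>The upper limit is shifted by one so that \<open>L N\<close> is the binomial
    coefficient of e + N over e.\<close>
  define L where "L = (\<lambda>N. real (\<Sum>j<Suc N. numm e j))"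
  have L: "L N = real ((e + N) choose e)" for N unfolding L_def e using sum_numm[where N=N and e=e'] by simp
  have pos: "L N > 0" for N unfolding L by simp
  have step: "L (Suc N) = L N * (real (e + N + 1) / real (N + 1))" for N
  proof -
    have "(Suc (e + N) - e) * (Suc (e + N) choose e) = Suc (e + N) * ((e + N) choose e)"
      using binomial_absorb_comp[of "Suc (e + N)" e] by simp
    then have "(N + 1) * ((e + Suc N) choose e) = (e + N + 1) * ((e + N) choose e)" by simp
    then have "real (N + 1) * L (Suc N) = real (e + N + 1) * L N" unfolding L by (metis of_nat_mult)
    then show ?thesis by (simp add: field_simps)
  qed
  have lim1: "(\<lambda>N. real (e + (N + d) + 1) / real (N + d + 1)) \<longlonglongrightarrow> 1" for d
  proof -
    have "(\<lambda>N. 1 + real e * inverse (real (Suc (N + d)))) \<longlonglongrightarrow> 1 + real e * 0"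
      by (intro tendsto_intros LIMSEQ_ignore_initial_segment[OF LIMSEQ_inverse_real_of_nat])
    then show ?thesis by (simp add: field_simps)
  qed
  have lim: "(\<lambda>N. L (N + d) / L N) \<longlonglongrightarrow> 1"
  proof (induction d)
    case 0 then show ?case using pos by (simp add: less_imp_neq[symmetric])
  next
    case (Suc d)
    have "(\<lambda>N. (L (N + d) / L N) * (real (e + (N + d) + 1) / real (N + d + 1))) \<longlonglongrightarrow> 1 * 1"
      by (rule tendsto_mult[OF Suc lim1])
    moreover have "L (N + Suc d) / L N = (L (N + d) / L N) * (real (e + (N + d) + 1) / real (N + d + 1))" for N
      using step[of "N + d"] by simp
    ultimately show ?case by (simp only: mult_1)
  qed
  have "\<forall>\<^sub>F N in sequentially. real q * (L (N + d) / L N) < real q + 1"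
    by (rule order_tendstoD(2)[OF tendsto_mult_left[OF lim]]) simp
  then obtain N where N: "N \<ge> 1" "real q * (L (N + d) / L N) < real q + 1"
    unfolding eventually_sequentially by (meson le_cases order_refl order_trans)
  then have "real q * L (N + d) < (real q + 1) * L N" using pos[of N] by (simp add: field_simps)
  then have "real (q * (\<Sum>j<Suc N + d. numm e j)) < real ((q + 1) * (\<Sum>j<Suc N. numm e j))"
    unfolding L_def of_nat_mult of_nat_add by simp
  then have "q * (\<Sum>j<Suc N + d. numm e j) < (q + 1) * (\<Sum>j<Suc N. numm e j)" by (simp only: of_nat_less_iff)
  then show ?thesis using N(1) by (intro exI[of _ "Suc N"]) auto
qed

section \<open>The polynomial ring: ring axioms, order filtration, Hilbert function, regularity of
  the variables\<close>

locale polyr = field K for K :: "('a, 'b) ring_scheme" (structure) +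
  fixes e :: nat
begin

abbreviation Q where "Q \<equiv> poly_ring K e"
abbreviation PC where "PC \<equiv> carrier (poly_ring K e)"
abbreviation xv :: "nat \<Rightarrow> nat multiset \<Rightarrow> 'a" where "xv \<equiv> indexed_var"
definition pmul :: "(nat multiset \<Rightarrow> 'a) \<Rightarrow> (nat multiset \<Rightarrow> 'a) \<Rightarrow> nat multiset \<Rightarrow> 'a"
  where "pmul P R = (\<lambda>m. \<Oplus>l\<in>{l. l \<subseteq># m}. P l \<otimes> R (m - l))"
definition mon :: "nat multiset \<Rightarrow> nat multiset \<Rightarrow> 'a"
  where "mon \<mu> = (\<lambda>m. if m = \<mu> then \<one> else \<zero>)"

lemma Q_simps: "P \<otimes>\<^bsub>Q\<^esub> R = pmul P R" "P \<oplus>\<^bsub>Q\<^esub> R = indexed_padd P R"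
  "\<one>\<^bsub>Q\<^esub> = indexed_const \<one>" "\<zero>\<^bsub>Q\<^esub> = indexed_const \<zero>" "PC = indexed_pset {..<e} (carrier K)"
  by (auto simp: poly_ring_def pmul_def)

lemma finite_sub_mset: "finite {l. l \<subseteq># (m :: nat multiset)}"
proof (rule finite_subset[of _ "mset ` {l. set l \<subseteq> set_mset m \<and> length l \<le> size m}"])
  show "{l. l \<subseteq># m} \<subseteq> mset ` {l. set l \<subseteq> set_mset m \<and> length l \<le> size m}"
  proof
    fix l assume l: "l \<in> {l. l \<subseteq># m}"
    obtain xs where xs: "mset xs = l" using ex_mset by blast
    have "length xs \<le> size m" using size_mset_mono[of l m] l xs by auto
    moreover have "set xs \<subseteq> set_mset m" using l xs set_mset_mono by fastforce
    ultimately show "l \<in> mset ` {l. set l \<subseteq> set_mset m \<and> length l \<le> size m}" using xs by blast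
  qed
qed (intro finite_imageI finite_lists_length_le finite_set_mset)

lemma pset_coeff: "P \<in> PC \<Longrightarrow> P m \<in> carrier K"
  using indexed_pset_in_carrier[of "carrier K" P "{..<e}"] unfolding Q_simps carrier_coeff_def by blast

lemma pset_support: "P \<in> PC \<Longrightarrow> finite {m. P m \<noteq> \<zero>} \<and> (\<forall>m. P m \<noteq> \<zero> \<longrightarrow> set_mset m \<subseteq> {..<e})"
  unfolding Q_simps
proof (induction rule: indexed_pset.induct)
  case (indexed_const k)
  have "{m. Indexed_Polynomials.ring.indexed_const K k m \<noteq> \<zero>} \<subseteq> {{#}}" by (auto simp: indexed_const_def)
  then show ?case using finite_subset by (auto simp: indexed_const_def)
next
  case (indexed_padd P R)
  have "{m. indexed_padd P R m \<noteq> \<zero>} \<subseteq> {m. P m \<noteq> \<zero>} \<union> {m. R m \<noteq> \<zero>}" by (auto simp: indexed_padd_def)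
  then show ?case using indexed_padd.IH finite_subset[of _ "{m. P m \<noteq> \<zero>} \<union> {m. R m \<noteq> \<zero>}"] by blast
next
  case (indexed_pmult P i)
  have sub: "{m. indexed_pmult P i m \<noteq> \<zero>} \<subseteq> add_mset i ` {m. P m \<noteq> \<zero>}"
    by (auto simp: indexed_pmult_def image_iff split: if_splits) (metis insert_DiffM)
  then have "finite {m. indexed_pmult P i m \<noteq> \<zero>}" using indexed_pmult.IH finite_subset by blast
  moreover have "set_mset m \<subseteq> {..<e}" if "indexed_pmult P i m \<noteq> \<zero>" for m
    using sub that indexed_pmult by fastforce
  ultimately show ?case by blast
qed

lemma const_PC: "k \<in> carrier K \<Longrightarrow> indexed_const k \<in> PC" unfolding Q_simps by (rule indexed_pset.indexed_const)
lemma add_PC: "\<lbrakk> P \<in> PC; R \<in> PC \<rbrakk> \<Longrightarrow> indexed_padd P R \<in> PC" unfolding Q_simps by (rule indexed_pset.indexed_padd)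
lemma pmult_PC: "\<lbrakk> P \<in> PC; i < e \<rbrakk> \<Longrightarrow> indexed_pmult P i \<in> PC" unfolding Q_simps by (rule indexed_pset.indexed_pmult) auto
lemma zero_PC: "(\<lambda>_. \<zero>) \<in> PC" using const_PC[of \<zero>] by (simp add: indexed_zero_def)
lemma var_PC: "i < e \<Longrightarrow> xv i \<in> PC" unfolding indexed_var_def by (rule pmult_PC[OF const_PC]) auto

lemma mon_PC: "\<lbrakk> set_mset \<mu> \<subseteq> {..<e}; c \<in> carrier K \<rbrakk> \<Longrightarrow> (\<lambda>m. if m = \<mu> then c else \<zero>) \<in> PC"
proof (induction \<mu>)
  case empty
  then show ?case using const_PC[of c] by (simp add: indexed_const_def)
next
  case (add i \<mu>)
  have "(\<lambda>m. if m = add_mset i \<mu> then c else \<zero>) = indexed_pmult (\<lambda>m. if m = \<mu> then c else \<zero>) i"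
    by (rule ext) (auto simp: indexed_pmult_def dest: multi_member_split)
  then show ?case using add pmult_PC by simp
qed

text \<open>The converse of \<open>pset_coeff\<close> and \<open>pset_support\<close>, by adding one
  monomial at a time. It replaces the inductive description of polynomials by finite support, in
  which pieces of a polynomial can be cut out freely.\<close>

lemma PC_I:
  assumes "\<And>m. P m \<in> carrier K" "finite {m. P m \<noteq> \<zero>}" "\<And>m. P m \<noteq> \<zero> \<Longrightarrow> set_mset m \<subseteq> {..<e}"
  shows "P \<in> PC"
proof -
  have "\<And>P. \<lbrakk> \<And>m. P m \<in> carrier K; {m. P m \<noteq> \<zero>} = S; \<And>m. P m \<noteq> \<zero> \<Longrightarrow> set_mset m \<subseteq> {..<e} \<rbrakk> \<Longrightarrow> P \<in> PC"
    if "finite S" for S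
    using that
  proof (induction S)
    case empty
    then have "P = (\<lambda>_. \<zero>)" by auto
    then show ?case using zero_PC by simp
  next
    case (insert \<mu> S)
    define R where "R = (\<lambda>m. if m = \<mu> then \<zero> else P m)"
    have "{m. R m \<noteq> \<zero>} = {m. P m \<noteq> \<zero>} - {\<mu>}" by (auto simp: R_def)
    then have "{m. R m \<noteq> \<zero>} = S" using insert.prems(2) insert.hyps(2) by simp
    then have R: "R \<in> PC" using insert.prems(1,3) by (intro insert.IH) (auto simp: R_def split: if_splits)
    have "P \<mu> \<noteq> \<zero>" using insert.prems(2) by blast
    then have "(\<lambda>m. if m = \<mu> then P \<mu> else \<zero>) \<in> PC" using insert.prems(1,3) by (intro mon_PC) auto
    from add_PC[OF R this] have "indexed_padd R (\<lambda>m. if m = \<mu> then P \<mu> else \<zero>) \<in> PC" .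
    moreover have "indexed_padd R (\<lambda>m. if m = \<mu> then P \<mu> else \<zero>) = P"
      using insert.prems(1) by (auto simp: indexed_padd_def R_def)
    ultimately show ?case by simp
  qed
  then show ?thesis using assms by blast
qed

text \<open>Together with \<open>pmul_add_l\<close> and \<open>pmul_pmult_l\<close> this gives the
  recursion of the product in its left factor along the three constructors of polynomials. Closure
  and associativity then follow by induction instead of manipulation of double sums.\<close>

lemma pmul_const: assumes "k \<in> carrier K" "\<And>m. P m \<in> carrier K" shows "pmul (indexed_const k) P = (\<lambda>m. k \<otimes> P m)"
proof
  fix m :: "nat multiset"
  have "pmul (indexed_const k) P m = (\<Oplus>l\<in>{l. l \<subseteq># m}. if {#} = l then k \<otimes> P (m - l) else \<zero>)"
    unfolding pmul_def by (rule finsum_cong') (use assms in \<open>auto simp: indexed_const_def\<close>)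
  also have "\<dots> = k \<otimes> P (m - {#})"
    by (rule finsum_singleton) (use assms finite_sub_mset in auto)
  finally show "pmul (indexed_const k) P m = k \<otimes> P m" by simp
qed

lemma pmul_add_l:
  assumes "\<And>m. P m \<in> carrier K" "\<And>m. P' m \<in> carrier K" "\<And>m. R m \<in> carrier K"
  shows "pmul (indexed_padd P P') R = indexed_padd (pmul P R) (pmul P' R)"
proof
  fix m :: "nat multiset"
  have "pmul (indexed_padd P P') R m = (\<Oplus>l\<in>{l. l \<subseteq># m}. P l \<otimes> R (m - l) \<oplus> P' l \<otimes> R (m - l))"
    unfolding pmul_def indexed_padd_def by (rule finsum_cong') (use assms l_distr in auto)
  also have "\<dots> = indexed_padd (pmul P R) (pmul P' R) m"
    unfolding pmul_def indexed_padd_def by (rule finsum_addf) (use assms in auto)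
  finally show "pmul (indexed_padd P P') R m = indexed_padd (pmul P R) (pmul P' R) m" .
qed

text \<open>Reindexing by complements, an involution on the submultisets of m.\<close>

lemma pmul_comm:
  assumes "\<And>m. P m \<in> carrier K" "\<And>m. R m \<in> carrier K" shows "pmul P R = pmul R P"
proof
  fix m :: "nat multiset"
  have inj: "inj_on (\<lambda>l. m - l) {l. l \<subseteq># m}"
    by (rule inj_onI) (metis mem_Collect_eq subset_mset.add_diff_inverse subset_mset.diff_add_assoc2 add_right_cancel diff_subset_eq_self subset_mset.diff_diff_right add_diff_cancel_right')
  have im: "(\<lambda>l. m - l) ` {l. l \<subseteq># m} = {l. l \<subseteq># m}"
  proof (intro subset_antisym subsetI)
    fix l assume l: "l \<in> {l. l \<subseteq># m}"
    then have "l = m - (m - l)" by (simp add: multiset_eq_iff subseteq_mset_def)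
    moreover have "m - l \<in> {l. l \<subseteq># m}" by simp
    ultimately show "l \<in> (\<lambda>l. m - l) ` {l. l \<subseteq># m}" by blast
  qed auto
  have "pmul R P m = (\<Oplus>l\<in>(\<lambda>l. m - l) ` {l. l \<subseteq># m}. R l \<otimes> P (m - l))" by (simp add: pmul_def im)
  also have "\<dots> = (\<Oplus>l\<in>{l. l \<subseteq># m}. R (m - l) \<otimes> P (m - (m - l)))"
    by (rule add.finprod_reindex[OF _ inj]) (use assms in auto)
  also have "\<dots> = pmul P R m"
    unfolding pmul_def
  proof (rule finsum_cong')
    fix l assume "l \<in> {l. l \<subseteq># m}"
    then have "m - (m - l) = l" by (simp add: multiset_eq_iff subseteq_mset_def)
    then show "R (m - l) \<otimes> P (m - (m - l)) = P l \<otimes> R (m - l)" using assms m_comm by simp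
  qed (use assms in auto)
  finally show "pmul P R m = pmul R P m" by simp
qed

lemma pmul_pmult_l:
  assumes "\<And>m. P m \<in> carrier K" "\<And>m. R m \<in> carrier K"
  shows "pmul (indexed_pmult P i) R = indexed_pmult (pmul P R) i"
proof
  fix m :: "nat multiset"
  show "pmul (indexed_pmult P i) R m = indexed_pmult (pmul P R) i m"
  proof (cases "i \<in># m")
    case False
    have "pmul (indexed_pmult P i) R m = (\<Oplus>l\<in>{l. l \<subseteq># m}. \<zero>)"
      unfolding pmul_def
      by (rule finsum_cong') (use False assms in \<open>auto simp: indexed_pmult_def dest: mset_subset_eqD\<close>)
    then show ?thesis using False by (simp add: indexed_pmult_def)
  next
    case True
    \<comment> \<open>Only the submultisets containing i contribute, and taking one i away from them
      gives all submultisets of \<open>m - {#i#}\<close>.\<close>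
    let ?A = "{l. l \<subseteq># m}" and ?B = "add_mset i ` {l. l \<subseteq># m - {#i#}}"
    have BA: "?B \<subseteq> ?A" using True by (auto simp: insert_subset_eq_iff)
    have "pmul (indexed_pmult P i) R m = (\<Oplus>l\<in>?B. indexed_pmult P i l \<otimes> R (m - l))"
      unfolding pmul_def
    proof (rule add.finprod_mono_neutral_cong_right[OF finite_sub_mset BA])
      show "indexed_pmult P i l \<otimes> R (m - l) = \<zero>" if "l \<in> ?A - ?B" for l
      proof -
        have "i \<notin># l"
        proof
          assume "i \<in># l"
          then obtain l' where "l = add_mset i l'" by (metis multi_member_split)
          then show False using that True by (auto simp: insert_subset_eq_iff)
        qed
        then show ?thesis using assms by (simp add: indexed_pmult_def)
      qed
    qed (use assms in \<open>auto simp: indexed_pmult_def\<close>)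
    also have "\<dots> = (\<Oplus>l\<in>{l. l \<subseteq># m - {#i#}}. indexed_pmult P i (add_mset i l) \<otimes> R (m - add_mset i l))"
      by (rule add.finprod_reindex) (use assms in \<open>auto simp: indexed_pmult_def inj_on_def\<close>)
    also have "\<dots> = (\<Oplus>l\<in>{l. l \<subseteq># m - {#i#}}. P l \<otimes> R (m - {#i#} - l))"
      by (rule finsum_cong') (use assms in \<open>auto simp: indexed_pmult_def\<close>)
    finally show ?thesis using True by (simp add: indexed_pmult_def pmul_def)
  qed
qed

lemma pmul_PC: assumes "P \<in> PC" "R \<in> PC" shows "pmul P R \<in> PC"
  using assms(1) unfolding Q_simps(5)
proof (induction rule: indexed_pset.induct)
  case (indexed_const k)
  have "finite {m. k \<otimes> R m \<noteq> \<zero>}"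
    by (rule finite_subset[OF _ conjunct1[OF pset_support[OF assms(2)]]]) (use indexed_const in auto)
  then have "(\<lambda>m. k \<otimes> R m) \<in> PC"
    using indexed_const pset_support[OF assms(2)] pset_coeff[OF assms(2)] by (intro PC_I) (auto, force)
  then show ?case using pmul_const[OF indexed_const pset_coeff[OF assms(2)]] by (simp add: Q_simps(5))
next
  case (indexed_padd P P')
  then have "P \<in> PC" "P' \<in> PC" by (simp_all add: Q_simps(5))
  then show ?case using pmul_add_l[of P P' R] pset_coeff assms(2) add_PC indexed_padd.IH by (simp add: Q_simps(5))
next
  case (indexed_pmult P i)
  then have "P \<in> PC" by (simp add: Q_simps(5))
  then show ?case using pmul_pmult_l[of P R i] pset_coeff assms(2) pmult_PC indexed_pmult by (simp add: Q_simps(5))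
qed

lemma pmul_assoc: assumes "P \<in> PC" "R \<in> PC" "S \<in> PC" shows "pmul (pmul P R) S = pmul P (pmul R S)"
  using assms(1) unfolding Q_simps(5)
proof (induction rule: indexed_pset.induct)
  note c = pset_coeff[OF assms(2)] pset_coeff[OF assms(3)] pset_coeff[OF pmul_PC[OF assms(2,3)]]
  {
    case (indexed_const k)
    have "pmul (\<lambda>m. k \<otimes> R m) S = pmul (pmul (indexed_const k) R) S" using pmul_const[OF indexed_const c(1)] by simp
    have "pmul (\<lambda>m. k \<otimes> R m) S m = k \<otimes> pmul R S m" for m
    proof -
      have "pmul (\<lambda>m. k \<otimes> R m) S m = (\<Oplus>l\<in>{l. l \<subseteq># m}. k \<otimes> (R l \<otimes> S (m - l)))"
        unfolding pmul_def by (rule finsum_cong') (use c indexed_const m_assoc in auto)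
      also have "\<dots> = k \<otimes> pmul R S m"
        unfolding pmul_def by (rule finsum_rdistr[symmetric]) (use c indexed_const finite_sub_mset in auto)
      finally show ?thesis .
    qed
    then show ?case using pmul_const[OF indexed_const c(1)] pmul_const[OF indexed_const c(3)] by auto
  next
    case (indexed_padd P P')
    then have P: "P \<in> PC" "P' \<in> PC" by (simp_all add: Q_simps(5))
    note cc = pset_coeff[OF P(1)] pset_coeff[OF P(2)] pset_coeff[OF pmul_PC[OF P(1) assms(2)]] pset_coeff[OF pmul_PC[OF P(2) assms(2)]]
    show ?case using pmul_add_l[OF cc(1,2) c(1)] pmul_add_l[OF cc(3,4) c(2)] pmul_add_l[OF cc(1,2) c(3)] indexed_padd.IH by simp
  next
    case (indexed_pmult P i)
    then have P: "P \<in> PC" by (simp add: Q_simps(5))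
    note cc = pset_coeff[OF P] pset_coeff[OF pmul_PC[OF P assms(2)]]
    show ?case using pmul_pmult_l[OF cc(1) c(1)] pmul_pmult_l[OF cc(2) c(2)] pmul_pmult_l[OF cc(1) c(3)] indexed_pmult.IH by simp
  }
qed

lemma cring_Q: "cring Q"
proof (rule cringI)
  show "abelian_group Q"
  proof (rule abelian_groupI)
    show "\<exists>y\<in>PC. y \<oplus>\<^bsub>Q\<^esub> P = \<zero>\<^bsub>Q\<^esub>" if P: "P \<in> PC" for P
    proof
      show "(\<lambda>m. \<ominus> P m) \<in> PC"
      proof (rule PC_I)
        show "finite {m. \<ominus> P m \<noteq> \<zero>}"
          by (rule finite_subset[OF _ conjunct1[OF pset_support[OF P]]]) auto
        show "set_mset m \<subseteq> {..<e}" if "\<ominus> P m \<noteq> \<zero>" for m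
        proof -
          have "P m \<noteq> \<zero>" using that by auto
          then show ?thesis using pset_support[OF P] by blast
        qed
      qed (use pset_coeff[OF P] in auto)
      show "(\<lambda>m. \<ominus> P m) \<oplus>\<^bsub>Q\<^esub> P = \<zero>\<^bsub>Q\<^esub>"
        using pset_coeff[OF P] by (auto simp: Q_simps indexed_padd_def indexed_zero_def l_neg)
    qed
  qed (use add_PC zero_PC pset_coeff a_assoc a_comm in \<open>auto simp: Q_simps(2-4) indexed_padd_def indexed_zero_def\<close>)
  show "Group.comm_monoid Q"
  proof (rule comm_monoidI)
    show "\<one>\<^bsub>Q\<^esub> \<otimes>\<^bsub>Q\<^esub> P = P" if "P \<in> PC" for P
      using pmul_const[of \<one> P] pset_coeff[OF that] by (simp add: Q_simps(1,3))
  qed (use pmul_PC pmul_assoc const_PC pmul_comm pset_coeff in \<open>simp_all add: Q_simps(1,3)\<close>)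
  show "(P \<oplus>\<^bsub>Q\<^esub> P') \<otimes>\<^bsub>Q\<^esub> R = P \<otimes>\<^bsub>Q\<^esub> R \<oplus>\<^bsub>Q\<^esub> P' \<otimes>\<^bsub>Q\<^esub> R" if "P \<in> PC" "P' \<in> PC" "R \<in> PC" for P P' R
    using pmul_add_l[of P P' R] pset_coeff that by (simp add: Q_simps(1,2))
qed

lemma var_mul: "P \<in> PC \<Longrightarrow> xv i \<otimes>\<^bsub>Q\<^esub> P = indexed_pmult P i"
proof -
  assume P: "P \<in> PC"
  have c: "\<And>m. indexed_const \<one> m \<in> carrier K" by (simp add: indexed_const_def)
  show ?thesis
    unfolding Q_simps(1) indexed_var_def pmul_pmult_l[OF c pset_coeff[OF P]]
    using pmul_const[OF one_closed pset_coeff[OF P]] pset_coeff[OF P] by simp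
qed

text \<open>\<open>J j\<close> is the \<open>j\<close>-th power of the ideal of the variables.\<close>
definition J :: "nat \<Rightarrow> (nat multiset \<Rightarrow> 'a) set"
  where "J j = {P \<in> PC. \<forall>m. size m < j \<longrightarrow> P m = \<zero>}"

lemma J_0: "J 0 = PC" by (simp add: J_def)
lemma J_PC: "P \<in> J j \<Longrightarrow> P \<in> PC" by (simp add: J_def)

text \<open>Polynomials arise from constants by sums and multiplication by variables. So closure
  under constants and variables is enough; the induction runs over the multiplier.\<close>

lemma idl_Q_I:
  assumes T: "T \<subseteq> PC" "(\<lambda>_. \<zero>) \<in> T" "\<And>P R. \<lbrakk> P \<in> T; R \<in> T \<rbrakk> \<Longrightarrow> indexed_padd P R \<in> T"
    "\<And>k P. \<lbrakk> k \<in> carrier K; P \<in> T \<rbrakk> \<Longrightarrow> (\<lambda>m. k \<otimes> P m) \<in> T"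
    "\<And>i P. \<lbrakk> i < e; P \<in> T \<rbrakk> \<Longrightarrow> indexed_pmult P i \<in> T"
  shows "submodule Q T (self_module Q)"
proof -
  interpret Q: cring Q by (rule cring_Q)
  have mod: "module Q (self_module Q)"
    by (rule module_criteria)
      (use Q.a_assoc Q.a_comm Q.m_assoc Q.l_distr Q.r_distr Q.l_neg Q.a_inv_closed Q.r_neg in \<open>auto simp: self_module_def cring_Q\<close>)
  have sm: "pmul R P \<in> T" if R: "R \<in> PC" and P: "P \<in> T" for R P
    using R unfolding Q_simps(5)
  proof (induction rule: indexed_pset.induct)
    have Pc: "\<And>m. P m \<in> carrier K" using P T(1) pset_coeff by blast
    {
      case (indexed_const k)
      show ?case using pmul_const[OF indexed_const Pc] T(4)[OF indexed_const P] by simp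
    next
      case (indexed_padd R R')
      then have "R \<in> PC" "R' \<in> PC" by (simp_all add: Q_simps(5))
      then show ?case using pmul_add_l[of R R' P] pset_coeff Pc T(3) indexed_padd.IH by simp
    next
      case (indexed_pmult R i)
      then have "R \<in> PC" by (simp add: Q_simps(5))
      then show ?case using pmul_pmult_l[of R P i] pset_coeff Pc T(5) indexed_pmult by simp
    }
  qed
  show ?thesis
    by (rule submodule.intro[OF mod])
      (use T(1-3) sm in \<open>auto simp: self_module_def Q_simps(1,2,4) indexed_zero_def\<close>)
qed

lemma J_idl: "submodule Q (J j) (self_module Q)"
proof (rule idl_Q_I)
  show "(\<lambda>_. \<zero>) \<in> J j" using zero_PC by (simp add: J_def)
  show "indexed_padd P R \<in> J j" if "P \<in> J j" "R \<in> J j" for P R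
    using that add_PC by (auto simp: J_def indexed_padd_def)
  show "(\<lambda>m. k \<otimes> P m) \<in> J j" if k: "k \<in> carrier K" and P: "P \<in> J j" for k P
  proof -
    have "(\<lambda>m. k \<otimes> P m) \<in> PC"
      using pmul_PC[OF const_PC[OF k] J_PC[OF P]] pmul_const[OF k pset_coeff[OF J_PC[OF P]]] by simp
    then show ?thesis using k P by (auto simp: J_def)
  qed
  show "indexed_pmult P i \<in> J j" if "i < e" "P \<in> J j" for i P
    using that pmult_PC by (auto simp: J_def indexed_pmult_def size_Diff_singleton less_imp_diff_less)
qed (auto simp: J_def)

lemma var_J: assumes "i < e" "P \<in> J j" shows "xv i \<otimes>\<^bsub>Q\<^esub> P \<in> J (Suc j)"
  unfolding var_mul[OF J_PC[OF assms(2)]] J_def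
proof (intro CollectI conjI allI impI pmult_PC[OF J_PC[OF assms(2)] assms(1)])
  fix m :: "nat multiset" assume m: "size m < Suc j"
  show "indexed_pmult P i m = \<zero>"
  proof (cases "i \<in># m")
    case True
    then have "size (m - {#i#}) < j" using m by (metis Suc_less_eq insert_DiffM size_add_mset)
    then show ?thesis using assms(2) by (simp add: J_def indexed_pmult_def)
  qed (simp add: indexed_pmult_def)
qed

text \<open>The part of \<open>P\<close> whose monomials have smallest variable \<open>j\<close>, divided by that variable.\<close>
definition strip :: "(nat multiset \<Rightarrow> 'a) \<Rightarrow> nat \<Rightarrow> nat multiset \<Rightarrow> 'a"
  where "strip P j = (\<lambda>m. if \<forall>t\<in>#m. j \<le> t then P (add_mset j m) else \<zero>)"

lemma strip_J: assumes "P \<in> J (Suc i)" shows "strip P j \<in> J i"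
proof -
  have P: "P \<in> PC" by (rule J_PC[OF assms])
  have "finite ((\<lambda>m. m - {#j#}) ` {m. P m \<noteq> \<zero>})" using pset_support[OF P] by blast
  moreover have "{m. strip P j m \<noteq> \<zero>} \<subseteq> (\<lambda>m. m - {#j#}) ` {m. P m \<noteq> \<zero>}"
  proof
    fix m assume "m \<in> {m. strip P j m \<noteq> \<zero>}"
    then have "P (add_mset j m) \<noteq> \<zero>" by (auto simp: strip_def split: if_splits)
    then show "m \<in> (\<lambda>m. m - {#j#}) ` {m. P m \<noteq> \<zero>}" by (intro image_eqI[of _ _ "add_mset j m"]) auto
  qed
  ultimately have "finite {m. strip P j m \<noteq> \<zero>}" using finite_subset by blast
  moreover have "set_mset m \<subseteq> {..<e}" if "strip P j m \<noteq> \<zero>" for m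
  proof -
    have "P (add_mset j m) \<noteq> \<zero>" using that by (auto simp: strip_def split: if_splits)
    then have "set_mset (add_mset j m) \<subseteq> {..<e}" using pset_support[OF P] by blast
    then show ?thesis by simp
  qed
  ultimately have "strip P j \<in> PC" using pset_coeff[OF P] by (intro PC_I) (auto simp: strip_def)
  then show ?thesis using assms by (auto simp: J_def strip_def)
qed

lemma finsum_Q_apply:
  assumes "finite A" "\<And>i. i \<in> A \<Longrightarrow> f i \<in> PC" shows "finsum Q f A m = (\<Oplus>i\<in>A. f i m)"
  using assms
proof (induction A)
  interpret Q: cring Q by (rule cring_Q)
  {
    case empty then show ?case by (simp add: Q_simps(4) indexed_zero_def)
  next
    case (insert i A)
    have 1: "f \<in> A \<rightarrow> PC" "f i \<in> PC" using insert.prems by auto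
    have 2: "(\<lambda>i. f i m) \<in> A \<rightarrow> carrier K" "f i m \<in> carrier K" using 1 pset_coeff by auto
    show ?case using insert 1 2 Q.finsum_insert[OF insert(1,2) 1] by (simp add: Q_simps(2) indexed_padd_def)
  }
qed

text \<open>Each monomial is divided by its smallest variable, so it occurs in exactly one summand.
  For k < e the monomials with all variables at least k are missed; they will be the remainder in
  the proof of \<open>colon\<close>.\<close>

lemma sum_strip:
  assumes P: "P \<in> PC" and k: "k \<le> e"
  shows "(\<Oplus>\<^bsub>Q\<^esub>j\<in>{..<k}. xv j \<otimes>\<^bsub>Q\<^esub> strip P j) m = (if \<exists>t\<in>#m. t < k then P m else \<zero>)"
proof -
  interpret Q: cring Q by (rule cring_Q)
  have sP: "strip P j \<in> PC" for j
  proof -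
    \<comment> \<open>The constant term is never read by \<open>strip\<close>, so it is removed
      first in order that \<open>strip_J\<close> applies.\<close>
    define P' where "P' = (\<lambda>m. if m = {#} then \<zero> else P m)"
    have "P' \<in> J 1"
    proof -
      have "finite {m. P' m \<noteq> \<zero>}" by (rule finite_subset[OF _ conjunct1[OF pset_support[OF P]]]) (auto simp: P'_def)
      moreover have "set_mset m \<subseteq> {..<e}" if "P' m \<noteq> \<zero>" for m using that pset_support[OF P] by (auto simp: P'_def split: if_splits)
      ultimately have "P' \<in> PC" using pset_coeff[OF P] by (intro PC_I) (auto simp: P'_def)
      then show ?thesis by (auto simp: J_def P'_def)
    qed
    then have "strip P' j \<in> J 0" using strip_J[of P' 0 j] by simp
    moreover have "strip P' j = strip P j" by (auto simp: strip_def P'_def)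
    ultimately show ?thesis by (simp add: J_0)
  qed
  have "(\<Oplus>\<^bsub>Q\<^esub>j\<in>{..<k}. xv j \<otimes>\<^bsub>Q\<^esub> strip P j) m = (\<Oplus>j\<in>{..<k}. (xv j \<otimes>\<^bsub>Q\<^esub> strip P j) m)"
    by (rule finsum_Q_apply) (use sP var_PC k in auto)
  also have "\<dots> = (\<Oplus>j\<in>{..<k}. if j \<in># m \<and> (\<forall>t\<in>#m. j \<le> t) then P m else \<zero>)"
  proof (rule finsum_cong')
    fix j assume "j \<in> {..<k}"
    show "(xv j \<otimes>\<^bsub>Q\<^esub> strip P j) m = (if j \<in># m \<and> (\<forall>t\<in>#m. j \<le> t) then P m else \<zero>)"
    proof (cases "j \<in># m")
      case True
      then obtain m' where "m = add_mset j m'" by (metis multi_member_split)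
      then show ?thesis unfolding var_mul[OF sP] by (auto simp: indexed_pmult_def strip_def)
    next
      case False
      then show ?thesis unfolding var_mul[OF sP] by (simp add: indexed_pmult_def)
    qed
  qed (use pset_coeff[OF P] in auto)
  also have "\<dots> = (if \<exists>t\<in>#m. t < k then P m else \<zero>)"
  proof (cases "\<exists>t\<in>#m. t < k")
    case False
    have "(\<Oplus>j\<in>{..<k}. if j \<in># m \<and> (\<forall>t\<in>#m. j \<le> t) then P m else \<zero>) = (\<Oplus>j\<in>{..<k}. \<zero>)"
      by (rule finsum_cong') (use False in auto)
    then show ?thesis using False by simp
  next
    case True
    define s where "s = Min (set_mset m)"
    have ne: "set_mset m \<noteq> {}" using True by auto
    have s: "s \<in># m" "\<And>t. t \<in># m \<Longrightarrow> s \<le> t" using Min_in[OF finite_set_mset ne] by (auto simp: s_def)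
    have sk: "s < k" using True s(2) by (meson le_less_trans)
    have "(\<Oplus>j\<in>{..<k}. if j \<in># m \<and> (\<forall>t\<in>#m. j \<le> t) then P m else \<zero>) = (\<Oplus>j\<in>{..<k}. if s = j then P m else \<zero>)"
      by (rule finsum_cong') (use s pset_coeff[OF P] in \<open>auto simp: order_antisym\<close>)
    also have "\<dots> = P m" by (rule finsum_singleton) (use sk pset_coeff[OF P] in auto)
    finally show ?thesis using True by simp
  qed
  finally show ?thesis .
qed

lemma finsum_self_Q: "finsum (self_module Q) f A = finsum Q f A"
  unfolding finsum_def finprod_def self_module_def by simp

lemma mmul_self_Q: "mmul (self_module Q) xv e U = {v. \<exists>f\<in>{..<e} \<rightarrow> U. v = (\<Oplus>\<^bsub>Q\<^esub>i\<in>{..<e}. xv i \<otimes>\<^bsub>Q\<^esub> f i)}"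
  unfolding mmul_def finsum_self_Q by (simp add: self_module_def)

lemma mm_J: "mmul (self_module Q) xv e (J j) = J (Suc j)"
proof (intro subset_antisym subsetI)
  interpret Q: cring Q by (rule cring_Q)
  fix P assume "P \<in> mmul (self_module Q) xv e (J j)"
  then obtain f where f: "f \<in> {..<e} \<rightarrow> J j" "P = (\<Oplus>\<^bsub>Q\<^esub>i\<in>{..<e}. xv i \<otimes>\<^bsub>Q\<^esub> f i)" by (auto simp: mmul_self_Q)
  have fJ: "xv i \<otimes>\<^bsub>Q\<^esub> f i \<in> J (Suc j)" if "i < e" for i using var_J f(1) that by auto
  have "P \<in> PC" unfolding f(2) by (rule Q.finsum_closed) (use fJ J_PC in auto)
  moreover have "P m = \<zero>" if m: "size m < Suc j" for m
  proof -
    have "P m = (\<Oplus>i\<in>{..<e}. (xv i \<otimes>\<^bsub>Q\<^esub> f i) m)" unfolding f(2) by (rule finsum_Q_apply) (use fJ J_PC in auto)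
    also have "\<dots> = (\<Oplus>i\<in>{..<e}. \<zero>)" by (rule finsum_cong') (use fJ m in \<open>auto simp: J_def\<close>)
    finally show ?thesis by simp
  qed
  ultimately show "P \<in> J (Suc j)" by (simp add: J_def)
next
  fix P assume P: "P \<in> J (Suc j)"
  have "P = (\<Oplus>\<^bsub>Q\<^esub>i\<in>{..<e}. xv i \<otimes>\<^bsub>Q\<^esub> strip P i)"
  proof
    fix m
    have "P m = (if \<exists>t\<in>#m. t < e then P m else \<zero>)"
    proof (cases "m = {#}")
      case True then show ?thesis using P by (auto simp: J_def)
    next
      case False
      then obtain t where "t \<in># m" by (metis multiset_nonemptyE)
      then show ?thesis using pset_support[OF J_PC[OF P]] by (metis lessThan_iff subsetD)
    qed
    then show "P m = (\<Oplus>\<^bsub>Q\<^esub>i\<in>{..<e}. xv i \<otimes>\<^bsub>Q\<^esub> strip P i) m" using sum_strip[OF J_PC[OF P] order_refl] by simp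
  qed
  then show "P \<in> mmul (self_module Q) xv e (J j)" unfolding mmul_self_Q using strip_J[OF P] by auto
qed

lemma mmk_J: "(mmul (self_module Q) xv e ^^ j) PC = J j"
  by (induction j) (simp_all add: J_0 mm_J)

lemma var_ideal_Q: "var_ideal Q xv e = J 1"
  unfolding var_ideal_def using mmk_J[of 1] by simp

text \<open>Outside the ideal of the variables the constant term is a nonzero scalar, and
  multiplication by its inverse makes it 1.\<close>

lemma mring_Q: "mring Q xv e"
proof (intro mring.intro mring_axioms.intro cring_Q)
  show "i < e \<Longrightarrow> xv i \<in> PC" for i by (rule var_PC)
  show "\<one>\<^bsub>Q\<^esub> \<notin> var_ideal Q xv e" unfolding var_ideal_Q by (auto simp: J_def Q_simps(3) indexed_const_def)
  fix P assume P: "P \<in> PC" "P \<notin> var_ideal Q xv e"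
  then have nz: "P {#} \<noteq> \<zero>" unfolding var_ideal_Q by (auto simp: J_def)
  have c: "P {#} \<in> carrier K" by (rule pset_coeff[OF P(1)])
  define k where "k = inv (P {#})"
  have k: "k \<in> carrier K" "P {#} \<otimes> k = \<one>" using nz c field_Units unfolding k_def by (auto intro: Units_r_inv)
  interpret Q: cring Q by (rule cring_Q)
  have kc: "indexed_const k \<in> PC" by (rule const_PC[OF k(1)])
  have Pk: "P \<otimes>\<^bsub>Q\<^esub> indexed_const k \<in> PC" using P kc by simp
  have val: "(P \<otimes>\<^bsub>Q\<^esub> indexed_const k) m = k \<otimes> P m" for m
    using Q.m_comm[OF P(1) kc] pmul_const[OF k(1) pset_coeff[OF P(1)]] by (simp add: Q_simps(1))
  define C where "C = P \<otimes>\<^bsub>Q\<^esub> indexed_const k \<ominus>\<^bsub>Q\<^esub> \<one>\<^bsub>Q\<^esub>"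
  have Cc: "C \<in> PC" unfolding C_def using Pk by simp
  have e1: "P \<otimes>\<^bsub>Q\<^esub> indexed_const k = \<one>\<^bsub>Q\<^esub> \<oplus>\<^bsub>Q\<^esub> C"
    unfolding C_def using Pk Q.a_comm[of _ "\<ominus>\<^bsub>Q\<^esub> \<one>\<^bsub>Q\<^esub>"] by (simp add: a_minus_def Q.r_neg2)
  then have "k \<otimes> P {#} = \<one> \<oplus> C {#}" using val[of "{#}"] by (simp add: Q_simps(2,3) indexed_padd_def indexed_const_def)
  then have "\<one> \<oplus> C {#} = \<one>" using k c by (simp add: m_comm)
  then have "C {#} = \<zero>" using pset_coeff[OF Cc] by simp
  then have "C \<in> J 1" using Cc by (auto simp: J_def)
  then show "\<exists>b\<in>PC. \<exists>c\<in>var_ideal Q xv e. P \<otimes>\<^bsub>Q\<^esub> b = \<one>\<^bsub>Q\<^esub> \<oplus>\<^bsub>Q\<^esub> c"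
    unfolding var_ideal_Q using e1 kc by blast
qed

text \<open>\<open>T S\<close> admits in degree j only the monomials of S. Enlarging S by one
  monomial adds one simple factor, because each variable raises the degree beyond j.\<close>

lemma hilb_Q: "mlen Q xv e (self_module Q) (J (Suc j)) (J j) (numm e j)"
proof -
  interpret M: lmod Q xv e "self_module Q" by (rule mring.lmod_self[OF mring_Q])
  define T where "T = (\<lambda>S. {P \<in> J j. \<forall>\<mu>\<in>monoms e j - S. P \<mu> = \<zero>})"
  have TI: "submodule Q (T S) (self_module Q)" for S
  proof (rule idl_Q_I)
    note Jm = idl_Q_I
    show "T S \<subseteq> PC" using J_PC by (auto simp: T_def)
    show "(\<lambda>_. \<zero>) \<in> T S" using zero_PC by (auto simp: T_def J_def)
    show "indexed_padd P R \<in> T S" if "P \<in> T S" "R \<in> T S" for P R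
      using that add_PC by (auto simp: T_def J_def indexed_padd_def)
    show "(\<lambda>m. k \<otimes> P m) \<in> T S" if k: "k \<in> carrier K" and P: "P \<in> T S" for k P
    proof -
      have PP: "P \<in> PC" using P J_PC by (auto simp: T_def)
      have "(\<lambda>m. k \<otimes> P m) \<in> PC"
        using pmul_PC[OF const_PC[OF k] PP] pmul_const[OF k pset_coeff[OF PP]] by simp
      then show ?thesis using k P by (auto simp: T_def J_def)
    qed
    show "indexed_pmult P i \<in> T S" if i: "i < e" and P: "P \<in> T S" for i P
    proof -
      have "P \<in> J j" using P by (simp add: T_def)
      then have 1: "indexed_pmult P i \<in> J (Suc j)" using var_J[OF i] var_mul[OF J_PC] by metis
      then show ?thesis by (auto simp: T_def J_def monoms_def)
    qed
  qed
  have "mlen Q xv e (self_module Q) (J (Suc j)) (T S) (card S)" if "finite S" "S \<subseteq> monoms e j" for S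
    using that
  proof (induction S)
    case empty
    have "T {} = J (Suc j)"
    proof (intro subset_antisym subsetI)
      fix P assume P: "P \<in> T {}"
      have "P m = \<zero>" if "size m < Suc j" for m
      proof (rule ccontr)
        assume nz: "P m \<noteq> \<zero>"
        then have "set_mset m \<subseteq> {..<e}" using P pset_support[OF J_PC, of P j] by (auto simp: T_def)
        moreover have "size m = j" using nz P that by (auto simp: T_def J_def less_Suc_eq)
        ultimately show False using nz P by (auto simp: T_def monoms_def)
      qed
      then show "P \<in> J (Suc j)" using P by (auto simp: T_def J_def)
    qed (auto simp: T_def J_def monoms_def)
    then show ?case using mlen.mlen_refl[OF TI[of "{}"]] by simp
  next
    case (insert \<mu> S)
    have \<mu>: "\<mu> \<in> monoms e j" "set_mset \<mu> \<subseteq> {..<e}" "size \<mu> = j" using insert.prems by (auto simp: monoms_def)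
    have mP: "mon \<mu> \<in> PC" unfolding mon_def by (rule mon_PC[OF \<mu>(2) one_closed])
    have mJ: "mon \<mu> \<in> J j" using mP \<mu>(3) by (auto simp: J_def mon_def)
    have mT: "mon \<mu> \<in> T (insert \<mu> S)" using mJ by (auto simp: T_def mon_def)
    have len: "mlen Q xv e (self_module Q) (J (Suc j)) (T S <+>\<^bsub>self_module Q\<^esub> cyc Q (self_module Q) (mon \<mu>)) (Suc (card S))"
    proof (rule mlen.mlen_step[OF insert.IH])
      show "S \<subseteq> monoms e j" using insert.prems by simp
      show "mon \<mu> \<in> carrier (self_module Q)" using mP by (simp add: self_module_def)
      show "mon \<mu> \<notin> T S" using \<mu>(1) insert.hyps(2) by (auto simp: T_def mon_def)
      show "xv i \<odot>\<^bsub>self_module Q\<^esub> mon \<mu> \<in> T S" if i: "i < e" for i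
      proof -
        have "xv i \<otimes>\<^bsub>Q\<^esub> mon \<mu> \<in> J (Suc j)" by (rule var_J[OF i mJ])
        then show ?thesis by (auto simp: T_def J_def monoms_def self_module_def)
      qed
    qed
    have "T S <+>\<^bsub>self_module Q\<^esub> cyc Q (self_module Q) (mon \<mu>) = T (insert \<mu> S)"
    proof (rule subset_antisym)
      show "T S <+>\<^bsub>self_module Q\<^esub> cyc Q (self_module Q) (mon \<mu>) \<subseteq> T (insert \<mu> S)"
        by (rule M.add_least[OF TI _ M.cyc_least[OF TI mT]]) (auto simp: T_def)
      show "T (insert \<mu> S) \<subseteq> T S <+>\<^bsub>self_module Q\<^esub> cyc Q (self_module Q) (mon \<mu>)"
      proof
        fix P assume P: "P \<in> T (insert \<mu> S)"
        have PP: "P \<in> PC" using P J_PC by (auto simp: T_def)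
        have Pm: "P \<mu> \<in> carrier K" by (rule pset_coeff[OF PP])
        define R where "R = (\<lambda>m. if m = \<mu> then \<zero> else P m)"
        have "finite {m. R m \<noteq> \<zero>}" by (rule finite_subset[OF _ conjunct1[OF pset_support[OF PP]]]) (auto simp: R_def)
        then have "R \<in> PC" using pset_coeff[OF PP] pset_support[OF PP]
          by (intro PC_I) (auto simp: R_def split: if_splits)
        then have RT: "R \<in> T S" using P by (auto simp: T_def J_def R_def)
        have "indexed_const (P \<mu>) \<otimes>\<^bsub>Q\<^esub> mon \<mu> = (\<lambda>m. P \<mu> \<otimes> mon \<mu> m)"
          unfolding Q_simps(1) by (rule pmul_const[OF Pm pset_coeff[OF mP]])
        then have "P = R \<oplus>\<^bsub>Q\<^esub> (indexed_const (P \<mu>) \<otimes>\<^bsub>Q\<^esub> mon \<mu>)"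
          using Pm pset_coeff[OF PP] by (auto simp: Q_simps(2) indexed_padd_def R_def mon_def)
        moreover have "indexed_const (P \<mu>) \<otimes>\<^bsub>Q\<^esub> mon \<mu> \<in> cyc Q (self_module Q) (mon \<mu>)"
          using const_PC[OF Pm] by (auto simp: cyc_def self_module_def)
        ultimately show "P \<in> T S <+>\<^bsub>self_module Q\<^esub> cyc Q (self_module Q) (mon \<mu>)"
          unfolding M.mem_add using RT by (auto simp: self_module_def)
      qed
    qed
    then show ?case using len insert.hyps by simp
  qed
  from this[OF finite_monoms subset_refl] show ?thesis by (simp add: T_def numm_def)
qed

text \<open>The point is \<open>colon\<close>. Stripping \<open>c k\<close> of the variables below k
  gives the coefficients; the remainder consists of the monomials of \<open>c k\<close> in which no
  variable below k occurs. Comparison of coefficients in the given relation shows that the remainder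
  has order N.\<close>

lemma kosz_Q: assumes "e \<ge> 1" shows "kosz Q xv e (numm e)"
proof (intro kosz.intro mring_Q kosz_axioms.intro)
  interpret Q: cring Q by (rule cring_Q)
  show "mlen Q xv e (self_module Q) ((mmul (self_module Q) xv e ^^ Suc j) PC) ((mmul (self_module Q) xv e ^^ j) PC) (numm e j)" for j
    unfolding mmk_J by (rule hilb_Q)
  show "\<exists>N>1. q * (\<Sum>j<N + d. numm e j) < (q + 1) * (\<Sum>j<N. numm e j)" for q d
    by (rule numm_growth[OF assms])
  fix k c m N
  assume k: "k < e" and c: "\<And>i. i \<le> k \<Longrightarrow> c i \<in> (mmul (self_module Q) xv e ^^ Suc m) PC"
    and s: "(\<Oplus>\<^bsub>Q\<^esub>i\<in>{..k}. xv i \<otimes>\<^bsub>Q\<^esub> c i) \<in> (mmul (self_module Q) xv e ^^ Suc N) PC"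
  have cJ: "c i \<in> J (Suc m)" if "i \<le> k" for i using c[OF that] unfolding mmk_J .
  have cP: "c i \<in> PC" if "i \<le> k" for i using cJ[OF that] by (rule J_PC)
  have s': "(\<Oplus>\<^bsub>Q\<^esub>i\<in>{..k}. xv i \<otimes>\<^bsub>Q\<^esub> c i) \<in> J (Suc N)" using s unfolding mmk_J .
  define r where "r = (\<lambda>m. if \<exists>t\<in>#m. t < k then \<zero> else c k m)"
  have "finite {m. r m \<noteq> \<zero>}"
    by (rule finite_subset[OF _ conjunct1[OF pset_support[OF cP[OF order_refl]]]]) (auto simp: r_def)
  then have rP: "r \<in> PC" using pset_coeff[OF cP[OF order_refl]] pset_support[OF cP[OF order_refl]]
    by (intro PC_I) (auto simp: r_def split: if_splits)
  have "r \<mu> = \<zero>" if \<mu>: "size \<mu> < N" for \<mu>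
  proof (cases "\<exists>t\<in>#\<mu>. t < k")
    case False
    have ci: "(\<lambda>i. c i \<mu>) \<in> {..k} \<rightarrow> carrier K" by (rule Pi_I) (rule pset_coeff[OF cP], simp)
    have "(if k = i then c i \<mu> else \<zero>) \<in> carrier K" for i
      by (cases "k = i") (use pset_coeff[OF cP[OF order_refl]] in auto)
    then have ckP: "(\<lambda>i. if k = i then c i \<mu> else \<zero>) \<in> {..k} \<rightarrow> carrier K" by (rule Pi_I)
    have "xv i \<otimes>\<^bsub>Q\<^esub> c i \<in> PC" if "i \<in> {..k}" for i
      by (rule Q.m_closed[OF var_PC cP]) (use that k in simp_all)
    then have "(\<Oplus>\<^bsub>Q\<^esub>i\<in>{..k}. xv i \<otimes>\<^bsub>Q\<^esub> c i) (add_mset k \<mu>) = (\<Oplus>i\<in>{..k}. (xv i \<otimes>\<^bsub>Q\<^esub> c i) (add_mset k \<mu>))"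
      by (rule finsum_Q_apply[OF finite_atMost])
    \<comment> \<open>At \<open>add_mset k \<mu>\<close>, where no variable of \<mu> is below k, the
      summands with i < k vanish, because their variable does not divide this monomial.\<close>
    also have "\<dots> = (\<Oplus>i\<in>{..k}. if k = i then c i \<mu> else \<zero>)"
    proof (rule finsum_cong')
      fix i assume "i \<in> {..k}"
      then have i: "i \<le> k" by simp
      have vm: "(xv i \<otimes>\<^bsub>Q\<^esub> c i) (add_mset k \<mu>) = (if i \<in># add_mset k \<mu> then c i (add_mset k \<mu> - {#i#}) else \<zero>)"
        unfolding var_mul[OF cP[OF i]] indexed_pmult_def ..
      show "(xv i \<otimes>\<^bsub>Q\<^esub> c i) (add_mset k \<mu>) = (if k = i then c i \<mu> else \<zero>)"
      proof (cases "i = k")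
        case True
        then show ?thesis unfolding vm by simp
      next
        case ne: False
        have "i \<notin># \<mu>"
        proof
          assume "i \<in># \<mu>"
          then have "\<not> i < k" using False by blast
          then show False using i ne by simp
        qed
        then show ?thesis unfolding vm using ne by simp
      qed
    qed (rule refl ckP)+
    also have "\<dots> = c k \<mu>" by (rule finsum_singleton[OF _ _ ci]) simp_all
    finally have "(\<Oplus>\<^bsub>Q\<^esub>i\<in>{..k}. xv i \<otimes>\<^bsub>Q\<^esub> c i) (add_mset k \<mu>) = c k \<mu>" .
    moreover have "(\<Oplus>\<^bsub>Q\<^esub>i\<in>{..k}. xv i \<otimes>\<^bsub>Q\<^esub> c i) (add_mset k \<mu>) = \<zero>"
      using s' \<mu> unfolding J_def by simp
    ultimately show ?thesis using False unfolding r_def by metis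
  qed (simp add: r_def)
  then have rJ: "r \<in> J N" using rP by (simp add: J_def)
  have "c k = (\<Oplus>\<^bsub>Q\<^esub>j\<in>{..<k}. xv j \<otimes>\<^bsub>Q\<^esub> strip (c k) j) \<oplus>\<^bsub>Q\<^esub> r"
    using sum_strip[OF cP[OF order_refl] less_imp_le[OF k]] pset_coeff[OF cP[OF order_refl]]
    by (auto simp: Q_simps(2) indexed_padd_def r_def fun_eq_iff)
  then show "\<exists>a r. (\<forall>j<k. a j \<in> (mmul (self_module Q) xv e ^^ m) PC) \<and>
        r \<in> (mmul (self_module Q) xv e ^^ N) PC \<and> c k = (\<Oplus>\<^bsub>Q\<^esub>j\<in>{..<k}. xv j \<otimes>\<^bsub>Q\<^esub> a j) \<oplus>\<^bsub>Q\<^esub> r"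
    unfolding mmk_J using strip_J[OF cJ[OF order_refl]] rJ by blast
qed

end

section \<open>Truncations of the polynomial ring\<close>

text \<open>The exponent n of the theorem is \<open>Suc m\<close>. The quotient is described by a
  surjection with the right kernel, so that the quotient of A by a power of its irrelevant ideal can
  be inserted without first being rewritten as a quotient of Q.\<close>

locale trunc = Q: kosz Q xq e h + R: cring R
  for Q :: "('q, 'z) ring_scheme" and xq e h and R :: "('r, 'y) ring_scheme" +
  fixes \<psi> :: "'q \<Rightarrow> 'r" and m :: nat
  assumes hom: "\<psi> \<in> ring_hom Q R" and surj: "\<psi> ` carrier Q = carrier R"
    and ker: "\<And>a. a \<in> carrier Q \<Longrightarrow> \<psi> a = \<zero>\<^bsub>R\<^esub> \<longleftrightarrow> a \<in> Q.Ipow (Suc m)"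
begin

definition y :: "nat \<Rightarrow> 'r" where "y i = \<psi> (xq i)"

lemma psi_simps: "a \<in> carrier Q \<Longrightarrow> \<psi> a \<in> carrier R" "\<lbrakk> a \<in> carrier Q; b \<in> carrier Q \<rbrakk> \<Longrightarrow> \<psi> (a \<otimes>\<^bsub>Q\<^esub> b) = \<psi> a \<otimes>\<^bsub>R\<^esub> \<psi> b"
  "\<lbrakk> a \<in> carrier Q; b \<in> carrier Q \<rbrakk> \<Longrightarrow> \<psi> (a \<oplus>\<^bsub>Q\<^esub> b) = \<psi> a \<oplus>\<^bsub>R\<^esub> \<psi> b" "\<psi> \<one>\<^bsub>Q\<^esub> = \<one>\<^bsub>R\<^esub>" "\<psi> \<zero>\<^bsub>Q\<^esub> = \<zero>\<^bsub>R\<^esub>"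
  using ring_hom_memE[OF hom] ring_hom_zero[OF hom Q.ring_axioms R.ring_axioms] by auto

lemma y_closed: "i < e \<Longrightarrow> y i \<in> carrier R" unfolding y_def by (intro psi_simps Q.x_closed)

lemma self_Q: "finsum (self_module R') f I = finsum R' f I"
  unfolding finsum_def finprod_def self_module_def by simp

lemma psi_finsum: "\<lbrakk> finite A; f \<in> A \<rightarrow> carrier Q \<rbrakk> \<Longrightarrow> \<psi> (finsum Q f A) = finsum R (\<lambda>i. \<psi> (f i)) A"
proof (induction A rule: finite_induct)
  case (insert i A)
  then have "f \<in> A \<rightarrow> carrier Q" "f i \<in> carrier Q" "(\<lambda>i. \<psi> (f i)) \<in> A \<rightarrow> carrier R" "\<psi> (f i) \<in> carrier R"
    using psi_simps(1) by auto
  then show ?case using insert by (simp add: psi_simps)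
qed (simp add: psi_simps)

lemma var_alt:
  "var_ideal R' x' e' = {r. \<exists>f\<in>{..<e'} \<rightarrow> carrier R'. r = (\<Oplus>\<^bsub>R'\<^esub>i\<in>{..<e'}. x' i \<otimes>\<^bsub>R'\<^esub> f i)}"
  unfolding var_ideal_def mmul_def self_Q by (simp add: self_module_def)

lemma var_ideal_image: "var_ideal R y e = \<psi> ` var_ideal Q xq e"
proof (intro subset_antisym subsetI)
  have eq: "\<psi> (\<Oplus>\<^bsub>Q\<^esub>i\<in>{..<e}. xq i \<otimes>\<^bsub>Q\<^esub> g i) = (\<Oplus>\<^bsub>R\<^esub>i\<in>{..<e}. y i \<otimes>\<^bsub>R\<^esub> \<psi> (g i))" if g: "g \<in> {..<e} \<rightarrow> carrier Q" for g
  proof -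
    have gc: "\<And>i. i < e \<Longrightarrow> g i \<in> carrier Q" using g by auto
    have "\<psi> (\<Oplus>\<^bsub>Q\<^esub>i\<in>{..<e}. xq i \<otimes>\<^bsub>Q\<^esub> g i) = (\<Oplus>\<^bsub>R\<^esub>i\<in>{..<e}. \<psi> (xq i \<otimes>\<^bsub>Q\<^esub> g i))"
      by (rule psi_finsum) (use gc Q.x_closed in auto)
    also have "\<dots> = (\<Oplus>\<^bsub>R\<^esub>i\<in>{..<e}. y i \<otimes>\<^bsub>R\<^esub> \<psi> (g i))"
      by (rule R.finsum_cong') (use gc Q.x_closed psi_simps y_closed in \<open>auto simp: y_def\<close>)
    finally show ?thesis .
  qed
  {
    fix r assume "r \<in> var_ideal R y e"
    then obtain f where f: "f \<in> {..<e} \<rightarrow> carrier R" "r = (\<Oplus>\<^bsub>R\<^esub>i\<in>{..<e}. y i \<otimes>\<^bsub>R\<^esub> f i)" unfolding var_alt by blast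
    have "\<forall>i. \<exists>g. i < e \<longrightarrow> g \<in> carrier Q \<and> \<psi> g = f i" using f(1) surj by (metis (no_types, lifting) PiE image_iff lessThan_iff)
    then obtain g where g: "\<And>i. i < e \<Longrightarrow> g i \<in> carrier Q" "\<And>i. i < e \<Longrightarrow> \<psi> (g i) = f i" by metis
    have gP: "g \<in> {..<e} \<rightarrow> carrier Q" using g by auto
    have fc: "\<And>i. i < e \<Longrightarrow> f i \<in> carrier R" using f(1) by auto
    have "r = \<psi> (\<Oplus>\<^bsub>Q\<^esub>i\<in>{..<e}. xq i \<otimes>\<^bsub>Q\<^esub> g i)"
      unfolding eq[OF gP] f(2) by (rule R.finsum_cong') (use fc y_closed g in auto)
    then show "r \<in> \<psi> ` var_ideal Q xq e" unfolding var_alt using gP by blast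
  }
  fix r assume "r \<in> \<psi> ` var_ideal Q xq e"
  then obtain g where g: "g \<in> {..<e} \<rightarrow> carrier Q" "r = \<psi> (\<Oplus>\<^bsub>Q\<^esub>i\<in>{..<e}. xq i \<otimes>\<^bsub>Q\<^esub> g i)" unfolding var_alt by blast
  have "(\<lambda>i. \<psi> (g i)) \<in> {..<e} \<rightarrow> carrier R" using g(1) psi_simps(1) by auto
  moreover have "r = (\<Oplus>\<^bsub>R\<^esub>i\<in>{..<e}. y i \<otimes>\<^bsub>R\<^esub> \<psi> (g i))" using g(2) eq[OF g(1)] by simp
  ultimately show "r \<in> var_ideal R y e" unfolding var_alt by (intro CollectI bexI[where x="\<lambda>i. \<psi> (g i)"])
qed

lemma Ipow_1: "Q.Ipow 1 = var_ideal Q xq e" by (simp only: Q.Ipow_def var_ideal_def One_nat_def funpow.simps comp_apply id_apply)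

lemma Ipow_carrier: "Q.Ipow j \<subseteq> carrier Q" by (rule Q.idlD(1)[OF Q.Ipow_idl])

lemma ker_var: "\<lbrakk> a \<in> carrier Q; \<psi> a = \<zero>\<^bsub>R\<^esub> \<rbrakk> \<Longrightarrow> a \<in> var_ideal Q xq e"
  using ker[of a] lmod.mmk_antimono[OF Q.lmod_self Q.idl_carrier, of 1 "Suc m"]
  by (auto simp: Ipow_1[symmetric] Q.Ipow_def)

text \<open>The kernel of \<psi> lies in the ideal of the variables, so membership in that ideal can
  be tested after reduction.\<close>

lemma psi_var_iff: assumes "a \<in> carrier Q" "\<psi> a \<in> var_ideal R y e" shows "a \<in> var_ideal Q xq e"
proof -
  obtain b where b: "b \<in> var_ideal Q xq e" "\<psi> a = \<psi> b" using assms(2) var_ideal_image by auto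
  have bc: "b \<in> carrier Q" using Q.idlD(1)[OF Q.idl_var] b(1) by blast
  interpret S: lmod Q xq e "self_module Q" by (rule Q.lmod_self)
  have ab: "a = b \<oplus>\<^bsub>Q\<^esub> (a \<ominus>\<^bsub>Q\<^esub> b)" using assms(1) bc by (simp add: a_minus_def Q.a_lcomm Q.r_neg)
  have c: "a \<ominus>\<^bsub>Q\<^esub> b \<in> carrier Q" using assms(1) bc by simp
  have "\<psi> b \<oplus>\<^bsub>R\<^esub> \<psi> (a \<ominus>\<^bsub>Q\<^esub> b) = \<psi> b" using psi_simps(3)[OF bc c] ab b(2) by simp
  then have "\<psi> (a \<ominus>\<^bsub>Q\<^esub> b) = \<zero>\<^bsub>R\<^esub>" using psi_simps(1)[OF bc] psi_simps(1)[OF c] by simp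
  then have "a \<ominus>\<^bsub>Q\<^esub> b \<in> var_ideal Q xq e" using ker_var c by blast
  then show ?thesis using Q.idlD(3)[OF Q.idl_var b(1)] ab by force
qed

lemma mring_R: "mring R y e"
proof (intro mring.intro mring_axioms.intro R.cring_axioms y_closed)
  show "\<one>\<^bsub>R\<^esub> \<notin> var_ideal R y e"
    using psi_var_iff[of "\<one>\<^bsub>Q\<^esub>"] Q.one_notin psi_simps(4) by auto
  fix a assume a: "a \<in> carrier R" "a \<notin> var_ideal R y e"
  obtain a' where a': "a' \<in> carrier Q" "a = \<psi> a'" using a(1) surj by blast
  have "a' \<notin> var_ideal Q xq e" using a(2) a'(2) var_ideal_image by blast
  then obtain b c where bc: "b \<in> carrier Q" "c \<in> var_ideal Q xq e" "a' \<otimes>\<^bsub>Q\<^esub> b = \<one>\<^bsub>Q\<^esub> \<oplus>\<^bsub>Q\<^esub> c"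
    using Q.inv_mod a'(1) by blast
  have cc: "c \<in> carrier Q" using bc(2) Q.idlD(1)[OF Q.idl_var] by blast
  have "a \<otimes>\<^bsub>R\<^esub> \<psi> b = \<one>\<^bsub>R\<^esub> \<oplus>\<^bsub>R\<^esub> \<psi> c"
    using arg_cong[OF bc(3), of \<psi>] psi_simps(2)[OF a'(1) bc(1)] psi_simps(3)[OF Q.one_closed cc] psi_simps(4) a'(2) by simp
  then show "\<exists>b\<in>carrier R. \<exists>c\<in>var_ideal R y e. a \<otimes>\<^bsub>R\<^esub> b = \<one>\<^bsub>R\<^esub> \<oplus>\<^bsub>R\<^esub> c"
    using psi_simps(1)[OF bc(1)] bc(2) var_ideal_image by blast
qed

lemma slin_psi: "slin Q xq e (self_module Q) R y (self_module R) \<psi> \<psi> (carrier Q)"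
  by (intro slin.intro slin_axioms.intro Q.lmod_self mring.lmod_self[OF mring_R] Q.idl_carrier surj)
    (simp_all add: self_module_def psi_simps y_def)

lemma image_Ipow: "\<psi> ` Q.Ipow j = (mmul (self_module R) y e ^^ j) (carrier R)"
proof (induction j)
  case 0 then show ?case by (simp add: Q.Ipow_def surj)
next
  case (Suc j)
  interpret slin Q xq e "self_module Q" R y "self_module R" \<psi> \<psi> "carrier Q" by (rule slin_psi)
  show ?case using image_mm[OF Q.Ipow_idl Ipow_carrier, of j] Suc by (simp add: Q.Ipow_def)
qed

lemma image_ker: "\<psi> ` Q.Ipow (Suc m) = {\<zero>\<^bsub>R\<^esub>}"
proof -
  have "\<zero>\<^bsub>Q\<^esub> \<in> Q.Ipow (Suc m)" by (rule Q.idlD(2)[OF Q.Ipow_idl])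
  then have 1: "\<zero>\<^bsub>R\<^esub> \<in> \<psi> ` Q.Ipow (Suc m)" by (rule rev_image_eqI) (simp add: psi_simps)
  have "\<psi> a = \<zero>\<^bsub>R\<^esub>" if a: "a \<in> Q.Ipow (Suc m)" for a
    using a ker[OF subsetD[OF Ipow_carrier a]] by simp
  then have "\<psi> ` Q.Ipow (Suc m) \<subseteq> {\<zero>\<^bsub>R\<^esub>}" by auto
  with 1 show ?thesis by auto
qed

lemma len_Ipow_image: assumes "mlen Q xq e (self_module Q) (Q.Ipow (Suc m)) (Q.Ipow j) k"
  shows "mlen R y e (self_module R) {\<zero>\<^bsub>R\<^esub>} (\<psi> ` Q.Ipow j) k"
proof -
  interpret slin Q xq e "self_module Q" R y "self_module R" \<psi> \<psi> "carrier Q" by (rule slin_psi)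
  have z: "\<zero>\<^bsub>self_module R\<^esub> = \<zero>\<^bsub>R\<^esub>" by (simp add: self_module_def)
  have eq: "{u \<in> carrier Q. \<psi> u \<in> {\<zero>\<^bsub>R\<^esub>}} = Q.Ipow (Suc m)" using ker Ipow_carrier by blast
  have im: "submodule R (\<psi> ` Q.Ipow j) (self_module R)" by (rule sub_image[OF Q.Ipow_idl Ipow_carrier])
  have Z: "submodule R {\<zero>\<^bsub>R\<^esub>} (self_module R)" using N.sub_zero z by simp
  have "mlen R y e (self_module R) {\<zero>\<^bsub>R\<^esub>} (\<psi> ` Q.Ipow j <+>\<^bsub>self_module R\<^esub> {\<zero>\<^bsub>R\<^esub>}) k"
    by (rule len_image[OF Z _ Ipow_carrier]) (simp only: eq assms)
  moreover have "\<psi> ` Q.Ipow j <+>\<^bsub>self_module R\<^esub> {\<zero>\<^bsub>R\<^esub>} = \<psi> ` Q.Ipow j"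
    by (rule N.add_absorb(2)[OF Z im]) (use N.subD(3)[OF im] z in simp)
  ultimately show ?thesis by simp
qed

lemma len_Ipow_top: "mlen Q xq e (self_module Q) (Q.Ipow N) (carrier Q) (Q.ell N)"
proof (induction N)
  case 0
  show ?case using mlen.mlen_refl[OF Q.idl_carrier, of xq e] by (simp add: Q.Ipow_def)
next
  case (Suc N)
  have "mlen Q xq e (self_module Q) (Q.Ipow (Suc N)) (Q.Ipow N) (h N)" unfolding Q.Ipow_def by (rule Q.hilb)
  from lmod.len_trans[OF Q.lmod_self Suc this] show ?case by (simp add: add.commute)
qed

text \<open>Since \<psi> kills exactly order m + 1, the image of order m has the length of a single
  graded piece. It acts as the socle in the estimates for Betti numbers.\<close>

lemma len_soc: "mlen R y e (self_module R) {\<zero>\<^bsub>R\<^esub>} ((mmul (self_module R) y e ^^ m) (carrier R)) (h m)"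
proof -
  have "mlen Q xq e (self_module Q) (Q.Ipow (Suc m)) (Q.Ipow m) (h m)" unfolding Q.Ipow_def by (rule Q.hilb)
  from len_Ipow_image[OF this] show ?thesis unfolding image_Ipow .
qed

lemma artin_R: "artin R y e (Suc m) (Q.ell (Suc m))"
proof (intro artin.intro mring_R artin_axioms.intro)
  show "(mmul (self_module R) y e ^^ Suc m) (carrier R) = {\<zero>\<^bsub>R\<^esub>}" unfolding image_Ipow[symmetric] by (rule image_ker)
  have "mlen Q xq e (self_module Q) (Q.Ipow (Suc m)) (Q.Ipow 0) (Q.ell (Suc m))"
    using len_Ipow_top[of "Suc m"] by (simp add: Q.Ipow_def)
  from len_Ipow_image[OF this] show "mlen R y e (self_module R) {\<zero>\<^bsub>R\<^esub>} (carrier R) (Q.ell (Suc m))"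
    unfolding image_Ipow by simp
qed

sublocale R: artin R y e "Suc m" "Q.ell (Suc m)" by (rule artin_R)

definition proj :: "nat \<Rightarrow> (nat \<Rightarrow> 'q) \<Rightarrow> nat \<Rightarrow> 'r" where "proj p c = (\<lambda>i\<in>{..<p}. \<psi> (c i))"

lemma proj_slin: "slin Q xq e (Q.Fr p) R y (R.Fr p) \<psi> (proj p) (Q.Fc p)"
proof (intro slin.intro slin_axioms.intro Q.lmod_Fr R.lmod_Fr lmod.sub_carrier[OF Q.lmod_Fr] surj)
  show "proj p u \<in> R.Fc p" if "u \<in> Q.Fc p" for u
    using Q.Fr_closed[OF that] psi_simps(1) by (auto simp: proj_def R.Fr_simps)
  show "proj p (u \<oplus>\<^bsub>Q.Fr p\<^esub> v) = proj p u \<oplus>\<^bsub>R.Fr p\<^esub> proj p v" if "u \<in> Q.Fc p" "v \<in> Q.Fc p" for u v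
    using Q.Fr_closed[OF that(1)] Q.Fr_closed[OF that(2)] psi_simps(3)
    unfolding proj_def Q.Fr_simps R.Fr_simps by (intro restrict_ext) simp
  show "proj p (r \<odot>\<^bsub>Q.Fr p\<^esub> u) = \<psi> r \<odot>\<^bsub>R.Fr p\<^esub> proj p u" if "r \<in> carrier Q" "u \<in> Q.Fc p" for r u
    using Q.Fr_closed[OF that(2)] that(1) psi_simps(2)
    unfolding proj_def Q.Fr_simps R.Fr_simps by (intro restrict_ext) simp
qed (simp add: y_def)

lemma proj_surj: "proj p ` Q.Fc p = R.Fc p"
proof (intro subset_antisym subsetI)
  interpret slin Q xq e "Q.Fr p" R y "R.Fr p" \<psi> "proj p" "Q.Fc p" by (rule proj_slin)
  show "c \<in> R.Fc p" if "c \<in> proj p ` Q.Fc p" for c using that a_closed by blast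
  fix c assume c: "c \<in> R.Fc p"
  have "\<forall>i. \<exists>g. i < p \<longrightarrow> g \<in> carrier Q \<and> \<psi> g = c i" using R.Fr_closed[OF c] surj by (metis image_iff)
  then obtain g where g: "\<And>i. i < p \<Longrightarrow> g i \<in> carrier Q" "\<And>i. i < p \<Longrightarrow> \<psi> (g i) = c i" by metis
  have "restrict g {..<p} \<in> Q.Fc p" using g(1) by (auto simp: Q.Fr_simps)
  moreover have "proj p (restrict g {..<p}) = c"
    by (rule R.Fr_eqI[OF a_closed c]) (use calculation g(2) in \<open>auto simp: proj_def\<close>)
  ultimately show "c \<in> proj p ` Q.Fc p" by blast
qed

lemma proj_zero: "c \<in> Q.Fc p \<Longrightarrow> proj p c = \<zero>\<^bsub>R.Fr p\<^esub> \<longleftrightarrow> c \<in> Q.Fm (Suc m) p"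
proof -
  assume c: "c \<in> Q.Fc p"
  have "proj p c = \<zero>\<^bsub>R.Fr p\<^esub> \<longleftrightarrow> (\<forall>i<p. \<psi> (c i) = \<zero>\<^bsub>R\<^esub>)"
    unfolding proj_def R.Fr_simps by (metis (no_types, lifting) lessThan_iff restrict_apply' restrict_ext)
  then show ?thesis using ker Q.Fr_closed[OF c] c by (auto simp: Q.Fm_def Q.pw_def)
qed

lemma proj_eq: assumes "u \<in> Q.Fc p" "w \<in> Q.Fc p" "proj p u = proj p w"
  obtains z where "z \<in> Q.Fm (Suc m) p" "u = w \<oplus>\<^bsub>Q.Fr p\<^esub> z"
proof -
  interpret slin Q xq e "Q.Fr p" R y "R.Fr p" \<psi> "proj p" "Q.Fc p" by (rule proj_slin)
  have c: "u \<ominus>\<^bsub>Q.Fr p\<^esub> w \<in> Q.Fc p" by (rule M.M.minus_closed[OF assms(1,2)])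
  have "proj p (u \<ominus>\<^bsub>Q.Fr p\<^esub> w) = \<zero>\<^bsub>R.Fr p\<^esub>"
    using a_minus[OF assms(1,2)] a_closed[OF assms(2)] assms(3) by simp
  then have "u \<ominus>\<^bsub>Q.Fr p\<^esub> w \<in> Q.Fm (Suc m) p" using proj_zero[OF c] by simp
  moreover have "u = w \<oplus>\<^bsub>Q.Fr p\<^esub> (u \<ominus>\<^bsub>Q.Fr p\<^esub> w)" using M.add_minus[OF assms(2,1)] by simp
  ultimately show ?thesis by (rule that)
qed

lemma proj_mmk: "proj p ` Q.Fm j p = (mmul (R.Fr p) y e ^^ j) (R.Fc p)"
proof (induction j)
  case 0 then show ?case by (simp add: Q.Fm_0 proj_surj)
next
  case (Suc j)
  interpret slin Q xq e "Q.Fr p" R y "R.Fr p" \<psi> "proj p" "Q.Fc p" by (rule proj_slin)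
  show ?case using image_mm[OF Q.Fm_sub Q.Fm_Fc, of j] Suc by (simp add: Q.mm_Fm)
qed

text \<open>The columns of \<phi> are lifted along \<psi> to a matrix \<Phi> over Q, and
  \<open>betti_growth\<close> is applied to \<Phi>. The kernel of \<phi> is the reduction of
  \<open>Zn (Suc m)\<close>, and this reduction does not change the number of generators.\<close>

theorem betti_ineq:
  assumes \<phi>: "lin R (R.Fr p) (R.Fc p) (R.Fr q) (R.Fc q) \<phi>" "\<phi> ` R.Fc p \<subseteq> mmul (R.Fr q) y e (R.Fc q)"
    "(mmul (R.Fr q) y e ^^ m) (R.Fc q) \<subseteq> \<phi> ` R.Fc p"
    and k: "mlen R y e (R.Fr p) (mmul (R.Fr p) y e (R.krn p (R.Fr q) \<phi>)) (R.krn p (R.Fr q) \<phi>) k"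
  shows "q * h (Suc m) + p \<le> k + q"
proof -
  interpret P: slin Q xq e "Q.Fr p" R y "R.Fr p" \<psi> "proj p" "Q.Fc p" by (rule proj_slin)
  interpret S: slin Q xq e "Q.Fr q" R y "R.Fr q" \<psi> "proj q" "Q.Fc q" by (rule proj_slin)
  have "\<exists>v. v \<in> Q.Fc q \<and> proj q v = \<phi> (unit_vec R p i)" for i
    using linD(1)[OF \<phi>(1) R.unit_vec_closed[of p i]] proj_surj by (metis image_iff)
  then obtain v where v: "\<And>i. v i \<in> Q.Fc q" "\<And>i. proj q (v i) = \<phi> (unit_vec R p i)" by metis
  define \<Phi> where "\<Phi> = S.M.comb p v"
  have lin: "lin Q (Q.Fr p) (Q.Fc p) (Q.Fr q) (Q.Fc q) \<Phi>"
    unfolding \<Phi>_def by (rule S.M.comb_lin[OF S.M.sub_carrier v(1)])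
  have comm: "proj q (\<Phi> c) = \<phi> (proj p c)" if c: "c \<in> Q.Fc p" for c
  proof -
    note cc = Q.Fr_closed[OF c]
    have uc: "\<phi> (unit_vec R p i) \<in> R.Fc q" for i by (rule linD(1)[OF \<phi>(1) R.unit_vec_closed])
    have "proj q (\<Phi> c) = (\<Oplus>\<^bsub>R.Fr q\<^esub>i\<in>{..<p}. proj q (c i \<odot>\<^bsub>Q.Fr q\<^esub> v i))"
      unfolding \<Phi>_def S.M.comb_def by (rule S.a_finsum) (use cc v(1) in auto)
    also have "\<dots> = (\<Oplus>\<^bsub>R.Fr q\<^esub>i\<in>{..<p}. proj p c i \<odot>\<^bsub>R.Fr q\<^esub> \<phi> (unit_vec R p i))"
      by (rule S.N.M.finsum_cong') (use cc v S.a_smult psi_simps(1) uc in \<open>auto simp: proj_def\<close>)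
    also have "\<dots> = \<phi> (proj p c)"
      using S.N.lin_expand[OF \<phi>(1) subset_refl P.a_closed[OF c]] by (simp add: S.N.comb_def)
    finally show ?thesis .
  qed
  have Pc: "\<Phi> c \<in> Q.Fc q" if "c \<in> Q.Fc p" for c by (rule linD(1)[OF lin that])
  interpret Km: kmat Q xq e h p q m \<Phi>
  proof (intro kmat.intro kmat_axioms.intro Q.kosz_axioms lin)
    show "\<Phi> ` Q.Fc p \<subseteq> mmul (Q.Fr q) xq e (Q.Fc q)"
    proof
      fix z assume "z \<in> \<Phi> ` Q.Fc p"
      then obtain c where c: "c \<in> Q.Fc p" "z = \<Phi> c" by blast
      have "proj q z \<in> proj q ` mmul (Q.Fr q) xq e (Q.Fc q)"
        using S.image_mm[OF S.M.sub_carrier subset_refl] comm[OF c(1)] \<phi>(2) P.a_closed[OF c(1)] c(2)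
        unfolding proj_surj by blast
      then obtain w where w: "w \<in> mmul (Q.Fr q) xq e (Q.Fc q)" "proj q z = proj q w" by blast
      have wc: "w \<in> Q.Fc q" using w(1) S.M.mm_subset[OF S.M.sub_carrier] by blast
      obtain t where t: "t \<in> Q.Fm (Suc m) q" "z = w \<oplus>\<^bsub>Q.Fr q\<^esub> t"
        using proj_eq[OF Pc[OF c(1)] wc] w(2) c(2) by metis
      have "t \<in> mmul (Q.Fr q) xq e (Q.Fc q)"
        using t(1) Q.Fm_antimono[of 1 "Suc m" q] Q.mm_Fm[of q 0] by (auto simp: Q.Fm_0)
      then show "z \<in> mmul (Q.Fr q) xq e (Q.Fc q)"
        unfolding t(2) by (rule S.M.subD(4)[OF S.M.mm_sub[OF S.M.sub_carrier] w(1)])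
    qed
    \<comment> \<open>The inclusion holds only modulo order \<open>Suc m\<close>, as the images
      under \<phi> are known only after reduction.\<close>
    show "Q.Fm m q \<subseteq> \<Phi> ` Q.Fc p <+>\<^bsub>Q.Fr q\<^esub> Q.Fm (Suc m) q"
    proof
      fix t assume t: "t \<in> Q.Fm m q"
      have "proj q t \<in> \<phi> ` R.Fc p" using t proj_mmk \<phi>(3) by blast
      then obtain c where c: "c \<in> Q.Fc p" "proj q t = \<phi> (proj p c)" unfolding proj_surj[symmetric] by blast
      have "t \<in> Q.Fc q" using t Q.Fm_Fc by blast
      then obtain z where "z \<in> Q.Fm (Suc m) q" "t = \<Phi> c \<oplus>\<^bsub>Q.Fr q\<^esub> z"
        using proj_eq[OF _ Pc[OF c(1)]] comm[OF c(1)] c(2) by metis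
      then show "t \<in> \<Phi> ` Q.Fc p <+>\<^bsub>Q.Fr q\<^esub> Q.Fm (Suc m) q" unfolding S.M.mem_add using c(1) by blast
    qed
  qed
  let ?N = "R.krn p (R.Fr q) \<phi>" and ?Z = "Km.Zn (Suc m)"
  have Z: "z \<in> ?Z \<longleftrightarrow> z \<in> Q.Fc p \<and> proj p z \<in> ?N" for z
    using comm[of z] proj_zero[OF Pc, of z] P.a_closed[of z] by (auto simp: Km.Zn_def R.krn_def)
  have imZ: "proj p ` ?Z = ?N"
  proof (intro subset_antisym subsetI)
    show "c \<in> ?N" if "c \<in> proj p ` ?Z" for c using that Z by blast
    fix c assume c: "c \<in> ?N"
    then have "c \<in> proj p ` Q.Fc p" unfolding proj_surj by (simp add: R.krn_def)
    then show "c \<in> proj p ` ?Z" using c Z by blast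
  qed
  have ZFc: "?Z \<subseteq> Q.Fc p" using Z by blast
  have mZ: "P.M.sub (P.M.mm ?Z)" by (rule P.M.mm_sub[OF Km.Zn_sub])
  have immZ: "proj p ` P.M.mm ?Z = P.N.mm ?N" using P.image_mm[OF Km.Zn_sub ZFc] imZ by simp
  \<comment> \<open>Order m lies in \<open>?Z\<close> because the matrix is minimal. One more
    variable puts order m + 1, the kernel of the reduction, among the multiples of \<open>?Z\<close>
    by variables, so generators can be counted on either side.\<close>
  have FmZ: "Q.Fm (Suc m) p \<subseteq> P.M.mm ?Z"
    unfolding Q.mm_Fm[symmetric] by (rule P.M.mm_mono[OF Km.Fm_Zn])
  obtain k' where k': "P.M.len (P.M.mm ?Z) ?Z k'"
    using P.M.len_sub_ex[OF Q.len_Fm_top mZ Km.Zn_sub FmZ P.M.mm_subset[OF Km.Zn_sub] ZFc] by blast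
  have N: "P.N.sub ?N" unfolding imZ[symmetric] by (rule P.sub_image[OF Km.Zn_sub ZFc])
  have "P.N.len (P.N.mm ?N) ?N k'"
  proof (rule P.len_hom[OF k' ZFc _ P.N.mm_sub[OF N] P.N.mm_subset[OF N] N])
    show "P.M.mm ?Z = {u \<in> Q.Fc p. proj p u \<in> P.N.mm ?N}"
    proof (intro subset_antisym subsetI)
      fix u assume "u \<in> P.M.mm ?Z"
      then show "u \<in> {u \<in> Q.Fc p. proj p u \<in> P.N.mm ?N}" using immZ P.M.mm_subset[OF Km.Zn_sub] ZFc by blast
    next
      fix u assume u: "u \<in> {u \<in> Q.Fc p. proj p u \<in> P.N.mm ?N}"
      then obtain w where w: "w \<in> P.M.mm ?Z" "proj p u = proj p w" using immZ by blast
      have "w \<in> Q.Fc p" using w(1) P.M.mm_subset[OF Km.Zn_sub] ZFc by blast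
      then obtain z where z: "z \<in> Q.Fm (Suc m) p" "u = w \<oplus>\<^bsub>Q.Fr p\<^esub> z" using proj_eq[of u p w] u w(2) by blast
      show "u \<in> P.M.mm ?Z" unfolding z(2) by (rule P.M.subD(4)[OF mZ w(1)]) (use z(1) FmZ in blast)
    qed
    show "proj p ` ?Z \<subseteq> ?N" using imZ by simp
    fix t assume t: "t \<in> ?N"
    then obtain u where u: "u \<in> ?Z" "t = proj p u" using imZ by blast
    have "t = proj p u \<oplus>\<^bsub>R.Fr p\<^esub> \<zero>\<^bsub>R.Fr p\<^esub>" using u P.N.subD(2)[OF N t] by simp
    then show "\<exists>u\<in>?Z. \<exists>v\<in>P.N.mm ?N. t = proj p u \<oplus>\<^bsub>R.Fr p\<^esub> v"
      using u(1) P.N.subD(3)[OF P.N.mm_sub[OF N]] by blast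
  qed
  then have "k' = k" by (rule P.N.len_unique[OF _ k])
  then show ?thesis using Km.betti_growth[OF k'] by simp
qed

end

section \<open>Tor and Betti numbers\<close>

text \<open>The module structure of a quotient is transported along the projection.\<close>
lemma transport:
  assumes N: "lmod R x e N" "submodule R U N" and K: "mring K y e"
    and psi: "\<psi> ` carrier R = carrier K" "\<And>i. i < e \<Longrightarrow> \<psi> (x i) = y i"
      "\<And>r s. \<lbrakk> r \<in> carrier R; s \<in> carrier R \<rbrakk> \<Longrightarrow> \<psi> (r \<oplus>\<^bsub>R\<^esub> s) = \<psi> r \<oplus>\<^bsub>K\<^esub> \<psi> s"
      "\<And>r s. \<lbrakk> r \<in> carrier R; s \<in> carrier R \<rbrakk> \<Longrightarrow> \<psi> (r \<otimes>\<^bsub>R\<^esub> s) = \<psi> r \<otimes>\<^bsub>K\<^esub> \<psi> s" "\<psi> \<one>\<^bsub>R\<^esub> = \<one>\<^bsub>K\<^esub>"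
    and sg: "\<sigma> ` U = carrier T" "\<And>u v. \<lbrakk> u \<in> U; v \<in> U \<rbrakk> \<Longrightarrow> \<sigma> (u \<oplus>\<^bsub>N\<^esub> v) = \<sigma> u \<oplus>\<^bsub>T\<^esub> \<sigma> v"
      "\<And>r u. \<lbrakk> r \<in> carrier R; u \<in> U \<rbrakk> \<Longrightarrow> \<sigma> (r \<odot>\<^bsub>N\<^esub> u) = \<psi> r \<odot>\<^bsub>T\<^esub> \<sigma> u" "\<sigma> \<zero>\<^bsub>N\<^esub> = \<zero>\<^bsub>T\<^esub>"
  shows "slin R x e N K y T \<psi> \<sigma> U"
proof -
  interpret N: lmod R x e N by fact
  interpret K: mring K y e by fact
  note D = N.subD[OF N(2)]
  have cl: "\<sigma> u \<in> carrier T" if "u \<in> U" for u using that sg(1) by blast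
  have pc: "\<psi> r \<in> carrier K" if "r \<in> carrier R" for r using that psi(1) by blast
  have ex: "\<exists>u\<in>U. t = \<sigma> u" if "t \<in> carrier T" for t using that sg(1) by blast
  have pex: "\<exists>r\<in>carrier R. c = \<psi> r" if "c \<in> carrier K" for c using that psi(1) by blast
  have ab: "abelian_group T"
  proof (rule abelian_groupI)
    fix s t assume st: "s \<in> carrier T" "t \<in> carrier T"
    obtain u v where uv: "u \<in> U" "s = \<sigma> u" "v \<in> U" "t = \<sigma> v" using ex st by blast
    show "s \<oplus>\<^bsub>T\<^esub> t \<in> carrier T" using cl[OF D(4)[OF uv(1,3)]] sg(2)[OF uv(1,3)] uv by simp
    show "s \<oplus>\<^bsub>T\<^esub> t = t \<oplus>\<^bsub>T\<^esub> s"
      using sg(2)[OF uv(1,3)] sg(2)[OF uv(3,1)] uv N.M.a_comm[OF D(2)[OF uv(1)] D(2)[OF uv(3)]] by simp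
    fix t' assume "t' \<in> carrier T"
    then obtain w where w: "w \<in> U" "t' = \<sigma> w" using ex by blast
    have "\<sigma> (u \<oplus>\<^bsub>N\<^esub> v \<oplus>\<^bsub>N\<^esub> w) = \<sigma> (u \<oplus>\<^bsub>N\<^esub> (v \<oplus>\<^bsub>N\<^esub> w))" using N.M.a_assoc D(2) uv w by simp
    then show "s \<oplus>\<^bsub>T\<^esub> t \<oplus>\<^bsub>T\<^esub> t' = s \<oplus>\<^bsub>T\<^esub> (t \<oplus>\<^bsub>T\<^esub> t')"
      unfolding sg(2)[OF D(4)[OF uv(1,3)] w(1)] sg(2)[OF uv(1) D(4)[OF uv(3) w(1)]] sg(2)[OF uv(1,3)] sg(2)[OF uv(3) w(1)]
      using uv w by simp
  next
    show "\<zero>\<^bsub>T\<^esub> \<in> carrier T" using cl[OF D(3)] sg(4) by simp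
    fix t assume "t \<in> carrier T"
    then obtain u where u: "u \<in> U" "t = \<sigma> u" using ex by blast
    show "\<zero>\<^bsub>T\<^esub> \<oplus>\<^bsub>T\<^esub> t = t" using sg(2)[OF D(3) u(1)] sg(4) u D(2) by simp
    have n: "\<ominus>\<^bsub>N\<^esub> u \<in> U" by (rule N.sub_neg[OF N(2) u(1)])
    have "\<sigma> (\<ominus>\<^bsub>N\<^esub> u) \<oplus>\<^bsub>T\<^esub> t = \<zero>\<^bsub>T\<^esub>" using sg(2)[OF n u(1)] sg(4) u D(2)[OF u(1)] N.M.l_neg by simp
    then show "\<exists>s\<in>carrier T. s \<oplus>\<^bsub>T\<^esub> t = \<zero>\<^bsub>T\<^esub>" using cl[OF n] by blast
  qed
  have mod: "module K T"
  proof (intro module.intro module_axioms.intro ab K.cring_axioms)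
    fix c t assume ct: "c \<in> carrier K" "t \<in> carrier T"
    obtain r u where ru: "r \<in> carrier R" "c = \<psi> r" "u \<in> U" "t = \<sigma> u" using ex[OF ct(2)] pex[OF ct(1)] by blast
    show "c \<odot>\<^bsub>T\<^esub> t \<in> carrier T" using sg(3)[OF ru(1,3)] cl[OF D(5)[OF ru(1,3)]] ru by simp
    fix c' assume "c' \<in> carrier K"
    then obtain s where s: "s \<in> carrier R" "c' = \<psi> s" using pex by blast
    note su = D(5)[OF s(1) ru(3)] and ruu = D(5)[OF ru(1,3)]
    have "\<sigma> ((r \<oplus>\<^bsub>R\<^esub> s) \<odot>\<^bsub>N\<^esub> u) = \<sigma> (r \<odot>\<^bsub>N\<^esub> u \<oplus>\<^bsub>N\<^esub> s \<odot>\<^bsub>N\<^esub> u)" using N.smult_l_distr ru s D(2) by simp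
    then show "(c \<oplus>\<^bsub>K\<^esub> c') \<odot>\<^bsub>T\<^esub> t = c \<odot>\<^bsub>T\<^esub> t \<oplus>\<^bsub>T\<^esub> c' \<odot>\<^bsub>T\<^esub> t"
      unfolding sg(2)[OF ruu su] sg(3)[OF N.R.a_closed[OF ru(1) s(1)] ru(3)] sg(3)[OF ru(1,3)] sg(3)[OF s(1) ru(3)]
      using psi(3)[OF ru(1) s(1)] ru s by simp
    have "\<sigma> ((r \<otimes>\<^bsub>R\<^esub> s) \<odot>\<^bsub>N\<^esub> u) = \<sigma> (r \<odot>\<^bsub>N\<^esub> (s \<odot>\<^bsub>N\<^esub> u))" using N.smult_assoc1 ru s D(2) by simp
    then show "(c \<otimes>\<^bsub>K\<^esub> c') \<odot>\<^bsub>T\<^esub> t = c \<odot>\<^bsub>T\<^esub> (c' \<odot>\<^bsub>T\<^esub> t)"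
      unfolding sg(3)[OF N.R.m_closed[OF ru(1) s(1)] ru(3)] sg(3)[OF ru(1) su] sg(3)[OF s(1) ru(3)]
      using psi(4)[OF ru(1) s(1)] ru s by simp
  next
    fix t assume "t \<in> carrier T"
    then obtain u where u: "u \<in> U" "t = \<sigma> u" using ex by blast
    show "\<one>\<^bsub>K\<^esub> \<odot>\<^bsub>T\<^esub> t = t" using sg(3)[OF N.R.one_closed u(1)] psi(5) u D(2) by simp
  next
    fix c s t assume ct: "c \<in> carrier K" "s \<in> carrier T" "t \<in> carrier T"
    obtain r u v where ru: "r \<in> carrier R" "c = \<psi> r" "u \<in> U" "s = \<sigma> u" "v \<in> U" "t = \<sigma> v"
      using ex[OF ct(2)] ex[OF ct(3)] pex[OF ct(1)] by blast
    have "\<sigma> (r \<odot>\<^bsub>N\<^esub> (u \<oplus>\<^bsub>N\<^esub> v)) = \<sigma> (r \<odot>\<^bsub>N\<^esub> u \<oplus>\<^bsub>N\<^esub> r \<odot>\<^bsub>N\<^esub> v)" using N.smult_r_distr ru D(2) by simp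
    then show "c \<odot>\<^bsub>T\<^esub> (s \<oplus>\<^bsub>T\<^esub> t) = c \<odot>\<^bsub>T\<^esub> s \<oplus>\<^bsub>T\<^esub> c \<odot>\<^bsub>T\<^esub> t"
      unfolding sg(2)[OF D(5)[OF ru(1,3)] D(5)[OF ru(1,5)]] sg(3)[OF ru(1) D(4)[OF ru(3,5)]] sg(2)[OF ru(3,5)]
        sg(3)[OF ru(1,3)] sg(3)[OF ru(1,5)] using ru by simp
  qed
  show ?thesis
    by (intro slin.intro slin_axioms.intro lmod.intro N(1,2) K mod psi(1,2) sg(2,3) cl)
qed

lemma (in lmod) transport_id:
  assumes "sub U" "\<sigma> ` U = carrier T" "\<And>u v. \<lbrakk> u \<in> U; v \<in> U \<rbrakk> \<Longrightarrow> \<sigma> (u \<oplus>\<^bsub>M\<^esub> v) = \<sigma> u \<oplus>\<^bsub>T\<^esub> \<sigma> v"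
      "\<And>r u. \<lbrakk> r \<in> carrier R; u \<in> U \<rbrakk> \<Longrightarrow> \<sigma> (r \<odot>\<^bsub>M\<^esub> u) = r \<odot>\<^bsub>T\<^esub> \<sigma> u" "\<sigma> \<zero>\<^bsub>M\<^esub> = \<zero>\<^bsub>T\<^esub>"
  shows "slin R x e M R x T (\<lambda>r. r) \<sigma> U"
  by (rule transport[OF lmod_axioms assms(1) mring_axioms]) (use assms in simp_all)

context lmod begin

lemma coset_eq: assumes "sub W" "s \<in> carrier M" "t \<in> carrier M"
  shows "W +>\<^bsub>M\<^esub> s = W +>\<^bsub>M\<^esub> t \<longleftrightarrow> s \<ominus>\<^bsub>M\<^esub> t \<in> W"
proof -
  note W = subD[OF assms(1)]
  have c: "z \<in> W +>\<^bsub>M\<^esub> a \<longleftrightarrow> (\<exists>w\<in>W. z = w \<oplus>\<^bsub>M\<^esub> a)" for z a by (auto simp: a_r_coset_def r_coset_def)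
  show ?thesis
  proof
    assume eq: "W +>\<^bsub>M\<^esub> s = W +>\<^bsub>M\<^esub> t"
    have "s \<in> W +>\<^bsub>M\<^esub> s" unfolding c using W(3) assms(2) by (intro bexI[of _ "\<zero>\<^bsub>M\<^esub>"]) auto
    then obtain w where w: "w \<in> W" "s = w \<oplus>\<^bsub>M\<^esub> t" unfolding eq c by blast
    have "s \<ominus>\<^bsub>M\<^esub> t = w" unfolding w(2) a_minus_def using W(2)[OF w(1)] assms(3) by (simp add: M.a_assoc M.r_neg)
    then show "s \<ominus>\<^bsub>M\<^esub> t \<in> W" using w by simp
  next
    assume d: "s \<ominus>\<^bsub>M\<^esub> t \<in> W"
    have 1: "z \<in> W +>\<^bsub>M\<^esub> b" if z: "z \<in> W +>\<^bsub>M\<^esub> a" and ab: "a \<ominus>\<^bsub>M\<^esub> b \<in> W" "a \<in> carrier M" "b \<in> carrier M" for z a b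
    proof -
      obtain w where w: "w \<in> W" "z = w \<oplus>\<^bsub>M\<^esub> a" using z unfolding c by blast
      have "(w \<oplus>\<^bsub>M\<^esub> (a \<ominus>\<^bsub>M\<^esub> b)) \<oplus>\<^bsub>M\<^esub> b = z"
        unfolding w(2) a_minus_def using W(2)[OF w(1)] ab(2,3) by (simp add: M.a_assoc M.l_neg)
      moreover have "w \<oplus>\<^bsub>M\<^esub> (a \<ominus>\<^bsub>M\<^esub> b) \<in> W" by (rule W(4)[OF w(1) ab(1)])
      ultimately show ?thesis unfolding c by metis
    qed
    have "\<ominus>\<^bsub>M\<^esub> (s \<ominus>\<^bsub>M\<^esub> t) \<in> W" by (rule sub_neg[OF assms(1) d])
    moreover have "\<ominus>\<^bsub>M\<^esub> (s \<ominus>\<^bsub>M\<^esub> t) = t \<ominus>\<^bsub>M\<^esub> s"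
      using assms(2,3) by (simp add: a_minus_def M.minus_add M.a_comm)
    ultimately have d': "t \<ominus>\<^bsub>M\<^esub> s \<in> W" by simp
    show "W +>\<^bsub>M\<^esub> s = W +>\<^bsub>M\<^esub> t" using 1[OF _ d assms(2,3)] 1[OF _ d' assms(3,2)] by (intro subset_antisym subsetI)
  qed
qed

text \<open>This makes the quotient records of the definitions usable: the module axioms are
  transported along the projection instead of being checked on cosets.\<close>

lemma quot_slin: assumes W: "sub W"
  shows "slin R x e M R x (quot_module M W) (\<lambda>r. r) (\<lambda>t. W +>\<^bsub>M\<^esub> t) (carrier M)"
    "(\<lambda>t. W +>\<^bsub>M\<^esub> t) ` carrier M = carrier (quot_module M W)"
proof -
  note D = subD[OF W]
  have c: "z \<in> W +>\<^bsub>M\<^esub> a \<longleftrightarrow> (\<exists>w\<in>W. z = w \<oplus>\<^bsub>M\<^esub> a)" for z a by (auto simp: a_r_coset_def r_coset_def)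
  show s: "(\<lambda>t. W +>\<^bsub>M\<^esub> t) ` carrier M = carrier (quot_module M W)"
    by (auto simp: quot_module_def A_RCOSETS_def' )
  show "slin R x e M R x (quot_module M W) (\<lambda>r. r) (\<lambda>t. W +>\<^bsub>M\<^esub> t) (carrier M)"
  proof (rule transport_id[OF sub_carrier s])
    fix u v assume uv: "u \<in> carrier M" "v \<in> carrier M"
    show "W +>\<^bsub>M\<^esub> (u \<oplus>\<^bsub>M\<^esub> v) = (W +>\<^bsub>M\<^esub> u) \<oplus>\<^bsub>quot_module M W\<^esub> (W +>\<^bsub>M\<^esub> v)"
    proof (intro subset_antisym subsetI)
      fix z assume "z \<in> W +>\<^bsub>M\<^esub> (u \<oplus>\<^bsub>M\<^esub> v)"
      then obtain w where w: "w \<in> W" "z = w \<oplus>\<^bsub>M\<^esub> (u \<oplus>\<^bsub>M\<^esub> v)" unfolding c by blast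
      have "z = (w \<oplus>\<^bsub>M\<^esub> u) \<oplus>\<^bsub>M\<^esub> (\<zero>\<^bsub>M\<^esub> \<oplus>\<^bsub>M\<^esub> v)" using w D(2)[OF w(1)] uv by (simp add: M.a_assoc)
      moreover have "w \<oplus>\<^bsub>M\<^esub> u \<in> W +>\<^bsub>M\<^esub> u" "\<zero>\<^bsub>M\<^esub> \<oplus>\<^bsub>M\<^esub> v \<in> W +>\<^bsub>M\<^esub> v" unfolding c using w D(3) by blast+
      ultimately show "z \<in> (W +>\<^bsub>M\<^esub> u) \<oplus>\<^bsub>quot_module M W\<^esub> (W +>\<^bsub>M\<^esub> v)"
        unfolding quot_module_def set_add_def' by auto
    next
      fix z assume "z \<in> (W +>\<^bsub>M\<^esub> u) \<oplus>\<^bsub>quot_module M W\<^esub> (W +>\<^bsub>M\<^esub> v)"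
      then obtain a b where ab: "a \<in> W +>\<^bsub>M\<^esub> u" "b \<in> W +>\<^bsub>M\<^esub> v" "z = a \<oplus>\<^bsub>M\<^esub> b"
        unfolding quot_module_def set_add_def' by auto
      obtain w where w: "w \<in> W" "a = w \<oplus>\<^bsub>M\<^esub> u" using ab(1) unfolding c by blast
      obtain w' where w': "w' \<in> W" "b = w' \<oplus>\<^bsub>M\<^esub> v" using ab(2) unfolding c by blast
      have "z = (w \<oplus>\<^bsub>M\<^esub> w') \<oplus>\<^bsub>M\<^esub> (u \<oplus>\<^bsub>M\<^esub> v)"
        unfolding ab(3) w(2) w'(2) using D(2)[OF w(1)] D(2)[OF w'(1)] uv by (simp add: M.a_ac)
      then show "z \<in> W +>\<^bsub>M\<^esub> (u \<oplus>\<^bsub>M\<^esub> v)" unfolding c using D(4)[OF w(1) w'(1)] by blast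
    qed
  next
    fix r u assume ru: "r \<in> carrier R" "u \<in> carrier M"
    have "W +>\<^bsub>M\<^esub> (r \<odot>\<^bsub>M\<^esub> a) = W +>\<^bsub>M\<^esub> (r \<odot>\<^bsub>M\<^esub> u)" if a: "a \<in> W +>\<^bsub>M\<^esub> u" for a
    proof -
      obtain w where w: "w \<in> W" "a = w \<oplus>\<^bsub>M\<^esub> u" using a unfolding c by blast
      have wc: "w \<in> carrier M" "a \<in> carrier M" using D(2)[OF w(1)] w(2) ru by auto
      have "r \<odot>\<^bsub>M\<^esub> a \<ominus>\<^bsub>M\<^esub> r \<odot>\<^bsub>M\<^esub> u = r \<odot>\<^bsub>M\<^esub> w"
        unfolding w(2) a_minus_def using wc(1) ru by (simp add: smult_r_distr M.a_assoc M.r_neg)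
      then show ?thesis using coset_eq[OF W, of "r \<odot>\<^bsub>M\<^esub> a" "r \<odot>\<^bsub>M\<^esub> u"] wc ru D(5)[OF ru(1) w(1)] by simp
    qed
    moreover have "u \<in> W +>\<^bsub>M\<^esub> u" unfolding c using D(3) ru by (intro bexI[of _ "\<zero>\<^bsub>M\<^esub>"]) auto
    ultimately have "(\<Union>a\<in>W +>\<^bsub>M\<^esub> u. W +>\<^bsub>M\<^esub> (r \<odot>\<^bsub>M\<^esub> a)) = W +>\<^bsub>M\<^esub> (r \<odot>\<^bsub>M\<^esub> u)" by blast
    then show "W +>\<^bsub>M\<^esub> (r \<odot>\<^bsub>M\<^esub> u) = r \<odot>\<^bsub>quot_module M W\<^esub> (W +>\<^bsub>M\<^esub> u)" by (simp add: quot_module_def)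
  next
    show "W +>\<^bsub>M\<^esub> \<zero>\<^bsub>M\<^esub> = \<zero>\<^bsub>quot_module M W\<^esub>"
      unfolding quot_module_def using D(2) by (auto simp: c)
  qed
qed

end

text \<open>Passes from an indexed family of generators without relations to a basis as a set of
  vectors; injectivity of u makes its cardinality equal to k.\<close>

lemma (in lmod) comb_basis:
  assumes u: "\<And>i. i < k \<Longrightarrow> u i \<in> carrier M" and gen: "carrier M \<subseteq> comb k u ` Fc k"
    and ind: "\<And>c i. \<lbrakk> c \<in> Fc k; comb k u c = \<zero>\<^bsub>M\<^esub>; i < k \<rbrakk> \<Longrightarrow> c i = \<zero>"
  shows "inj_on u {..<k}" "lin_indpt (u ` {..<k})" "span (u ` {..<k}) = carrier M"
proof -
  have one: "\<one> \<noteq> \<zero>" using one_notin idlD(2)[OF idl_var] by auto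
  show inj: "inj_on u {..<k}"
  proof (rule inj_onI, rule ccontr)
    fix i j assume ij: "i \<in> {..<k}" "j \<in> {..<k}" "u i = u j" "i \<noteq> j"
    interpret F: lmod R x e "Fr k" by (rule lmod_Fr)
    note L = comb_lin[OF sub_carrier, of k u, OF u]
    interpret C: slin R x e "Fr k" R x M "\<lambda>r. r" "comb k u" "Fc k"
      by (rule F.slin_lin[OF lmod_axioms F.sub_carrier L]) (simp_all)
    let ?c = "unit_vec R k i \<ominus>\<^bsub>Fr k\<^esub> unit_vec R k j"
    have c: "?c \<in> Fc k" using unit_vec_closed by (intro F.M.minus_closed)
    have "comb k u ?c = u i \<ominus>\<^bsub>M\<^esub> u j"
      using C.a_minus[OF unit_vec_closed unit_vec_closed] comb_unit_vec[of k u] u ij by simp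
    then have "comb k u ?c = \<zero>\<^bsub>M\<^esub>" using ij u by (simp add: M.r_neg a_minus_def)
    then have z: "?c i = \<zero>" using ind[OF c] ij by blast
    have "unit_vec R k i = unit_vec R k j \<oplus>\<^bsub>Fr k\<^esub> ?c" using F.add_minus[of "unit_vec R k j" "unit_vec R k i"] unit_vec_closed by simp
    then have "unit_vec R k i i = (unit_vec R k j \<oplus>\<^bsub>Fr k\<^esub> ?c) i" by simp
    then have "\<one> = \<zero>" using z ij by (auto simp: Fr_simps unit_vec_def)
    then show False using one by simp
  qed
  have comb: "lincomb a (u ` {..<k}) = comb k u (\<lambda>i\<in>{..<k}. a (u i))" if a: "a \<in> u ` {..<k} \<rightarrow> carrier R" for a
  proof -
    have ac: "a (u i) \<in> carrier R" if "i < k" for i using a that by auto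
    have "lincomb a (u ` {..<k}) = (\<Oplus>\<^bsub>M\<^esub>i\<in>{..<k}. a (u i) \<odot>\<^bsub>M\<^esub> u i)"
      unfolding lincomb_def by (rule M.add.finprod_reindex[OF _ inj]) (use ac u in auto)
    also have "\<dots> = comb k u (\<lambda>i\<in>{..<k}. a (u i))"
      unfolding comb_def by (rule M.finsum_cong') (use ac u in auto)
    finally show ?thesis .
  qed
  have Fc: "(\<lambda>i\<in>{..<k}. a (u i)) \<in> Fc k" if a: "a \<in> u ` {..<k} \<rightarrow> carrier R" for a
    using a by (auto simp: Fr_simps)
  have sub: "u ` {..<k} \<subseteq> carrier M" using u by auto
  show "lin_indpt (u ` {..<k})"
  proof (rule finite_lin_indpt2[OF _ sub])
    fix a assume a: "a \<in> u ` {..<k} \<rightarrow> carrier R" "lincomb a (u ` {..<k}) = \<zero>\<^bsub>M\<^esub>"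
    have z: "comb k u (\<lambda>i\<in>{..<k}. a (u i)) = \<zero>\<^bsub>M\<^esub>" using a(2) comb[OF a(1)] by simp
    show "\<forall>v\<in>u ` {..<k}. a v = \<zero>"
    proof
      fix v assume "v \<in> u ` {..<k}"
      then obtain i where i: "i < k" "v = u i" by blast
      show "a v = \<zero>" using ind[OF Fc[OF a(1)] z i(1)] i by simp
    qed
  qed simp
  show "span (u ` {..<k}) = carrier M"
  proof (intro subset_antisym span_is_subset2 sub subsetI)
    fix v assume v: "v \<in> carrier M"
    then obtain c where c: "c \<in> Fc k" "v = comb k u c" using gen by blast
    define a where "a = (\<lambda>w. c (the_inv_into {..<k} u w))"
    have au: "a (u i) = c i" if "i < k" for i using that the_inv_into_f_f[OF inj] by (simp add: a_def)
    have a: "a \<in> u ` {..<k} \<rightarrow> carrier R" using au Fr_closed[OF c(1)] by auto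
    have "(\<lambda>i\<in>{..<k}. a (u i)) = c" by (rule Fr_eqI[OF Fc[OF a] c(1)]) (simp add: au)
    then have "v = lincomb a (u ` {..<k})" using comb[OF a] c(2) by simp
    then show "v \<in> span (u ` {..<k})" unfolding span_def using a by blast
  qed
qed

text \<open>When all \<open>y j\<close> are zero, the vectors from \<open>len_generators\<close> are
  killed by them, and relations have coefficients in the zero ideal; so the vectors are a
  basis.\<close>

lemma dim_len:
  assumes V: "lmod K y e V" and K: "field K" "var_ideal K y e = {\<zero>\<^bsub>K\<^esub>}"
    and yz: "\<And>j. j < e \<Longrightarrow> y j = \<zero>\<^bsub>K\<^esub>" and k: "mlen K y e V {\<zero>\<^bsub>V\<^esub>} (carrier V) k"
  shows "vectorspace.dim K V = k"
proof -
  interpret lmod K y e V by fact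
  interpret vs: vectorspace K V by (intro vectorspace.intro module_axioms K(1))
  obtain u where u: "\<And>i. i < k \<Longrightarrow> u i \<in> carrier V" "carrier V \<subseteq> {\<zero>\<^bsub>V\<^esub>} <+>\<^bsub>V\<^esub> comb k u ` Fc k"
    "(\<forall>i<k. \<forall>j<e. y j \<odot>\<^bsub>V\<^esub> u i \<in> {\<zero>\<^bsub>V\<^esub>}) \<longrightarrow>
      (\<forall>c\<in>Fc k. comb k u c \<in> {\<zero>\<^bsub>V\<^esub>} \<longrightarrow> (\<forall>i<k. c i \<in> var_ideal K y e))"
    by (rule len_generators[OF k]) blast
  have ind: "c i = \<zero>\<^bsub>K\<^esub>" if "c \<in> Fc k" "comb k u c = \<zero>\<^bsub>V\<^esub>" "i < k" for c i
    using u(3) u(1) yz that K(2) by (auto simp: smult_l_null)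
  have gen: "carrier V \<subseteq> comb k u ` Fc k"
  proof
    fix v assume v: "v \<in> carrier V"
    then obtain c where c: "c \<in> Fc k" "v = \<zero>\<^bsub>V\<^esub> \<oplus>\<^bsub>V\<^esub> comb k u c" using u(2) unfolding subset_iff mem_add by blast
    have "comb k u c \<in> carrier V" unfolding comb_def by (rule M.finsum_closed) (use Fr_closed[OF c(1)] u(1) in auto)
    then show "v \<in> comb k u ` Fc k" using c by simp
  qed
  have b: "inj_on u {..<k}" "lin_indpt (u ` {..<k})" "span (u ` {..<k}) = carrier V"
    by (rule comb_basis[OF _ gen]; use u(1) ind in blast)+
  have "vs.basis (u ` {..<k})" unfolding vs.basis_def using b(2,3) u(1) by auto
  then have "vs.dim = card (u ` {..<k})" by (intro vs.dim_basis) auto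
  then show ?thesis using card_image[OF b(1)] by simp
qed

section \<open>Locality and the residue field\<close>

lemma (in mring) idl_iff_ideal: "idl J \<longleftrightarrow> ideal J R"
proof
  assume J: "idl J"
  note D = idlD[OF J]
  interpret S: lmod R x e S1 by (rule lmod_self)
  show "ideal J R"
  proof (rule idealI)
    show "subgroup J (add_monoid R)"
    proof (rule subgroup.intro)
      fix u assume u: "u \<in> J"
      have "\<ominus> \<one> \<otimes> u \<in> J" by (rule D(4)) (use u in auto)
      moreover have "\<ominus> \<one> \<otimes> u = \<ominus> u" using u D(1) by (simp add: l_minus subset_iff)
      ultimately show "inv\<^bsub>add_monoid R\<^esub> u \<in> J" by (simp add: a_inv_def)
    qed (use D in auto)
    fix a r assume "a \<in> J" "r \<in> carrier R"
    then show "r \<otimes> a \<in> J" "a \<otimes> r \<in> J" using D(4)[of r a] D(1) m_comm[of r a] by auto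
  qed (rule ring_axioms)
next
  assume J: "ideal J R"
  interpret J: ideal J R by fact
  interpret S: lmod R x e S1 by (rule lmod_self)
  show "idl J"
    by (rule S.subI) (auto simp: self_module_def J.a_Hcarr J.I_l_closed J.a_closed J.zero_closed)
qed

context artin begin

text \<open>J contains an element invertible modulo m, so J + m is the whole ring, and Nakayama with
  nilpotent m gives J = R. This is the locality of R.\<close>

lemma idl_not_var: assumes "idl J" "\<not> J \<subseteq> var_ideal R x e" shows "J = carrier R"
proof -
  interpret S: lmod R x e S1 by (rule lmod_self)
  note D = idlD[OF assms(1)]
  obtain a where a: "a \<in> J" "a \<notin> var_ideal R x e" using assms(2) by blast
  obtain b c where bc: "b \<in> carrier R" "c \<in> var_ideal R x e" "a \<otimes> b = \<one> \<oplus> c" using inv_mod[OF subsetD[OF D(1) a(1)] a(2)] by blast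
  have ac: "a \<in> carrier R" "c \<in> carrier R" using a D(1) bc(2) idlD(1)[OF idl_var] by auto
  have "carrier R \<subseteq> J"
  proof (rule S.nakayama[of J "carrier R" n])
    show "carrier R \<subseteq> J <+>\<^bsub>S1\<^esub> S.mm (carrier R)"
    proof
      fix r assume r: "r \<in> carrier R"
      have 1: "r \<otimes> (a \<otimes> b) \<in> J" using D(4)[of b a] D(4)[of r "b \<otimes> a"] a bc(1) r ac by (simp add: m_comm)
      have 2: "\<ominus> r \<otimes> c \<in> var_ideal R x e" by (rule idlD(4)[OF idl_var _ bc(2)]) (use r in simp)
      have "r = r \<otimes> (a \<otimes> b) \<oplus> \<ominus> r \<otimes> c"
        unfolding bc(3) using r ac(2) by (simp add: r_distr l_minus a_assoc r_neg)
      then show "r \<in> J <+>\<^bsub>S1\<^esub> S.mm (carrier R)"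
        unfolding S.mem_add using 1 2 by (auto simp: var_ideal_def self_module_def)
    qed
  qed (use assms(1) idl_carrier nilp D(2) in auto)
  then show ?thesis using D(1) by blast
qed

lemma local_max: "maximalideal (var_ideal R x e) R" "local_max_ideal R = var_ideal R x e"
proof -
  have vI: "ideal (var_ideal R x e) R" using idl_var idl_iff_ideal by blast
  show m: "maximalideal (var_ideal R x e) R"
  proof (rule maximalidealI[OF vI])
    show "carrier R \<noteq> var_ideal R x e" using one_notin by auto
    fix J assume "ideal J R" "var_ideal R x e \<subseteq> J" "J \<subseteq> carrier R"
    then show "J = var_ideal R x e \<or> J = carrier R" using idl_not_var idl_iff_ideal by blast
  qed
  show "local_max_ideal R = var_ideal R x e"
    unfolding local_max_ideal_def
  proof (rule the_equality)
    show "maximalideal (var_ideal R x e) R" by (rule m)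
    fix J assume J: "maximalideal J R"
    then have JI: "ideal J R" "carrier R \<noteq> J" by (auto simp: maximalideal_def maximalideal_axioms_def)
    then have "idl J" using idl_iff_ideal by blast
    then have "J \<subseteq> var_ideal R x e" using idl_not_var JI(2) by metis
    then show "J = var_ideal R x e"
      using maximalideal.I_maximal[OF J vI] one_notin idlD(1)[OF idl_var] by auto
  qed
qed

abbreviation kpr :: "'a \<Rightarrow> 'a set" where "kpr r \<equiv> var_ideal R x e +>\<^bsub>R\<^esub> r"

text \<open>The residue field becomes an instance of \<open>mring\<close> in which all variables are
  zero, so lengths over it are dimensions.\<close>

lemma residue_mring: "mring (residue_field R) (\<lambda>i. kpr (x i)) e" "field (residue_field R)"
  "var_ideal (residue_field R) (\<lambda>i. kpr (x i)) e = {\<zero>\<^bsub>residue_field R\<^esub>}"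
  "\<And>i. i < e \<Longrightarrow> kpr (x i) = \<zero>\<^bsub>residue_field R\<^esub>" "kpr ` carrier R = carrier (residue_field R)"
  "kpr \<in> ring_hom R (residue_field R)"
proof -
  have rf: "residue_field R = R Quot var_ideal R x e" by (simp add: residue_field_def local_max(2))
  show f: "field (residue_field R)" unfolding rf by (rule maximalideal.quotient_is_field[OF local_max(1) cring_axioms])
  interpret K: field "residue_field R" by (rule f)
  have vI: "ideal (var_ideal R x e) R" using idl_var idl_iff_ideal by blast
  show h: "kpr \<in> ring_hom R (residue_field R)" unfolding rf by (rule ideal.rcos_ring_hom[OF vI])
  show s: "kpr ` carrier R = carrier (residue_field R)" unfolding rf FactRing_def A_RCOSETS_def' by auto
  interpret S: lmod R x e S1 by (rule lmod_self)
  show z: "kpr (x i) = \<zero>\<^bsub>residue_field R\<^esub>" if "i < e" for i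
  proof -
    have "x i \<in> var_ideal R x e"
      using S.mm_gen[OF idl_carrier that one_closed] x_closed[OF that] by (simp add: var_ideal_def self_module_def)
    then show ?thesis unfolding rf by (simp add: FactRing_def abelian_subgroup.a_rcos_const[OF abelian_subgroupI3[OF ideal.axioms(1)[OF vI] abelian_group_axioms]])
  qed
  show v: "var_ideal (residue_field R) (\<lambda>i. kpr (x i)) e = {\<zero>\<^bsub>residue_field R\<^esub>}"
  proof -
    have 1: "(\<Oplus>\<^bsub>residue_field R\<^esub>i\<in>{..<e}. kpr (x i) \<otimes>\<^bsub>residue_field R\<^esub> f i) = \<zero>\<^bsub>residue_field R\<^esub>"
      if "f \<in> {..<e} \<rightarrow> carrier (residue_field R)" for f
    proof -
      have "(\<Oplus>\<^bsub>residue_field R\<^esub>i\<in>{..<e}. kpr (x i) \<otimes>\<^bsub>residue_field R\<^esub> f i) = (\<Oplus>\<^bsub>residue_field R\<^esub>i\<in>{..<e}. \<zero>\<^bsub>residue_field R\<^esub>)"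
        by (rule K.finsum_cong') (use that z in \<open>auto simp: Pi_iff\<close>)
      then show ?thesis by simp
    qed
    have 2: "finsum (self_module (residue_field R)) f I = finsum (residue_field R) f I" for f and I :: "nat set"
      unfolding finsum_def finprod_def self_module_def by simp
    have 3: "(\<lambda>i. \<zero>\<^bsub>residue_field R\<^esub>) \<in> {..<e} \<rightarrow> carrier (residue_field R)" by simp
    have gen: "var_ideal (residue_field R) y e = {v. \<exists>f\<in>{..<e} \<rightarrow> carrier (residue_field R).
        v = (\<Oplus>\<^bsub>residue_field R\<^esub>i\<in>{..<e}. y i \<otimes>\<^bsub>residue_field R\<^esub> f i)}" for y :: "nat \<Rightarrow> 'a set"
      unfolding var_ideal_def mmul_def 2 by (simp add: self_module_def)
    show ?thesis unfolding gen
    proof (intro subset_antisym subsetI)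
      show "z \<in> {\<zero>\<^bsub>residue_field R\<^esub>}" if "z \<in> {v. \<exists>f\<in>{..<e} \<rightarrow> carrier (residue_field R).
        v = (\<Oplus>\<^bsub>residue_field R\<^esub>i\<in>{..<e}. kpr (x i) \<otimes>\<^bsub>residue_field R\<^esub> f i)}" for z
        using that 1 by auto
      show "z \<in> {v. \<exists>f\<in>{..<e} \<rightarrow> carrier (residue_field R).
        v = (\<Oplus>\<^bsub>residue_field R\<^esub>i\<in>{..<e}. kpr (x i) \<otimes>\<^bsub>residue_field R\<^esub> f i)}" if "z \<in> {\<zero>\<^bsub>residue_field R\<^esub>}" for z
        using that 1[OF 3] by (intro CollectI bexI[OF _ 3]) simp
    qed
  qed
  show "mring (residue_field R) (\<lambda>i. kpr (x i)) e"
  proof (intro mring.intro mring_axioms.intro K.is_cring)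
    show "kpr (x i) \<in> carrier (residue_field R)" if "i < e" for i using z[OF that] by simp
    show "\<one>\<^bsub>residue_field R\<^esub> \<notin> var_ideal (residue_field R) (\<lambda>i. kpr (x i)) e" unfolding v by simp
    fix a assume a: "a \<in> carrier (residue_field R)" "a \<notin> var_ideal (residue_field R) (\<lambda>i. kpr (x i)) e"
    then have "a \<in> Units (residue_field R)" using v K.field_Units by auto
    then have "inv\<^bsub>residue_field R\<^esub> a \<in> carrier (residue_field R)"
      "a \<otimes>\<^bsub>residue_field R\<^esub> inv\<^bsub>residue_field R\<^esub> a = \<one>\<^bsub>residue_field R\<^esub> \<oplus>\<^bsub>residue_field R\<^esub> \<zero>\<^bsub>residue_field R\<^esub>" by auto
    then show "\<exists>b\<in>carrier (residue_field R). \<exists>c\<in>var_ideal (residue_field R) (\<lambda>i. kpr (x i)) e.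
      a \<otimes>\<^bsub>residue_field R\<^esub> b = \<one>\<^bsub>residue_field R\<^esub> \<oplus>\<^bsub>residue_field R\<^esub> c" unfolding v by blast
  qed
qed

text \<open>T is U/V and is killed by m because mU \<subseteq> V. Hence the action of the residue
  field through representatives is well defined, and a composition series of U/V is one of vector
  spaces.\<close>

lemma dim_quot:
  assumes S: "slin R x e N R x T (\<lambda>r. r) \<pi> U" "\<pi> ` U = carrier T" "\<And>u. u \<in> U \<Longrightarrow> \<pi> u = \<zero>\<^bsub>T\<^esub> \<longleftrightarrow> u \<in> V"
    and V: "mmul N x e U \<subseteq> V" "mlen R x e N V U k"
  shows "vectorspace.dim (residue_field R) (over_residue_field T) = k"
proof -
  interpret S: slin R x e N R x T "\<lambda>r. r" \<pi> U by (rule S(1))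
  let ?V = "over_residue_field T" and ?K = "residue_field R"
  have VU: "V \<subseteq> U" "S.M.sub V" using S.M.len_sub[OF V(2)] by auto
  have smz: "r \<odot>\<^bsub>T\<^esub> \<pi> u = \<zero>\<^bsub>T\<^esub>" if "r \<in> var_ideal R x e" "u \<in> U" for r u
  proof -
    have "r \<odot>\<^bsub>N\<^esub> u \<in> V" using S.M.smult_var_ideal[OF S.U that(2,1)] V(1) by blast
    moreover have "r \<odot>\<^bsub>N\<^esub> u \<in> U" using calculation VU by blast
    ultimately have "\<pi> (r \<odot>\<^bsub>N\<^esub> u) = \<zero>\<^bsub>T\<^esub>" using S(3) by blast
    then show ?thesis using S.a_smult[OF _ that(2), of r] that(1) idlD(1)[OF idl_var] by auto
  qed
  have sm: "kpr r \<odot>\<^bsub>?V\<^esub> \<pi> u = r \<odot>\<^bsub>T\<^esub> \<pi> u" if ru: "r \<in> carrier R" "u \<in> U" for r u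
  proof -
    have uc: "\<pi> u \<in> carrier T" by (rule S.a_closed[OF ru(2)])
    have "(THE w. \<exists>s\<in>kpr r. w = s \<odot>\<^bsub>T\<^esub> \<pi> u) = r \<odot>\<^bsub>T\<^esub> \<pi> u"
    proof (rule the_equality)
      have "r \<in> kpr r" unfolding a_r_coset_def r_coset_def using idlD(2)[OF idl_var] ru by force
      then show "\<exists>s\<in>kpr r. r \<odot>\<^bsub>T\<^esub> \<pi> u = s \<odot>\<^bsub>T\<^esub> \<pi> u" by blast
      fix w assume "\<exists>s\<in>kpr r. w = s \<odot>\<^bsub>T\<^esub> \<pi> u"
      then obtain z where z: "z \<in> var_ideal R x e" "w = (z \<oplus> r) \<odot>\<^bsub>T\<^esub> \<pi> u" by (auto simp: a_r_coset_def r_coset_def)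
      have zc: "z \<in> carrier R" using z(1) idlD(1)[OF idl_var] by blast
      show "w = r \<odot>\<^bsub>T\<^esub> \<pi> u" unfolding z(2) using smz[OF z(1) ru(2)] zc ru(1) uc by (simp add: S.N.smult_l_distr)
    qed
    then show ?thesis by (simp add: over_residue_field_def)
  qed
  note h = ring_hom_memE[OF residue_mring(6)]
  have ids: "carrier ?V = carrier T" "\<And>a b. a \<oplus>\<^bsub>?V\<^esub> b = a \<oplus>\<^bsub>T\<^esub> b" "\<zero>\<^bsub>?V\<^esub> = \<zero>\<^bsub>T\<^esub>"
    by (simp_all add: over_residue_field_def)
  interpret Q: slin R x e N ?K "\<lambda>i. kpr (x i)" ?V kpr \<pi> U
  proof (rule transport[OF S.M.lmod_axioms S.U residue_mring(1,5)])
    show "\<pi> ` U = carrier ?V" using S(2) ids by simp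
    show "\<pi> (u \<oplus>\<^bsub>N\<^esub> v) = \<pi> u \<oplus>\<^bsub>?V\<^esub> \<pi> v" if "u \<in> U" "v \<in> U" for u v using S.a_add[OF that] ids by simp
    show "\<pi> (r \<odot>\<^bsub>N\<^esub> u) = kpr r \<odot>\<^bsub>?V\<^esub> \<pi> u" if "r \<in> carrier R" "u \<in> U" for r u
      using S.a_smult[OF that] sm[OF that] by simp
    show "\<pi> \<zero>\<^bsub>N\<^esub> = \<zero>\<^bsub>?V\<^esub>" using S.a_zero ids by simp
  qed (use h in simp_all)
  have eq: "{u \<in> U. \<pi> u \<in> {\<zero>\<^bsub>?V\<^esub>}} = V" using S(3) VU ids by auto
  have "mlen ?K (\<lambda>i. kpr (x i)) e ?V {\<zero>\<^bsub>?V\<^esub>} (\<pi> ` U <+>\<^bsub>?V\<^esub> {\<zero>\<^bsub>?V\<^esub>}) k"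
    by (rule Q.len_image[OF Q.N.sub_zero _ subset_refl]) (simp only: eq V(2))
  moreover have "\<pi> ` U <+>\<^bsub>?V\<^esub> {\<zero>\<^bsub>?V\<^esub>} = carrier ?V"
    using Q.N.add_absorb(2)[OF Q.N.sub_zero Q.N.sub_carrier] S(2) ids by simp
  ultimately have kk: "mlen ?K (\<lambda>i. kpr (x i)) e ?V {\<zero>\<^bsub>?V\<^esub>} (carrier ?V) k" by simp
  show ?thesis by (rule dim_len[OF Q.N.lmod_axioms residue_mring(2,3) _ kk]) (rule residue_mring(4))
qed

end

lemma (in slin) vimage_image:
  assumes W: "submodule R W M" "W \<subseteq> U"
  shows "{u \<in> U. a u \<in> a ` W} = {u \<in> U. a u = \<zero>\<^bsub>N\<^esub>} <+>\<^bsub>M\<^esub> W"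
proof (intro subset_antisym subsetI)
  fix u assume "u \<in> {u \<in> U. a u \<in> a ` W}"
  then obtain w where uw: "u \<in> U" "w \<in> W" "a u = a w" by blast
  have wU: "w \<in> U" using uw(2) W(2) by blast
  have "a (u \<ominus>\<^bsub>M\<^esub> w) = \<zero>\<^bsub>N\<^esub>" using a_minus[OF uw(1) wU] uw(3) a_closed[OF wU] by (simp add: a_minus_def N.M.r_neg)
  moreover have "u = (u \<ominus>\<^bsub>M\<^esub> w) \<oplus>\<^bsub>M\<^esub> w"
    using U_c[OF uw(1)] U_c[OF wU] by (simp add: a_minus_def M.M.a_assoc M.M.l_neg)
  ultimately show "u \<in> {u \<in> U. a u = \<zero>\<^bsub>N\<^esub>} <+>\<^bsub>M\<^esub> W" unfolding M.mem_add using M.sub_minus[OF U uw(1) wU] uw(2) by blast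
next
  fix z assume "z \<in> {u \<in> U. a u = \<zero>\<^bsub>N\<^esub>} <+>\<^bsub>M\<^esub> W"
  then obtain u w where uw: "u \<in> U" "a u = \<zero>\<^bsub>N\<^esub>" "w \<in> W" "z = u \<oplus>\<^bsub>M\<^esub> w" unfolding M.mem_add by blast
  have wU: "w \<in> U" using uw(3) W(2) by blast
  have "a z = a w" unfolding uw(4) using a_add[OF uw(1) wU] uw(2) a_closed[OF wU] by simp
  then show "z \<in> {u \<in> U. a u \<in> a ` W}" using M.subD(4)[OF U uw(1) wU] uw(3,4) by blast
qed

section \<open>Tensoring with the residue field\<close>

text \<open>The generating set inside \<open>tensor_relations\<close>, named so that
  \<open>relsE\<close> can distinguish its three kinds.\<close>

definition rels ::
    "('r, 'b) ring_scheme \<Rightarrow> ('r, 'm, 'c) module_scheme \<Rightarrow> ('r, 'n, 'd) module_scheme \<Rightarrow> ('m \<times> 'n \<Rightarrow>\<^sub>0 int) set"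
  where "rels R M N =
    {frag_of (x \<oplus>\<^bsub>M\<^esub> x', y) - frag_of (x, y) - frag_of (x', y) | x x' y.
        x \<in> carrier M \<and> x' \<in> carrier M \<and> y \<in> carrier N} \<union>
     {frag_of (x, y \<oplus>\<^bsub>N\<^esub> y') - frag_of (x, y) - frag_of (x, y') | x y y'.
        x \<in> carrier M \<and> y \<in> carrier N \<and> y' \<in> carrier N} \<union>
     {frag_of (r \<odot>\<^bsub>M\<^esub> x, y) - frag_of (x, r \<odot>\<^bsub>N\<^esub> y) | r x y.
        r \<in> carrier R \<and> x \<in> carrier M \<and> y \<in> carrier N}"

lemma relsI:
  "\<lbrakk> x \<in> carrier M; x' \<in> carrier M; y \<in> carrier N \<rbrakk> \<Longrightarrow> frag_of (x \<oplus>\<^bsub>M\<^esub> x', y) - frag_of (x, y) - frag_of (x', y) \<in> rels R M N"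
  "\<lbrakk> x \<in> carrier M; y \<in> carrier N; y' \<in> carrier N \<rbrakk> \<Longrightarrow> frag_of (x, y \<oplus>\<^bsub>N\<^esub> y') - frag_of (x, y) - frag_of (x, y') \<in> rels R M N"
  "\<lbrakk> r \<in> carrier R; x \<in> carrier M; y \<in> carrier N \<rbrakk> \<Longrightarrow> frag_of (r \<odot>\<^bsub>M\<^esub> x, y) - frag_of (x, r \<odot>\<^bsub>N\<^esub> y) \<in> rels R M N"
  unfolding rels_def by blast+

lemma relsE:
  assumes "f \<in> rels R M N"
  obtains (1) x x' y where "x \<in> carrier M" "x' \<in> carrier M" "y \<in> carrier N"
      "f = frag_of (x \<oplus>\<^bsub>M\<^esub> x', y) - frag_of (x, y) - frag_of (x', y)"
    | (2) x y y' where "x \<in> carrier M" "y \<in> carrier N" "y' \<in> carrier N"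
      "f = frag_of (x, y \<oplus>\<^bsub>N\<^esub> y') - frag_of (x, y) - frag_of (x, y')"
    | (3) r x y where "r \<in> carrier R" "x \<in> carrier M" "y \<in> carrier N" "f = frag_of (r \<odot>\<^bsub>M\<^esub> x, y) - frag_of (x, r \<odot>\<^bsub>N\<^esub> y)"
  using assms unfolding rels_def by blast

lemma tensor_relations_eq: "tensor_relations R M N = generate (tensor_free M N) (rels R M N)"
  by (simp add: tensor_relations_def rels_def)

lemma tensor_free_diff: "\<lbrakk> f \<in> carrier (tensor_free M N); g \<in> carrier (tensor_free M N) \<rbrakk> \<Longrightarrow> f - g \<in> carrier (tensor_free M N)"
  unfolding tensor_free_def carrier_free_Abelian_group_iff using keys_diff[of f g] by blast

lemma tensor_free_of: "frag_of (x, y) \<in> carrier (tensor_free M N) \<longleftrightarrow> x \<in> carrier M \<and> y \<in> carrier N"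
  unfolding tensor_free_def by simp

lemma tensor_free_mult: "f \<otimes>\<^bsub>tensor_free M N\<^esub> g = f + g" "\<one>\<^bsub>tensor_free M N\<^esub> = 0"
  "f \<in> carrier (tensor_free M N) \<Longrightarrow> inv\<^bsub>tensor_free M N\<^esub> f = - f"
  unfolding tensor_free_def by simp_all

lemma tensor_free_group: "group (tensor_free M N)" unfolding tensor_free_def by simp

lemma rels_carrier: assumes "module R M" "module R N" shows "rels R M N \<subseteq> carrier (tensor_free M N)"
proof
  interpret M: module R M by fact
  interpret N: module R N by fact
  fix f assume "f \<in> rels R M N"
  then show "f \<in> carrier (tensor_free M N)"
    by (cases rule: relsE) (auto intro!: tensor_free_diff simp: tensor_free_of)
qed

lemma relations_subgroup: assumes "module R M" "module R N"
  shows "subgroup (tensor_relations R M N) (tensor_free M N)"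
  unfolding tensor_relations_eq by (rule group.generate_is_subgroup[OF tensor_free_group rels_carrier[OF assms]])

lemma relations_closed: assumes "module R M" "module R N"
  shows "0 \<in> tensor_relations R M N"
    "\<lbrakk> f \<in> tensor_relations R M N; g \<in> tensor_relations R M N \<rbrakk> \<Longrightarrow> f + g \<in> tensor_relations R M N"
    "f \<in> tensor_relations R M N \<Longrightarrow> - f \<in> tensor_relations R M N"
    "\<lbrakk> f \<in> tensor_relations R M N; g \<in> tensor_relations R M N \<rbrakk> \<Longrightarrow> f - g \<in> tensor_relations R M N"
    "f \<in> rels R M N \<Longrightarrow> f \<in> tensor_relations R M N"
    "f \<in> tensor_relations R M N \<Longrightarrow> f \<in> carrier (tensor_free M N)"
proof -
  note S = relations_subgroup[OF assms]
  show "0 \<in> tensor_relations R M N" using subgroup.one_closed[OF S] by (simp add: tensor_free_mult)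
  show c: "f \<in> tensor_relations R M N \<Longrightarrow> f \<in> carrier (tensor_free M N)" for f by (rule subgroup.mem_carrier[OF S])
  show a: "\<lbrakk> f \<in> tensor_relations R M N; g \<in> tensor_relations R M N \<rbrakk> \<Longrightarrow> f + g \<in> tensor_relations R M N" for f g
    using subgroup.m_closed[OF S, of f g] by (simp add: tensor_free_mult)
  show m: "f \<in> tensor_relations R M N \<Longrightarrow> - f \<in> tensor_relations R M N" for f
    using subgroup.m_inv_closed[OF S, of f] c[of f] by (simp add: tensor_free_mult)
  show "\<lbrakk> f \<in> tensor_relations R M N; g \<in> tensor_relations R M N \<rbrakk> \<Longrightarrow> f - g \<in> tensor_relations R M N"
    using a[of f "- g"] m[of g] by simp
  show "f \<in> rels R M N \<Longrightarrow> f \<in> tensor_relations R M N"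
    unfolding tensor_relations_eq by (rule generate.incl)
qed

lemma relations_coset: assumes "module R M" "module R N"
  shows "tensor_relations R M N #>\<^bsub>tensor_free M N\<^esub> f = tensor_relations R M N #>\<^bsub>tensor_free M N\<^esub> g
    \<longleftrightarrow> f - g \<in> tensor_relations R M N"
    "h \<in> tensor_relations R M N #>\<^bsub>tensor_free M N\<^esub> f \<longleftrightarrow> h - f \<in> tensor_relations R M N"
proof -
  note Z = relations_closed[OF assms]
  show c: "h \<in> tensor_relations R M N #>\<^bsub>tensor_free M N\<^esub> f \<longleftrightarrow> h - f \<in> tensor_relations R M N" for h f
  proof -
    have "h \<in> tensor_relations R M N #>\<^bsub>tensor_free M N\<^esub> f \<longleftrightarrow> (\<exists>z\<in>tensor_relations R M N. h = z + f)"
      by (auto simp: r_coset_def tensor_free_mult)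
    also have "\<dots> \<longleftrightarrow> h - f \<in> tensor_relations R M N"
    proof
      show "h - f \<in> tensor_relations R M N" if "\<exists>z\<in>tensor_relations R M N. h = z + f" using that by auto
      show "\<exists>z\<in>tensor_relations R M N. h = z + f" if "h - f \<in> tensor_relations R M N" using that by (intro bexI[OF _ that]) simp
    qed
    finally show ?thesis .
  qed
  show "tensor_relations R M N #>\<^bsub>tensor_free M N\<^esub> f = tensor_relations R M N #>\<^bsub>tensor_free M N\<^esub> g
    \<longleftrightarrow> f - g \<in> tensor_relations R M N"
  proof
    assume "tensor_relations R M N #>\<^bsub>tensor_free M N\<^esub> f = tensor_relations R M N #>\<^bsub>tensor_free M N\<^esub> g"
    moreover have "f \<in> tensor_relations R M N #>\<^bsub>tensor_free M N\<^esub> f" unfolding c using Z(1) by simp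
    ultimately show "f - g \<in> tensor_relations R M N" using c by blast
  next
    assume fg: "f - g \<in> tensor_relations R M N"
    have "h - f \<in> tensor_relations R M N \<longleftrightarrow> h - g \<in> tensor_relations R M N" for h
    proof
      show "h - g \<in> tensor_relations R M N" if "h - f \<in> tensor_relations R M N" using Z(2)[OF that fg] by simp
      show "h - f \<in> tensor_relations R M N" if "h - g \<in> tensor_relations R M N" using Z(4)[OF that fg] by simp
    qed
    then show "tensor_relations R M N #>\<^bsub>tensor_free M N\<^esub> f = tensor_relations R M N #>\<^bsub>tensor_free M N\<^esub> g"
      unfolding set_eq_iff c by blast
  qed
qed

text \<open>Functoriality of the tensor product: each kind of relation goes to one of the same kind.
  It serves both the scalar action and the maps induced by differentials.\<close>

lemma frag_extend_relations:
  assumes M: "module R M" "module R N" "module R M'" "module R N'"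
    and \<alpha>: "lin R M (carrier M) M' (carrier M') \<alpha>" and \<delta>: "lin R N (carrier N) N' (carrier N') \<delta>"
    and c: "c \<in> tensor_relations R M N"
  shows "frag_extend (\<lambda>(x, y). frag_of (\<alpha> x, \<delta> y)) c \<in> tensor_relations R M' N'"
proof -
  interpret M: module R M by fact
  interpret N: module R N by fact
  note Z = relations_closed[OF M(3,4)]
  let ?h = "frag_extend (\<lambda>(x, y). frag_of (\<alpha> x, \<delta> y))"
  have gen: "?h f \<in> tensor_relations R M' N'" if "f \<in> rels R M N" for f
    using that
  proof (cases rule: relsE)
    case (1 x x' y)
    have "?h f = frag_of (\<alpha> x \<oplus>\<^bsub>M'\<^esub> \<alpha> x', \<delta> y) - frag_of (\<alpha> x, \<delta> y) - frag_of (\<alpha> x', \<delta> y)"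
      unfolding 1(4) by (simp add: frag_extend_diff linD(2)[OF \<alpha>] 1)
    then show ?thesis using Z(5)[OF relsI(1)[OF linD(1)[OF \<alpha> 1(1)] linD(1)[OF \<alpha> 1(2)] linD(1)[OF \<delta> 1(3)]]] by simp
  next
    case (2 x y y')
    have "?h f = frag_of (\<alpha> x, \<delta> y \<oplus>\<^bsub>N'\<^esub> \<delta> y') - frag_of (\<alpha> x, \<delta> y) - frag_of (\<alpha> x, \<delta> y')"
      unfolding 2(4) by (simp add: frag_extend_diff linD(2)[OF \<delta>] 2)
    then show ?thesis using Z(5)[OF relsI(2)[OF linD(1)[OF \<alpha> 2(1)] linD(1)[OF \<delta> 2(2)] linD(1)[OF \<delta> 2(3)]]] by simp
  next
    case (3 r x y)
    have "?h f = frag_of (r \<odot>\<^bsub>M'\<^esub> \<alpha> x, \<delta> y) - frag_of (\<alpha> x, r \<odot>\<^bsub>N'\<^esub> \<delta> y)"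
      unfolding 3(4) by (simp add: frag_extend_diff linD(3)[OF \<alpha>] linD(3)[OF \<delta>] 3)
    then show ?thesis using Z(5)[OF relsI(3)[OF 3(1) linD(1)[OF \<alpha> 3(2)] linD(1)[OF \<delta> 3(3)]]] by simp
  qed
  show ?thesis using c unfolding tensor_relations_eq[of R M N]
  proof (induction rule: generate.induct)
    case one then show ?case using Z(1) by (simp add: tensor_free_mult)
  next
    case (incl h) then show ?case by (rule gen)
  next
    case (inv h)
    then have "inv\<^bsub>tensor_free M N\<^esub> h = - h" using rels_carrier[OF M(1,2)] by (intro tensor_free_mult(3)) blast
    then show ?case using Z(3)[OF gen[OF inv]] by (simp add: frag_extend_minus)
  next
    case (eng h1 h2) then show ?case using Z(2) by (simp add: tensor_free_mult frag_extend_add)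
  qed
qed

context artin begin

abbreviation "resm \<equiv> residue_module R"
text \<open>The class of r in the residue field as a module; \<open>kpr\<close> is the class in the
  residue field as a ring.\<close>

definition kp :: "'a \<Rightarrow> 'a set" where "kp r = var_ideal R x e +>\<^bsub>S1\<^esub> r"

lemma resm_eq: "resm = quot_module S1 (var_ideal R x e)"
  by (simp add: residue_module_def local_max(2))

lemma kp_slin: "slin R x e S1 R x resm (\<lambda>r. r) kp (carrier R)"
  using lmod.quot_slin(1)[OF lmod_self idl_var] unfolding resm_eq kp_def[abs_def] by (simp add: self_module_def)

lemma kp_image: "kp ` carrier R = carrier resm"
  using lmod.quot_slin(2)[OF lmod_self idl_var] unfolding resm_eq kp_def[abs_def] by (simp add: self_module_def)

lemma kp_simps:
  "\<lbrakk> r \<in> carrier R; s \<in> carrier R \<rbrakk> \<Longrightarrow> kp (r \<oplus> s) = kp r \<oplus>\<^bsub>resm\<^esub> kp s"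
  "\<lbrakk> r \<in> carrier R; s \<in> carrier R \<rbrakk> \<Longrightarrow> kp (r \<otimes> s) = r \<odot>\<^bsub>resm\<^esub> kp s"
  "r \<in> carrier R \<Longrightarrow> kp r \<in> carrier resm"
  using slin.a_add[OF kp_slin] slin.a_smult[OF kp_slin] slin.a_closed[OF kp_slin] by (simp_all add: self_module_def)

lemma kp_eq: "\<lbrakk> r \<in> carrier R; s \<in> carrier R \<rbrakk> \<Longrightarrow> kp r = kp s \<longleftrightarrow> r \<ominus> s \<in> var_ideal R x e"
  using lmod.coset_eq[OF lmod_self idl_var, of r s] unfolding kp_def
  by (simp add: self_module_def a_minus_def a_inv_def m_inv_def)

lemma resm_lmod: "lmod R x e resm" using kp_slin by (rule slin.axioms(2))

text \<open>The map z \<mapsto> 1 \<otimes> z into the tensor product with the residue field. It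
  identifies that product with P/mP.\<close>

definition sg :: "('a, 'm, 'c) module_scheme \<Rightarrow> 'm \<Rightarrow> ('a set \<times> 'm \<Rightarrow>\<^sub>0 int) set"
  where "sg P z = tensor_relations R resm P #>\<^bsub>tensor_free resm P\<^esub> frag_of (kp \<one>, z)"

end

locale tens = artin R x e n l + P: lmod R x e P
  for R :: "('a, 'b) ring_scheme" (structure) and x e n l and P :: "('a, 'm, 'c) module_scheme"
begin

abbreviation "ZZ \<equiv> tensor_relations R resm P"
abbreviation "TF \<equiv> tensor_free resm P"
abbreviation "E z \<equiv> frag_of (kp \<one>, z)"

lemma mods: "module R resm" "module R P"
  using lmod.axioms(2)[OF resm_lmod] P.module_axioms by blast+

lemmas ZD = relations_closed[OF mods]

lemma E_add: "\<lbrakk> y \<in> carrier P; z \<in> carrier P \<rbrakk> \<Longrightarrow> E (y \<oplus>\<^bsub>P\<^esub> z) - E y - E z \<in> ZZ"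
  by (rule ZD(5)[OF relsI(2)[OF kp_simps(3)[OF one_closed]]])

lemma E_smult: "\<lbrakk> r \<in> carrier R; y \<in> carrier P \<rbrakk> \<Longrightarrow> frag_of (kp r, y) - E (r \<odot>\<^bsub>P\<^esub> y) \<in> ZZ"
  using ZD(5)[OF relsI(3)[OF _ kp_simps(3)[OF one_closed]], of r y] kp_simps(2)[of r \<one>] by simp

lemma E_0: "y \<in> carrier P \<Longrightarrow> frag_of (kp \<zero>, y) \<in> ZZ"
proof -
  assume y: "y \<in> carrier P"
  have "frag_of (kp \<zero> \<oplus>\<^bsub>resm\<^esub> kp \<zero>, y) - frag_of (kp \<zero>, y) - frag_of (kp \<zero>, y) \<in> ZZ"
    by (rule ZD(5)[OF relsI(1)[OF kp_simps(3) kp_simps(3) y]]) simp_all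
  then have "- frag_of (kp \<zero>, y) \<in> ZZ" using kp_simps(1)[of \<zero> \<zero>] by simp
  from ZD(3)[OF this] show ?thesis by simp
qed

lemma E_zero: "E \<zero>\<^bsub>P\<^esub> \<in> ZZ"
  using ZD(3)[OF E_add[of "\<zero>\<^bsub>P\<^esub>" "\<zero>\<^bsub>P\<^esub>"]] by simp

lemma E_plus: assumes "y \<in> carrier P" "z \<in> carrier P" "E y \<in> ZZ" "E z \<in> ZZ" shows "E (y \<oplus>\<^bsub>P\<^esub> z) \<in> ZZ"
proof -
  have "E (y \<oplus>\<^bsub>P\<^esub> z) = (E (y \<oplus>\<^bsub>P\<^esub> z) - E y - E z) + (E y + E z)" by simp
  also have "\<dots> \<in> ZZ" by (rule ZD(2)[OF E_add[OF assms(1,2)] ZD(2)[OF assms(3,4)]])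
  finally show ?thesis .
qed

lemma E_finsum: fixes k :: nat assumes "\<And>i. i < k \<Longrightarrow> f i \<in> carrier P" "\<And>i. i < k \<Longrightarrow> E (f i) \<in> ZZ"
  shows "E (\<Oplus>\<^bsub>P\<^esub>i\<in>{..<k}. f i) \<in> ZZ"
  using assms
proof (induction k rule: nat_induct)
  case 0 then show ?case using E_zero by simp
next
  case (Suc k)
  have eq: "(\<Oplus>\<^bsub>P\<^esub>i\<in>{..<Suc k}. f i) = f k \<oplus>\<^bsub>P\<^esub> (\<Oplus>\<^bsub>P\<^esub>i\<in>{..<k}. f i)"
    unfolding lessThan_Suc using Suc.prems(1) by (intro P.M.finsum_insert) auto
  show ?case unfolding eq
    by (rule E_plus) (use Suc in \<open>auto intro!: P.M.finsum_closed\<close>)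
qed

text \<open>A factor \<open>x i\<close> moves across the tensor sign and becomes the zero residue
  class.\<close>

lemma E_mm: assumes "w \<in> P.mm (carrier P)" shows "E w \<in> ZZ"
proof -
  obtain f where f: "f \<in> {..<e} \<rightarrow> carrier P" "w = (\<Oplus>\<^bsub>P\<^esub>i\<in>{..<e}. x i \<odot>\<^bsub>P\<^esub> f i)" using assms unfolding mmul_def by blast
  show ?thesis unfolding f(2)
  proof (rule E_finsum)
    fix i assume i: "i < e"
    have fi: "f i \<in> carrier P" using f(1) i by auto
    show "x i \<odot>\<^bsub>P\<^esub> f i \<in> carrier P" using x_closed[OF i] fi by simp
    interpret S: lmod R x e S1 by (rule lmod_self)
    have "x i \<in> var_ideal R x e"
      using S.mm_gen[OF idl_carrier i one_closed] x_closed[OF i] by (simp add: var_ideal_def self_module_def)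
    then have "x i \<ominus> \<zero> \<in> var_ideal R x e" using x_closed[OF i] by (simp add: a_minus_def)
    then have "kp (x i) = kp \<zero>" using kp_eq[OF x_closed[OF i] zero_closed] by simp
    then have "frag_of (kp \<zero>, f i) - E (x i \<odot>\<^bsub>P\<^esub> f i) \<in> ZZ" using E_smult[OF x_closed[OF i] fi] by simp
    from ZD(4)[OF E_0[OF fi] this] show "E (x i \<odot>\<^bsub>P\<^esub> f i) \<in> ZZ" by simp
  qed
qed

text \<open>A pure tensor of the class of r with y equals the class of 1 with ry, and sums are then
  collected by additivity in the second argument.\<close>

lemma E_surj: assumes "f \<in> carrier TF" shows "\<exists>z\<in>carrier P. f - E z \<in> ZZ"
proof -
  have "Poly_Mapping.keys f \<subseteq> carrier resm \<times> carrier P" using assms by (simp add: tensor_free_def)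
  then show ?thesis
  proof (induction f rule: frag_induction)
    case zero show ?case using ZD(3)[OF E_zero] by (intro bexI[of _ "\<zero>\<^bsub>P\<^esub>"]) simp_all
  next
    case (one c)
    then obtain r y where ry: "r \<in> carrier R" "c = (kp r, y)" "y \<in> carrier P" unfolding kp_image[symmetric] by blast
    then show ?case using E_smult[OF ry(1,3)] by (intro bexI[of _ "r \<odot>\<^bsub>P\<^esub> y"]) simp_all
  next
    case (diff f g)
    then obtain y z where yz: "y \<in> carrier P" "f - E y \<in> ZZ" "z \<in> carrier P" "g - E z \<in> ZZ" by blast
    have m: "y \<ominus>\<^bsub>P\<^esub> z \<in> carrier P" using yz by simp
    have "(y \<ominus>\<^bsub>P\<^esub> z) \<oplus>\<^bsub>P\<^esub> z = y" using yz by (simp add: a_minus_def P.M.a_assoc P.M.l_neg)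
    then have a: "E y - E (y \<ominus>\<^bsub>P\<^esub> z) - E z \<in> ZZ" using E_add[OF m yz(3)] by simp
    have "(f - g) - E (y \<ominus>\<^bsub>P\<^esub> z) = (f - E y) - (g - E z) + (E y - E (y \<ominus>\<^bsub>P\<^esub> z) - E z)" by simp
    also have "\<dots> \<in> ZZ" by (rule ZD(2)[OF ZD(4)[OF yz(2,4)] a])
    finally show ?case using m by blast
  qed
qed

text \<open>Injectivity on P/mP requires a map out of the tensor product. The universal property of
  the free abelian group provides one that sends the pair of the class of r and y to the class of ry
  in P/mP; it kills all three kinds of relations.\<close>

lemma E_ker: assumes yz: "y \<in> carrier P" "z \<in> carrier P" and d: "E y - E z \<in> ZZ"
  shows "y \<ominus>\<^bsub>P\<^esub> z \<in> P.mm (carrier P)"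
proof -
  let ?m = "P.mm (carrier P)"
  have msub: "P.sub ?m" by (rule P.mm_sub[OF P.sub_carrier])
  define \<kappa> where "\<kappa> = (\<lambda>t. ?m +>\<^bsub>P\<^esub> t)"
  interpret Q: slin R x e P R x "quot_module P ?m" "\<lambda>r. r" \<kappa> "carrier P" unfolding \<kappa>_def by (rule P.quot_slin(1)[OF msub])
  have cg: "comm_group (add_monoid (quot_module P ?m))" by (rule Q.N.M.a_comm_group)
  \<comment> \<open>A representative of the residue class is chosen; \<open>gk\<close> shows that
    the choice does not matter modulo mP.\<close>
  define g where "g = (\<lambda>(C, y). \<kappa> ((SOME r. r \<in> carrier R \<and> C = kp r) \<odot>\<^bsub>P\<^esub> y))"
  have gk: "g (kp r, y) = \<kappa> (r \<odot>\<^bsub>P\<^esub> y)" if ry: "r \<in> carrier R" "y \<in> carrier P" for r y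
  proof -
    define s where "s = (SOME s. s \<in> carrier R \<and> kp r = kp s)"
    have s: "s \<in> carrier R" "kp r = kp s" using someI[of "\<lambda>s. s \<in> carrier R \<and> kp r = kp s" r] ry unfolding s_def by auto
    have v: "s \<ominus> r \<in> var_ideal R x e" using kp_eq[OF s(1) ry(1)] s(2) by simp
    have "s \<odot>\<^bsub>P\<^esub> y \<ominus>\<^bsub>P\<^esub> r \<odot>\<^bsub>P\<^esub> y = (s \<ominus> r) \<odot>\<^bsub>P\<^esub> y"
      using s ry by (simp add: a_minus_def P.smult_l_distr P.smult_l_minus)
    also have "\<dots> \<in> ?m" by (rule P.smult_var_ideal[OF P.sub_carrier ry(2) v])
    finally have "\<kappa> (s \<odot>\<^bsub>P\<^esub> y) = \<kappa> (r \<odot>\<^bsub>P\<^esub> y)" unfolding \<kappa>_def using P.coset_eq[OF msub] s ry by simp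
    then show ?thesis unfolding g_def s_def by simp
  qed
  have "g ` (carrier resm \<times> carrier P) \<subseteq> carrier (add_monoid (quot_module P ?m))"
    unfolding kp_image[symmetric] using gk Q.a_closed by auto
  then obtain h where h: "h \<in> hom (free_Abelian_group (carrier resm \<times> carrier P)) (add_monoid (quot_module P ?m))"
    "\<And>c. c \<in> carrier resm \<times> carrier P \<Longrightarrow> h (frag_of c) = g c"
    by (rule comm_group.free_Abelian_group_universal[OF cg]) blast
  have h1: "h \<in> hom TF (add_monoid (quot_module P ?m))" using h(1) by (simp add: tensor_free_def)
  have hf: "h (frag_of (kp r, y)) = \<kappa> (r \<odot>\<^bsub>P\<^esub> y)" if "r \<in> carrier R" "y \<in> carrier P" for r y
    using h(2)[of "(kp r, y)"] gk[OF that] kp_simps(3) that by simp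
  have hc: "h f \<in> carrier (quot_module P ?m)" if "f \<in> carrier TF" for f using h1 that by (auto simp: hom_def)
  have ha: "h (f + f') = h f \<oplus>\<^bsub>quot_module P ?m\<^esub> h f'" if "f \<in> carrier TF" "f' \<in> carrier TF" for f f'
    using hom_mult[OF h1 that] by (simp add: tensor_free_mult)
  have canc1: "h (a - b) = \<zero>\<^bsub>quot_module P ?m\<^esub>" if "a \<in> carrier TF" "b \<in> carrier TF" "h a = h b" for a b
  proof -
    have d: "a - b \<in> carrier TF" by (rule tensor_free_diff[OF that(1,2)])
    have "h (a - b) \<oplus>\<^bsub>quot_module P ?m\<^esub> h b = h b" using ha[OF d that(2)] that(3) by simp
    then show ?thesis using hc[OF d] hc[OF that(2)] Q.N.M.add.r_cancel_one by blast
  qed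
  have canc2: "h (a - b - c) = \<zero>\<^bsub>quot_module P ?m\<^esub>"
    if "a \<in> carrier TF" "b \<in> carrier TF" "c \<in> carrier TF" "h a = h b \<oplus>\<^bsub>quot_module P ?m\<^esub> h c" for a b c
  proof -
    have "h (a - c) \<oplus>\<^bsub>quot_module P ?m\<^esub> h c = h b \<oplus>\<^bsub>quot_module P ?m\<^esub> h c"
      using ha[OF tensor_free_diff[OF that(1,3)] that(3)] that(4) by simp
    then have "h (a - c) = h b" using hc tensor_free_diff that by (metis Q.N.M.add.right_cancel)
    then have "h (a - c - b) = \<zero>\<^bsub>quot_module P ?m\<^esub>" by (intro canc1 tensor_free_diff that)
    moreover have "a - c - b = a - b - c" by simp
    ultimately show ?thesis by simp
  qed
  have hr: "h f = \<zero>\<^bsub>quot_module P ?m\<^esub>" if "f \<in> rels R resm P" for f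
    using that
  proof (cases rule: relsE)
    case (1 C C' y)
    obtain r s where rs: "r \<in> carrier R" "C = kp r" "s \<in> carrier R" "C' = kp s" using 1(1,2) unfolding kp_image[symmetric] by blast
    have "h (frag_of (C \<oplus>\<^bsub>resm\<^esub> C', y)) = \<kappa> ((r \<oplus> s) \<odot>\<^bsub>P\<^esub> y)" using hf[of "r \<oplus> s" y] kp_simps(1) rs 1(3) by simp
    also have "\<dots> = h (frag_of (C, y)) \<oplus>\<^bsub>quot_module P ?m\<^esub> h (frag_of (C', y))"
      using hf rs 1(3) Q.a_add[of "r \<odot>\<^bsub>P\<^esub> y" "s \<odot>\<^bsub>P\<^esub> y"] P.smult_l_distr by simp
    finally show ?thesis unfolding 1(4) by (intro canc2) (use 1 resm_lmod lmod.subD(4)[OF resm_lmod lmod.sub_carrier[OF resm_lmod]] in \<open>auto simp: tensor_free_of\<close>)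
  next
    case (2 C y y')
    obtain r where r: "r \<in> carrier R" "C = kp r" using 2(1) unfolding kp_image[symmetric] by blast
    have "h (frag_of (C, y \<oplus>\<^bsub>P\<^esub> y')) = h (frag_of (C, y)) \<oplus>\<^bsub>quot_module P ?m\<^esub> h (frag_of (C, y'))"
      using hf r 2(2,3) Q.a_add[of "r \<odot>\<^bsub>P\<^esub> y" "r \<odot>\<^bsub>P\<^esub> y'"] P.smult_r_distr by simp
    then show ?thesis unfolding 2(4) by (intro canc2) (use 2 in \<open>auto simp: tensor_free_of\<close>)
  next
    case (3 r C y)
    obtain s where s: "s \<in> carrier R" "C = kp s" using 3(2) unfolding kp_image[symmetric] by blast
    have "h (frag_of (r \<odot>\<^bsub>resm\<^esub> C, y)) = \<kappa> ((r \<otimes> s) \<odot>\<^bsub>P\<^esub> y)" using hf[of "r \<otimes> s" y] kp_simps(2) s 3 by simp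
    also have "\<dots> = h (frag_of (C, r \<odot>\<^bsub>P\<^esub> y))"
      using hf[of s "r \<odot>\<^bsub>P\<^esub> y"] s 3 P.smult_assoc1[of s r y] m_comm[of r s] by simp
    finally have "h (frag_of (r \<odot>\<^bsub>resm\<^esub> C, y)) = h (frag_of (C, r \<odot>\<^bsub>P\<^esub> y))" .
    then show ?thesis unfolding 3(4)
      by (intro canc1) (use 3 lmod.subD(5)[OF resm_lmod lmod.sub_carrier[OF resm_lmod]] in \<open>auto simp: tensor_free_of\<close>)
  qed
  interpret gh: group_hom TF "add_monoid (quot_module P ?m)" h
    by (intro group_hom.intro tensor_free_group group_hom_axioms.intro h1) (rule Q.N.M.a_group)
  have "rels R resm P \<subseteq> kernel TF (add_monoid (quot_module P ?m)) h"
    using hr rels_carrier[OF mods] by (auto simp: kernel_def)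
  then have "ZZ \<subseteq> kernel TF (add_monoid (quot_module P ?m)) h"
    unfolding tensor_relations_eq by (rule gh.generate_subgroup_incl[OF _ gh.subgroup_kernel])
  then have "h (E y - E z) = \<zero>\<^bsub>quot_module P ?m\<^esub>" using d by (auto simp: kernel_def)
  moreover have Ec: "E w \<in> carrier TF" if "w \<in> carrier P" for w using kp_simps(3)[OF one_closed] that by (simp add: tensor_free_of)
  ultimately have "h (E y - E z + E z) = h (E z)"
    using ha[OF tensor_free_diff[OF Ec[OF yz(1)] Ec[OF yz(2)]] Ec[OF yz(2)]] hc[OF Ec[OF yz(2)]] by simp
  then have "\<kappa> y = \<kappa> z" using hf[OF one_closed yz(1)] hf[OF one_closed yz(2)] yz by simp
  then show ?thesis unfolding \<kappa>_def using P.coset_eq[OF msub yz] by simp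
qed

lemma sg_eq: assumes yz: "y \<in> carrier P" "z \<in> carrier P"
  shows "sg P y = sg P z \<longleftrightarrow> y \<ominus>\<^bsub>P\<^esub> z \<in> P.mm (carrier P)"
proof -
  have m: "y \<ominus>\<^bsub>P\<^esub> z \<in> carrier P" using yz by simp
  have eq: "(y \<ominus>\<^bsub>P\<^esub> z) \<oplus>\<^bsub>P\<^esub> z = y" using yz by (simp add: a_minus_def P.M.a_assoc P.M.l_neg)
  have "E y - E z \<in> ZZ" if "y \<ominus>\<^bsub>P\<^esub> z \<in> P.mm (carrier P)"
    using ZD(2)[OF E_add[OF m yz(2)] E_mm[OF that]] unfolding eq by simp
  then show ?thesis unfolding sg_def relations_coset(1)[OF mods] using E_ker[OF yz] by blast
qed

lemma sg_zero: "sg P \<zero>\<^bsub>P\<^esub> = \<zero>\<^bsub>tensor_product R resm P\<^esub>"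
proof -
  have "sg P \<zero>\<^bsub>P\<^esub> = ZZ" unfolding set_eq_iff sg_def relations_coset(2)[OF mods]
  proof
    fix h
    show "h - E \<zero>\<^bsub>P\<^esub> \<in> ZZ \<longleftrightarrow> h \<in> ZZ"
      using ZD(2)[OF _ E_zero, of "h - E \<zero>\<^bsub>P\<^esub>"] ZD(4)[OF _ E_zero, of h] by auto
  qed
  then show ?thesis by (simp add: tensor_product_def Let_def)
qed

lemma sg_image: "sg P ` carrier P = carrier (tensor_product R resm P)"
proof -
  have "carrier (tensor_product R resm P) = (\<lambda>f. ZZ #>\<^bsub>TF\<^esub> f) ` carrier TF"
    by (auto simp: tensor_product_def Let_def RCOSETS_def)
  also have "\<dots> = sg P ` carrier P"
  proof (intro subset_antisym subsetI)
    fix C assume "C \<in> (\<lambda>f. ZZ #>\<^bsub>TF\<^esub> f) ` carrier TF"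
    then obtain f where f: "f \<in> carrier TF" "C = ZZ #>\<^bsub>TF\<^esub> f" by blast
    obtain z where z: "z \<in> carrier P" "f - E z \<in> ZZ" using E_surj[OF f(1)] by blast
    then have "C = sg P z" unfolding f(2) sg_def relations_coset(1)[OF mods] by simp
    then show "C \<in> sg P ` carrier P" using z(1) by blast
  next
    fix C assume "C \<in> sg P ` carrier P"
    then obtain z where z: "z \<in> carrier P" "C = ZZ #>\<^bsub>TF\<^esub> E z" unfolding sg_def by blast
    have "E z \<in> carrier TF" using kp_simps(3)[OF one_closed] z(1) by (simp add: tensor_free_of)
    then show "C \<in> (\<lambda>f. ZZ #>\<^bsub>TF\<^esub> f) ` carrier TF" using z(2) by blast
  qed
  finally show ?thesis by simp
qed

lemma sg_add: assumes "y \<in> carrier P" "z \<in> carrier P"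
  shows "sg P (y \<oplus>\<^bsub>P\<^esub> z) = sg P y \<oplus>\<^bsub>tensor_product R resm P\<^esub> sg P z"
proof -
  have "h \<in> sg P (y \<oplus>\<^bsub>P\<^esub> z) \<longleftrightarrow> (\<exists>f\<in>sg P y. \<exists>g\<in>sg P z. h = f + g)" for h
  proof
    assume "h \<in> sg P (y \<oplus>\<^bsub>P\<^esub> z)"
    then have "h - E (y \<oplus>\<^bsub>P\<^esub> z) \<in> ZZ" unfolding sg_def relations_coset(2)[OF mods] .
    from ZD(2)[OF this E_add[OF assms]] have "h - E z - E y \<in> ZZ" by (simp add: algebra_simps)
    then have "h - E z \<in> sg P y" "E z \<in> sg P z" unfolding sg_def relations_coset(2)[OF mods] using ZD(1) by simp_all
    then show "\<exists>f\<in>sg P y. \<exists>g\<in>sg P z. h = f + g" by (intro bexI[of _ "h - E z"] bexI[of _ "E z"]) simp_all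
  next
    assume "\<exists>f\<in>sg P y. \<exists>g\<in>sg P z. h = f + g"
    then obtain f g where f: "f \<in> sg P y" "g \<in> sg P z" and "h = f + g" by blast
    with f have fg: "f - E y \<in> ZZ" "g - E z \<in> ZZ" "h = f + g" unfolding sg_def relations_coset(2)[OF mods] by simp_all
    have "h - E (y \<oplus>\<^bsub>P\<^esub> z) = (f - E y) + (g - E z) - (E (y \<oplus>\<^bsub>P\<^esub> z) - E y - E z)" unfolding fg(3) by simp
    also have "\<dots> \<in> ZZ" by (rule ZD(4)[OF ZD(2)[OF fg(1,2)] E_add[OF assms]])
    finally show "h \<in> sg P (y \<oplus>\<^bsub>P\<^esub> z)" unfolding sg_def relations_coset(2)[OF mods] .
  qed
  moreover have "h \<in> sg P y \<oplus>\<^bsub>tensor_product R resm P\<^esub> sg P z \<longleftrightarrow> (\<exists>f\<in>sg P y. \<exists>g\<in>sg P z. h = f + g)" for h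
    by (auto simp: tensor_product_def Let_def set_mult_def tensor_free_mult)
  ultimately show ?thesis by blast
qed

text \<open>Scalar action and \<open>tensor_map\<close> are defined as unions over a coset. All
  members of such a union coincide because the underlying map respects the relations.\<close>

lemma coset_map:
  assumes Q: "module R Q" and \<alpha>: "lin R resm (carrier resm) resm (carrier resm) \<alpha>" and \<delta>: "lin R P (carrier P) Q (carrier Q) \<delta>"
    and z: "z \<in> carrier P"
  shows "(\<Union>c\<in>sg P z. tensor_relations R resm Q #>\<^bsub>tensor_free resm Q\<^esub> frag_extend (\<lambda>(x, y). frag_of (\<alpha> x, \<delta> y)) c)
    = tensor_relations R resm Q #>\<^bsub>tensor_free resm Q\<^esub> frag_of (\<alpha> (kp \<one>), \<delta> z)"
proof -
  have "tensor_relations R resm Q #>\<^bsub>tensor_free resm Q\<^esub> frag_extend (\<lambda>(x, y). frag_of (\<alpha> x, \<delta> y)) c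
      = tensor_relations R resm Q #>\<^bsub>tensor_free resm Q\<^esub> frag_of (\<alpha> (kp \<one>), \<delta> z)" if "c \<in> sg P z" for c
  proof -
    have "c - E z \<in> ZZ" using that unfolding sg_def relations_coset(2)[OF mods] .
    from frag_extend_relations[OF mods mods(1) Q \<alpha> \<delta> this] show ?thesis
      unfolding relations_coset(1)[OF mods(1) Q] by (simp add: frag_extend_diff)
  qed
  moreover have "E z \<in> sg P z" unfolding sg_def relations_coset(2)[OF mods] using ZD(1) by simp
  ultimately show ?thesis by blast
qed

lemma sg_smult: assumes r: "r \<in> carrier R" and z: "z \<in> carrier P"
  shows "sg P (r \<odot>\<^bsub>P\<^esub> z) = r \<odot>\<^bsub>tensor_product R resm P\<^esub> sg P z"
proof -
  interpret K: lmod R x e resm by (rule resm_lmod)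
  have \<alpha>: "lin R resm (carrier resm) resm (carrier resm) (\<lambda>c. r \<odot>\<^bsub>resm\<^esub> c)"
    unfolding lin_def using r by (auto simp: K.smult_r_distr K.smult_assoc1[symmetric] m_comm)
  have \<delta>: "lin R P (carrier P) P (carrier P) (\<lambda>y. y)" unfolding lin_def by simp
  have "r \<odot>\<^bsub>tensor_product R resm P\<^esub> sg P z = ZZ #>\<^bsub>TF\<^esub> frag_of (r \<odot>\<^bsub>resm\<^esub> kp \<one>, z)"
    using coset_map[OF mods(2) \<alpha> \<delta> z] by (simp add: tensor_product_def Let_def)
  also have "\<dots> = sg P (r \<odot>\<^bsub>P\<^esub> z)"
    unfolding sg_def relations_coset(1)[OF mods] using E_smult[OF r z] kp_simps(2)[OF r one_closed] r by simp
  finally show ?thesis by simp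
qed

lemma sg_map: assumes Q: "module R Q" and \<delta>: "lin R P (carrier P) Q (carrier Q) \<delta>" and z: "z \<in> carrier P"
  shows "tensor_map R resm Q \<delta> (sg P z) = sg Q (\<delta> z)"
proof -
  have \<alpha>: "lin R resm (carrier resm) resm (carrier resm) (\<lambda>c. c)" unfolding lin_def by simp
  show ?thesis unfolding tensor_map_def using coset_map[OF Q \<alpha> \<delta> z] by (simp add: sg_def)
qed

text \<open>Homology is computed in P/mP instead of the tensor product: cycles from U modulo
  boundaries from B become U/(B + mP).\<close>

lemma tor_quot:
  assumes U: "P.sub U" and B: "P.sub B" "B \<subseteq> U" and k: "P.len (B <+>\<^bsub>P\<^esub> P.mm (carrier P)) U k"
  shows "vectorspace.dim (residue_field R) (over_residue_field
    (quot_module ((tensor_product R resm P)\<lparr>carrier := sg P ` U\<rparr>) (sg P ` B))) = k"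
proof -
  let ?T = "(tensor_product R resm P)\<lparr>carrier := sg P ` U\<rparr>"
  note UD = P.subD[OF U]
  interpret A: slin R x e P R x ?T "\<lambda>r. r" "sg P" U
    by (rule P.transport_id[OF U]) (simp_all add: UD(2) sg_add sg_smult sg_zero)
  have WB: "A.N.sub (sg P ` B)" by (rule A.sub_image[OF B])
  let ?Q = "quot_module ?T (sg P ` B)"
  define \<pi> where "\<pi> u = sg P ` B +>\<^bsub>?T\<^esub> sg P u" for u
  interpret C: slin R x e ?T R x ?Q "\<lambda>r. r" "\<lambda>t. sg P ` B +>\<^bsub>?T\<^esub> t" "carrier ?T" by (rule A.N.quot_slin(1)[OF WB])
  have im: "\<pi> ` U = carrier ?Q" using A.N.quot_slin(2)[OF WB] unfolding \<pi>_def by (simp add: image_image)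
  have sl: "slin R x e P R x ?Q (\<lambda>r. r) \<pi> U"
  proof (rule P.transport_id[OF U im])
    show "\<pi> (u \<oplus>\<^bsub>P\<^esub> v) = \<pi> u \<oplus>\<^bsub>?Q\<^esub> \<pi> v" if "u \<in> U" "v \<in> U" for u v
      unfolding \<pi>_def A.a_add[OF that] by (rule C.a_add[OF A.a_closed[OF that(1)] A.a_closed[OF that(2)]])
    show "\<pi> (r \<odot>\<^bsub>P\<^esub> u) = r \<odot>\<^bsub>?Q\<^esub> \<pi> u" if "r \<in> carrier R" "u \<in> U" for r u
      unfolding \<pi>_def A.a_smult[OF that] by (rule C.a_smult[OF that(1) A.a_closed[OF that(2)]])
    show "\<pi> \<zero>\<^bsub>P\<^esub> = \<zero>\<^bsub>?Q\<^esub>" unfolding \<pi>_def A.a_zero by (rule C.a_zero)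
  qed
  show ?thesis
  proof (rule dim_quot[OF sl im _ _ k])
    have mc: "P.sub (P.mm (carrier P))" by (rule P.mm_sub[OF P.sub_carrier])
    show "P.mm U \<subseteq> B <+>\<^bsub>P\<^esub> P.mm (carrier P)"
      using P.mm_mono[OF UD(1)] P.add_upper2[OF B(1) mc] by blast
    fix u assume u: "u \<in> U"
    have uc: "sg P u \<in> carrier ?T" by (rule A.a_closed[OF u])
    have "\<pi> u = \<zero>\<^bsub>?Q\<^esub> \<longleftrightarrow> sg P ` B +>\<^bsub>?T\<^esub> sg P u = sg P ` B +>\<^bsub>?T\<^esub> \<zero>\<^bsub>?T\<^esub>" unfolding \<pi>_def C.a_zero[symmetric] ..
    also have "\<dots> \<longleftrightarrow> sg P u \<ominus>\<^bsub>?T\<^esub> \<zero>\<^bsub>?T\<^esub> \<in> sg P ` B" by (rule A.N.coset_eq[OF WB uc A.N.M.zero_closed])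
    also have "\<dots> \<longleftrightarrow> sg P u \<in> sg P ` B" using uc by (metis A.N.add_minus A.N.l_zero A.N.minus_closed A.N.zero_closed)
    also have "\<dots> \<longleftrightarrow> (\<exists>b\<in>B. u \<ominus>\<^bsub>P\<^esub> b \<in> P.mm (carrier P))"
      using sg_eq[OF UD(2)[OF u]] P.subD(2)[OF B(1)] by (auto simp: image_iff)
    also have "\<dots> \<longleftrightarrow> u \<in> B <+>\<^bsub>P\<^esub> P.mm (carrier P)"
    proof
      assume "\<exists>b\<in>B. u \<ominus>\<^bsub>P\<^esub> b \<in> P.mm (carrier P)"
      then obtain b where b: "b \<in> B" "u \<ominus>\<^bsub>P\<^esub> b \<in> P.mm (carrier P)" by blast
      have "u = b \<oplus>\<^bsub>P\<^esub> (u \<ominus>\<^bsub>P\<^esub> b)" using P.add_minus[OF P.subD(2)[OF B(1) b(1)] UD(2)[OF u]] by simp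
      then show "u \<in> B <+>\<^bsub>P\<^esub> P.mm (carrier P)" unfolding P.mem_add using b by blast
    next
      assume "u \<in> B <+>\<^bsub>P\<^esub> P.mm (carrier P)"
      then obtain b w where b: "b \<in> B" "w \<in> P.mm (carrier P)" "u = b \<oplus>\<^bsub>P\<^esub> w" unfolding P.mem_add by blast
      have "u \<ominus>\<^bsub>P\<^esub> b = w" unfolding b(3) a_minus_def
        using P.subD(2)[OF B(1) b(1)] P.subD(2)[OF mc b(2)] by (metis P.add.inv_closed P.add.m_assoc P.add.m_comm P.r_neg P.r_zero)
      then show "\<exists>b\<in>B. u \<ominus>\<^bsub>P\<^esub> b \<in> P.mm (carrier P)" using b by blast
    qed
    finally show "\<pi> u = \<zero>\<^bsub>?Q\<^esub> \<longleftrightarrow> u \<in> B <+>\<^bsub>P\<^esub> P.mm (carrier P)" .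
  qed
qed

end

section \<open>Free resolutions, and Betti numbers as lengths\<close>

context artin begin

lemma tens_Fr: "tens R x e n l (Fr p)" by (intro tens.intro artin_axioms lmod_Fr)

text \<open>It ensures that the choice in \<open>Tor\<close> picks a resolution. Every syzygy is a
  submodule of a finite free module and so has a finite cover; dependent choice strings these covers
  together.\<close>

lemma ex_free_resolution:
  assumes M: "lmod R x e M" and fg: "finitely_generated_module R M"
  shows "\<exists>b d \<epsilon>. free_resolution R M b d \<epsilon>"
proof -
  interpret M: lmod R x e M by fact
  obtain S where S: "finite S" "S \<subseteq> carrier M" "M.span S = carrier M" using fg unfolding finitely_generated_module_def by blast
  obtain u where u: "bij_betw u {0..<card S} S" using ex_bij_betw_nat_finite[OF S(1)] by blast
  define p where "p = card S"
  have uS: "u ` {..<p} = S" using u unfolding bij_betw_def p_def by (simp add: lessThan_atLeast0)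
  have uc: "u i \<in> carrier M" if "i < p" for i using that uS S(2) by blast
  interpret F: lmod R x e "Fr p" by (rule lmod_Fr)
  have L: "lin R (Fr p) (Fc p) M (carrier M) (M.comb p u)" by (rule M.comb_lin[OF M.sub_carrier uc])
  interpret L: slin R x e "Fr p" R x M "\<lambda>r. r" "M.comb p u" "Fc p" by (rule F.slin_lin[OF M F.sub_carrier L]) simp
  have I: "M.sub (M.comb p u ` Fc p)" by (rule L.sub_image[OF F.sub_carrier]) simp
  have SI: "s \<in> M.comb p u ` Fc p" if s: "s \<in> S" for s
  proof -
    obtain i where i: "i < p" "s = u i" using s uS by blast
    have "M.comb p u (unit_vec R p i) = s" using M.comb_unit_vec[of p u i] uc i by simp
    then show ?thesis using unit_vec_closed[of p i] by blast
  qed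
  have "carrier M \<subseteq> M.comb p u ` Fc p"
  proof
    fix v assume "v \<in> carrier M"
    then have "v \<in> M.span S" using S(3) by simp
    then obtain a A where a: "finite A" "A \<subseteq> S" "a \<in> A \<rightarrow> carrier R" "v = M.lincomb a A" unfolding M.span_def by blast
    show "v \<in> M.comb p u ` Fc p" unfolding a(4) M.lincomb_def
      by (rule M.sub_finsum[OF I a(1)]) (rule M.subD(5)[OF I], use a SI in auto)
  qed
  then have cov: "cover p M (carrier M) (M.comb p u)" unfolding cover_def using L linD(1)[OF L] by blast
  define K0 where "K0 = krn p M (M.comb p u)"
  have K0: "submodule R K0 (Fr p)" unfolding K0_def by (rule krn_sub[OF M M.sub_carrier cov])
  \<comment> \<open>A state (q', q, \<pi>) is a cover \<pi>, from rank q', of a submodule of the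
    free module of rank q. The clause for k = 0 anchors the sequence at the first syzygy of
    M.\<close>
  define PP where "PP k s = (case s of (q', q, \<pi>) \<Rightarrow> (k = 0 \<longrightarrow> q = p \<and> cover q' (Fr p) K0 \<pi>) \<and>
    (\<exists>K. submodule R K (Fr q) \<and> cover q' (Fr q) K \<pi>))" for k :: nat and s :: "nat \<times> nat \<times> ((nat \<Rightarrow> 'a) \<Rightarrow> (nat \<Rightarrow> 'a))"
  define QQ where "QQ k s t = (case s of (q', q, \<pi>) \<Rightarrow> case t of (r', r, \<rho>) \<Rightarrow> r = q' \<and> cover r' (Fr q') (krn q' (Fr q) \<pi>) \<rho>)"
    for k :: nat and s t :: "nat \<times> nat \<times> ((nat \<Rightarrow> 'a) \<Rightarrow> (nat \<Rightarrow> 'a))"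
  have "\<exists>f. \<forall>k. PP k (f k) \<and> QQ k (f k) (f (Suc k))"
  proof (rule dependent_nat_choice)
    obtain q \<pi> where "cover q (Fr p) K0 \<pi>" by (rule ex_cover_Fr[OF K0])
    then show "\<exists>s. PP 0 s" using K0 by (intro exI[of _ "(q, p, \<pi>)"]) (auto simp: PP_def)
    fix s k assume s: "PP k s"
    obtain q' q \<pi> where sq: "s = (q', q, \<pi>)" by (cases s) auto
    obtain K where K: "submodule R K (Fr q)" "cover q' (Fr q) K \<pi>" using s sq by (auto simp: PP_def)
    have kk: "submodule R (krn q' (Fr q) \<pi>) (Fr q')" by (rule krn_sub[OF lmod_Fr K])
    obtain r \<rho> where "cover r (Fr q') (krn q' (Fr q) \<pi>) \<rho>" by (rule ex_cover_Fr[OF kk])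
    then show "\<exists>t. PP (Suc k) t \<and> QQ k s t" using kk by (intro exI[of _ "(r, q', \<rho>)"]) (auto simp: PP_def QQ_def sq)
  qed
  then obtain f where f: "\<And>k. PP k (f k)" "\<And>k. QQ k (f k) (f (Suc k))" by blast
  define b where "b i = fst (snd (f i))" for i
  define d where "d i = snd (snd (f i))" for i
  have bS: "fst (f i) = b (Suc i)" for i using f(2)[of i] by (auto simp: QQ_def b_def split: prod.splits)
  have fi: "f i = (b (Suc i), b i, d i)" for i using bS[of i] by (simp add: b_def d_def prod_eq_iff)
  have b0: "b 0 = p" "cover (b (Suc 0)) (Fr p) K0 (d 0)" using f(1)[of 0] unfolding fi PP_def by auto
  have cS: "cover (b (Suc (Suc i))) (Fr (b (Suc i))) (krn (b (Suc i)) (Fr (b i)) (d i)) (d (Suc i))" for i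
    using f(2)[of i] unfolding fi QQ_def by auto
  have lin_c: "lin R (Fr q) (Fc q) (Fr r) (Fc r) \<rho>" if "cover q (Fr r) K \<rho>" "K \<subseteq> Fc r" for q r K \<rho>
    using that by (auto simp: cover_def lin_def)
  have dl: "lin R (Fr (b (Suc i))) (Fc (b (Suc i))) (Fr (b i)) (Fc (b i)) (d i)" for i
  proof (cases i)
    case 0
    show ?thesis unfolding 0 by (rule lin_c[OF b0(2)[folded b0(1)]]) (auto simp: K0_def krn_def b0(1))
  next
    case (Suc j)
    show ?thesis unfolding Suc by (rule lin_c[OF cS]) (auto simp: krn_def)
  qed
  have "free_resolution R M b d (M.comb p u)"
    unfolding free_resolution_def module_hom_lin a_kernel_def'
    using b0 L dl cS cov by (auto simp: cover_def K0_def krn_def)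
  then show ?thesis by blast
qed

lemma free_resolution_resol:
  assumes M: "lmod R x e M" and f: "free_resolution R M b d \<epsilon>"
  shows "resol M b d \<epsilon> (\<lambda>i. d i ` Fc (b (Suc i)))"
proof -
  have im: "\<epsilon> ` Fc (b 0) = carrier M" "lin R (Fr (b 0)) (Fc (b 0)) M (carrier M) \<epsilon>"
    "d 0 ` Fc (b (Suc 0)) = krn (b 0) M \<epsilon>"
    "\<And>i. d (Suc i) ` Fc (b (Suc (Suc i))) = krn (b (Suc i)) (Fr (b i)) (d i)"
    "\<And>i. lin R (Fr (b (Suc i))) (Fc (b (Suc i))) (Fr (b i)) (Fc (b i)) (d i)"
    using f unfolding free_resolution_def module_hom_lin a_kernel_def' krn_def by auto
  have "cover (b (Suc i)) (Fr (b i)) (d i ` Fc (b (Suc i))) (d i)" for i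
    unfolding cover_def by (intro conjI lin_mono[OF im(5)]) auto
  then show ?thesis unfolding resol_def cover_def using im by auto
qed

text \<open>In degree j + 1 the cycles are lifted to the u with \<open>d j u\<close> in mF. The
  differential carries them, modulo boundaries and mF, isomorphically onto (B \<inter> mF)/mB one
  step below. In this form Betti numbers can be compared across resolutions by
  \<open>syz_compare\<close>.\<close>

theorem betti_len:
  assumes M: "lmod R x e M" and fg: "finitely_generated_module R M"
  obtains b d \<epsilon> B where "resol M b d \<epsilon> B" "mlen R x e M (mmul M x e (carrier M)) (carrier M) (betti R M 0)"
    "\<And>i. mlen R x e (Fr (b i)) (mmul (Fr (b i)) x e (B i)) (B i \<inter> mmul (Fr (b i)) x e (Fc (b i))) (betti R M (Suc i))"
proof -
  interpret M: lmod R x e M by fact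
  define bd where "bd = (SOME (b, d). \<exists>\<epsilon>. free_resolution R M b d \<epsilon>)"
  obtain b d where bd: "bd = (b, d)" by (cases bd)
  have "\<exists>s. case s of (b, d) \<Rightarrow> \<exists>\<epsilon>. free_resolution R M b d \<epsilon>" using ex_free_resolution[OF M fg] by auto
  from someI_ex[OF this] obtain \<epsilon> where f: "free_resolution R M b d \<epsilon>" unfolding bd_def[symmetric] bd by auto
  define B where "B i = d i ` Fc (b (Suc i))" for i
  have rs: "resol M b d \<epsilon> B" using free_resolution_resol[OF M f] unfolding B_def[abs_def] .
  note rd = resolD[OF rs] and Bs = resol_sub[OF M rs]
  interpret F: lmod R x e "Fr p" for p by (rule lmod_Fr)
  interpret T: tens R x e n l "Fr p" for p by (rule tens_Fr)
  let ?m = "\<lambda>i. mmul (Fr (b i)) x e (Fc (b i))"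
  \<comment> \<open>The cycles of the tensored complex, lifted to the free modules: a tensored image
    is zero exactly if it lies in m times the free module.\<close>
  define U where "U i = (case i of 0 \<Rightarrow> Fc (b 0) | Suc j \<Rightarrow> {u \<in> Fc (b (Suc j)). d j u \<in> ?m j})" for i
  have ms: "submodule R (?m i) (Fr (b i))" for i by (rule F.mm_sub[OF F.sub_carrier])
  have dl: "lin R (Fr (b (Suc i))) (Fc (b (Suc i))) (Fr (b i)) (Fc (b i)) (d i)" for i
    using f unfolding free_resolution_def module_hom_lin by auto
  have D: "slin R x e (Fr (b (Suc i))) R x (Fr (b i)) (\<lambda>r. r) (d i) (Fc (b (Suc i)))" for i
    by (rule F.slin_lin[OF lmod_Fr F.sub_carrier dl]) simp
  have Us: "submodule R (U i) (Fr (b i))" for i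
  proof (cases i)
    case 0 then show ?thesis using F.sub_carrier by (simp add: U_def)
  next
    case (Suc j)
    interpret Dj: slin R x e "Fr (b (Suc j))" R x "Fr (b j)" "\<lambda>r. r" "d j" "Fc (b (Suc j))" by (rule D)
    show ?thesis unfolding Suc U_def using Dj.sub_vimage[OF ms] by simp
  qed
  have dB: "B (Suc j) = {u \<in> Fc (b (Suc j)). d j u = \<zero>\<^bsub>Fr (b j)\<^esub>}" for j using rd(4)[of j] by (simp add: krn_def)
  have BU: "B i \<subseteq> U i" for i
  proof (cases i)
    case 0 then show ?thesis using F.subD(1)[OF Bs[of 0]] by (simp add: U_def)
  next
    case (Suc j)
    show ?thesis unfolding Suc dB U_def using F.subD(3)[OF ms[of j]] by auto
  qed
  have mU: "?m i \<subseteq> U i" for i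
  proof (cases i)
    case 0 then show ?thesis using F.subD(1)[OF ms[of 0]] by (simp add: U_def)
  next
    case (Suc j)
    interpret Dj: slin R x e "Fr (b (Suc j))" R x "Fr (b j)" "\<lambda>r. r" "d j" "Fc (b (Suc j))" by (rule D)
    have "d j ` ?m (Suc j) = mmul (Fr (b j)) x e (B j)" unfolding B_def by (rule Dj.image_mm[OF F.sub_carrier subset_refl])
    also have "\<dots> \<subseteq> ?m j" by (rule F.mm_mono[OF F.subD(1)[OF Bs]])
    finally show ?thesis unfolding Suc U_def using F.subD(1)[OF ms[of "Suc j"]] by auto
  qed
  let ?V = "\<lambda>i. B i <+>\<^bsub>Fr (b i)\<^esub> ?m i"
  have Vs: "submodule R (?V i) (Fr (b i))" for i by (rule F.sub_add[OF Bs ms])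
  have VU: "?V i \<subseteq> U i" for i by (rule F.add_least[OF Us BU mU])
  have "\<exists>k. mlen R x e (Fr (b i)) (?V i) (U i) k" for i
    using F.len_sub_ex[OF len_Fr Vs Us _ VU F.subD(1)[OF Us]] F.subD(3)[OF Vs] by blast
  then obtain k where k: "\<And>i. mlen R x e (Fr (b i)) (?V i) (U i) (k i)" by metis
  have betti: "betti R M i = k i" for i
  proof -
    let ?TP = "\<lambda>j. tensor_product R resm (Fr (b j))" and ?D = "\<lambda>j. tensor_map R resm (Fr (b j)) (d j)"
    have Dsg: "?D j (sg (Fr (b (Suc j))) u) = sg (Fr (b j)) (d j u)" if "u \<in> Fc (b (Suc j))" for j u
      by (rule T.sg_map[OF F.module_axioms dl that])
    have cyc: "(case i of 0 \<Rightarrow> carrier (?TP 0) | Suc j \<Rightarrow> a_kernel (?TP (Suc j)) (?TP j) (?D j)) = sg (Fr (b i)) ` U i"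
    proof (cases i)
      case 0 then show ?thesis using T.sg_image[of "b 0"] by (simp add: U_def)
    next
      case (Suc j)
      have "?D j (sg (Fr (b (Suc j))) u) = \<zero>\<^bsub>?TP j\<^esub> \<longleftrightarrow> d j u \<in> ?m j" if u: "u \<in> Fc (b (Suc j))" for u
      proof -
        have du: "d j u \<in> Fc (b j)" by (rule linD(1)[OF dl u])
        have "?D j (sg (Fr (b (Suc j))) u) = \<zero>\<^bsub>?TP j\<^esub> \<longleftrightarrow> d j u \<ominus>\<^bsub>Fr (b j)\<^esub> \<zero>\<^bsub>Fr (b j)\<^esub> \<in> ?m j"
          unfolding Dsg[OF u] T.sg_zero[symmetric] by (rule T.sg_eq[OF du F.M.zero_closed])
        also have "d j u \<ominus>\<^bsub>Fr (b j)\<^esub> \<zero>\<^bsub>Fr (b j)\<^esub> = d j u" using du F.M.r_zero by (simp add: a_minus_def)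
        finally show ?thesis .
      qed
      then show ?thesis unfolding Suc U_def a_kernel_def' T.sg_image[symmetric] by auto
    qed
    have bnd: "?D i ` carrier (?TP (Suc i)) = sg (Fr (b i)) ` B i"
      unfolding T.sg_image[symmetric] B_def using Dsg by (auto simp: image_image image_iff)
    have "betti R M i = vectorspace.dim (residue_field R) (over_residue_field
      (quot_module ((?TP i)\<lparr>carrier := sg (Fr (b i)) ` U i\<rparr>) (sg (Fr (b i)) ` B i)))"
      unfolding betti_def Tor_def bd_def[symmetric] bd Let_def prod.case cyc bnd ..
    then show ?thesis using T.tor_quot[OF Us Bs BU k] by simp
  qed
  show ?thesis
  proof (rule that[OF rs])
    interpret E: slin R x e "Fr (b 0)" R x M "\<lambda>r. r" \<epsilon> "Fc (b 0)"
      by (rule cover_slin[OF M M.sub_carrier rd(1)])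
    have eim: "\<epsilon> ` Fc (b 0) = carrier M" using rd(1) by (simp add: cover_def)
    have em: "\<epsilon> ` ?m 0 = M.mm (carrier M)" using E.image_mm[OF F.sub_carrier subset_refl] eim by simp
    have V0: "?V 0 = {u \<in> Fc (b 0). \<epsilon> u \<in> M.mm (carrier M)}"
      using E.vimage_image[OF ms[of 0] F.subD(1)[OF ms[of 0]]] em rd(2) by (simp add: krn_def)
    have k0: "mlen R x e (Fr (b 0)) (?V 0) (Fc (b 0)) (k 0)" using k[of 0] by (simp add: U_def)
    have mc: "M.sub (M.mm (carrier M))" by (rule M.mm_sub[OF M.sub_carrier])
    have "M.len (M.mm (carrier M)) (carrier M) (k 0)"
    proof (rule E.len_hom[OF k0 subset_refl V0 mc M.mm_subset[OF M.sub_carrier] M.sub_carrier])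
      show "\<epsilon> ` Fc (b 0) \<subseteq> carrier M" using eim by simp
      fix t assume t: "t \<in> carrier M"
      then obtain u where u: "u \<in> Fc (b 0)" "t = \<epsilon> u" using eim by blast
      have "t = \<epsilon> u \<oplus>\<^bsub>M\<^esub> \<zero>\<^bsub>M\<^esub>" using u(2) t by simp
      then show "\<exists>u\<in>Fc (b 0). \<exists>v\<in>M.mm (carrier M). t = \<epsilon> u \<oplus>\<^bsub>M\<^esub> v" using u(1) M.subD(3)[OF mc] by blast
    qed
    then show "M.len (M.mm (carrier M)) (carrier M) (betti R M 0)" unfolding betti .
  next
    fix j
    interpret Dj: slin R x e "Fr (b (Suc j))" R x "Fr (b j)" "\<lambda>r. r" "d j" "Fc (b (Suc j))" by (rule D)
    have mB: "submodule R (mmul (Fr (b j)) x e (B j)) (Fr (b j))" by (rule F.mm_sub[OF Bs])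
    have em: "d j ` ?m (Suc j) = mmul (Fr (b j)) x e (B j)" unfolding B_def by (rule Dj.image_mm[OF F.sub_carrier subset_refl])
    \<comment> \<open>This is the kernel of the induced map: \<open>d j u\<close> lies in mB exactly
      if u is a boundary up to an element of mF, because mB is the image of mF.\<close>
    have V: "?V (Suc j) = {u \<in> Fc (b (Suc j)). d j u \<in> mmul (Fr (b j)) x e (B j)}"
      using Dj.vimage_image[OF ms F.subD(1)[OF ms]] em dB by simp
    have US: "U (Suc j) = {u \<in> Fc (b (Suc j)). d j u \<in> ?m j}" by (simp add: U_def)
    have sub1: "mmul (Fr (b j)) x e (B j) \<subseteq> B j \<inter> ?m j"
      using F.mm_subset[OF Bs] F.mm_mono[OF F.subD(1)[OF Bs]] by blast
    have "mlen R x e (Fr (b j)) (mmul (Fr (b j)) x e (B j)) (B j \<inter> ?m j) (k (Suc j))"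
    proof (rule Dj.len_hom[OF k _ V mB sub1 F.sub_Int[OF Bs ms]])
      show "U (Suc j) \<subseteq> Fc (b (Suc j))" unfolding US by blast
      show "d j ` U (Suc j) \<subseteq> B j \<inter> ?m j" unfolding US B_def by blast
      fix t assume t: "t \<in> B j \<inter> ?m j"
      then obtain u where u: "u \<in> U (Suc j)" "t = d j u" unfolding US B_def by blast
      have "t = d j u \<oplus>\<^bsub>Fr (b j)\<^esub> \<zero>\<^bsub>Fr (b j)\<^esub>" using u(2) t F.subD(2)[OF ms[of j]] by simp
      then show "\<exists>u\<in>U (Suc j). \<exists>v\<in>mmul (Fr (b j)) x e (B j). t = d j u \<oplus>\<^bsub>Fr (b j)\<^esub> v"
        using u(1) F.subD(3)[OF mB] by blast
    qed
    then show "mlen R x e (Fr (b j)) (mmul (Fr (b j)) x e (B j)) (B j \<inter> ?m j) (betti R M (Suc j))" unfolding betti .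
  qed
qed

end

text \<open>With zero kernel the images of the unit vectors would be a basis.\<close>

lemma (in lmod) not_free_cover:
  assumes "\<not> free_module R M" "cover q M (carrier M) \<rho>"
  shows "krn q M \<rho> \<noteq> {\<zero>\<^bsub>Fr q\<^esub>}"
proof
  assume k: "krn q M \<rho> = {\<zero>\<^bsub>Fr q\<^esub>}"
  have L: "lin R (Fr q) (Fc q) M (carrier M) \<rho>" "\<rho> ` Fc q = carrier M" using assms(2) by (auto simp: cover_def)
  define u where "u = (\<lambda>i. \<rho> (unit_vec R q i))"
  have uc: "u i \<in> carrier M" for i unfolding u_def by (rule linD(1)[OF L(1) unit_vec_closed])
  have eq: "comb q u c = \<rho> c" if "c \<in> Fc q" for c
    using lin_expand[OF L(1) subset_refl that] unfolding u_def by simp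
  have gen: "carrier M \<subseteq> comb q u ` Fc q" using L(2) eq by (auto simp: image_iff)
  have ind: "c i = \<zero>" if "c \<in> Fc q" "comb q u c = \<zero>\<^bsub>M\<^esub>" "i < q" for c i
  proof -
    have "c \<in> krn q M \<rho>" using that eq by (simp add: krn_def)
    then have "c = \<zero>\<^bsub>Fr q\<^esub>" using k by blast
    then show ?thesis using that(3) by (simp add: Fr_simps)
  qed
  have b: "lin_indpt (u ` {..<q})" "span (u ` {..<q}) = carrier M"
    by (rule comb_basis[OF _ gen]; use uc ind in blast)+
  have "u ` {..<q} \<subseteq> carrier M" using uc by blast
  then show False using assms(1) b unfolding free_module_def by blast
qed

theorem (in trunc) betti_diff:
  assumes h1: "h m \<ge> 1" "h (Suc m) \<ge> 1" and M: "lmod R y e M" "finitely_generated_module R M" "\<not> free_module R M" and i: "i \<ge> 2"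
  shows "h (Suc m) + betti R M i \<le> betti R M (Suc i) + 1"
proof -
  obtain b d \<epsilon> B where B: "R.resol M b d \<epsilon> B"
    "\<And>i. mlen R y e (R.Fr (b i)) (mmul (R.Fr (b i)) y e (B i)) (B i \<inter> mmul (R.Fr (b i)) y e (R.Fc (b i))) (betti R M (Suc i))"
    by (rule R.betti_len[OF M(1,2)]) blast
  have soc: "(mmul (self_module R) y e ^^ (Suc m - 1)) (carrier R) \<noteq> {\<zero>\<^bsub>R\<^esub>}"
  proof
    assume "(mmul (self_module R) y e ^^ (Suc m - 1)) (carrier R) = {\<zero>\<^bsub>R\<^esub>}"
    then have "mlen R y e (self_module R) {\<zero>\<^bsub>R\<^esub>} {\<zero>\<^bsub>R\<^esub>} (h m)" using len_soc by simp
    then show False using lmod.len_0[OF R.lmod_self] h1(1) by fastforce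
  qed
  \<comment> \<open>The first degree within reach of \<open>resol_betti_minimal\<close> is 2: its
    \<beta> begins in degree 1, and the minimal matrix appears one step later.\<close>
  obtain j where j: "i = Suc (Suc j)" using i by (metis add_2_eq_Suc le_Suc_ex)
  obtain q \<phi> where q: "q \<ge> 1" "lin R (R.Fr (betti R M (Suc (Suc j)))) (R.Fc (betti R M (Suc (Suc j)))) (R.Fr q) (R.Fc q) \<phi>"
    "\<phi> ` R.Fc (betti R M (Suc (Suc j))) \<subseteq> mmul (R.Fr q) y e (R.Fc q)"
    "(mmul (R.Fr q) y e ^^ (Suc m - 1)) (R.Fc q) \<subseteq> \<phi> ` R.Fc (betti R M (Suc (Suc j)))"
    "mlen R y e (R.Fr (betti R M (Suc (Suc j)))) (mmul (R.Fr (betti R M (Suc (Suc j)))) y e (R.krn (betti R M (Suc (Suc j))) (R.Fr q) \<phi>))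
      (R.krn (betti R M (Suc (Suc j))) (R.Fr q) \<phi>) (betti R M (Suc (Suc (Suc j))))"
    by (rule R.resol_betti_minimal[where \<beta> = "\<lambda>i. betti R M (Suc i)" and i = j, OF soc _ M(1) B(1) lmod.not_free_cover[OF M(1,3)] B(2)])
      simp_all
  have "q * h (Suc m) + betti R M i \<le> betti R M (Suc i) + q"
    unfolding j by (rule betti_ineq[OF q(2,3) _ q(5)]) (use q(4) in simp)
  \<comment> \<open>The rank q is unknown, but (q - 1)(h - 1) \<ge> 0 reduces the bound to its case
    q = 1.\<close>
  moreover have "h (Suc m) + q \<le> q * h (Suc m) + 1"
  proof -
    obtain a where "q = Suc a" using q(1) by (cases q) auto
    moreover obtain b where "h (Suc m) = Suc b" using h1(2) by (cases "h (Suc m)") auto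
    ultimately show ?thesis by simp
  qed
  ultimately show ?thesis by linarith
qed

section \<open>The canonical module\<close>

text \<open>The dual of an ideal \<open>I\<close> inside the canonical module \<open>W\<close> is \<open>(0 :\<^sub>W I)\<close>; passing to it
  reverses and preserves lengths.\<close>
locale canon = artin R x e n l + W: lmod R x e W
  for R :: "('a, 'b) ring_scheme" (structure) and x e n l and W :: "('a, 'm, 'c) module_scheme" +
  assumes can: "canonical_module R W"
begin

lemma fgW: "finitely_generated_module R W" using can by (simp add: canonical_module_def)

definition socW :: "'m set" where "socW = {w \<in> carrier W. \<forall>i<e. x i \<odot>\<^bsub>W\<^esub> w = \<zero>\<^bsub>W\<^esub>}"

text \<open>w is the image of 1 under the embedding of the residue field. By essentiality, a nonzero
  socle element v has a nonzero multiple in that image; the multiplier lies outside m, hence is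
  invertible modulo m, and v itself is a multiple of w.\<close>

lemma ex_socle: obtains w where "w \<in> carrier W" "w \<noteq> \<zero>\<^bsub>W\<^esub>" "\<And>r. r \<in> var_ideal R x e \<Longrightarrow> r \<odot>\<^bsub>W\<^esub> w = \<zero>\<^bsub>W\<^esub>" "socW \<subseteq> cyc R W w"
proof -
  obtain \<iota> where io: "\<iota> \<in> module_hom R resm W" "inj_on \<iota> (carrier resm)"
    "\<And>N. W.sub N \<Longrightarrow> N \<noteq> {\<zero>\<^bsub>W\<^esub>} \<Longrightarrow> N \<inter> \<iota> ` carrier resm \<noteq> {\<zero>\<^bsub>W\<^esub>}"
    using can unfolding canonical_module_def by blast
  have L: "lin R resm (carrier resm) W (carrier W) \<iota>" using io(1) by (simp add: module_hom_lin)
  interpret K: slin R x e S1 R x resm "\<lambda>r. r" kp "carrier R" by (rule kp_slin)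
  interpret I: slin R x e resm R x W "\<lambda>r. r" \<iota> "carrier resm"
    by (rule K.N.slin_lin[OF W.lmod_axioms K.N.sub_carrier L subset_refl])
  define w where "w = \<iota> (kp \<one>)"
  have wc: "w \<in> carrier W" unfolding w_def by (rule I.a_closed[OF kp_simps(3)[OF one_closed]])
  have rw: "r \<odot>\<^bsub>W\<^esub> w = \<iota> (kp r)" if "r \<in> carrier R" for r
    unfolding w_def using I.a_smult[OF that kp_simps(3)[OF one_closed]] kp_simps(2)[OF that one_closed] that by simp
  have kz: "kp \<zero> = \<zero>\<^bsub>resm\<^esub>" using K.a_zero by (simp add: self_module_def)
  have kill: "r \<odot>\<^bsub>W\<^esub> w = \<zero>\<^bsub>W\<^esub>" if r: "r \<in> var_ideal R x e" for r
  proof -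
    have rc: "r \<in> carrier R" using r idlD(1)[OF idl_var] by blast
    have "r \<ominus> \<zero> \<in> var_ideal R x e" using r rc by (simp add: a_minus_def)
    then have "kp r = kp \<zero>" using kp_eq[OF rc zero_closed] by simp
    then show ?thesis using rw[OF rc] I.a_zero kz by simp
  qed
  have nz: "w \<noteq> \<zero>\<^bsub>W\<^esub>"
  proof
    assume "w = \<zero>\<^bsub>W\<^esub>"
    then have "\<iota> (kp \<one>) = \<iota> (kp \<zero>)" using I.a_zero kz by (simp add: w_def)
    then have "kp \<one> = kp \<zero>" using io(2) kp_simps(3) by (meson inj_onD one_closed zero_closed)
    then have "\<one> \<ominus> \<zero> \<in> var_ideal R x e" using kp_eq by simp
    then show False using one_notin by (simp add: a_minus_def)
  qed
  have "socW \<subseteq> cyc R W w"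
  proof
    fix v assume v: "v \<in> socW"
    have vc: "v \<in> carrier W" using v by (simp add: socW_def)
    have vsub: "W.sub (cyc R W v)" by (rule W.sub_cyc[OF vc])
    have sk: "W.mm (cyc R W v) \<subseteq> {\<zero>\<^bsub>W\<^esub>}"
    proof (rule W.mm_least[OF W.sub_zero])
      fix i u assume i: "i < e" and "u \<in> cyc R W v"
      then obtain r where r: "r \<in> carrier R" "u = r \<odot>\<^bsub>W\<^esub> v" by (auto simp: cyc_def)
      have "x i \<odot>\<^bsub>W\<^esub> u = r \<odot>\<^bsub>W\<^esub> (x i \<odot>\<^bsub>W\<^esub> v)"
        unfolding r(2) using r(1) x_closed[OF i] vc by (simp add: W.smult_assoc1[symmetric] m_comm)
      then show "x i \<odot>\<^bsub>W\<^esub> u \<in> {\<zero>\<^bsub>W\<^esub>}" using v i r(1) by (simp add: socW_def)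
    qed
    show "v \<in> cyc R W w"
    proof (cases "v = \<zero>\<^bsub>W\<^esub>")
      case True then show ?thesis using W.subD(3)[OF W.sub_cyc[OF wc]] by simp
    next
      case False
      have vz: "\<zero>\<^bsub>W\<^esub> \<in> cyc R W v" "v \<in> cyc R W v" using W.subD(3)[OF vsub] W.cyc_self[OF vc] by auto
      then have "cyc R W v \<noteq> {\<zero>\<^bsub>W\<^esub>}" using False by blast
      from io(3)[OF vsub this] have ne: "cyc R W v \<inter> \<iota> ` carrier resm \<noteq> {\<zero>\<^bsub>W\<^esub>}" .
      have "\<zero>\<^bsub>W\<^esub> \<in> \<iota> ` carrier resm" using I.a_zero K.N.M.zero_closed by (metis image_eqI)
      then obtain z where z: "z \<in> cyc R W v" "z \<in> \<iota> ` carrier resm" "z \<noteq> \<zero>\<^bsub>W\<^esub>" using ne vz(1) by blast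
      obtain r where r: "r \<in> carrier R" "z = r \<odot>\<^bsub>W\<^esub> v" using z(1) by (auto simp: cyc_def)
      obtain s where s: "s \<in> carrier R" "z = s \<odot>\<^bsub>W\<^esub> w" using z(2) rw unfolding kp_image[symmetric] by auto
      have vk: "c \<odot>\<^bsub>W\<^esub> v = \<zero>\<^bsub>W\<^esub>" if "c \<in> var_ideal R x e" for c
        using W.smult_var_ideal[OF vsub vz(2) that] sk by blast
      have "r \<notin> var_ideal R x e" using vk[of r] z(3) r(2) by blast
      then obtain b c where bc: "b \<in> carrier R" "c \<in> var_ideal R x e" "r \<otimes> b = \<one> \<oplus> c" using inv_mod[OF r(1)] by blast
      have cc: "c \<in> carrier R" using bc(2) idlD(1)[OF idl_var] by blast
      have "(r \<otimes> b) \<odot>\<^bsub>W\<^esub> v = v" unfolding bc(3) using vk[OF bc(2)] cc vc by (simp add: W.smult_l_distr)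
      moreover have "(r \<otimes> b) \<odot>\<^bsub>W\<^esub> v = b \<odot>\<^bsub>W\<^esub> z" unfolding r(2) using r(1) bc(1) vc by (simp add: W.smult_assoc1 m_comm)
      moreover have "b \<odot>\<^bsub>W\<^esub> z = (b \<otimes> s) \<odot>\<^bsub>W\<^esub> w" unfolding s(2) using s(1) bc(1) wc by (simp add: W.smult_assoc1)
      ultimately show ?thesis using s(1) bc(1) unfolding cyc_def by auto
    qed
  qed
  then show ?thesis using that wc nz kill by blast
qed

text \<open>By \<open>ex_socle\<close> the socle lies in a cyclic module killed by m, which has
  length 1.\<close>

lemma socW_len: assumes "W.sub S" "S \<subseteq> socW" "W.len {\<zero>\<^bsub>W\<^esub>} S k" shows "k \<le> 1"
proof -
  obtain w where w: "w \<in> carrier W" "w \<noteq> \<zero>\<^bsub>W\<^esub>" "\<And>r. r \<in> var_ideal R x e \<Longrightarrow> r \<odot>\<^bsub>W\<^esub> w = \<zero>\<^bsub>W\<^esub>" "socW \<subseteq> cyc R W w"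
    by (rule ex_socle) blast
  interpret S: lmod R x e S1 by (rule lmod_self)
  have xv: "x i \<in> var_ideal R x e" if "i < e" for i
    using S.mm_gen[OF idl_carrier that one_closed] x_closed[OF that] by (simp add: var_ideal_def self_module_def)
  have "W.len {\<zero>\<^bsub>W\<^esub>} ({\<zero>\<^bsub>W\<^esub>} <+>\<^bsub>W\<^esub> cyc R W w) (Suc 0)"
    by (rule mlen.mlen_step[OF mlen.mlen_refl[OF W.sub_zero] w(1)]) (use w(2,3) xv in simp_all)
  moreover have "{\<zero>\<^bsub>W\<^esub>} <+>\<^bsub>W\<^esub> cyc R W w = cyc R W w"
    by (rule W.add_absorb(1)[OF W.sub_zero W.sub_cyc[OF w(1)]]) (use W.subD(3)[OF W.sub_cyc[OF w(1)]] in simp)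
  ultimately have 1: "W.len {\<zero>\<^bsub>W\<^esub>} (cyc R W w) (Suc 0)" by simp
  have "S \<subseteq> cyc R W w" using assms(2) w(4) by blast
  from W.len_mono[OF 1 assms(3) subset_refl this] show ?thesis by simp
qed

text \<open>W is finitely generated, so it is covered by a free module of finite length.\<close>

lemma len_W_ex: assumes "W.sub T" "W.sub U" "T \<subseteq> U" shows "\<exists>k. W.len T U k"
proof -
  obtain b d \<epsilon> where "free_resolution R W b d \<epsilon>" using ex_free_resolution[OF W.lmod_axioms fgW] by blast
  then have c: "cover (b 0) W (carrier W) \<epsilon>" using resolD(1)[OF free_resolution_resol[OF W.lmod_axioms]] by blast
  obtain k where "W.len T (carrier W) k"
    using cover_len[OF W.lmod_axioms W.sub_carrier c assms(1)] W.subD(1)[OF assms(1)] by blast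
  from W.len_sub_ex[OF this assms(1,2) subset_refl assms(3) W.subD(1)[OF assms(2)]] show ?thesis .
qed

definition ann :: "'a set \<Rightarrow> 'm set" where "ann I = {w \<in> carrier W. \<forall>r\<in>I. r \<odot>\<^bsub>W\<^esub> w = \<zero>\<^bsub>W\<^esub>}"

lemma ann_sub: assumes "idl I" shows "W.sub (ann I)"
proof (rule W.subI)
  note D = idlD[OF assms]
  fix u v assume "u \<in> ann I" "v \<in> ann I"
  then show "u \<oplus>\<^bsub>W\<^esub> v \<in> ann I" using D(1) by (auto simp: ann_def W.smult_r_distr subset_iff)
next
  note D = idlD[OF assms]
  fix r u assume ru: "r \<in> carrier R" "u \<in> ann I"
  have "s \<odot>\<^bsub>W\<^esub> (r \<odot>\<^bsub>W\<^esub> u) = \<zero>\<^bsub>W\<^esub>" if s: "s \<in> I" for s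
  proof -
    have sc: "s \<in> carrier R" using s D(1) by blast
    have "s \<odot>\<^bsub>W\<^esub> (r \<odot>\<^bsub>W\<^esub> u) = r \<odot>\<^bsub>W\<^esub> (s \<odot>\<^bsub>W\<^esub> u)"
      using sc ru by (simp add: ann_def W.smult_assoc1[symmetric] m_comm)
    then show ?thesis using ru s by (simp add: ann_def)
  qed
  then show "r \<odot>\<^bsub>W\<^esub> u \<in> ann I" using ru by (simp add: ann_def)
qed (use idlD(1)[OF assms] in \<open>auto simp: ann_def\<close>)

text \<open>With w from \<open>ex_socle\<close>, the rule v + ru \<mapsto> rw defines a map on U +
  Ru, because the r with ru in U form a proper ideal, which lies in m and kills w. Injectivity of W
  extends the map to R, and the image of 1 is the element sought.\<close>

lemma ex_functional:
  assumes U: "idl U" and u: "u \<in> carrier R" "u \<notin> U" "\<And>i. i < e \<Longrightarrow> x i \<otimes> u \<in> U"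
  obtains w where "w \<in> ann U" "u \<odot>\<^bsub>W\<^esub> w \<noteq> \<zero>\<^bsub>W\<^esub>"
proof -
  interpret S: lmod R x e S1 by (rule lmod_self)
  note UD = idlD[OF U]
  obtain w where w: "w \<in> carrier W" "w \<noteq> \<zero>\<^bsub>W\<^esub>" "\<And>r. r \<in> var_ideal R x e \<Longrightarrow> r \<odot>\<^bsub>W\<^esub> w = \<zero>\<^bsub>W\<^esub>" "socW \<subseteq> cyc R W w"
    by (rule ex_socle) blast
  define T where "T = {r \<in> carrier R. r \<otimes> u \<in> U}"
  have T: "idl T"
    by (rule S.subI) (use UD u(1) in \<open>auto simp: T_def self_simps l_distr m_assoc\<close>)
  have "T \<subseteq> var_ideal R x e"
  proof (rule ccontr)
    assume "\<not> T \<subseteq> var_ideal R x e"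
    then have "\<one> \<in> T" using idl_not_var[OF T] by simp
    then show False using u by (simp add: T_def)
  qed
  then have Tv: "r \<odot>\<^bsub>W\<^esub> w = \<zero>\<^bsub>W\<^esub>" if "r \<in> T" for r using w(3) that by blast
  let ?Z = "U <+>\<^bsub>S1\<^esub> cyc R S1 u"
  have cu: "S.sub (cyc R S1 u)" by (rule S.sub_cyc) (use u(1) in \<open>simp add: self_simps\<close>)
  have Z: "S.sub ?Z" by (rule S.sub_add[OF U cu])
  have memZ: "z \<in> ?Z \<longleftrightarrow> (\<exists>v\<in>U. \<exists>r\<in>carrier R. z = v \<oplus> r \<otimes> u)" for z
    unfolding S.mem_add by (auto simp: cyc_def self_simps)
  define g where "g z = (SOME r. r \<in> carrier R \<and> (\<exists>v\<in>U. z = v \<oplus> r \<otimes> u)) \<odot>\<^bsub>W\<^esub> w" for z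
  have g: "g (v \<oplus> r \<otimes> u) = r \<odot>\<^bsub>W\<^esub> w" if vr: "v \<in> U" "r \<in> carrier R" for v r
  proof -
    define s where "s = (SOME s. s \<in> carrier R \<and> (\<exists>v'\<in>U. v \<oplus> r \<otimes> u = v' \<oplus> s \<otimes> u))"
    have "s \<in> carrier R \<and> (\<exists>v'\<in>U. v \<oplus> r \<otimes> u = v' \<oplus> s \<otimes> u)"
      unfolding s_def by (rule someI[of _ r]) (use vr in blast)
    then obtain v' where s: "s \<in> carrier R" "v' \<in> U" "v \<oplus> r \<otimes> u = v' \<oplus> s \<otimes> u" by blast
    have vc: "v \<in> carrier R" "v' \<in> carrier R" using vr s UD(1) by auto
    have "(s \<ominus> r) \<otimes> u = s \<otimes> u \<ominus> r \<otimes> u" using s vr u(1) by (simp add: a_minus_def l_distr l_minus)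
    also have "\<dots> = v \<ominus> v'"
    proof -
      have "v \<oplus> r \<otimes> u \<ominus> v' \<ominus> r \<otimes> u = v' \<oplus> s \<otimes> u \<ominus> v' \<ominus> r \<otimes> u" using s(3) by simp
      moreover have "v \<oplus> r \<otimes> u \<ominus> v' \<ominus> r \<otimes> u = v \<ominus> v'"
        using vc s(1) vr(2) u(1) by algebra
      moreover have "v' \<oplus> s \<otimes> u \<ominus> v' \<ominus> r \<otimes> u = s \<otimes> u \<ominus> r \<otimes> u"
        using vc s(1) vr(2) u(1) by algebra
      ultimately show ?thesis by simp
    qed
    also have "\<dots> \<in> U" using S.sub_minus[OF U vr(1) s(2)] vc by (simp add: self_module_def a_minus_def a_inv_def m_inv_def)
    finally have "s \<ominus> r \<in> T" using s vr by (simp add: T_def)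
    from Tv[OF this] have "s \<odot>\<^bsub>W\<^esub> w \<ominus>\<^bsub>W\<^esub> r \<odot>\<^bsub>W\<^esub> w = \<zero>\<^bsub>W\<^esub>"
      using s(1) vr(2) w(1) by (simp add: a_minus_def W.smult_l_distr W.smult_l_minus)
    then have "s \<odot>\<^bsub>W\<^esub> w = r \<odot>\<^bsub>W\<^esub> w" using s(1) vr(2) w(1) by auto
    then show ?thesis unfolding g_def s_def .
  qed
  have "g \<in> module_hom R (S1\<lparr>carrier := ?Z\<rparr>) W"
    unfolding module_hom_lin lin_def
  proof (intro CollectI conjI ballI)
    fix z assume "z \<in> carrier (S1\<lparr>carrier := ?Z\<rparr>)"
    then obtain v r where z: "v \<in> U" "r \<in> carrier R" "z = v \<oplus> r \<otimes> u" using memZ by auto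
    show "g z \<in> carrier W" unfolding z(3) g[OF z(1,2)] using z(2) w(1) by simp
    { fix z' assume "z' \<in> carrier (S1\<lparr>carrier := ?Z\<rparr>)"
      then obtain v' r' where z': "v' \<in> U" "r' \<in> carrier R" "z' = v' \<oplus> r' \<otimes> u" using memZ by auto
      have vc: "v \<in> carrier R" "v' \<in> carrier R" using z z' UD(1) by auto
      have "z \<oplus> z' = (v \<oplus> v') \<oplus> (r \<oplus> r') \<otimes> u" unfolding z(3) z'(3) using vc z(2) z'(2) u(1) by algebra
      then have "g (z \<oplus> z') = (r \<oplus> r') \<odot>\<^bsub>W\<^esub> w" using g[OF UD(3)[OF z(1) z'(1)] a_closed[OF z(2) z'(2)]] by simp
      then show "g (z \<oplus>\<^bsub>S1\<lparr>carrier := ?Z\<rparr>\<^esub> z') = g z \<oplus>\<^bsub>W\<^esub> g z'"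
        unfolding z(3) z'(3) g[OF z(1,2)] g[OF z'(1,2)] using z(2) z'(2) w(1) by (simp add: self_module_def W.smult_l_distr) }
    fix s assume s: "s \<in> carrier R"
    have vc: "v \<in> carrier R" using z UD(1) by auto
    have "s \<otimes> z = s \<otimes> v \<oplus> (s \<otimes> r) \<otimes> u" unfolding z(3) using vc z(2) s u(1) by algebra
    then have "g (s \<otimes> z) = (s \<otimes> r) \<odot>\<^bsub>W\<^esub> w" using g[OF UD(4)[OF s z(1)] m_closed[OF s z(2)]] by simp
    then show "g (s \<odot>\<^bsub>S1\<lparr>carrier := ?Z\<rparr>\<^esub> z) = s \<odot>\<^bsub>W\<^esub> g z"
      unfolding z(3) g[OF z(1,2)] using z(2) s w(1) by (simp add: self_module_def W.smult_assoc1)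
  qed
  moreover have "injective_module R W" using can by (simp add: canonical_module_def)
  ultimately obtain f where f: "f \<in> module_hom R S1 W" "\<And>z. z \<in> ?Z \<Longrightarrow> f z = g z"
    unfolding injective_module_def using S.module_axioms Z by blast
  have fl: "lin R S1 (carrier R) W (carrier W) f" using f(1) by (simp add: module_hom_lin self_module_def)
  have fr: "r \<odot>\<^bsub>W\<^esub> f \<one> = f r" if "r \<in> carrier R" for r
    using linD(3)[OF fl that one_closed] that by (simp add: self_module_def)
  have f1: "f \<one> \<in> carrier W" by (rule linD(1)[OF fl one_closed])
  show ?thesis
  proof (rule that[of "f \<one>"])
    have "r \<odot>\<^bsub>W\<^esub> f \<one> = \<zero>\<^bsub>W\<^esub>" if r: "r \<in> U" for r
    proof -
      have rc: "r \<in> carrier R" using r UD(1) by blast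
      have eq: "r = r \<oplus> \<zero> \<otimes> u" using rc u(1) by simp
      have "r \<in> ?Z" unfolding memZ using r eq by blast
      then have "f r = g (r \<oplus> \<zero> \<otimes> u)" using f(2) eq by simp
      then show ?thesis using fr[OF rc] g[OF r zero_closed] w(1) by simp
    qed
    then show "f \<one> \<in> ann U" using f1 by (simp add: ann_def)
    have eq: "u = \<zero> \<oplus> \<one> \<otimes> u" using u(1) by simp
    have "u \<in> ?Z" unfolding memZ using UD(2) eq by blast
    then have "f u = g (\<zero> \<oplus> \<one> \<otimes> u)" using f(2) eq by simp
    then have "f u = w" using g[OF UD(2) one_closed] w(1) by simp
    then show "u \<odot>\<^bsub>W\<^esub> f \<one> \<noteq> \<zero>\<^bsub>W\<^esub>" using fr[OF u(1)] w(2) by simp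
  qed
qed

text \<open>For a step from U to U' = U + Ru, multiplication by u maps \<open>ann U\<close> into the
  socle with kernel \<open>ann U'\<close>. So the dual step has length at most 1, and by
  \<open>ex_functional\<close> it is not 0.\<close>

lemma len_ann: assumes "mlen R x e S1 V U k" shows "W.len (ann U) (ann V) k"
  using assms
proof (induction rule: mlen.induct)
  case mlen_refl then show ?case by (intro mlen.mlen_refl ann_sub)
next
  case (mlen_step U k u)
  interpret S: lmod R x e S1 by (rule lmod_self)
  have U: "idl U" using S.len_sub(2)[OF mlen_step(1)] .
  have u: "u \<in> carrier R" "u \<notin> U" "\<And>i. i < e \<Longrightarrow> x i \<otimes> u \<in> U" using mlen_step(2-4) by (simp_all add: self_simps)
  let ?U' = "U <+>\<^bsub>S1\<^esub> cyc R S1 u"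
  have cu: "S.sub (cyc R S1 u)" by (rule S.sub_cyc) (use u(1) in \<open>simp add: self_simps\<close>)
  have U': "idl ?U'" by (rule S.sub_add[OF U cu])
  have memZ: "z \<in> ?U' \<longleftrightarrow> (\<exists>v\<in>U. \<exists>r\<in>carrier R. z = v \<oplus> r \<otimes> u)" for z
    unfolding S.mem_add by (auto simp: cyc_def self_simps)
  note UD = idlD[OF U]
  have annU': "ann ?U' = {w \<in> ann U. u \<odot>\<^bsub>W\<^esub> w \<in> {\<zero>\<^bsub>W\<^esub>}}"
  proof (intro subset_antisym subsetI)
    fix w assume w: "w \<in> ann ?U'"
    have "r \<in> ?U'" if "r \<in> U" for r unfolding memZ using that UD(1) u(1) by (intro bexI[OF _ that] bexI[of _ \<zero>]) auto
    moreover have "u \<in> ?U'" unfolding memZ using UD(2) u(1) by (intro bexI[OF _ UD(2)] bexI[of _ \<one>]) auto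
    ultimately show "w \<in> {w \<in> ann U. u \<odot>\<^bsub>W\<^esub> w \<in> {\<zero>\<^bsub>W\<^esub>}}" using w by (simp add: ann_def)
  next
    fix w assume w: "w \<in> {w \<in> ann U. u \<odot>\<^bsub>W\<^esub> w \<in> {\<zero>\<^bsub>W\<^esub>}}"
    have "z \<odot>\<^bsub>W\<^esub> w = \<zero>\<^bsub>W\<^esub>" if zU: "z \<in> ?U'" for z
    proof -
      obtain v r where z: "v \<in> U" "r \<in> carrier R" "z = v \<oplus> r \<otimes> u" using iffD1[OF memZ zU] by blast
      have "v \<in> carrier R" using z UD(1) by blast
      then show ?thesis unfolding z(3) using w z u(1) by (simp add: ann_def W.smult_l_distr W.smult_assoc1)
    qed
    then show "w \<in> ann ?U'" using w by (simp add: ann_def)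
  qed
  have as: "W.sub (ann U)" "W.sub (ann ?U')" using ann_sub U U' by auto
  have ac: "ann U \<subseteq> carrier W" by (auto simp: ann_def)
  obtain c where c: "W.len (ann ?U') (ann U) c" using len_W_ex[OF as(2,1)] annU' by blast
  have L: "lin R W (ann U) W (carrier W) (\<lambda>w. u \<odot>\<^bsub>W\<^esub> w)"
    unfolding lin_def using u(1) ac by (auto simp: W.smult_r_distr W.smult_assoc1[symmetric] m_comm subset_iff)
  interpret L: slin R x e W R x W "\<lambda>r. r" "\<lambda>w. u \<odot>\<^bsub>W\<^esub> w" "ann U"
    by (rule W.slin_lin[OF W.lmod_axioms as(1) L subset_refl])
  let ?I = "(\<lambda>w. u \<odot>\<^bsub>W\<^esub> w) ` ann U"
  have I: "W.sub ?I" by (rule L.sub_image[OF as(1) subset_refl])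
  have "W.len {\<zero>\<^bsub>W\<^esub>} (?I <+>\<^bsub>W\<^esub> {\<zero>\<^bsub>W\<^esub>}) c"
    by (rule L.len_image[OF W.sub_zero _ subset_refl]) (use c annU' in simp)
  moreover have "?I <+>\<^bsub>W\<^esub> {\<zero>\<^bsub>W\<^esub>} = ?I" by (rule W.add_absorb(2)[OF W.sub_zero I]) (use W.subD(3)[OF I] in simp)
  ultimately have c2: "W.len {\<zero>\<^bsub>W\<^esub>} ?I c" by simp
  have "?I \<subseteq> socW"
  proof
    fix z assume "z \<in> ?I"
    then obtain w where w: "w \<in> ann U" "z = u \<odot>\<^bsub>W\<^esub> w" by blast
    have wc: "w \<in> carrier W" using w(1) by (simp add: ann_def)
    have "x i \<odot>\<^bsub>W\<^esub> z = \<zero>\<^bsub>W\<^esub>" if i: "i < e" for i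
    proof -
      have "x i \<odot>\<^bsub>W\<^esub> z = (x i \<otimes> u) \<odot>\<^bsub>W\<^esub> w" unfolding w(2) using u(1) x_closed[OF i] wc by (simp add: W.smult_assoc1)
      then show ?thesis using u(3)[OF i] w(1) by (simp add: ann_def)
    qed
    then show "z \<in> socW" using w(2) wc u(1) by (simp add: socW_def)
  qed
  then have "c \<le> 1" by (rule socW_len[OF I _ c2])
  moreover have "c \<noteq> 0"
  proof
    assume "c = 0"
    then have eq: "ann ?U' = ann U" using c W.len_0_eq by simp
    obtain w where "w \<in> ann U" "u \<odot>\<^bsub>W\<^esub> w \<noteq> \<zero>\<^bsub>W\<^esub>" by (rule ex_functional[OF U u(1,2)]) (use u(3) in auto)
    then show False using eq annU' by blast
  qed
  ultimately have "c = 1" by simp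
  then show ?case using W.len_trans[OF mlen_step(5), of "ann ?U'" 1] c by simp
qed

lemma len_W: "W.len {\<zero>\<^bsub>W\<^esub>} (carrier W) l"
proof -
  have "ann (carrier R) = {\<zero>\<^bsub>W\<^esub>}"
  proof (intro subset_antisym subsetI)
    show "w \<in> {\<zero>\<^bsub>W\<^esub>}" if "w \<in> ann (carrier R)" for w
    proof -
      have w: "w \<in> carrier W" "\<one> \<odot>\<^bsub>W\<^esub> w = \<zero>\<^bsub>W\<^esub>" using that one_closed unfolding ann_def by blast+
      then show ?thesis using W.smult_one[OF w(1)] by simp
    qed
  qed (auto simp: ann_def)
  moreover have "ann {\<zero>} = carrier W" by (auto simp: ann_def)
  ultimately show ?thesis using len_ann[OF fin_len] by simp
qed

section \<open>Betti numbers of the canonical module in degrees 0 and 1\<close>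

context
  fixes r assumes n1: "n \<ge> 1" and r: "mlen R x e S1 {\<zero>} ((mmul S1 x e ^^ (n - 1)) (carrier R)) r"
begin

text \<open>Let S be the power m^(n-1). Since mS = 0, mW lies in \<open>ann S\<close>, so W/mW
  surjects onto W/ann S; by duality the latter has the length r of S.\<close>

lemma betti0_ge: "r \<le> betti R W 0"
proof -
  obtain b where b: "W.len (W.mm (carrier W)) (carrier W) (betti R W 0)"
    by (rule betti_len[OF W.lmod_axioms fgW]) blast
  interpret S: lmod R x e S1 by (rule lmod_self)
  let ?S = "(S.mm ^^ (n - 1)) (carrier R)"
  have S: "idl ?S" by (rule S.mmk_sub[OF idl_carrier])
  have "ann {\<zero>} = carrier W" by (auto simp: ann_def)
  then have a: "W.len (ann ?S) (carrier W) r" using len_ann[OF r] by simp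
  have z: "S.mm ?S = {\<zero>}" using nilp n1 by (cases n) simp_all
  have "W.mm (carrier W) \<subseteq> ann ?S"
  proof (rule W.mm_least[OF ann_sub[OF S]])
    fix i w assume i: "i < e" and w: "w \<in> carrier W"
    have "s \<odot>\<^bsub>W\<^esub> (x i \<odot>\<^bsub>W\<^esub> w) = \<zero>\<^bsub>W\<^esub>" if s: "s \<in> ?S" for s
    proof -
      have sc: "s \<in> carrier R" using s idlD(1)[OF S] by blast
      have "x i \<otimes> s = \<zero>" using S.mm_gen[OF S i s] z by (simp add: self_simps)
      moreover have "s \<odot>\<^bsub>W\<^esub> (x i \<odot>\<^bsub>W\<^esub> w) = (x i \<otimes> s) \<odot>\<^bsub>W\<^esub> w"
        using sc x_closed[OF i] w by (simp add: W.smult_assoc1[symmetric] m_comm)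
      ultimately show ?thesis using w by simp
    qed
    then show "x i \<odot>\<^bsub>W\<^esub> w \<in> ann ?S" using x_closed[OF i] w by (simp add: ann_def)
  qed
  then show ?thesis by (rule W.len_mono[OF b a _ subset_refl])
qed

text \<open>Let g and p be the two Betti numbers. The kernel C of the minimal cover of W has length
  gl - l. The cover of C by R^p kills m^(n-1) R^p, of length pr, since C lies in m R^g. So gl - l
  \<le> pl - pr, written here without subtraction.\<close>

lemma betti1_ineq: "(betti R W 0) * l + betti R W 1 * r \<le> betti R W 1 * l + l"
proof -
  obtain b d \<epsilon> B where B: "resol W b d \<epsilon> B" "W.len (W.mm (carrier W)) (carrier W) (betti R W 0)"
    "\<And>i. mlen R x e (Fr (b i)) (mmul (Fr (b i)) x e (B i)) (B i \<inter> mmul (Fr (b i)) x e (Fc (b i))) (betti R W (Suc i))"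
    by (rule betti_len[OF W.lmod_axioms fgW]) blast
  note c = resolD[OF B(1)]
  define g where "g = betti R W 0"
  define p where "p = betti R W 1"
  have nl: "(W.mm ^^ n) (carrier W) \<subseteq> {\<zero>\<^bsub>W\<^esub>}" using cover_nil[OF W.lmod_axioms W.sub_carrier c(1)] by simp
  obtain \<rho> where \<rho>: "cover g W (carrier W) \<rho>" "krn g W \<rho> \<subseteq> mmul (Fr g) x e (Fc g)"
    by (rule min_cover[OF W.lmod_axioms W.sub_carrier B(2) nl]) (simp add: g_def)
  let ?C = "krn g W \<rho>"
  interpret F: lmod R x e "Fr g" by (rule lmod_Fr)
  interpret P: lmod R x e "Fr p" by (rule lmod_Fr)
  have C: "F.sub ?C" by (rule krn_sub[OF W.lmod_axioms W.sub_carrier \<rho>(1)])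
  have "mlen R x e (Fr g) (F.mm ?C) (?C \<inter> F.mm (Fc g)) (betti R W 1)"
    by (rule syz_compare(2)[OF W.lmod_axioms W.sub_carrier W.lmod_axioms W.sub_carrier c(1) \<rho>(1) steq_refl[OF W.lmod_axioms W.sub_carrier]])
      (use B(3)[of 0] c(2) in simp)
  moreover have "?C \<inter> F.mm (Fc g) = ?C" using \<rho>(2) by blast
  ultimately have lC: "mlen R x e (Fr g) (F.mm ?C) ?C p" by (simp add: p_def)
  obtain p' \<rho>' where p': "cover p' (Fr g) ?C \<rho>'" by (rule ex_cover_Fr[OF C])
  have nlC: "(F.mm ^^ n) ?C \<subseteq> {\<zero>\<^bsub>Fr g\<^esub>}" using cover_nil[OF lmod_Fr C p'] by simp
  obtain \<pi> where \<pi>: "cover p (Fr g) ?C \<pi>" by (rule min_cover[OF lmod_Fr C lC nlC]) blast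
  obtain a1 c1 where 1: "F.len {\<zero>\<^bsub>Fr g\<^esub>} ?C a1" "W.len {\<zero>\<^bsub>W\<^esub>} (carrier W) c1" "a1 + c1 = g * l"
    by (rule cover_krn_len[OF W.lmod_axioms W.sub_carrier \<rho>(1)])
  obtain a2 c2 where 2: "P.len {\<zero>\<^bsub>Fr p\<^esub>} (krn p (Fr g) \<pi>) a2" "F.len {\<zero>\<^bsub>Fr g\<^esub>} ?C c2" "a2 + c2 = p * l"
    by (rule cover_krn_len[OF lmod_Fr C \<pi>])
  have "c1 = l" by (rule W.len_unique[OF 1(2) len_W])
  have "c2 = a1" by (rule F.len_unique[OF 2(2) 1(1)])
  have "F.mm (Fc g) \<subseteq> Fc g" by (rule F.mm_subset[OF F.sub_carrier])
  interpret \<pi>: slin R x e "Fr p" R x "Fr g" "\<lambda>r. r" \<pi> "Fc p" by (rule cover_slin[OF lmod_Fr C \<pi>])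
  have pl: "lin R (Fr p) (Fc p) (Fr g) ?C \<pi>" "\<pi> ` Fc p = ?C" by (rule coverD[OF \<pi>])+
  have "\<pi> ` ((P.mm ^^ (n - 1)) (Fc p)) = (F.mm ^^ (n - 1)) ?C"
    using P.image_mmk[OF lmod_Fr P.sub_carrier pl(1) F.subD(1)[OF C]] pl(2) by simp
  also have "\<dots> \<subseteq> (F.mm ^^ (n - 1)) (F.mm (Fc g))" by (rule F.mmk_mono[OF \<rho>(2)])
  also have "\<dots> = (F.mm ^^ n) (Fc g)" using n1 funpow_Suc_right[of "n - 1" "F.mm"] by simp
  also have "\<dots> = {\<zero>\<^bsub>Fr g\<^esub>}" by (rule nil_Fr)
  finally have "(P.mm ^^ (n - 1)) (Fc p) \<subseteq> krn p (Fr g) \<pi>"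
    using P.mmk_subset[OF P.sub_carrier, of "n - 1"] by (auto simp: krn_def)
  moreover have "P.len {\<zero>\<^bsub>Fr p\<^esub>} ((P.mm ^^ (n - 1)) (Fc p)) (p * r)"
    using len_pw[OF r, of p] mmk_pw[OF idl_carrier, where p = p and k = "n - 1"] by (simp add: pw_zero pw_carrier)
  ultimately have "p * r \<le> a2" using P.len_mono[OF 2(1) _ subset_refl] by blast
  then show ?thesis unfolding g_def[symmetric] p_def[symmetric] using 1(3) 2(3) \<open>c1 = l\<close> \<open>c2 = a1\<close> by linarith
qed

text \<open>A member b of a basis embeds R into W. Both have the same length, so the embedding is
  onto, W is cyclic, and its Betti number in degree 0 is 1, against the lower bound r.\<close>

lemma W_not_free: assumes r2: "r \<ge> 2" shows "\<not> free_module R W"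
proof
  assume "free_module R W"
  then obtain Bs where Bs: "Bs \<subseteq> carrier W" "\<not> W.lin_dep Bs" "W.span Bs = carrier W" unfolding free_module_def by blast
  interpret S: lmod R x e S1 by (rule lmod_self)
  have "Bs \<noteq> {}"
  proof
    assume "Bs = {}"
    then have "W.span Bs = {\<zero>\<^bsub>W\<^esub>}" unfolding W.span_def W.lincomb_def by auto
    then have c: "carrier W = {\<zero>\<^bsub>W\<^esub>}" using Bs(3) by simp
    obtain w where "w \<in> carrier W" "w \<noteq> \<zero>\<^bsub>W\<^esub>" by (rule ex_socle) blast
    then show False using c by blast
  qed
  then obtain b where b: "b \<in> Bs" by blast
  have bc: "b \<in> carrier W" using b Bs(1) by blast
  have inj: "s = \<zero>" if s: "s \<in> carrier R" "s \<odot>\<^bsub>W\<^esub> b = \<zero>\<^bsub>W\<^esub>" for s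
  proof (rule ccontr)
    assume "s \<noteq> \<zero>"
    then have "W.lin_dep Bs"
      using W.lin_dep_crit[of "{b}" Bs "\<lambda>_. s" b] b s bc by (simp add: W.lincomb_def)
    then show False using Bs(2) by simp
  qed
  have L: "lin R S1 (carrier R) W (carrier W) (\<lambda>s. s \<odot>\<^bsub>W\<^esub> b)"
    unfolding lin_def using bc by (auto simp: self_module_def W.smult_l_distr W.smult_assoc1)
  interpret L: slin R x e S1 R x W "\<lambda>r. r" "\<lambda>s. s \<odot>\<^bsub>W\<^esub> b" "carrier R"
    by (rule S.slin_lin[OF W.lmod_axioms idl_carrier L subset_refl])
  let ?I = "(\<lambda>s. s \<odot>\<^bsub>W\<^esub> b) ` carrier R"
  have I: "W.sub ?I" by (rule L.sub_image[OF idl_carrier subset_refl])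
  have eq: "{s \<in> carrier R. s \<odot>\<^bsub>W\<^esub> b \<in> {\<zero>\<^bsub>W\<^esub>}} = {\<zero>}" using inj bc by auto
  have "W.len {\<zero>\<^bsub>W\<^esub>} (?I <+>\<^bsub>W\<^esub> {\<zero>\<^bsub>W\<^esub>}) l"
    by (rule L.len_image[OF W.sub_zero _ subset_refl]) (use fin_len eq in simp)
  moreover have "?I <+>\<^bsub>W\<^esub> {\<zero>\<^bsub>W\<^esub>} = ?I" by (rule W.add_absorb(2)[OF W.sub_zero I]) (use W.subD(3)[OF I] in simp)
  ultimately have l1: "W.len {\<zero>\<^bsub>W\<^esub>} ?I l" by simp
  obtain c where c: "W.len ?I (carrier W) c" using len_W_ex[OF I W.sub_carrier W.subD(1)[OF I]] by blast
  have "c + l = l" by (rule W.len_unique[OF _ len_W]) (use W.len_trans[OF c l1] in \<open>simp add: add.commute\<close>)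
  then have Iw: "?I = carrier W" using c W.len_0_eq by simp
  have B0: "W.len (W.mm (carrier W)) (carrier W) (betti R W 0)"
    by (rule betti_len[OF W.lmod_axioms fgW]) blast
  have m: "W.mm (carrier W) = (\<lambda>s. s \<odot>\<^bsub>W\<^esub> b) ` S.mm (carrier R)"
    using L.image_mm[OF idl_carrier subset_refl] Iw by simp
  have v: "idl (var_ideal R x e)" by (rule idl_var)
  have eq2: "{s \<in> carrier R. s \<odot>\<^bsub>W\<^esub> b \<in> W.mm (carrier W)} = var_ideal R x e"
  proof (intro subset_antisym subsetI)
    fix s assume "s \<in> {s \<in> carrier R. s \<odot>\<^bsub>W\<^esub> b \<in> W.mm (carrier W)}"
    then obtain t where t: "s \<in> carrier R" "t \<in> var_ideal R x e" "s \<odot>\<^bsub>W\<^esub> b = t \<odot>\<^bsub>W\<^esub> b" unfolding m var_ideal_def by blast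
    have tc: "t \<in> carrier R" using t(2) idlD(1)[OF v] by blast
    have "(s \<ominus> t) \<odot>\<^bsub>W\<^esub> b = \<zero>\<^bsub>W\<^esub>" using t tc bc by (simp add: a_minus_def W.smult_l_distr W.smult_l_minus W.M.r_neg)
    then have "s \<ominus> t = \<zero>" by (intro inj) (use t tc in auto)
    then show "s \<in> var_ideal R x e" using t tc by simp
  next
    fix s assume "s \<in> var_ideal R x e"
    then show "s \<in> {s \<in> carrier R. s \<odot>\<^bsub>W\<^esub> b \<in> W.mm (carrier W)}"
      unfolding m using idlD(1)[OF v] by (auto simp: var_ideal_def)
  qed
  have mc: "W.sub (W.mm (carrier W))" by (rule W.mm_sub[OF W.sub_carrier])
  have "W.len (W.mm (carrier W)) (?I <+>\<^bsub>W\<^esub> W.mm (carrier W)) 1"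
    by (rule L.len_image[OF mc _ subset_refl]) (use len_residue eq2 in simp)
  moreover have "?I <+>\<^bsub>W\<^esub> W.mm (carrier W) = carrier W"
    unfolding Iw by (rule W.add_absorb(2)[OF mc W.sub_carrier W.subD(1)[OF mc]])
  ultimately have "betti R W 0 = 1" using W.len_unique[OF B0] by simp
  then show False using betti0_ge r2 by simp
qed

end

end

text \<open>With l and r for the two binomials, t = l - r satisfies ml = (e + m)t. The last
  hypothesis says (g - 1)l \<le> bt, hence (g - 1)(e + m) \<le> mb; and g - 1 \<ge> m makes the left
  side at least m(g - 1 + e).\<close>

lemma binomial_growth:
  fixes g b m e :: nat
  assumes e: "e \<ge> 2" and m: "m \<ge> 1" and g: "((e - 1) + m) choose (e - 1) \<le> g"
    and b: "g * ((e + m) choose e) + b * (((e - 1) + m) choose (e - 1)) \<le> b * ((e + m) choose e) + ((e + m) choose e)"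
  shows "g + (e - 1) \<le> b"
proof -
  obtain e' where e': "e = Suc (Suc e')" using e by (metis add_2_eq_Suc le_Suc_ex)
  define t where "t = (Suc e' + m) choose e"
  have l: "(e + m) choose e = (((e - 1) + m) choose (e - 1)) + t"
  proof -
    have "(e + m) choose e = Suc (Suc e' + m) choose Suc (Suc e')" by (simp add: e')
    also have "\<dots> = ((Suc e' + m) choose Suc e') + ((Suc e' + m) choose Suc (Suc e'))" by (rule binomial_Suc_Suc)
    also have "\<dots> = (((e - 1) + m) choose (e - 1)) + t" unfolding t_def by (simp add: e')
    finally show ?thesis .
  qed
  have ml: "m * ((e + m) choose e) = (e + m) * t"
    using binomial_absorb_comp[of "e + m" e] unfolding e' t_def by simp
  have tp: "t > 0" unfolding t_def e' using m by (intro zero_less_binomial) simp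
  \<comment> \<open>The binomial increases with e, and for e = 2 it is m + 1.\<close>
  have "Suc m \<le> (Suc e' + m) choose (Suc e')"
  proof -
    have "(Suc e' + m) choose (Suc e') = (Suc e' + m) choose m" using binomial_symmetric[of m "Suc e' + m"] by simp
    moreover have "Suc m choose m \<le> (Suc e' + m) choose m" by (metis add.commute binomial_right_mono le_add1 nat_add_left_cancel_le plus_1_eq_Suc)
    ultimately show ?thesis by simp
  qed
  then have gm: "Suc m \<le> g" using g unfolding e' by simp
  then obtain g' where g': "g = Suc g'" by (metis Suc_le_D)
  have mg: "m \<le> g'" using gm g' by simp
  have "g' * ((e + m) choose e) \<le> b * t" 
  proof -
    have "g' * (r + t) \<le> b * t" if "Suc g' * (r + t) + b * r \<le> b * (r + t) + (r + t)" for r t :: nat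
      using that by (simp add: algebra_simps)
    then show ?thesis using b unfolding l g' by blast
  qed
  then have "m * (g' * ((e + m) choose e)) \<le> m * (b * t)" by simp
  then have "g' * ((e + m) * t) \<le> m * b * t" using ml by (metis mult.assoc mult.left_commute)
  then have "g' * (e + m) * t \<le> m * b * t" by (simp only: mult.assoc)
  then have 1: "g' * (e + m) \<le> m * b" using tp by simp
  have "m * (g' + e) \<le> g' * (e + m)" using mult_right_mono[OF mg, of e] by (simp add: algebra_simps)
  from order_trans[OF this 1] have "m * (g' + e) \<le> m * b" .
  then have "g' + e \<le> b" using m by simp
  then show ?thesis using g' e by simp
qed

section \<open>Powers of the ideal of the variables\<close>

context polyr begin

lemma J_ideal: "ideal (J j) Q"
  using mring.idl_iff_ideal[OF mring_Q] J_idl by blast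

lemma xv_J: assumes "i < e" shows "xv i \<in> J 1"
proof -
  interpret Q: cring Q by (rule cring_Q)
  have one: "\<one>\<^bsub>Q\<^esub> \<in> J 0" using Q.one_closed by (simp add: J_def)
  have "xv i \<otimes>\<^bsub>Q\<^esub> \<one>\<^bsub>Q\<^esub> \<in> J (Suc 0)" by (rule var_J[OF assms one])
  moreover have "xv i \<in> PC" using mring.x_closed[OF mring_Q assms] .
  ultimately show ?thesis by simp
qed

lemma vars_ideal_J: "vars_ideal K e = J 1"
proof -
  interpret Q: mring Q xv e by (rule mring_Q)
  have c: "xv ` {..<e} \<subseteq> PC" using Q.x_closed by auto
  have I: "ideal (vars_ideal K e) Q" unfolding vars_ideal_def by (rule Q.genideal_ideal[OF c])
  interpret S: lmod Q xv e "self_module Q" by (rule Q.lmod_self)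
  show ?thesis
  proof (rule subset_antisym)
    show "vars_ideal K e \<subseteq> J 1" unfolding vars_ideal_def by (rule Q.genideal_minimal[OF J_ideal]) (use xv_J in auto)
    have "mmul (self_module Q) xv e PC \<subseteq> vars_ideal K e"
    proof (rule S.mm_least)
      show "submodule Q (vars_ideal K e) (self_module Q)" using I Q.idl_iff_ideal by blast
      fix i P assume "i < e" "P \<in> PC"
      then have "xv i \<in> vars_ideal K e" "P \<in> PC" using Q.genideal_self[OF c] unfolding vars_ideal_def by auto
      then show "xv i \<odot>\<^bsub>self_module Q\<^esub> P \<in> vars_ideal K e" using ideal.I_r_closed[OF I] by (simp add: self_module_def)
    qed
    then show "J 1 \<subseteq> vars_ideal K e" using mmk_J[of 1] by simp
  qed
qed

lemma J_prod: "ideal_prod Q (J i) (J 1) = J (Suc i)"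
proof (rule subset_antisym)
  interpret Q: mring Q xv e by (rule mring_Q)
  interpret S: lmod Q xv e "self_module Q" by (rule Q.lmod_self)
  show "ideal_prod Q (J i) (J 1) \<subseteq> J (Suc i)"
  proof
    fix s assume "s \<in> ideal_prod Q (J i) (J 1)"
    then show "s \<in> J (Suc i)"
    proof (induction rule: ideal_prod.induct)
      case (prod P R)
      have c: "P \<in> PC" "R \<in> PC" using prod by (auto simp: J_def)
      have "R \<odot>\<^bsub>self_module Q\<^esub> P \<in> S.mm (J i)"
        by (rule S.smult_var_ideal[OF J_idl prod(1)]) (use prod(2) var_ideal_Q in simp)
      then show ?case unfolding mm_J using Q.m_comm[OF c] by (simp add: self_module_def)
    next
      case (sum s t) then show ?case using S.subD(4)[OF J_idl, of s "Suc i" t] by (simp add: self_module_def)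
    qed
  qed
  have I: "ideal (ideal_prod Q (J i) (J 1)) Q" by (rule Q.ideal_prod_is_ideal[OF J_ideal J_ideal])
  have "S.mm (J i) \<subseteq> ideal_prod Q (J i) (J 1)"
  proof (rule S.mm_least)
    show "submodule Q (ideal_prod Q (J i) (J 1)) (self_module Q)" using I Q.idl_iff_ideal by blast
    fix k P assume k: "k < e" "P \<in> J i"
    have "P \<otimes>\<^bsub>Q\<^esub> xv k \<in> ideal_prod Q (J i) (J 1)" by (rule ideal_prod.prod[OF k(2) xv_J[OF k(1)]])
    moreover have "P \<in> PC" using k(2) by (simp add: J_def)
    ultimately show "xv k \<odot>\<^bsub>self_module Q\<^esub> P \<in> ideal_prod Q (J i) (J 1)"
      using Q.m_comm[OF \<open>P \<in> PC\<close> Q.x_closed[OF k(1)]] by (simp add: self_module_def)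
  qed
  then show "J (Suc i) \<subseteq> ideal_prod Q (J i) (J 1)" unfolding mm_J .
qed

text \<open>Turns the powers occurring in \<open>Ord\<close> into a condition on the coefficients of
  low degree.\<close>

lemma ideal_power_J: "ideal_power Q (vars_ideal K e) i = J i"
proof (induction i)
  case 0 then show ?case by (simp add: ideal_power_def nat_pow_def ideals_set_def J_0)
next
  case (Suc i)
  then show ?case using J_prod[of i] unfolding ideal_power_def nat_pow_def vars_ideal_J by (simp add: ideals_set_def)
qed

end

section \<open>Graded presentations\<close>

text \<open>Used to carry the powers of the ideal of the variables to those of the irrelevant ideal,
  see \<open>power_pres\<close>.\<close>

lemma hom_ideal_prod:
  assumes h: "\<phi> \<in> ring_hom Q A" and IJ: "I \<subseteq> carrier Q" "J \<subseteq> carrier Q" and Q: "ring Q"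
  shows "\<phi> ` ideal_prod Q I J = ideal_prod A (\<phi> ` I) (\<phi> ` J)"
proof (intro subset_antisym subsetI)
  interpret Q: ring Q by fact
  have c: "s \<in> carrier Q" if "s \<in> ideal_prod Q I J" for s
    using that by (induction rule: ideal_prod.induct) (use IJ in auto)
  note hs = ring_hom_mult[OF h] ring_hom_add[OF h]
  fix t
  {
    assume "t \<in> \<phi> ` ideal_prod Q I J"
    then obtain s where s: "s \<in> ideal_prod Q I J" "t = \<phi> s" by blast
    have "\<phi> s \<in> ideal_prod A (\<phi> ` I) (\<phi> ` J)" using s(1)
    proof (induction rule: ideal_prod.induct)
      case (prod i j)
      then have "i \<in> carrier Q" "j \<in> carrier Q" using IJ by auto
      then show ?case using hs(1) prod ideal_prod.prod[of "\<phi> i" "\<phi> ` I" "\<phi> j" "\<phi> ` J" A] by simp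
    next
      case (sum s1 s2) then show ?case using hs(2)[OF c[OF sum(1)] c[OF sum(2)]] ideal_prod.sum by simp
    qed
    then show "t \<in> ideal_prod A (\<phi> ` I) (\<phi> ` J)" using s(2) by simp
  }
  assume "t \<in> ideal_prod A (\<phi> ` I) (\<phi> ` J)"
  then show "t \<in> \<phi> ` ideal_prod Q I J"
  proof (induction rule: ideal_prod.induct)
    case (prod a b)
    then obtain i j where ij: "i \<in> I" "j \<in> J" "a = \<phi> i" "b = \<phi> j" by blast
    then have "i \<in> carrier Q" "j \<in> carrier Q" using IJ by auto
    then have "a \<otimes>\<^bsub>A\<^esub> b = \<phi> (i \<otimes>\<^bsub>Q\<^esub> j)" using hs(1) ij by simp
    then show ?case using ideal_prod.prod[OF ij(1,2), of Q] by simp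
  next
    case (sum s1 s2)
    then obtain u v where uv: "u \<in> ideal_prod Q I J" "v \<in> ideal_prod Q I J" "s1 = \<phi> u" "s2 = \<phi> v" by blast
    then have "s1 \<oplus>\<^bsub>A\<^esub> s2 = \<phi> (u \<oplus>\<^bsub>Q\<^esub> v)" using hs(2)[OF c c] by simp
    then show ?case using ideal_prod.sum[OF uv(1,2)] by simp
  qed
qed

lemma hom_ideal_image:
  assumes h: "\<phi> \<in> ring_hom Q A" "\<phi> ` carrier Q = carrier A" and QA: "cring Q" "cring A" and I: "ideal I Q"
  shows "ideal (\<phi> ` I) A"
proof -
  interpret Q: cring Q by fact
  interpret A: cring A by fact
  interpret I: ideal I Q by fact
  note hs = ring_hom_mult[OF h(1)] ring_hom_add[OF h(1)] ring_hom_closed[OF h(1)] ring_hom_zero[OF h(1) Q.ring_axioms A.ring_axioms]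
  show ?thesis
  proof (rule idealI)
    show "subgroup (\<phi> ` I) (add_monoid A)"
    proof (rule subgroup.intro)
      show "\<phi> ` I \<subseteq> carrier (add_monoid A)" using hs(3) I.a_Hcarr by auto
      show "\<one>\<^bsub>add_monoid A\<^esub> \<in> \<phi> ` I" 
      proof -
        have "\<phi> \<zero>\<^bsub>Q\<^esub> \<in> \<phi> ` I" using I.zero_closed by (rule imageI)
        then show ?thesis using hs(4) by simp
      qed
      fix a b assume "a \<in> \<phi> ` I" "b \<in> \<phi> ` I"
      then obtain i j where ij: "i \<in> I" "j \<in> I" "a = \<phi> i" "b = \<phi> j" by blast
      have "a \<oplus>\<^bsub>A\<^esub> b = \<phi> (i \<oplus>\<^bsub>Q\<^esub> j)" using hs(2)[OF I.a_Hcarr I.a_Hcarr] ij by simp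
      then show "a \<otimes>\<^bsub>add_monoid A\<^esub> b \<in> \<phi> ` I" using I.a_closed[OF ij(1,2)] by simp
    next
      fix a assume "a \<in> \<phi> ` I"
      then obtain i where i: "i \<in> I" "a = \<phi> i" by blast
      have ic: "i \<in> carrier Q" by (rule I.a_Hcarr[OF i(1)])
      have "\<phi> (\<ominus>\<^bsub>Q\<^esub> i) \<oplus>\<^bsub>A\<^esub> a = \<zero>\<^bsub>A\<^esub>" using hs(2)[of "\<ominus>\<^bsub>Q\<^esub> i" i] hs(4) ic i(2) by (simp add: Q.l_neg)
      then have "\<ominus>\<^bsub>A\<^esub> a = \<phi> (\<ominus>\<^bsub>Q\<^esub> i)" using hs(3) ic i(2) by (intro A.minus_equality) auto
      then show "inv\<^bsub>add_monoid A\<^esub> a \<in> \<phi> ` I" using I.a_inv_closed[OF i(1)] by (simp add: a_inv_def)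
    qed
    fix a r assume ar: "a \<in> \<phi> ` I" "r \<in> carrier A"
    obtain i where i: "i \<in> I" "a = \<phi> i" using ar(1) by blast
    obtain s where s: "s \<in> carrier Q" "r = \<phi> s" using ar(2) h(2) by blast
    have "r \<otimes>\<^bsub>A\<^esub> a = \<phi> (s \<otimes>\<^bsub>Q\<^esub> i)" using hs(1)[OF s(1) I.a_Hcarr[OF i(1)]] i s by simp
    then show "r \<otimes>\<^bsub>A\<^esub> a \<in> \<phi> ` I" using I.I_l_closed[OF i(1) s(1)] by simp
    moreover have "a \<in> carrier A" using hs(3) I.a_Hcarr i by simp
    ultimately show "a \<otimes>\<^bsub>A\<^esub> r \<in> \<phi> ` I" using A.m_comm[of a r] ar(2) by simp
  qed (rule A.ring_axioms)
qed

context standard_graded begin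

abbreviation "kk \<equiv> degree_zero_ring A G"
abbreviation "ee \<equiv> embdim A G"

lemma kk_simps: "carrier kk = G 0" "a \<otimes>\<^bsub>kk\<^esub> b = a \<otimes> b" "a \<oplus>\<^bsub>kk\<^esub> b = a \<oplus> b" "\<zero>\<^bsub>kk\<^esub> = \<zero>" "\<one>\<^bsub>kk\<^esub> = \<one>"
  by (simp_all add: degree_zero_ring_def)

lemma kk_field: "field kk" unfolding degree_zero_ring_def by (rule subfield_iff(2)[OF base_field])

sublocale P: polyr "degree_zero_ring A G" "embdim A G" by (intro polyr.intro kk_field)

lemma G_carrier: "x \<in> G i \<Longrightarrow> x \<in> carrier A" using additive_subgroup.a_subset[OF component_subgroup] by blast
lemma G_zero: "\<zero> \<in> G i" by (rule additive_subgroup.zero_closed[OF component_subgroup])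
lemma G_add: "\<lbrakk> x \<in> G i; y \<in> G i \<rbrakk> \<Longrightarrow> x \<oplus> y \<in> G i" by (rule additive_subgroup.a_closed[OF component_subgroup])

lemma coeff: "R \<in> P.PC \<Longrightarrow> R m \<in> G 0" using P.pset_coeff[of R m] by (simp add: kk_simps)
lemma coeffA: "R \<in> P.PC \<Longrightarrow> R m \<in> carrier A" using coeff G_carrier by blast
lemma supp: "R \<in> P.PC \<Longrightarrow> finite {m. R m \<noteq> \<zero>}" "\<lbrakk> R \<in> P.PC; R m \<noteq> \<zero> \<rbrakk> \<Longrightarrow> set_mset m \<subseteq> {..<ee}"
  using P.pset_support[of R] by (auto simp: kk_simps)

lemma PC_induct [consumes 1, case_names const padd pmult]:
  assumes "R \<in> P.PC" "\<And>k. k \<in> G 0 \<Longrightarrow> S (P.indexed_const k)"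
    "\<And>R T. \<lbrakk> R \<in> P.PC; S R; T \<in> P.PC; S T \<rbrakk> \<Longrightarrow> S (P.indexed_padd R T)"
    "\<And>R i. \<lbrakk> R \<in> P.PC; S R; i < ee \<rbrakk> \<Longrightarrow> S (P.indexed_pmult R i)"
  shows "S R"
proof -
  have "R \<in> P.indexed_pset {..<ee} (carrier kk)" using assms(1) by (simp add: P.Q_simps)
  then have "R \<in> P.PC \<and> S R"
  proof (induction rule: P.indexed_pset.induct)
    case (indexed_const k) then show ?case using assms(2) P.indexed_pset.indexed_const[of k "carrier kk"] by (simp add: P.Q_simps kk_simps)
  next
    case (indexed_padd R T) then show ?case using assms(3) P.indexed_pset.indexed_padd by (simp add: P.Q_simps)
  next
    case (indexed_pmult R i) then show ?case using assms(4)[of R i] P.pmult_PC[of R i] by simp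
  qed
  then show ?thesis by blast
qed

section \<open>Evaluation of polynomials over the field of degree 0\<close>

definition mona :: "(nat \<Rightarrow> 'a) \<Rightarrow> nat multiset \<Rightarrow> 'a" where "mona a m = (\<Otimes>i\<in>{..<ee}. a i [^] count m i)"
definition ev :: "(nat \<Rightarrow> 'a) \<Rightarrow> (nat multiset \<Rightarrow> 'a) \<Rightarrow> 'a" where "ev a R = (\<Oplus>m\<in>{m. R m \<noteq> \<zero>}. R m \<otimes> mona a m)"

context fixes a assumes a: "\<And>i. i < ee \<Longrightarrow> a i \<in> carrier A" begin

lemma mona_closed: "mona a m \<in> carrier A" unfolding mona_def by (rule finprod_closed) (use a in auto)

lemma mona_empty: "mona a {#} = \<one>"
proof -
  have "mona a {#} = (\<Otimes>i\<in>{..<ee}. \<one>)" unfolding mona_def by (rule finprod_cong') (use a in auto)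
  then show ?thesis by simp
qed

lemma mona_add: assumes i: "i < ee" shows "mona a (add_mset i m) = mona a m \<otimes> a i"
proof -
  have "mona a (add_mset i m) = (\<Otimes>j\<in>{..<ee}. a j [^] count m j \<otimes> (if i = j then a j else \<one>))"
    unfolding mona_def by (rule finprod_cong') (use a in auto)
  also have "\<dots> = mona a m \<otimes> (\<Otimes>j\<in>{..<ee}. if i = j then a j else \<one>)"
    unfolding mona_def by (rule finprod_multf) (use a in auto)
  also have "(\<Otimes>j\<in>{..<ee}. if i = j then a j else \<one>) = a i"
    by (rule finprod_singleton) (use a i in auto)
  finally show ?thesis .
qed

lemma ev_sup: assumes R: "R \<in> P.PC" and S: "finite S" "{m. R m \<noteq> \<zero>} \<subseteq> S" shows "ev a R = (\<Oplus>m\<in>S. R m \<otimes> mona a m)"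
  unfolding ev_def by (rule add.finprod_mono_neutral_cong_left[OF S]) (use coeffA[OF R] mona_closed in auto)

lemma ev_closed: "R \<in> P.PC \<Longrightarrow> ev a R \<in> carrier A"
  unfolding ev_def by (rule finsum_closed) (use coeffA mona_closed in auto)

lemma const_PC: "c \<in> G 0 \<Longrightarrow> P.indexed_const c \<in> P.PC"
  using P.indexed_pset.indexed_const[of c "carrier kk"] by (simp add: P.Q_simps kk_simps)
lemma padd_PC: "\<lbrakk> R \<in> P.PC; T \<in> P.PC \<rbrakk> \<Longrightarrow> P.indexed_padd R T \<in> P.PC"
  using P.indexed_pset.indexed_padd by (simp add: P.Q_simps)
lemma pmult_PC: "\<lbrakk> R \<in> P.PC; i < ee \<rbrakk> \<Longrightarrow> P.indexed_pmult R i \<in> P.PC"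
  by (rule P.pmult_PC)

lemma ev_const: assumes c: "c \<in> G 0" shows "ev a (P.indexed_const c) = c"
proof -
  have "ev a (P.indexed_const c) = (\<Oplus>m\<in>{{#}}. P.indexed_const c m \<otimes> mona a m)"
    by (rule ev_sup[OF const_PC[OF c]]) (auto simp: P.indexed_const_def kk_simps)
  also have "\<dots> = c" using G_carrier[OF c] by (simp add: mona_empty P.indexed_const_def)
  finally show ?thesis .
qed

lemma ev_padd: assumes RT: "R \<in> P.PC" "T \<in> P.PC" shows "ev a (P.indexed_padd R T) = ev a R \<oplus> ev a T"
proof -
  let ?S = "{m. R m \<noteq> \<zero>} \<union> {m. T m \<noteq> \<zero>}"
  have f: "finite ?S" using supp(1) RT by auto
  have "ev a (P.indexed_padd R T) = (\<Oplus>m\<in>?S. P.indexed_padd R T m \<otimes> mona a m)"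
    by (rule ev_sup[OF padd_PC[OF RT] f]) (auto simp: P.indexed_padd_def kk_simps)
  also have "\<dots> = (\<Oplus>m\<in>?S. R m \<otimes> mona a m \<oplus> T m \<otimes> mona a m)"
    by (rule finsum_cong') (use coeffA[OF RT(1)] coeffA[OF RT(2)] mona_closed in \<open>auto simp: P.indexed_padd_def kk_simps l_distr\<close>)
  also have "\<dots> = (\<Oplus>m\<in>?S. R m \<otimes> mona a m) \<oplus> (\<Oplus>m\<in>?S. T m \<otimes> mona a m)"
    by (rule finsum_addf) (use coeffA[OF RT(1)] coeffA[OF RT(2)] mona_closed in auto)
  also have "\<dots> = ev a R \<oplus> ev a T" using ev_sup[OF RT(1) f] ev_sup[OF RT(2) f] by simp
  finally show ?thesis .
qed

lemma ev_smult: assumes c: "c \<in> G 0" and R: "R \<in> P.PC" shows "ev a (\<lambda>m. c \<otimes> R m) = c \<otimes> ev a R"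
proof -
  have PC: "(\<lambda>m. c \<otimes> R m) \<in> P.PC"
    using P.pmul_PC[OF const_PC[OF c] R] P.pmul_const[of c R] c coeff[OF R] by (simp add: kk_simps)
  have "ev a (\<lambda>m. c \<otimes> R m) = (\<Oplus>m\<in>{m. R m \<noteq> \<zero>}. (c \<otimes> R m) \<otimes> mona a m)"
    by (rule ev_sup[OF PC supp(1)[OF R]]) (use G_carrier[OF c] in auto)
  also have "\<dots> = (\<Oplus>m\<in>{m. R m \<noteq> \<zero>}. c \<otimes> (R m \<otimes> mona a m))"
    by (rule finsum_cong') (use G_carrier[OF c] coeffA[OF R] mona_closed in \<open>auto simp: m_assoc\<close>)
  also have "\<dots> = c \<otimes> ev a R" unfolding ev_def
    by (rule finsum_rdistr[symmetric]) (use supp(1)[OF R] G_carrier[OF c] coeffA[OF R] mona_closed in auto)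
  finally show ?thesis .
qed

lemma ev_pmult: assumes R: "R \<in> P.PC" and i: "i < ee" shows "ev a (P.indexed_pmult R i) = ev a R \<otimes> a i"
proof -
  let ?S = "{m. R m \<noteq> \<zero>}"
  have pm: "P.indexed_pmult R i (add_mset i m) = R m" for m by (simp add: P.indexed_pmult_def)
  have sub: "{m. P.indexed_pmult R i m \<noteq> \<zero>} \<subseteq> add_mset i ` ?S"
  proof
    fix m assume "m \<in> {m. P.indexed_pmult R i m \<noteq> \<zero>}"
    then have m: "i \<in># m" "R (m - {#i#}) \<noteq> \<zero>" by (auto simp: P.indexed_pmult_def kk_simps split: if_splits)
    then have "m = add_mset i (m - {#i#})" by simp
    then show "m \<in> add_mset i ` ?S" using m(2) by blast
  qed
  have "ev a (P.indexed_pmult R i) = (\<Oplus>m\<in>add_mset i ` ?S. P.indexed_pmult R i m \<otimes> mona a m)"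
    by (rule ev_sup[OF pmult_PC[OF R i] _ sub]) (use supp(1)[OF R] in simp)
  also have "\<dots> = (\<Oplus>m\<in>?S. P.indexed_pmult R i (add_mset i m) \<otimes> mona a (add_mset i m))"
    by (rule add.finprod_reindex) (use coeffA[OF pmult_PC[OF R i]] mona_closed in \<open>auto simp: inj_on_def\<close>)
  also have "\<dots> = (\<Oplus>m\<in>?S. (R m \<otimes> mona a m) \<otimes> a i)"
    by (rule finsum_cong') (use coeffA[OF R] mona_closed a[OF i] in \<open>auto simp: pm mona_add[OF i] m_assoc\<close>)
  also have "\<dots> = ev a R \<otimes> a i" unfolding ev_def
    by (rule finsum_ldistr[symmetric]) (use supp(1)[OF R] a[OF i] coeffA[OF R] mona_closed in auto)
  finally show ?thesis .
qed

lemma ev_mult: assumes R: "R \<in> P.PC" and T: "T \<in> P.PC" shows "ev a (P.pmul R T) = ev a R \<otimes> ev a T"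
  using R
proof (induction R rule: PC_induct)
  case (const k)
  have "P.pmul (P.indexed_const k) T = (\<lambda>m. k \<otimes> T m)"
    using P.pmul_const[of k T] const coeff[OF T] by (simp add: kk_simps)
  then show ?case using ev_smult[OF const T] ev_const[OF const] by simp
next
  case (padd R R')
  have "P.pmul (P.indexed_padd R R') T = P.indexed_padd (P.pmul R T) (P.pmul R' T)"
    by (rule P.pmul_add_l) (use P.pset_coeff padd T in blast)+
  then show ?case using ev_padd P.pmul_PC padd T ev_closed by (simp add: l_distr)
next
  case (pmult R i)
  have "P.pmul (P.indexed_pmult R i) T = P.indexed_pmult (P.pmul R T) i"
    by (rule P.pmul_pmult_l) (use P.pset_coeff pmult T in blast)+
  then have "ev a (P.pmul (P.indexed_pmult R i) T) = (ev a R \<otimes> ev a T) \<otimes> a i"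
    using ev_pmult[OF P.pmul_PC[OF pmult.hyps(1) T] pmult.hyps(2)] pmult.IH by simp
  also have "\<dots> = (ev a R \<otimes> a i) \<otimes> ev a T"
    using ev_closed[OF pmult.hyps(1)] ev_closed[OF T] a[OF pmult.hyps(2)] by (simp add: m_ac)
  finally show ?case using ev_pmult[OF pmult.hyps] by simp
qed

lemma ev_hom: "ev a \<in> ring_hom P.Q A"
proof (rule ring_hom_memI)
  have "\<one> \<in> G 0" using field.is_ring[OF kk_field] monoid.one_closed[of kk] ring.is_monoid[of kk] by (simp add: kk_simps)
  then show "ev a \<one>\<^bsub>P.Q\<^esub> = \<one>" using ev_const by (simp add: P.Q_simps kk_simps)
qed (simp_all add: ev_closed ev_mult ev_padd P.Q_simps(1,2))

lemma ev_var: "i < ee \<Longrightarrow> ev a (P.xv i) = a i"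
proof -
  assume i: "i < ee"
  have o: "\<one> \<in> G 0" using field.is_ring[OF kk_field] monoid.one_closed[of kk] ring.is_monoid[of kk] by (simp add: kk_simps)
  show ?thesis unfolding P.indexed_var_def using ev_pmult[OF const_PC[OF o] i] ev_const[OF o] a[OF i] by (simp add: kk_simps)
qed

end

text \<open>Needed because \<open>relations_ideal\<close> picks some presentation. A basis of
  \<open>G 1\<close> over \<open>G 0\<close> defines an evaluation map, and its image is a subring
  containing \<open>G 0\<close> and \<open>G 1\<close>.\<close>

lemma ex_presentation: "\<exists>\<phi>. graded_presentation A G \<phi>"
proof -
  have dm: "dimension ee (G 0) (G 1)"
    using finite_dimensionE[OF base_field degree_one_finite] by (simp add: embdim_def over_def)
  obtain Us where Us: "set Us \<subseteq> carrier A" "independent (G 0) Us" "length Us = ee" "Span (G 0) Us = G 1"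
    using exists_base[OF base_field dm] by blast
  define a where "a i = Us ! i" for i
  have ac: "a i \<in> carrier A" if "i < ee" for i using that Us(1,3) nth_mem[of i Us] by (auto simp: a_def)
  have UsG: "set Us \<subseteq> G 1" using Span_base_incl[OF base_field Us(1)] Us(4) by simp
  have aG: "a i \<in> G 1" if "i < ee" for i using that UsG Us(3) nth_mem[of i Us] by (auto simp: a_def)
  note hom = ev_hom[of a, OF ac]
  let ?I = "ev a ` P.PC"
  interpret Q: cring P.Q by (rule P.cring_Q)
  note hs = ring_hom_mult[OF hom] ring_hom_add[OF hom] ring_hom_one[OF hom] ring_hom_closed[OF hom]
  have I0: "G 0 \<subseteq> ?I" using ev_const[of a, OF ac] const_PC[of a, OF ac] by (force simp: image_iff)
  have Iadd: "s \<oplus> t \<in> ?I" if "s \<in> ?I" "t \<in> ?I" for s t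
  proof -
    obtain R T where "R \<in> P.PC" "s = ev a R" "T \<in> P.PC" "t = ev a T" using \<open>s \<in> ?I\<close> \<open>t \<in> ?I\<close> by blast
    then show ?thesis using hs(2)[of R T] Q.a_closed[of R T] by (metis image_eqI)
  qed
  have Imul: "s \<otimes> t \<in> ?I" if "s \<in> ?I" "t \<in> ?I" for s t
  proof -
    obtain R T where "R \<in> P.PC" "s = ev a R" "T \<in> P.PC" "t = ev a T" using \<open>s \<in> ?I\<close> \<open>t \<in> ?I\<close> by blast
    then show ?thesis using hs(1)[of R T] Q.m_closed[of R T] by (metis image_eqI)
  qed
  have Ione: "\<one> \<in> ?I" using hs(3) Q.one_closed by (metis image_eqI)
  have Ic: "?I \<subseteq> carrier A" using hs(4) by blast
  have Ineg: "\<ominus> s \<in> ?I" if s: "s \<in> ?I" for s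
  proof -
    have "\<ominus> \<one> \<in> G 0"
      using additive_subgroup.a_inv_closed[OF component_subgroup, of \<one> 0] subringE(3)[OF subfieldE(1)[OF base_field]] by blast
    then have "\<ominus> \<one> \<otimes> s \<in> ?I" using Imul[OF _ s] I0 by blast
    moreover have "\<ominus> \<one> \<otimes> s = \<ominus> s" using s Ic by (simp add: l_minus subset_iff)
    ultimately show ?thesis by simp
  qed
  have Ius: "set Us \<subseteq> ?I"
  proof
    fix u assume "u \<in> set Us"
    then obtain i where i: "i < ee" "u = a i" using Us(3) by (auto simp: a_def in_set_conv_nth)
    have "ev a (P.xv i) = u" using ev_var[of a i, OF ac i(1)] i(2) by simp
    then show "u \<in> ?I" using mring.x_closed[OF P.mring_Q i(1)] by blast
  qed
  have "Span (G 0) Vs \<subseteq> ?I" if "set Vs \<subseteq> ?I" for Vs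
    using that
  proof (induction Vs)
    case Nil
    have "\<zero> \<in> ?I" using I0 G_zero[of 0] by blast
    then show ?case by simp
  next
    case (Cons v Vs)
    show ?case
    proof
      fix z assume "z \<in> Span (G 0) (v # Vs)"
      then obtain k w where kw: "k \<in> G 0" "w \<in> Span (G 0) Vs" "z = k \<otimes> v \<oplus> w"
        using line_extension_mem_iff[of z "G 0" v "Span (G 0) Vs"] by auto
      have "k \<otimes> v \<in> ?I" using Imul[of k v] I0 kw(1) Cons.prems by auto
      moreover have "w \<in> ?I" using Cons kw(2) by auto
      ultimately show "z \<in> ?I" unfolding kw(3) by (rule Iadd)
    qed
  qed
  then have I1: "G 1 \<subseteq> ?I" using Ius Us(4) by blast
  have "z \<in> ?I" if "z \<in> generate_ring A (G 0 \<union> G 1)" for z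
    using that
  proof (induction rule: generate_ring.induct)
    case one show ?case by (rule Ione)
  next
    case (incl h) then show ?case using I0 I1 by blast
  next
    case (a_inv h) then show ?case by (intro Ineg)
  next
    case (eng_add h1 h2) then show ?case by (intro Iadd)
  next
    case (eng_mult h1 h2) then show ?case by (intro Imul)
  qed
  then have "?I = carrier A" using Ic generated_in_degree_one by blast
  then have "graded_presentation A G (ev a)"
    unfolding graded_presentation_def Let_def using hom ev_const[of a, OF ac] ev_var[of a, OF ac] aG by simp
  then show ?thesis by blast
qed

section \<open>Homogeneous components and the irrelevant ideal\<close>

lemma hc_sum: assumes f: "\<And>i. f i \<in> G i" "\<And>i. N \<le> i \<Longrightarrow> f i = \<zero>" shows "homogeneous_components A G f (\<Oplus>i\<in>{..<N}. f i)"
proof -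
  have sub: "{i. f i \<noteq> \<zero>} \<subseteq> {..<N}" using f(2) linorder_not_le by auto
  have "(\<Oplus>i\<in>{i. f i \<noteq> \<zero>}. f i) = (\<Oplus>i\<in>{..<N}. f i)"
    by (rule add.finprod_mono_neutral_cong_left[OF _ sub]) (use f(1) G_carrier in auto)
  then show ?thesis unfolding homogeneous_components_def using f(1) finite_subset[OF sub] by simp
qed

lemma hcE: assumes "homogeneous_components A G f a"
  obtains N where "\<And>i. f i \<in> G i" "\<And>i. N \<le> i \<Longrightarrow> f i = \<zero>" "\<And>M. N \<le> M \<Longrightarrow> a = (\<Oplus>i\<in>{..<M}. f i)"
proof -
  have f: "\<And>i. f i \<in> G i" "finite {i. f i \<noteq> \<zero>}" "a = (\<Oplus>i\<in>{i. f i \<noteq> \<zero>}. f i)"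
    using assms unfolding homogeneous_components_def by auto
  obtain N where N: "\<forall>i\<in>{i. f i \<noteq> \<zero>}. i < N" using f(2) finite_nat_set_iff_bounded by blast
  show ?thesis
  proof (rule that[of N, OF f(1)])
    show z: "f i = \<zero>" if "N \<le> i" for i using N that by (meson leD mem_Collect_eq)
    fix M assume M: "N \<le> M"
    have sub: "{i. f i \<noteq> \<zero>} \<subseteq> {..<M}" using N M by (auto intro: less_le_trans)
    show "a = (\<Oplus>i\<in>{..<M}. f i)" unfolding f(3)
      by (rule add.finprod_mono_neutral_cong_left[OF _ sub]) (use f(1) G_carrier in auto)
  qed
qed

definition pres where "pres = (SOME \<phi>. graded_presentation A G \<phi>)"

lemma pres: "pres \<in> ring_hom P.Q A" "c \<in> G 0 \<Longrightarrow> pres (P.indexed_const c) = c" "i < ee \<Longrightarrow> pres (P.xv i) \<in> G 1"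
  "pres ` P.PC = carrier A" "relations_ideal A G = {R \<in> P.PC. pres R = \<zero>}"
proof -
  have gp: "graded_presentation A G pres" unfolding pres_def by (rule someI_ex[OF ex_presentation])
  show "pres \<in> ring_hom P.Q A" "c \<in> G 0 \<Longrightarrow> pres (P.indexed_const c) = c" "i < ee \<Longrightarrow> pres (P.xv i) \<in> G 1"
    "pres ` P.PC = carrier A" using gp unfolding graded_presentation_def Let_def by blast+
  show "relations_ideal A G = {R \<in> P.PC. pres R = \<zero>}"
    unfolding relations_ideal_def pres_def[symmetric] a_kernel_def' ..
qed

lemma pres_simps: "R \<in> P.PC \<Longrightarrow> pres R \<in> carrier A"
  "\<lbrakk> R \<in> P.PC; T \<in> P.PC \<rbrakk> \<Longrightarrow> pres (R \<otimes>\<^bsub>P.Q\<^esub> T) = pres R \<otimes> pres T"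
  "\<lbrakk> R \<in> P.PC; T \<in> P.PC \<rbrakk> \<Longrightarrow> pres (R \<oplus>\<^bsub>P.Q\<^esub> T) = pres R \<oplus> pres T"
  using ring_hom_closed[OF pres(1)] ring_hom_mult[OF pres(1)] ring_hom_add[OF pres(1)] by auto

text \<open>Only the component of degree 0 is recorded, as it alone decides membership in the
  irrelevant ideal. The components are built along the construction of the polynomial.\<close>

lemma pres_components: assumes "R \<in> P.PC" shows "\<exists>f. homogeneous_components A G f (pres R) \<and> f 0 = R {#}"
  using assms
proof (induction R rule: PC_induct)
  case (const k)
  define f where "f = (\<lambda>i::nat. if i = 0 then k else \<zero>)"
  have "homogeneous_components A G f (\<Oplus>i\<in>{..<Suc 0}. f i)"
    by (rule hc_sum) (use const G_zero in \<open>auto simp: f_def\<close>)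
  moreover have "(\<Oplus>i\<in>{..<Suc 0}. f i) = k" using G_carrier[OF const] by (simp add: f_def lessThan_Suc)
  ultimately show ?case using pres(2)[OF const] by (intro exI[of _ f]) (simp add: f_def P.indexed_const_def)
next
  case (padd R T)
  obtain f g where f: "homogeneous_components A G f (pres R)" "f 0 = R {#}"
    and g: "homogeneous_components A G g (pres T)" "g 0 = T {#}" using padd by blast
  obtain N where N: "\<And>i. f i \<in> G i" "\<And>i. N \<le> i \<Longrightarrow> f i = \<zero>" "\<And>M. N \<le> M \<Longrightarrow> pres R = (\<Oplus>i\<in>{..<M}. f i)"
    by (rule hcE[OF f(1)]) blast
  obtain N' where N': "\<And>i. g i \<in> G i" "\<And>i. N' \<le> i \<Longrightarrow> g i = \<zero>" "\<And>M. N' \<le> M \<Longrightarrow> pres T = (\<Oplus>i\<in>{..<M}. g i)"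
    by (rule hcE[OF g(1)]) blast
  define M where "M = max N N'"
  have "homogeneous_components A G (\<lambda>i. f i \<oplus> g i) (\<Oplus>i\<in>{..<M}. f i \<oplus> g i)"
    by (rule hc_sum) (use N(1,2) N'(1,2) G_add in \<open>auto simp: M_def\<close>)
  moreover have "(\<Oplus>i\<in>{..<M}. f i \<oplus> g i) = (\<Oplus>i\<in>{..<M}. f i) \<oplus> (\<Oplus>i\<in>{..<M}. g i)"
    by (rule finsum_addf) (use N(1) N'(1) G_carrier in auto)
  moreover have "\<dots> = pres (P.indexed_padd R T)"
    using N(3)[of M] N'(3)[of M] pres_simps(3)[OF padd.hyps] by (simp add: M_def P.Q_simps)
  ultimately show ?case using f(2) g(2) by (intro exI[of _ "\<lambda>i. f i \<oplus> g i"]) (simp add: P.indexed_padd_def kk_simps)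
next
  case (pmult R i)
  obtain f where f: "homogeneous_components A G f (pres R)" "f 0 = R {#}" using pmult by blast
  obtain N where N: "\<And>i. f i \<in> G i" "\<And>i. N \<le> i \<Longrightarrow> f i = \<zero>" "\<And>M. N \<le> M \<Longrightarrow> pres R = (\<Oplus>i\<in>{..<M}. f i)"
    by (rule hcE[OF f(1)]) blast
  define b where "b = pres (P.xv i)"
  have b: "b \<in> G 1" "b \<in> carrier A" using pres(3)[OF pmult.hyps(2)] G_carrier by (auto simp: b_def)
  \<comment> \<open>A factor of degree 1 shifts the components by one; the 0 left in degree 0
    matches the vanishing constant term.\<close>
  define g where "g = (\<lambda>j. case j of 0 \<Rightarrow> \<zero> | Suc d \<Rightarrow> f d \<otimes> b)"
  have gG: "g j \<in> G j" for j
    using component_mult[OF N(1) b(1)] G_zero by (cases j) (auto simp: g_def)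
  have "homogeneous_components A G g (\<Oplus>j\<in>{..<Suc N}. g j)"
    by (rule hc_sum[OF gG]) (use N(2) b(2) in \<open>auto simp: g_def split: nat.splits\<close>)
  moreover have "(\<Oplus>j\<in>{..<Suc N}. g j) = pres (P.indexed_pmult R i)"
  proof -
    have fc: "f d \<in> carrier A" for d using N(1) G_carrier by blast
    have "(\<Oplus>j\<in>{..<Suc N}. g j) = g 0 \<oplus> (\<Oplus>j\<in>Suc ` {..<N}. g j)"
      unfolding lessThan_Suc_eq_insert_0 by (rule finsum_insert) (use gG G_carrier in auto)
    also have "(\<Oplus>j\<in>Suc ` {..<N}. g j) = (\<Oplus>d\<in>{..<N}. g (Suc d))"
      by (rule add.finprod_reindex) (use gG G_carrier in auto)
    also have "g 0 \<oplus> (\<Oplus>d\<in>{..<N}. g (Suc d)) = (\<Oplus>d\<in>{..<N}. g (Suc d))"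
    proof -
      have "(\<Oplus>d\<in>{..<N}. g (Suc d)) \<in> carrier A" by (rule finsum_closed) (use gG G_carrier in auto)
      moreover have "g 0 = \<zero>" by (simp add: g_def)
      ultimately show ?thesis by simp
    qed
    also have "\<dots> = (\<Oplus>d\<in>{..<N}. f d \<otimes> b)" by (simp add: g_def)
    also have "\<dots> = (\<Oplus>d\<in>{..<N}. f d) \<otimes> b" by (rule finsum_ldistr[symmetric]) (use fc b(2) in auto)
    also have "\<dots> = pres R \<otimes> b" using N(3)[of N] by simp
    also have "\<dots> = pres (P.xv i \<otimes>\<^bsub>P.Q\<^esub> R)"
      using pres_simps(2)[OF mring.x_closed[OF P.mring_Q pmult.hyps(2)] pmult.hyps(1)] pres_simps(1)[OF pmult.hyps(1)] b(2) m_comm by (simp add: b_def)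
    also have "\<dots> = pres (P.indexed_pmult R i)" using P.var_mul[OF pmult.hyps(1)] by simp
    finally show ?thesis .
  qed
  ultimately show ?case by (intro exI[of _ g]) (simp add: g_def P.indexed_pmult_def kk_simps)
qed

text \<open>By uniqueness of the decomposition, the degree 0 component of an element is the constant
  term of any of its preimages.\<close>

lemma irrelevant_pres: "irrelevant_ideal A G = pres ` P.J 1"
proof (intro subset_antisym subsetI)
  fix a assume "a \<in> irrelevant_ideal A G"
  then obtain f where f: "homogeneous_components A G f a" "f 0 = \<zero>" unfolding irrelevant_ideal_def by blast
  obtain N where N: "\<And>i. f i \<in> G i" "\<And>M. N \<le> M \<Longrightarrow> a = (\<Oplus>i\<in>{..<M}. f i)" by (rule hcE[OF f(1)]) blast
  have ac: "a \<in> carrier A" unfolding N(2)[OF order_refl] by (rule finsum_closed) (use N(1) G_carrier in auto)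
  obtain R where R: "R \<in> P.PC" "a = pres R" using ac pres(4) by blast
  obtain g where g: "homogeneous_components A G g (pres R)" "g 0 = R {#}" using pres_components[OF R(1)] by blast
  have "g = f" using decomposition[OF ac] f(1) g(1) R(2) by blast
  then have "R {#} = \<zero>" using g(2) f(2) by simp
  then have "R \<in> P.J 1" using R(1) by (simp add: P.J_def kk_simps)
  then show "a \<in> pres ` P.J 1" using R(2) by blast
next
  fix a assume "a \<in> pres ` P.J 1"
  then obtain R where R: "R \<in> P.J 1" "a = pres R" by blast
  have "R \<in> P.PC" "R {#} = \<zero>" using R(1) by (auto simp: P.J_def kk_simps)
  then show "a \<in> irrelevant_ideal A G" unfolding irrelevant_ideal_def using pres_components R(2) by force
qed

lemma power_pres: "ideal_power A (irrelevant_ideal A G) n = pres ` P.J n"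
proof (induction n)
  case 0 then show ?case by (simp add: ideal_power_def nat_pow_def ideals_set_def P.J_0 pres(4))
next
  case (Suc n)
  have c: "P.J j \<subseteq> P.PC" for j by (auto simp: P.J_def)
  have "ideal_power A (irrelevant_ideal A G) (Suc n) = ideal_prod A (pres ` P.J n) (pres ` P.J 1)"
    using Suc unfolding ideal_power_def nat_pow_def irrelevant_pres by (simp add: ideals_set_def)
  also have "\<dots> = pres ` ideal_prod P.Q (P.J n) (P.J 1)"
    by (rule hom_ideal_prod[OF pres(1) c c cring.axioms(1)[OF P.cring_Q], symmetric])
  finally show ?case using P.J_prod by simp
qed

lemma J_antimono: "i \<le> j \<Longrightarrow> P.J j \<subseteq> P.J i" by (auto simp: P.J_def)

text \<open>\<open>Ord\<close> is a supremum, so containment at n has to be extracted from it. As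
  the powers decrease, failure at n confines every admissible i to values below n, and the supremum
  is at most n - 1.\<close>

lemma relations_J: assumes "enat n \<le> Ord A G" "n \<ge> 1" shows "relations_ideal A G \<subseteq> P.J n"
proof (rule ccontr)
  assume no: "\<not> relations_ideal A G \<subseteq> P.J n"
  have "Ord A G = Sup {enat i | i. relations_ideal A G \<subseteq> P.J i}"
    unfolding Ord_def Let_def P.ideal_power_J ..
  also have "\<dots> \<le> enat (n - 1)"
  proof (rule Sup_least)
    fix z assume "z \<in> {enat i | i. relations_ideal A G \<subseteq> P.J i}"
    then obtain i where i: "z = enat i" "relations_ideal A G \<subseteq> P.J i" by blast
    have "\<not> n \<le> i" using no i(2) J_antimono[of n i] by blast
    then show "z \<le> enat (n - 1)" unfolding i(1) by simp
  qed
  finally have "enat n \<le> enat (n - 1)" using assms(1) by (rule order_trans[rotated])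
  then show False using assms(2) by simp
qed

text \<open>The relations have order at least \<open>Suc m\<close>, so polynomials with equal image
  in A agree up to that order. Hence the composite map to the quotient has exactly that power of the
  ideal of the variables as its kernel.\<close>

theorem trunc_ex:
  assumes n: "enat (Suc m) \<le> Ord A G" and e: "ee \<ge> 1"
  shows "\<exists>\<psi>. trunc P.Q P.xv ee (numm ee) (A Quot (ideal_power A (irrelevant_ideal A G) (Suc m))) \<psi> m"
proof -
  let ?I = "pres ` P.J (Suc m)"
  have I: "ideal ?I A" by (rule hom_ideal_image[OF pres(1,4) P.cring_Q cring_axioms P.J_ideal])
  interpret I: ideal ?I A by (rule I)
  interpret Q: kosz P.Q P.xv ee "numm ee" by (rule P.kosz_Q[OF e])
  define \<psi> where "\<psi> R = ?I +> pres R" for R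
  have h: "\<psi> \<in> ring_hom P.Q (A Quot ?I)"
    using ring_hom_trans[OF pres(1) I.rcos_ring_hom] unfolding \<psi>_def[abs_def] by (simp add: comp_def)
  have ker: "\<psi> R = \<zero>\<^bsub>A Quot ?I\<^esub> \<longleftrightarrow> R \<in> Q.Ipow (Suc m)" if R: "R \<in> P.PC" for R
  proof -
    have "\<psi> R = \<zero>\<^bsub>A Quot ?I\<^esub> \<longleftrightarrow> ?I +> pres R = ?I" by (simp add: \<psi>_def FactRing_def)
    also have "\<dots> \<longleftrightarrow> pres R \<in> ?I" using I.a_rcos_const I.a_rcos_self[OF pres_simps(1)[OF R]] by metis
    also have "\<dots> \<longleftrightarrow> R \<in> P.J (Suc m)"
    proof
      assume "pres R \<in> ?I"
      then obtain T where T: "T \<in> P.J (Suc m)" "pres R = pres T" by blast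
      have Tc: "T \<in> P.PC" using T(1) by (simp add: P.J_def)
      have d: "R \<ominus>\<^bsub>P.Q\<^esub> T \<in> P.PC" using R Tc by simp
      have eq: "R = (R \<ominus>\<^bsub>P.Q\<^esub> T) \<oplus>\<^bsub>P.Q\<^esub> T" using R Tc by (simp add: a_minus_def Q.a_assoc Q.l_neg)
      have "pres (R \<ominus>\<^bsub>P.Q\<^esub> T) \<oplus> pres T = pres T" using pres_simps(3)[OF d Tc] eq T(2) by simp
      then have "pres (R \<ominus>\<^bsub>P.Q\<^esub> T) = \<zero>" using pres_simps(1)[OF d] pres_simps(1)[OF Tc] by simp
      then have "R \<ominus>\<^bsub>P.Q\<^esub> T \<in> P.J (Suc m)" using relations_J[OF n] d pres(5) by auto
      then show "R \<in> P.J (Suc m)" using eq T(1) Q.idlD(3)[OF P.J_idl] by metis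
    qed blast
    also have "\<dots> \<longleftrightarrow> R \<in> Q.Ipow (Suc m)" unfolding Q.Ipow_def P.mmk_J ..
    finally show ?thesis .
  qed
  have "\<psi> ` P.PC = carrier (A Quot ?I)"
  proof -
    have "\<psi> ` P.PC = (\<lambda>a. ?I +> a) ` pres ` P.PC" by (simp add: \<psi>_def image_image)
    then show ?thesis unfolding pres(4) by (auto simp: FactRing_def A_RCOSETS_def')
  qed
  then have "trunc P.Q P.xv ee (numm ee) (A Quot ?I) \<psi> m"
    by (intro trunc.intro trunc_axioms.intro Q.kosz_axioms I.quotient_is_cring[OF cring_axioms] h ker)
  then show ?thesis unfolding power_pres by blast
qed

end

section \<open>The Krull dimension\<close>

text \<open>Gaussian elimination, by induction on the set of equations.\<close>

lemma (in field) linear_system: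
  assumes "finite B" "finite I" "card B < card I" "\<And>i b. i \<in> I \<Longrightarrow> a i b \<in> carrier R"
  shows "\<exists>c. (\<forall>i\<in>I. c i \<in> carrier R) \<and> (\<exists>i\<in>I. c i \<noteq> \<zero>) \<and> (\<forall>b\<in>B. (\<Oplus>i\<in>I. c i \<otimes> a i b) = \<zero>)"
  using assms
proof (induction B arbitrary: I a rule: finite_induct)
  case empty
  then obtain i0 where "i0 \<in> I" by fastforce
  then show ?case by (intro exI[of _ "\<lambda>_. \<one>"]) auto
next
  case (insert b B)
  show ?case
  proof (cases "\<forall>i\<in>I. a i b = \<zero>")
    case True
    have "card B < card I" using insert by simp
    then obtain c where c: "\<forall>i\<in>I. c i \<in> carrier R" "\<exists>i\<in>I. c i \<noteq> \<zero>" "\<forall>b\<in>B. (\<Oplus>i\<in>I. c i \<otimes> a i b) = \<zero>"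
      using insert.IH[of I a] insert.prems by blast
    have "(\<Oplus>i\<in>I. c i \<otimes> a i b) = (\<Oplus>i\<in>I. \<zero>)" by (rule finsum_cong') (use c(1) True in auto)
    then have "(\<Oplus>i\<in>I. c i \<otimes> a i b) = \<zero>" by simp
    then show ?thesis using c by blast
  next
    case False
    then obtain i0 where i0: "i0 \<in> I" "a i0 b \<noteq> \<zero>" by blast
    define I' where "I' = I - {i0}"
    have I': "finite I'" "card B < card I'" "I = insert i0 I'" "i0 \<notin> I'" using insert i0 by (auto simp: I'_def)
    have ac: "a i t \<in> carrier R" if "i \<in> I" for i t using insert.prems that by blast
    define k where "k i = a i b \<otimes> inv (a i0 b)" for i
    have u: "a i0 b \<in> Units R" using ac[OF i0(1)] i0(2) field_Units by blast
    have kc: "k i \<in> carrier R" if "i \<in> I" for i unfolding k_def using ac[OF that] u by simp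
    \<comment> \<open>Equation b determines the unknown at i0 as minus the sum of the
      \<open>c i \<otimes> k i\<close>. Substituting it into the other equations gives the system a'
      in the remaining unknowns.\<close>
    define a' where "a' i t = a i t \<ominus> k i \<otimes> a i0 t" for i t
    have a'c: "a' i t \<in> carrier R" if "i \<in> I'" for i t unfolding a'_def using ac kc that i0(1) I'(3) by simp
    obtain c where c: "\<forall>i\<in>I'. c i \<in> carrier R" "\<exists>i\<in>I'. c i \<noteq> \<zero>" "\<forall>t\<in>B. (\<Oplus>i\<in>I'. c i \<otimes> a' i t) = \<zero>"
      using insert.IH[of I' a'] I'(1,2) a'c by blast
    define s where "s = (\<Oplus>i\<in>I'. c i \<otimes> k i)"
    have sc: "s \<in> carrier R" unfolding s_def by (rule finsum_closed) (use c(1) kc I'(3) in auto)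
    define d where "d = c(i0 := \<ominus> s)"
    have dI': "d i = c i" if "i \<in> I'" for i using that I'(4) by (auto simp: d_def)
    have d0: "d i0 = \<ominus> s" by (simp add: d_def)
    have dc: "\<forall>i\<in>I. d i \<in> carrier R" using c(1) sc I'(3) dI' d0 by auto
    have zero': "(\<Oplus>i\<in>I'. c i \<otimes> a' i t) = \<zero>" if "t \<in> insert b B" for t
    proof (cases "t = b")
      case True
      have "a' i b = \<zero>" if "i \<in> I'" for i
        unfolding a'_def k_def using ac[of i b] that I'(3) u ac[OF i0(1), of b] by (simp add: m_assoc r_neg a_minus_def)
      then have "(\<Oplus>i\<in>I'. c i \<otimes> a' i b) = (\<Oplus>i\<in>I'. \<zero>)" by (intro finsum_cong') (use c(1) in auto)
      then show ?thesis using True by simp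
    next
      case False then show ?thesis using c(3) that by blast
    qed
    have "(\<Oplus>i\<in>I. d i \<otimes> a i t) = \<zero>" if t: "t \<in> insert b B" for t
    proof -
      have a0: "a i0 t \<in> carrier R" by (rule ac[OF i0(1)])
      have X: "(\<Oplus>i\<in>I'. d i \<otimes> a i t) = (\<Oplus>i\<in>I'. c i \<otimes> a' i t \<oplus> (c i \<otimes> k i) \<otimes> a i0 t)"
      proof (rule finsum_cong')
        fix i assume i: "i \<in> I'"
        have "c i \<in> carrier R" "a i t \<in> carrier R" "k i \<in> carrier R" using c(1) ac kc i I'(3) by auto
        then show "d i \<otimes> a i t = c i \<otimes> a' i t \<oplus> (c i \<otimes> k i) \<otimes> a i0 t"
          unfolding dI'[OF i] a'_def using a0 by algebra
      qed (use c(1) a'c kc a0 I'(3) in auto)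
      also have "\<dots> = (\<Oplus>i\<in>I'. c i \<otimes> a' i t) \<oplus> (\<Oplus>i\<in>I'. (c i \<otimes> k i) \<otimes> a i0 t)"
        by (rule finsum_addf) (use c(1) a'c kc a0 I'(3) in auto)
      also have "(\<Oplus>i\<in>I'. (c i \<otimes> k i) \<otimes> a i0 t) = s \<otimes> a i0 t" unfolding s_def
        by (rule finsum_ldistr[symmetric]) (use c(1) kc a0 I' in auto)
      finally have Y: "(\<Oplus>i\<in>I'. d i \<otimes> a i t) = s \<otimes> a i0 t" using zero'[OF t] sc a0 by simp
      have "(\<Oplus>i\<in>I. d i \<otimes> a i t) = d i0 \<otimes> a i0 t \<oplus> (\<Oplus>i\<in>I'. d i \<otimes> a i t)"
        unfolding I'(3) by (rule finsum_insert) (use I' dc ac in auto)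
      then show ?thesis unfolding Y d0 using sc a0 by (simp add: l_minus l_neg)
    qed
    moreover have "\<exists>i\<in>I. d i \<noteq> \<zero>" using c(2) dI' I'(3) by auto
    ultimately show ?thesis using dc by blast
  qed
qed

text \<open>The monomial in the k elements from \<open>x i\<close> on, with exponents \<alpha>. The
  recursion splits off the first factor because the chain of primes removes the variables in
  increasing order.\<close>

primrec mpr :: "('c, 'd) monoid_scheme \<Rightarrow> (nat \<Rightarrow> 'c) \<Rightarrow> (nat \<Rightarrow> nat) \<Rightarrow> nat \<Rightarrow> nat \<Rightarrow> 'c" where
  "mpr M x \<alpha> 0 = (\<lambda>i. \<one>\<^bsub>M\<^esub>)"
| "mpr M x \<alpha> (Suc k) = (\<lambda>i. x i [^]\<^bsub>M\<^esub> \<alpha> i \<otimes>\<^bsub>M\<^esub> mpr M x \<alpha> k (Suc i))"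

lemma (in cring) mpr_closed: "(\<And>j. x j \<in> carrier R) \<Longrightarrow> mpr R x \<alpha> k i \<in> carrier R"
  by (induction k arbitrary: i) auto

lemma mpr_hom:
  assumes h: "\<phi> \<in> ring_hom Q A" and Q: "cring Q" and A: "cring A" and P: "\<And>j. P j \<in> carrier Q"
  shows "\<phi> (mpr Q P \<alpha> k i) = mpr A (\<lambda>j. \<phi> (P j)) \<alpha> k i"
proof (induction k arbitrary: i)
  case 0 then show ?case using ring_hom_one[OF h] by simp
next
  case (Suc k)
  interpret Q: cring Q by (rule Q)
  interpret A: cring A by (rule A)
  have pw: "\<phi> (P i [^]\<^bsub>Q\<^esub> (n :: nat)) = \<phi> (P i) [^]\<^bsub>A\<^esub> n" for n
    by (induction n) (use ring_hom_one[OF h] ring_hom_mult[OF h] P in simp_all)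
  show ?case using ring_hom_mult[OF h Q.nat_pow_closed[OF P] Q.mpr_closed[OF P]] pw Suc by simp
qed

section \<open>Polynomials of bounded degree\<close>

context polyr begin

definition Ldeg :: "nat \<Rightarrow> (nat multiset \<Rightarrow> 'a) set" where "Ldeg d = {P \<in> PC. \<forall>m. P m \<noteq> \<zero> \<longrightarrow> size m \<le> d}"

lemma Ldeg_mono: "d \<le> d' \<Longrightarrow> Ldeg d \<subseteq> Ldeg d'" by (auto simp: Ldeg_def)

lemma Ldeg_ex: assumes "P \<in> PC" shows "\<exists>d. P \<in> Ldeg d"
proof -
  have f: "finite (size ` {m. P m \<noteq> \<zero>})" using pset_support[OF assms] by simp
  then obtain d where "\<forall>k\<in>size ` {m. P m \<noteq> \<zero>}. k \<le> d" using finite_nat_set_iff_bounded_le by blast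
  then show ?thesis using assms by (intro exI[of _ d]) (auto simp: Ldeg_def)
qed

lemma Ldeg_mult: assumes P: "P \<in> Ldeg c" and R: "R \<in> Ldeg d" shows "P \<otimes>\<^bsub>Q\<^esub> R \<in> Ldeg (c + d)"
proof -
  have PR: "P \<in> PC" "R \<in> PC" using P R by (auto simp: Ldeg_def)
  have "pmul P R m = \<zero>" if m: "\<not> size m \<le> c + d" for m
  proof -
    have "pmul P R m = (\<Oplus>l\<in>{l. l \<subseteq># m}. \<zero>)"
      unfolding pmul_def
    proof (rule finsum_cong')
      fix l assume l: "l \<in> {l. l \<subseteq># m}"
      have "size m = size l + size (m - l)" using l by (simp add: size_Diff_submset size_mset_mono)
      then have "\<not> size l \<le> c \<or> \<not> size (m - l) \<le> d" using m by linarith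
      then have "P l = \<zero> \<or> R (m - l) = \<zero>" using P R by (auto simp: Ldeg_def)
      then show "P l \<otimes> R (m - l) = \<zero>" using pset_coeff[OF PR(1)] pset_coeff[OF PR(2)] by auto
    qed auto
    then show ?thesis by simp
  qed
  then show ?thesis using pmul_PC[OF PR] unfolding Q_simps(1) Ldeg_def by blast
qed

lemma Ldeg_one: "\<one>\<^bsub>Q\<^esub> \<in> Ldeg 0"
proof -
  interpret Q: cring Q by (rule cring_Q)
  have "\<one>\<^bsub>Q\<^esub> \<in> PC" by simp
  then show ?thesis unfolding Ldeg_def Q_simps(3) by (auto simp: indexed_const_def)
qed

lemma Ldeg_pow: assumes P: "P \<in> Ldeg d" shows "P [^]\<^bsub>Q\<^esub> (n :: nat) \<in> Ldeg (n * d)"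
proof (induction n)
  case 0 then show ?case using Ldeg_one by simp
next
  case (Suc n)
  interpret Q: cring Q by (rule cring_Q)
  have "P [^]\<^bsub>Q\<^esub> n \<otimes>\<^bsub>Q\<^esub> P \<in> Ldeg (n * d + d)" by (rule Ldeg_mult[OF Suc P])
  then show ?case by (simp add: add.commute)
qed

lemma Ldeg_mpr:
  assumes "\<And>j. j < i + k \<Longrightarrow> P j \<in> Ldeg d" "\<And>j. j < i + k \<Longrightarrow> \<alpha> j \<le> s" shows "mpr Q P \<alpha> k i \<in> Ldeg (k * (s * d))"
  using assms
proof (induction k arbitrary: i)
  case 0 then show ?case using Ldeg_one by simp
next
  case (Suc k)
  have "P i [^]\<^bsub>Q\<^esub> \<alpha> i \<in> Ldeg (\<alpha> i * d)" by (rule Ldeg_pow) (use Suc.prems in simp)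
  also have "Ldeg (\<alpha> i * d) \<subseteq> Ldeg (s * d)" by (rule Ldeg_mono) (use Suc.prems(2)[of i] in simp)
  finally have 1: "P i [^]\<^bsub>Q\<^esub> \<alpha> i \<in> Ldeg (s * d)" .
  have 2: "mpr Q P \<alpha> k (Suc i) \<in> Ldeg (k * (s * d))" by (rule Suc.IH) (use Suc.prems in simp_all)
  show ?case using Ldeg_mult[OF 1 2] by simp
qed

definition bmon :: "nat \<Rightarrow> nat multiset set" where "bmon d = {m. set_mset m \<subseteq> {..<e} \<and> size m \<le> d}"

text \<open>A monomial of degree at most d is determined by e exponents not exceeding d. This crude
  bound already has the right order of growth.\<close>

lemma bmon_card: "finite (bmon d)" "card (bmon d) \<le> Suc d ^ e"
proof -
  have "bmon d = (\<Union>j\<in>{..d}. monoms e j)" by (auto simp: bmon_def monoms_def)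
  then show "finite (bmon d)" using finite_monoms by simp
  define F where "F m = (\<lambda>i\<in>{..<e}. count m i)" for m :: "nat multiset"
  have inj: "inj_on F (bmon d)"
  proof (rule inj_onI)
    fix m m' assume m: "m \<in> bmon d" "m' \<in> bmon d" "F m = F m'"
    show "m = m'"
    proof (rule multiset_eqI)
      fix i show "count m i = count m' i"
      proof (cases "i < e")
        case True then show ?thesis using fun_cong[OF m(3), of i] by (simp add: F_def)
      next
        case False
        then have "i \<notin># m" "i \<notin># m'" using m(1,2) by (auto simp: bmon_def)
        then show ?thesis by (simp add: not_in_iff)
      qed
    qed
  qed
  have "F ` bmon d \<subseteq> {..<e} \<rightarrow>\<^sub>E {..d}"
  proof
    fix g assume "g \<in> F ` bmon d"
    then obtain m where m: "m \<in> bmon d" "g = F m" by blast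
    have "count m i \<le> d" for i using m(1) count_le_size[of m i] by (simp add: bmon_def)
    then show "g \<in> {..<e} \<rightarrow>\<^sub>E {..d}" unfolding m(2) F_def by auto
  qed
  then have "card (bmon d) \<le> card ({..<e} \<rightarrow>\<^sub>E {..d})" by (rule card_inj_on_le[OF inj]) (simp add: finite_PiE)
  then show "card (bmon d) \<le> Suc d ^ e" by (simp add: card_PiE)
qed

end

text \<open>Exponent vectors are functions on all natural numbers, set to 0 beyond e, so that
  vectors which agree up to e are equal.\<close>

lemma exponents:
  fixes e S :: nat
  obtains E :: "(nat \<Rightarrow> nat) set" where "finite E" "card E = S ^ Suc e" "\<And>\<alpha> j. \<alpha> \<in> E \<Longrightarrow> e < j \<Longrightarrow> \<alpha> j = 0" "\<And>\<alpha> j. \<alpha> \<in> E \<Longrightarrow> j \<le> e \<Longrightarrow> \<alpha> j < S"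
proof -
  define F where "F g = (\<lambda>j. if j \<le> e then g j else 0)" for g :: "nat \<Rightarrow> nat"
  let ?P = "{..e} \<rightarrow>\<^sub>E {..<S}"
  have inj: "inj_on F ?P"
  proof (rule inj_onI)
    fix g h assume gh: "g \<in> ?P" "h \<in> ?P" "F g = F h"
    show "g = h"
    proof (rule PiE_ext[OF gh(1,2)])
      fix j assume "j \<in> {..e}" then show "g j = h j" using fun_cong[OF gh(3), of j] by (simp add: F_def)
    qed
  qed
  show ?thesis
  proof (rule that[of "F ` ?P"])
    show "finite (F ` ?P)" by (simp add: finite_PiE)
    show "card (F ` ?P) = S ^ Suc e" using card_image[OF inj] by (simp add: card_PiE)
  qed (auto simp: F_def)
qed

declare mpr.simps(2) [simp del]

context standard_graded begin

lemma pres_finsum: "\<lbrakk> finite I; \<And>i. i \<in> I \<Longrightarrow> f i \<in> P.PC \<rbrakk> \<Longrightarrow> pres (finsum P.Q f I) = (\<Oplus>i\<in>I. pres (f i))"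
proof (induction I rule: finite_induct)
  case empty
  show ?case using ring_hom_zero[OF pres(1) cring.axioms(1)[OF P.cring_Q] ring_axioms]
    abelian_monoid.finsum_empty[OF abelian_group.axioms(1)[OF ring.is_abelian_group[OF cring.axioms(1)[OF P.cring_Q]]]] by (metis finsum_empty)
next
  case (insert i I)
  interpret Q: cring P.Q by (rule P.cring_Q)
  have f: "f \<in> I \<rightarrow> P.PC" "f i \<in> P.PC" "finsum P.Q f I \<in> P.PC" using insert by (auto intro!: Q.finsum_closed)
  have "pres (finsum P.Q f (insert i I)) = pres (f i) \<oplus> pres (finsum P.Q f I)"
    using Q.finsum_insert[OF insert(1,2) f(1,2)] pres_simps(3)[OF f(2,3)] by simp
  also have "\<dots> = (\<Oplus>i\<in>insert i I. pres (f i))"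
    using insert f pres_simps(1) by (subst finsum_insert) auto
  finally show ?case .
qed

text \<open>Counting: the \<open>s\<^sup>e\<^sup>+\<^sup>1\<close> monomials of exponents below \<open>s\<close> in \<open>e + 1\<close> elements lie in a space of
  dimension \<open>O(s\<^sup>e)\<close>.\<close>
lemma relation:
  assumes x: "\<And>j. x j \<in> carrier A"
  shows "\<exists>S c. finite S \<and> S \<noteq> {} \<and> (\<forall>\<alpha>\<in>S. \<forall>j>ee. \<alpha> j = 0) \<and> (\<forall>\<alpha>\<in>S. c \<alpha> \<in> G 0 \<and> c \<alpha> \<noteq> \<zero>) \<and>
    (\<Oplus>\<alpha>\<in>S. c \<alpha> \<otimes> mpr A x \<alpha> (Suc ee) 0) = \<zero>"
proof -
  interpret Q: cring P.Q by (rule P.cring_Q)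
  have "\<forall>j. \<exists>R. R \<in> P.PC \<and> pres R = x j" using x pres(4) by (metis image_iff)
  then obtain R where R: "\<And>j. R j \<in> P.PC" "\<And>j. pres (R j) = x j" by metis
  have "\<forall>j. \<exists>d. R j \<in> P.Ldeg d" using P.Ldeg_ex R(1) by blast
  then obtain d where d: "\<And>j. R j \<in> P.Ldeg (d j)" by metis
  define D where "D = (\<Sum>j\<le>ee. d j)"
  have RD: "R j \<in> P.Ldeg D" if "j \<le> ee" for j
    using d[of j] P.Ldeg_mono[of "d j" D] member_le_sum[of j "{..ee}" d] that by (auto simp: D_def)
  \<comment> \<open>The constants of the count. Products of e + 1 polynomials of degree at most D
    with exponents below s have degree at most N, and s is chosen after C so that (N + 1)^e \<le>
    s^e C^e < s^(e+1).\<close>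
  define C where "C = Suc (Suc ee * D)"
  define s where "s = Suc (C ^ ee)"
  define N where "N = Suc ee * (s * D)"
  have "Suc N \<le> s * C" unfolding N_def C_def s_def by (simp add: algebra_simps)
  then have "Suc N ^ ee \<le> (s * C) ^ ee" by (rule power_mono) simp
  also have "\<dots> = s ^ ee * C ^ ee" by (rule power_mult_distrib)
  also have "\<dots> < s ^ ee * s" by (rule mult_strict_left_mono) (simp_all add: s_def)
  finally have lt: "Suc N ^ ee < s ^ Suc ee" by (simp add: mult.commute)
  obtain E where E: "finite E" "card E = s ^ Suc ee" "\<And>\<alpha> j. \<alpha> \<in> E \<Longrightarrow> ee < j \<Longrightarrow> \<alpha> j = 0" "\<And>\<alpha> j. \<alpha> \<in> E \<Longrightarrow> j \<le> ee \<Longrightarrow> \<alpha> j < s"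
    by (rule exponents) blast
  define F where "F \<alpha> = mpr P.Q R \<alpha> (Suc ee) 0" for \<alpha>
  have FL: "F \<alpha> \<in> P.Ldeg N" if "\<alpha> \<in> E" for \<alpha>
    unfolding F_def N_def by (rule P.Ldeg_mpr) (use RD E(4)[OF that] in \<open>auto simp: less_Suc_eq_le intro: less_imp_le\<close>)
  have Fc: "F \<alpha> \<in> P.PC" for \<alpha> unfolding F_def by (rule Q.mpr_closed[OF R(1)])
  have Fx: "pres (F \<alpha>) = mpr A x \<alpha> (Suc ee) 0" for \<alpha>
    unfolding F_def using mpr_hom[where P = R, OF pres(1) P.cring_Q cring_axioms R(1)] R(2) by simp
  \<comment> \<open>There are fewer coefficients to cancel than products, so some nontrivial
    combination of the products vanishes.\<close>
  have "card (P.bmon N) < card E" using P.bmon_card(2)[of N] lt E(2) by simp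
  from P.linear_system[OF P.bmon_card(1) E(1) this, of F] obtain c where
    c: "\<forall>\<alpha>\<in>E. c \<alpha> \<in> carrier kk" "\<exists>\<alpha>\<in>E. c \<alpha> \<noteq> \<zero>\<^bsub>kk\<^esub>"
      "\<forall>m\<in>P.bmon N. finsum kk (\<lambda>\<alpha>. c \<alpha> \<otimes>\<^bsub>kk\<^esub> F \<alpha> m) E = \<zero>\<^bsub>kk\<^esub>" using P.pset_coeff[OF Fc] by blast
  have cG: "c \<alpha> \<in> G 0" if "\<alpha> \<in> E" for \<alpha> using c(1) that by (simp add: kk_simps)
  have cA: "c \<alpha> \<in> carrier A" if "\<alpha> \<in> E" for \<alpha> by (rule G_carrier[OF cG[OF that]])
  define T where "T \<alpha> = P.pmul (P.indexed_const (c \<alpha>)) (F \<alpha>)" for \<alpha>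
  have cP: "P.indexed_const (c \<alpha>) \<in> P.PC" if "\<alpha> \<in> E" for \<alpha>
    using P.indexed_pset.indexed_const[of "c \<alpha>" "carrier kk"] c(1) that by (simp add: P.Q_simps)
  have TP: "T \<alpha> \<in> P.PC" if "\<alpha> \<in> E" for \<alpha> unfolding T_def by (rule P.pmul_PC[OF cP[OF that] Fc])
  have Tm: "T \<alpha> m = c \<alpha> \<otimes>\<^bsub>kk\<^esub> F \<alpha> m" if "\<alpha> \<in> E" for \<alpha> m
    unfolding T_def using P.pmul_const[of "c \<alpha>" "F \<alpha>"] c(1) that P.pset_coeff[OF Fc] by simp
  have "finsum P.Q T E m = \<zero>\<^bsub>kk\<^esub>" for m
  proof -
    have "finsum P.Q T E m = finsum kk (\<lambda>\<alpha>. T \<alpha> m) E" by (rule P.finsum_Q_apply[OF E(1) TP])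
    also have "\<dots> = finsum kk (\<lambda>\<alpha>. c \<alpha> \<otimes>\<^bsub>kk\<^esub> F \<alpha> m) E"
      by (rule P.finsum_cong') (use Tm c(1) P.pset_coeff[OF Fc] in auto)
    also have "\<dots> = \<zero>\<^bsub>kk\<^esub>"
    proof (cases "m \<in> P.bmon N")
      case True then show ?thesis using c(3) by blast
    next
      case False
      have "F \<alpha> m = \<zero>\<^bsub>kk\<^esub>" if "\<alpha> \<in> E" for \<alpha>
        using False FL[OF that] P.pset_support[OF Fc[of \<alpha>]] by (auto simp: P.bmon_def P.Ldeg_def)
      then have "finsum kk (\<lambda>\<alpha>. c \<alpha> \<otimes>\<^bsub>kk\<^esub> F \<alpha> m) E = finsum kk (\<lambda>\<alpha>. \<zero>\<^bsub>kk\<^esub>) E"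
        by (intro P.finsum_cong') (use c(1) in auto)
      then show ?thesis by simp
    qed
    finally show ?thesis .
  qed
  then have "finsum P.Q T E = \<zero>\<^bsub>P.Q\<^esub>" unfolding P.Q_simps(4) by (auto simp: P.indexed_const_def fun_eq_iff)
  then have z: "pres (finsum P.Q T E) = \<zero>" using ring_hom_zero[OF pres(1) Q.ring_axioms ring_axioms] by simp
  have mc: "mpr A x \<alpha> (Suc ee) 0 \<in> carrier A" for \<alpha> by (rule mpr_closed[OF x])
  have "(\<Oplus>\<alpha>\<in>E. pres (T \<alpha>)) = (\<Oplus>\<alpha>\<in>E. c \<alpha> \<otimes> mpr A x \<alpha> (Suc ee) 0)"
  proof (rule finsum_cong')
    fix \<alpha> assume a: "\<alpha> \<in> E"
    have "pres (T \<alpha>) = pres (P.indexed_const (c \<alpha>)) \<otimes> pres (F \<alpha>)"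
      unfolding T_def using pres_simps(2)[OF cP[OF a] Fc] by (simp add: P.Q_simps(1))
    then show "pres (T \<alpha>) = c \<alpha> \<otimes> mpr A x \<alpha> (Suc ee) 0" using pres(2)[OF cG[OF a]] Fx by simp
  qed (use mc cA in auto)
  moreover have "pres (finsum P.Q T E) = (\<Oplus>\<alpha>\<in>E. pres (T \<alpha>))" by (rule pres_finsum[OF E(1)]) (rule TP)
  ultimately have z2: "(\<Oplus>\<alpha>\<in>E. c \<alpha> \<otimes> mpr A x \<alpha> (Suc ee) 0) = \<zero>" using z by simp
  \<comment> \<open>Zero coefficients are dropped, so that whichever coefficient remains at the end
    of \<open>chain_bound\<close> is a unit.\<close>
  let ?S = "{\<alpha> \<in> E. c \<alpha> \<noteq> \<zero>}"
  have "(\<Oplus>\<alpha>\<in>?S. c \<alpha> \<otimes> mpr A x \<alpha> (Suc ee) 0) = (\<Oplus>\<alpha>\<in>E. c \<alpha> \<otimes> mpr A x \<alpha> (Suc ee) 0)"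
    by (rule add.finprod_mono_neutral_cong_left[OF E(1)]) (use mc cA in auto)
  moreover have "?S \<noteq> {}" using c(2) by (auto simp: kk_simps)
  ultimately show ?thesis using z2 E(1,3) cG by (intro exI[of _ ?S] exI[of _ c]) auto
qed

text \<open>Take \<open>x i\<close> in \<open>p (Suc i)\<close> outside \<open>p i\<close>, and a
  relation among these elements over the field \<open>G 0\<close>. If the relation holds in
  \<open>p i\<close>, the least power of \<open>x i\<close> can be cancelled because
  \<open>p i\<close> is prime; modulo \<open>p (Suc i)\<close> only the terms with that least
  exponent survive. After all variables a single exponent vector is left, whose coefficient is a
  unit inside a prime ideal.\<close>

lemma chain_bound:
  assumes p: "\<And>i. i \<le> Suc ee \<Longrightarrow> primeideal (p i) A" and s: "\<And>i. i \<le> ee \<Longrightarrow> p i \<subset> p (Suc i)"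
  shows False
proof -
  have "\<forall>i. \<exists>x. i \<le> ee \<longrightarrow> x \<in> p (Suc i) \<and> x \<notin> p i" using s by blast
  then obtain x0 where x0: "\<And>i. i \<le> ee \<Longrightarrow> x0 i \<in> p (Suc i) \<and> x0 i \<notin> p i" by metis
  \<comment> \<open>Padded with 1, so that x is a total function into the carrier.\<close>
  define x where "x i = (if i \<le> ee then x0 i else \<one>)" for i
  have pI: "ideal (p i) A" if "i \<le> Suc ee" for i using p[OF that] by (rule primeideal.axioms(1))
  have xp: "x i \<in> p (Suc i)" "x i \<notin> p i" if "i \<le> ee" for i using x0[OF that] that by (auto simp: x_def)
  have xc: "x j \<in> carrier A" for j
  proof (cases "j \<le> ee")
    case True then show ?thesis using xp(1)[OF True] ideal.Icarr[OF pI[of "Suc j"]] by simp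
  qed (simp add: x_def)
  have mc: "mpr A x \<alpha> k i \<in> carrier A" for \<alpha> k i by (rule mpr_closed[OF xc])
  have "i \<le> Suc ee \<Longrightarrow> \<exists>S c. finite S \<and> S \<noteq> {} \<and> (\<forall>\<alpha>\<in>S. \<forall>j>ee. \<alpha> j = 0) \<and> (\<forall>\<alpha>\<in>S. c \<alpha> \<in> G 0 \<and> c \<alpha> \<noteq> \<zero>) \<and>
    (\<forall>\<alpha>\<in>S. \<forall>\<beta>\<in>S. \<forall>j<i. \<alpha> j = \<beta> j) \<and> (\<Oplus>\<alpha>\<in>S. c \<alpha> \<otimes> mpr A x \<alpha> (Suc ee - i) i) \<in> p i" for i
  proof (induction i)
    case 0
    obtain S c where S: "finite S" "S \<noteq> {}" "\<forall>\<alpha>\<in>S. \<forall>j>ee. \<alpha> j = 0" "\<forall>\<alpha>\<in>S. c \<alpha> \<in> G 0 \<and> c \<alpha> \<noteq> \<zero>"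
      "(\<Oplus>\<alpha>\<in>S. c \<alpha> \<otimes> mpr A x \<alpha> (Suc ee) 0) = \<zero>" using relation[of x, OF xc] by blast
    have "\<zero> \<in> p 0" using additive_subgroup.zero_closed[OF ideal.axioms(1)[OF pI[of 0]]] by simp
    then show ?case using S by (intro exI[of _ S] exI[of _ c]) simp
  next
    case (Suc i)
    then have ie: "i \<le> ee" by simp
    obtain S c where S: "finite S" "S \<noteq> {}" "\<forall>\<alpha>\<in>S. \<forall>j>ee. \<alpha> j = 0" "\<forall>\<alpha>\<in>S. c \<alpha> \<in> G 0 \<and> c \<alpha> \<noteq> \<zero>"
      "\<forall>\<alpha>\<in>S. \<forall>\<beta>\<in>S. \<forall>j<i. \<alpha> j = \<beta> j" "(\<Oplus>\<alpha>\<in>S. c \<alpha> \<otimes> mpr A x \<alpha> (Suc ee - i) i) \<in> p i" using Suc by auto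
    have cc: "c \<alpha> \<in> carrier A" if "\<alpha> \<in> S" for \<alpha> using S(4) that G_carrier by blast
    define a where "a = Min ((\<lambda>\<alpha>. \<alpha> i) ` S)"
    have amin: "a \<le> \<alpha> i" if "\<alpha> \<in> S" for \<alpha> using S(1) that by (simp add: a_def)
    have "a \<in> (\<lambda>\<alpha>. \<alpha> i) ` S" unfolding a_def using S(1,2) by (intro Min_in) auto
    then obtain \<alpha>0 where \<alpha>0: "\<alpha>0 \<in> S" "\<alpha>0 i = a" by blast
    define r where "r \<alpha> = mpr A x \<alpha> (Suc ee - Suc i) (Suc i)" for \<alpha>
    have rc: "r \<alpha> \<in> carrier A" for \<alpha> unfolding r_def by (rule mc)
    define t where "t \<alpha> = c \<alpha> \<otimes> (x i [^] (\<alpha> i - a) \<otimes> r \<alpha>)" for \<alpha>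
    have tc: "t \<alpha> \<in> carrier A" if "\<alpha> \<in> S" for \<alpha> unfolding t_def using cc[OF that] rc xc by simp
    have fac: "c \<alpha> \<otimes> mpr A x \<alpha> (Suc ee - i) i = x i [^] a \<otimes> t \<alpha>" if \<alpha>: "\<alpha> \<in> S" for \<alpha>
    proof -
      have "Suc ee - i = Suc (Suc ee - Suc i)" using ie by simp
      then have "mpr A x \<alpha> (Suc ee - i) i = x i [^] \<alpha> i \<otimes> r \<alpha>" unfolding r_def by (simp add: mpr.simps(2))
      also have "x i [^] \<alpha> i = x i [^] a \<otimes> x i [^] (\<alpha> i - a)" using nat_pow_mult[OF xc, of i a "\<alpha> i - a"] amin[OF \<alpha>] by simp
      finally show ?thesis unfolding t_def using cc[OF \<alpha>] rc xc by (simp add: m_ac)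
    qed
    have "(\<Oplus>\<alpha>\<in>S. c \<alpha> \<otimes> mpr A x \<alpha> (Suc ee - i) i) = (\<Oplus>\<alpha>\<in>S. x i [^] a \<otimes> t \<alpha>)"
      by (rule finsum_cong') (use fac tc xc in auto)
    also have "\<dots> = x i [^] a \<otimes> (\<Oplus>\<alpha>\<in>S. t \<alpha>)"
      by (rule finsum_rdistr[symmetric]) (use S(1) tc xc in auto)
    finally have prod: "x i [^] a \<otimes> (\<Oplus>\<alpha>\<in>S. t \<alpha>) \<in> p i" using S(6) by simp
    interpret pr: primeideal "p i" A by (rule p) (use ie in simp)
    interpret pn: ideal "p (Suc i)" A by (rule pI) (use ie in simp)
    have tS: "(\<Oplus>\<alpha>\<in>S. t \<alpha>) \<in> carrier A" by (rule finsum_closed) (use tc in auto)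
    have pow: "x i [^] (k :: nat) \<notin> p i" for k
    proof (induction k)
      case 0
      have "\<one> \<notin> p i" using pr.one_imp_carrier pr.I_notcarr by metis
      then show ?case by simp
    next
      case (Suc k)
      then show ?case using pr.I_prime[of "x i [^] k" "x i"] xp(2)[OF ie] xc by auto
    qed
    have "(\<Oplus>\<alpha>\<in>S. t \<alpha>) \<in> p i" using pr.I_prime[OF _ tS prod] pow xc by auto
    then have in1: "(\<Oplus>\<alpha>\<in>S. t \<alpha>) \<in> p (Suc i)" using s[OF ie] by blast
    define T where "T = {\<alpha> \<in> S. \<alpha> i = a}"
    have Tfin: "finite T" "finite (S - T)" "T \<inter> (S - T) = {}" "S = T \<union> (S - T)" "T \<subseteq> S" using S(1) by (auto simp: T_def)
    have split: "(\<Oplus>\<alpha>\<in>S. t \<alpha>) = (\<Oplus>\<alpha>\<in>T. t \<alpha>) \<oplus> (\<Oplus>\<alpha>\<in>S - T. t \<alpha>)"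
      by (subst Tfin(4), rule finsum_Un_disjoint[OF Tfin(1-3)]) (use tc Tfin(5) in auto)
    \<comment> \<open>Terms in which the exponent of \<open>x i\<close> exceeds the minimum keep a
      factor \<open>x i\<close>, which lies in the next prime.\<close>
    have in2: "(\<Oplus>\<alpha>\<in>U. t \<alpha>) \<in> p (Suc i)" if "finite U" "U \<subseteq> S - T" for U
      using that
    proof (induction U rule: finite_induct)
      case empty then show ?case using pn.zero_closed by simp
    next
      case (insert \<alpha> U)
      have \<alpha>: "\<alpha> \<in> S" "\<alpha> i \<noteq> a" using insert.prems by (auto simp: T_def)
      then obtain k where k: "\<alpha> i - a = Suc k" using amin[OF \<alpha>(1)] by (metis Suc_pred diff_is_0_eq le_antisym neq0_conv)
      have "t \<alpha> = (c \<alpha> \<otimes> (x i [^] k \<otimes> r \<alpha>)) \<otimes> x i" unfolding t_def k using cc[OF \<alpha>(1)] rc xc by (simp add: m_ac)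
      then have "t \<alpha> \<in> p (Suc i)" using pn.I_l_closed[OF xp(1)[OF ie]] cc[OF \<alpha>(1)] rc xc by simp
      moreover have "(\<Oplus>\<alpha>\<in>insert \<alpha> U. t \<alpha>) = t \<alpha> \<oplus> (\<Oplus>\<alpha>\<in>U. t \<alpha>)"
        by (rule finsum_insert) (use insert tc in auto)
      ultimately show ?case using insert pn.a_closed by simp
    qed
    have Tc: "(\<Oplus>\<alpha>\<in>T. t \<alpha>) \<in> carrier A" by (rule finsum_closed) (use tc Tfin(5) in auto)
    have STp: "(\<Oplus>\<alpha>\<in>S - T. t \<alpha>) \<in> p (Suc i)" by (rule in2[OF Tfin(2) subset_refl])
    have STc: "(\<Oplus>\<alpha>\<in>S - T. t \<alpha>) \<in> carrier A" by (rule pn.Icarr[OF STp])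
    have "(\<Oplus>\<alpha>\<in>T. t \<alpha>) = (\<Oplus>\<alpha>\<in>S. t \<alpha>) \<oplus> \<ominus> (\<Oplus>\<alpha>\<in>S - T. t \<alpha>)" unfolding split using Tc STc by (simp add: a_assoc r_neg)
    then have "(\<Oplus>\<alpha>\<in>T. t \<alpha>) \<in> p (Suc i)" using pn.a_closed[OF in1 pn.a_inv_closed[OF STp]] by simp
    moreover have "(\<Oplus>\<alpha>\<in>T. t \<alpha>) = (\<Oplus>\<alpha>\<in>T. c \<alpha> \<otimes> mpr A x \<alpha> (Suc ee - Suc i) (Suc i))"
    proof (rule finsum_cong')
      show "t \<alpha> = c \<alpha> \<otimes> mpr A x \<alpha> (Suc ee - Suc i) (Suc i)" if "\<alpha> \<in> T" for \<alpha>
        unfolding t_def r_def[symmetric] using that rc by (simp add: T_def)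
      show "(\<lambda>\<alpha>. c \<alpha> \<otimes> mpr A x \<alpha> (Suc ee - Suc i) (Suc i)) \<in> T \<rightarrow> carrier A"
        using cc rc Tfin(5) unfolding r_def[symmetric] by auto
    qed simp
    ultimately have "(\<Oplus>\<alpha>\<in>T. c \<alpha> \<otimes> mpr A x \<alpha> (Suc ee - Suc i) (Suc i)) \<in> p (Suc i)" by simp
    moreover have "\<forall>\<alpha>\<in>T. \<forall>\<beta>\<in>T. \<forall>j<Suc i. \<alpha> j = \<beta> j" using S(5) by (auto simp: T_def less_Suc_eq)
    moreover have "T \<noteq> {}" using \<alpha>0 by (auto simp: T_def)
    ultimately show ?case using Tfin(1,5) S(3,4) by (intro exI[of _ T] exI[of _ c]) blast
  qed
  from this[OF order_refl] obtain S c where S: "S \<noteq> {}" "\<forall>\<alpha>\<in>S. \<forall>j>ee. \<alpha> j = 0" "\<forall>\<alpha>\<in>S. c \<alpha> \<in> G 0 \<and> c \<alpha> \<noteq> \<zero>"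
      "\<forall>\<alpha>\<in>S. \<forall>\<beta>\<in>S. \<forall>j<Suc ee. \<alpha> j = \<beta> j" "(\<Oplus>\<alpha>\<in>S. c \<alpha> \<otimes> mpr A x \<alpha> (Suc ee - Suc ee) (Suc ee)) \<in> p (Suc ee)" by blast
  obtain \<alpha> where \<alpha>: "\<alpha> \<in> S" using S(1) by blast
  \<comment> \<open>All exponents up to \<open>ee\<close> have been made equal, and those beyond
    vanish.\<close>
  have "\<beta> = \<alpha>" if "\<beta> \<in> S" for \<beta>
  proof
    fix j show "\<beta> j = \<alpha> j"
    proof (cases "j < Suc ee")
      case True then show ?thesis using S(4) \<alpha> that by blast
    next
      case False
      then have "\<beta> j = 0" "\<alpha> j = 0" using S(2) \<alpha> that by auto
      then show ?thesis by simp
    qed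
  qed
  then have "S = {\<alpha>}" using \<alpha> by blast
  moreover have c: "c \<alpha> \<in> G 0" "c \<alpha> \<noteq> \<zero>" "c \<alpha> \<in> carrier A" using S(3) \<alpha> G_carrier by auto
  ultimately have cp: "c \<alpha> \<in> p (Suc ee)" using S(5) by simp
  have "c \<alpha> \<in> Units kk" using field.field_Units[OF kk_field] c by (simp add: kk_simps)
  then obtain b where b: "b \<in> G 0" "b \<otimes> c \<alpha> = \<one>" unfolding Units_def by (auto simp: kk_simps)
  interpret pr: primeideal "p (Suc ee)" A by (rule p) simp
  have "\<one> \<in> p (Suc ee)" using pr.I_l_closed[OF cp G_carrier[OF b(1)]] b(2) by simp
  then show False using pr.one_imp_carrier pr.I_notcarr by metis
qed

lemma krull_dim_le: "krull_dim A \<le> enat ee"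
  unfolding krull_dim_def
proof (rule Sup_least)
  fix z assume "z \<in> {enat n | n. \<exists>p :: nat \<Rightarrow> 'a set. (\<forall>i\<le>n. primeideal (p i) A) \<and> (\<forall>i<n. p i \<subset> p (Suc i))}"
  then obtain n p where n: "z = enat n" "\<forall>i\<le>n. primeideal (p i) A" "\<forall>i<n. p i \<subset> p (Suc i)" by blast
  have "\<not> Suc ee \<le> n"
  proof
    assume "Suc ee \<le> n"
    then show False using chain_bound[of p] n(2,3) by simp
  qed
  then show "z \<le> enat ee" using n(1) by simp
qed

end

section \<open>Binomial estimates and the final combination\<close>

lemma numm_eq: "e \<ge> 1 \<Longrightarrow> numm e j = ((e - 1) + j) choose (e - 1)"
  by (cases e) (simp_all add: numm_def card_monoms)

text \<open>The smallest case n = 2 is the binomial of e + 1 over 2, that is (e + 1)e/2, which is at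
  least e + 1.\<close>

lemma binomial_large: fixes e n :: nat assumes "e > 1" "n > 1" shows "(e + n - 1) choose (e - 1) > e"
proof -
  have "Suc e choose (e - 1) = Suc e choose 2" using binomial_symmetric[of "e - 1" "Suc e"] assms by simp
  also have "\<dots> = Suc e * e div 2" by (simp add: choose_two)
  also have "\<dots> \<ge> Suc e" using div_le_mono[OF mult_le_mono2[of 2 e "Suc e"], of 2] assms(1) by simp
  finally have "Suc e choose (e - 1) \<ge> Suc e" .
  also have "Suc e choose (e - 1) \<le> (e + n - 1) choose (e - 1)" by (rule binomial_right_mono) (use assms in simp)
  finally show ?thesis by simp
qed

theorem corollary4p7:
  fixes A :: "('a, 'b) ring_scheme" and G :: "nat \<Rightarrow> 'a set" and n e :: nat
    and R :: "'a set ring"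
  assumes "standard_graded A G"
    and "e = ring.dim A (G 0) (G 1)" and "e > 1"
    and "Ord A G > 1"
    and "1 < n" and "enat n \<le> Ord A G"
    and "R = A Quot (ideal_power A (irrelevant_ideal A G) n)"
  shows "(\<forall>(M :: ('a set, 'm) module) i.
            module R M \<and> finitely_generated_module R M \<and> \<not> free_module R M \<and> i \<ge> 2 \<longrightarrow>
            int (betti R M (i + 1)) - int (betti R M i) \<ge> int ((e + n - 1) choose (e - 1)) - 1) \<and>
         ereal (real ((e + n - 1) choose (e - 1))) - 1 > ereal_of_enat (krull_dim A) - 1 \<and>
         (\<forall>(W :: ('a set, 'w) module) i.
            canonical_module R W \<and> i \<noteq> 1 \<longrightarrow>
            int (betti R W (i + 1)) - int (betti R W i) \<ge> int e - 1) \<and>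
         ereal (real e) - 1 \<ge> ereal_of_enat (krull_dim A) - 1"
proof -
  interpret standard_graded A G by (rule assms(1))
  have ee: "ee = e" using assms(2) by (simp add: embdim_def)
  obtain m where m: "n = Suc m" "m \<ge> 1" using assms(5) by (cases n) auto
  have e1: "e \<ge> 1" using assms(3) by simp
  obtain \<psi> where "trunc P.Q P.xv e (numm e) R \<psi> m"
    using trunc_ex[of m] assms(6,7) e1 unfolding ee m(1) by blast
  then interpret T: trunc P.Q P.xv e "numm e" R \<psi> m .
  have h: "numm e m \<ge> 1" "numm e (Suc m) = (e + n - 1) choose (e - 1)"
    using e1 by (simp_all add: numm_eq m(1) Suc_le_eq)
  have big: "(e + n - 1) choose (e - 1) > e" by (rule binomial_large[OF assms(3,5)])
  \<comment> \<open>Stated for a type of its own, so that it serves the modules M as well as the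
    canonical modules W.\<close>
  have main: "int (betti R M (i + 1)) - int (betti R M i) \<ge> int ((e + n - 1) choose (e - 1)) - 1"
    if M: "module R M" "finitely_generated_module R M" "\<not> free_module R M" "i \<ge> 2" for M :: "('a set, 'z) module" and i
  proof -
    have "lmod R T.y e M" by (intro lmod.intro T.mring_R M(1))
    from T.betti_diff[OF h(1) _ this M(2-4)] show ?thesis using big unfolding h(2) by simp
  qed
  obtain d where d: "krull_dim A = enat d" "d \<le> e"
    using krull_dim_le unfolding ee by (cases "krull_dim A") auto
  have kd: "ereal (real k) - 1 = ereal (real k - 1)" for k by (simp add: one_ereal_def)
  have W: "int (betti R W (i + 1)) - int (betti R W i) \<ge> int e - 1"
    if W: "canonical_module R W" "i \<noteq> 1" for W :: "('a set, 'w) module" and i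
  proof -
    have mod: "module R W" using W(1) by (simp add: canonical_module_def injective_module_def)
    have lm: "lmod R T.y e W" by (intro lmod.intro T.mring_R mod)
    interpret C: canon R T.y e "Suc m" "T.Q.ell (Suc m)" W
      by (intro canon.intro T.artin_R lm canon_axioms.intro W(1))
    have soc: "mlen R T.y e (self_module R) {\<zero>\<^bsub>R\<^esub>} ((mmul (self_module R) T.y e ^^ (Suc m - 1)) (carrier R)) (numm e m)"
      using T.len_soc by simp
    have r: "numm e m = ((e - 1) + m) choose (e - 1)" by (rule numm_eq[OF e1])
    \<comment> \<open>The length of R is the number of monomials of degree at most m in e
      variables.\<close>
    have l: "T.Q.ell (Suc m) = (e + m) choose e" using sum_numm[of "e - 1" m] assms(3) by simp
    show ?thesis
    proof (cases "i = 0")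
      case True
      have "betti R W 0 + (e - 1) \<le> betti R W 1"
        by (rule binomial_growth[of e m]) (use C.betti0_ge[OF _ soc] C.betti1_ineq[OF _ soc] r l assms(3) m(2) in simp_all)
      then show ?thesis using True e1 by simp
    next
      \<comment> \<open>Here i \<ge> 2. The module W is not free, since the socle has length at
        least 2, and the general bound exceeds e - 1.\<close>
      case False
      have "2 \<le> ((e - 1) + m) choose (e - 1)"
      proof -
        have "Suc (e - 1) choose (e - 1) \<le> ((e - 1) + m) choose (e - 1)" by (rule binomial_right_mono) (use m(2) in simp)
        then show ?thesis using binomial_Suc_n[of "e - 1"] assms(3) by linarith
      qed
      then have "\<not> free_module R W" using C.W_not_free[OF _ soc] r by simp
      then have "int (betti R W (i + 1)) - int (betti R W i) \<ge> int ((e + n - 1) choose (e - 1)) - 1"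
        using main[OF mod C.fgW] False W(2) by simp
      then show ?thesis using big by linarith
    qed
  qed
  have "ereal (real ((e + n - 1) choose (e - 1))) - 1 > ereal_of_enat (krull_dim A) - 1"
    "ereal (real e) - 1 \<ge> ereal_of_enat (krull_dim A) - 1"
    unfolding d(1) using d(2) big by (simp_all add: kd)
  with main W show ?thesis by blast
qed

end
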